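(* Let $\beta\in]0,1[$. There exists a constant $C_\beta>0$ such that any Leray solution $u$ of the Navier-Stokes system (NS) on $\mathbb{R}^3$ with initial data $u_0\in L^2\cap L^1(\mathbb{R}^3)$ satisfies, for almost every $t\ge0$ (and all $K>0$), $$E^\ast(K,t)\le\rho\,C_\beta\,K^{2(1+\beta)}\,\big\|(1+|x|)^{3/2+\beta}u(t)\big\|_{L^2(\mathbb{R}^3)}^2.$$ If moreover the initial data satisfies $(1+|x|)^{3+\beta'}u_0\in L^\infty(\mathbb{R}^3)$ for some $\beta'>\beta$, then the right-hand side is finite as long as $u$ is a smooth solution of (NS) on $[0,t]$.
   Context: (NS) is $\partial_tu-\nu\Delta u+(u\cdot\nabla)u=-\nabla\Pi$, $\operatorname{div}u=0$, $u|_{t=0}=u_0$ on $\mathbb{R}_+\times\mathbb{R}^3$, with $\nu>0$. A Leray solution is a weak solution in $L^\infty(\mathbb{R}_+;L^2)\cap L^2(\mathbb{R}_+;\dot H^1)$ satisfying the energy inequality $\|u(t)\|_{L^2}^2+2\nu\int_{t'}^t\|\nabla u\|_{L^2}^2\le\|u(t')\|_{L^2}^2$ for a.e. $t>t'$. "Smooth on $[0,t]$" means $u\in L^\infty([0,t]\times\mathbb{R}^3)$. $\rho=1$ on $\mathbb{R}^3$. The energy spectrum is $E^\ast(K,t)=\frac{\rho}{K}\int_{\mathbb{R}^3}\psi(|\xi|/K)|\hat u(t,\xi)|^2\frac{d\xi}{(2\pi)^3}$, $\hat u(t,\xi)=\int e^{-ix\cdot\xi}u(t,x)dx$, where $\psi\ge0$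 is a smooth bump function supported in $[2^{-1},2]$ with $\int_0^\infty\psi(r)\frac{dr}r=1$. The right-hand side of the inequality may be $+\infty$. *)

theory Defs
  imports "HOL-Analysis.Analysis"
begin

section \<open>Smooth functions and test functions\<close>

definition dir_deriv :: "'a::real_normed_vector \<Rightarrow> ('a \<Rightarrow> 'b::real_normed_vector) \<Rightarrow> 'a \<Rightarrow> 'b" where
  "dir_deriv v f x = frechet_derivative f (at x) v"

primrec C_k :: "nat \<Rightarrow> ('a::real_normed_vector \<Rightarrow> 'b::real_normed_vector) \<Rightarrow> bool" where
  "C_k 0 f \<longleftrightarrow> continuous_on UNIV f"
| "C_k (Suc k) f \<longleftrightarrow> (\<forall>x. f differentiable (at x)) \<and> (\<forall>v. C_k k (dir_deriv v f))"

definition smooth :: "('a::real_normed_vector \<Rightarrow> 'b::real_normed_vector) \<Rightarrow> bool" where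
  "smooth f \<longleftrightarrow> (\<forall>k. C_k k f)"

definition test_function :: "('a::euclidean_space \<Rightarrow> 'b::real_normed_vector) \<Rightarrow> bool" where
  "test_function \<phi> \<longleftrightarrow> smooth \<phi> \<and> compact (closure {x. \<phi> x \<noteq> 0})"

section \<open>Lebesgue spaces\<close>

definition L2_norm_sq :: "'a measure \<Rightarrow> ('a \<Rightarrow> 'b::real_normed_vector) \<Rightarrow> ennreal" where
  "L2_norm_sq M f = (\<integral>\<^sup>+ x. ennreal ((norm (f x))\<^sup>2) \<partial>M)"

definition in_L1 :: "'a measure \<Rightarrow> ('a \<Rightarrow> 'b::euclidean_space) \<Rightarrow> bool" where
  "in_L1 M f \<longleftrightarrow> integrable M f"

definition in_L2 :: "'a measure \<Rightarrow> ('a \<Rightarrow> 'b::euclidean_space) \<Rightarrow> bool" where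
  "in_L2 M f \<longleftrightarrow> f \<in> borel_measurable M \<and> L2_norm_sq M f < \<infinity>"

definition in_Linf :: "'a measure \<Rightarrow> ('a \<Rightarrow> 'b::euclidean_space) \<Rightarrow> bool" where
  "in_Linf M f \<longleftrightarrow> f \<in> borel_measurable M \<and> (\<exists>B. AE x in M. norm (f x) \<le> B)"

section \<open>Leray solutions\<close>

definition weakly_divergence_free :: "(real^3 \<Rightarrow> real^3) \<Rightarrow> bool" where
  "weakly_divergence_free f \<longleftrightarrow>
     (\<forall>\<phi> :: real^3 \<Rightarrow> real. test_function \<phi> \<longrightarrow>
        (LINT x|lebesgue. dir_deriv (f x) \<phi> x) = 0)"

text \<open>The entry \<open>G x $ i $ j\<close> is the weak derivative of the component \<open>f $ i\<close> in the direction
  \<open>j\<close>. Both functions are required to be square integrable, so that all the integrals exist;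
  the norm on \<open>real^3^3\<close> is the Frobenius norm.\<close>

definition has_weak_gradient :: "(real^3 \<Rightarrow> real^3) \<Rightarrow> (real^3 \<Rightarrow> real^3^3) \<Rightarrow> bool" where
  "has_weak_gradient f G \<longleftrightarrow> in_L2 lebesgue f \<and> in_L2 lebesgue G \<and>
     (\<forall>\<phi> :: real^3 \<Rightarrow> real. test_function \<phi> \<longrightarrow>
        (\<forall>i j. (LINT x|lebesgue. f x $ i * dir_deriv (axis j 1) \<phi> x)
             = - (LINT x|lebesgue. G x $ i $ j * \<phi> x)))"

definition dx :: "3 \<Rightarrow> (real \<times> (real^3) \<Rightarrow> 'b::real_normed_vector) \<Rightarrow> real \<times> (real^3) \<Rightarrow> 'b" where
  "dx j \<phi> = dir_deriv (0, axis j 1) \<phi>"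

definition dt :: "(real \<times> (real^3) \<Rightarrow> 'b::real_normed_vector) \<Rightarrow> real \<times> (real^3) \<Rightarrow> 'b" where
  "dt \<phi> = dir_deriv (1, 0) \<phi>"

definition div_x :: "(real \<times> (real^3) \<Rightarrow> real^3) \<Rightarrow> real \<times> (real^3) \<Rightarrow> real" where
  "div_x \<phi> p = (\<Sum>j\<in>UNIV. dx j \<phi> p $ j)"

definition laplace_x :: "(real \<times> (real^3) \<Rightarrow> real^3) \<Rightarrow> real \<times> (real^3) \<Rightarrow> real^3" where
  "laplace_x \<phi> p = (\<Sum>j\<in>UNIV. dx j (dx j \<phi>) p)"

text \<open>Weak form of the momentum equation. Testing with divergence-free fields eliminates the
  pressure; the test fields need not vanish at time \<open>0\<close>, which encodes the initial condition. By
  \<open>div u = 0\<close>, the convection term is \<open>- \<integral> u \<bullet> (u \<bullet> \<nabla>) \<phi>\<close> after integration by parts.\<close>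

definition weak_NS :: "real \<Rightarrow> (real^3 \<Rightarrow> real^3) \<Rightarrow> (real \<Rightarrow> real^3 \<Rightarrow> real^3) \<Rightarrow> bool" where
  "weak_NS \<nu> u\<^sub>0 u \<longleftrightarrow>
     (\<forall>\<phi>. test_function \<phi> \<and> (\<forall>p. div_x \<phi> p = 0) \<longrightarrow>
        (LINT (t, x)|lebesgue_on ({0..} \<times> UNIV).
             u t x \<bullet> dt \<phi> (t, x)
           + \<nu> * (u t x \<bullet> laplace_x \<phi> (t, x))
           + u t x \<bullet> (\<Sum>j\<in>UNIV. (u t x $ j) *\<^sub>R dx j \<phi> (t, x)))
        + (LINT x|lebesgue. u\<^sub>0 x \<bullet> \<phi> (0, x)) = 0)"

text \<open>Test fields in \<open>weak_NS\<close> do not see a gradient part of \<open>u\<^sub>0\<close>, so \<open>div u = 0\<close> at time \<open>0\<close> is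
  required separately. The field \<open>G\<close> is the spatial gradient of \<open>u\<close>. The velocity matters only up
  to equality almost everywhere in space-time and is unconstrained at negative times.\<close>

definition leray_solution :: "real \<Rightarrow> (real^3 \<Rightarrow> real^3) \<Rightarrow> (real \<Rightarrow> real^3 \<Rightarrow> real^3) \<Rightarrow> bool" where
  "leray_solution \<nu> u\<^sub>0 u \<longleftrightarrow>
     (\<lambda>(t, x). u t x) \<in> borel_measurable (lebesgue_on ({0..} \<times> UNIV)) \<and>
     (\<exists>B::real. AE t in lebesgue_on {0..}. L2_norm_sq lebesgue (u t) \<le> ennreal B) \<and>
     weakly_divergence_free u\<^sub>0 \<and>
     (AE t in lebesgue_on {0..}. weakly_divergence_free (u t)) \<and>
     weak_NS \<nu> u\<^sub>0 u \<and>
     (\<exists>G :: real \<Rightarrow> real^3 \<Rightarrow> real^3^3.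
        in_L2 (lebesgue_on ({0..} \<times> UNIV)) (\<lambda>(t, x). G t x) \<and>
        (AE t in lebesgue_on {0..}. has_weak_gradient (u t) (G t)) \<and>
        (AE t' in lebesgue_on {0..}. AE t in lebesgue_on {t'..}.
           L2_norm_sq lebesgue (u t)
             + ennreal (2 * \<nu>) * (\<integral>\<^sup>+ s. L2_norm_sq lebesgue (G s) \<partial>lebesgue_on {t'..t})
           \<le> L2_norm_sq lebesgue (u t')))"

definition smooth_solution_upto :: "real \<Rightarrow> (real \<Rightarrow> real^3 \<Rightarrow> real^3) \<Rightarrow> bool" where
  "smooth_solution_upto t u \<longleftrightarrow> in_Linf (lebesgue_on ({0..t} \<times> UNIV)) (\<lambda>(s, x). u s x)"

section \<open>Energy spectrum\<close>

definition \<rho> :: real where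
  "\<rho> = 1"

definition spectral_bump :: "(real \<Rightarrow> real) \<Rightarrow> bool" where
  "spectral_bump \<psi> \<longleftrightarrow> smooth \<psi> \<and> (\<forall>r. 0 \<le> \<psi> r) \<and> closure {r. \<psi> r \<noteq> 0} \<subseteq> {1/2..2} \<and>
     (LINT r:{0<..}|lebesgue. \<psi> r / r) = 1"

text \<open>As usual for Bochner integrals, the value is \<open>0\<close> if \<open>f\<close> is not integrable.\<close>

definition fourier :: "(real^3 \<Rightarrow> real^3) \<Rightarrow> real^3 \<Rightarrow> complex^3" where
  "fourier f \<xi> =
     (\<chi> i. LINT x|lebesgue. exp (- \<i> * complex_of_real (x \<bullet> \<xi>)) * complex_of_real (f x $ i))"

definition energy_spectrum ::
    "(real \<Rightarrow> real) \<Rightarrow> (real \<Rightarrow> real^3 \<Rightarrow> real^3) \<Rightarrow> real \<Rightarrow> real \<Rightarrow> ennreal" where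
  "energy_spectrum \<psi> u K t = ennreal (\<rho> / K) *
     (\<integral>\<^sup>+ \<xi>. ennreal (\<psi> (norm \<xi> / K) * (norm (fourier (u t) \<xi>))\<^sup>2 / (2 * pi) ^ 3) \<partial>lebesgue)"

end

theory Submission
  imports Defs "HOL-Probability.Probability"
begin

text \<open>If the weighted norm is finite then \<open>u(t)\<close> is integrable, and testing \<open>div u(t) = 0\<close> with
  truncations of \<open>x \<mapsto> x $ i\<close> shows that it has mean zero. Hence its Fourier transform at \<open>\<xi>\<close> is
  bounded by \<open>\<integral> min 2 (\<bar>x\<bar>\<bar>\<xi>\<bar>) \<bar>u(t, x)\<bar> dx\<close>, which by the Cauchy--Schwarz inequality and scaling is at most a constant
  times \<open>\<bar>\<xi>\<bar> powr \<beta>\<close> times the weighted norm. The spectrum only sees \<open>\<bar>\<xi>\<bar> \<le> 2 K\<close>.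

  For the finiteness, let \<open>a = min (3 + \<beta>') 4\<close>. Testing the equation with the divergence-free fields
  \<open>curl curl (\<theta>(s) g e\<^sub>i)\<close>, where \<open>g\<close> is a heat kernel solving the backward heat equation, and integrating over
  the diffusion parameter gives a Duhamel inequality for \<open>\<bar>u\<bar>\<close>, in which the convection term is
  \<open>\<bar>u\<bar>\<^sup>2\<close> convolved with a kernel that decays like \<open>\<bar>x\<bar> powr -4\<close> (the derivative of the Oseen kernel)
  and whose space integral is \<open>O((t - s) powr (-1/2))\<close>. As \<open>u\<close> is bounded on \<open>[0, t]\<close> with bounded energy,
  iterating this inequality in the norm \<open>sup e\<^sup>-\<^sup>\<lambda>\<^sup>s (1 + \<bar>x\<bar>) powr a \<bar>u(s, x)\<bar>\<close> with a large \<open>\<lambda>\<close>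
  yields \<open>\<bar>u(s, x)\<bar> = O((1 + \<bar>x\<bar>) powr -a)\<close>, and \<open>a > 3 + \<beta>\<close>.\<close>

text \<open>The spectral estimate is pointwise in time; the work lies in the finiteness, where the
  obstacles are the nonlocal pressure and the low regularity of \<open>u\<close>. A heat kernel
  times \<open>e_i\<close> is not divergence free, but its curl curl is; and since curl curl = grad
  div - \<Delta> and the velocity is divergence free, only the Laplacian of the kernel meets the
  linear terms. That Laplacian is also the derivative in the diffusion parameter, so integrating
  over the parameter inverts it, and neither a Riesz transform nor the Leray projection is ever
  formed. The order 4 in the decay of the differentiated Oseen kernel caps \<open>a\<close> at 4,
  and \<open>a > 3 + \<beta>\<close> then needs \<open>\<beta> < 1\<close>. Two further difficulties
  shape the argument. The velocity is known only almost everywhere, so the Duhamel inequality is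
  first proved for time averages of mollifications, and both are removed by Lebesgue
  differentiation. And the weighted supremum might be infinite at the start of the iteration, so the
  weight gets a floor \<open>\<delta> > 0\<close>: then the boundedness of \<open>u\<close> starts
  the iteration, and its limit does not depend on \<open>\<delta>\<close>.\<close>

section \<open>Calculus of directional derivatives and smooth functions\<close>

lemma dir_deriv_eq:
  assumes "(f has_derivative f') (at x)"
  shows "dir_deriv v f x = f' v"
  using frechet_derivative_at[OF assms] by (simp add: dir_deriv_def)

lemma dir_deriv_cong_open:
  assumes "open S" "x \<in> S" "f differentiable (at x)" "\<And>y. y \<in> S \<Longrightarrow> f y = g y"
  shows "dir_deriv v f x = dir_deriv v g x" "g differentiable (at x)"
proof -
  have f: "(f has_derivative frechet_derivative f (at x)) (at x)"
    using assms(3) frechet_derivative_works by blast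
  have g: "(g has_derivative frechet_derivative f (at x)) (at x)"
    using has_derivative_transform_within_open[OF f assms(1,2)] assms(4) by metis
  show "dir_deriv v f x = dir_deriv v g x" using dir_deriv_eq[OF g] by (simp add: dir_deriv_def)
  show "g differentiable (at x)" using g differentiable_def by blast
qed

lemma dir_deriv_add:
  assumes "f differentiable (at x)" "g differentiable (at x)"
  shows "dir_deriv v (\<lambda>x. f x + g x) x = dir_deriv v f x + dir_deriv v g x"
  using assms[unfolded frechet_derivative_works]
  by (subst dir_deriv_eq[OF has_derivative_add]) (auto simp: dir_deriv_def)

lemma dir_deriv_mult:
  fixes f g :: "'a::real_normed_vector \<Rightarrow> real"
  assumes "f differentiable (at x)" "g differentiable (at x)"
  shows "dir_deriv v (\<lambda>x. f x * g x) x = dir_deriv v f x * g x + f x * dir_deriv v g x"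
  using assms[unfolded frechet_derivative_works]
  by (subst dir_deriv_eq[OF has_derivative_mult]) (auto simp: dir_deriv_def)

lemma dir_deriv_scaleR_const:
  fixes f :: "'a::real_normed_vector \<Rightarrow> real"
  assumes "f differentiable (at x)"
  shows "dir_deriv v (\<lambda>x. f x *\<^sub>R c) x = dir_deriv v f x *\<^sub>R c"
  using assms[unfolded frechet_derivative_works]
  by (subst dir_deriv_eq[OF has_derivative_scaleR_left]) (auto simp: dir_deriv_def)

lemma dir_deriv_sum:
  assumes "\<And>i. i \<in> I \<Longrightarrow> f i differentiable (at x)"
  shows "dir_deriv v (\<lambda>x. \<Sum>i\<in>I. f i x) x = (\<Sum>i\<in>I. dir_deriv v (f i) x)"
  using assms[unfolded frechet_derivative_works]
  by (subst dir_deriv_eq[OF has_derivative_sum]) (auto simp: dir_deriv_def)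

lemma dir_deriv_real:
  fixes h :: "real \<Rightarrow> real"
  assumes "(h has_real_derivative d) (at r)"
  shows "dir_deriv v h r = d * v"
  using dir_deriv_eq[OF assms[unfolded has_field_derivative_def]] by simp

lemma dir_deriv_compose:
  fixes h :: "real \<Rightarrow> real"
  assumes "h differentiable (at (f x))" "f differentiable (at x)"
  shows "dir_deriv v (\<lambda>x. h (f x)) x = dir_deriv 1 h (f x) * dir_deriv v f x"
proof -
  obtain d where d: "(h has_real_derivative d) (at (f x))"
    using assms(1) real_differentiable_def by blast
  have "((\<lambda>x. h (f x)) has_derivative (\<lambda>v. d * frechet_derivative f (at x) v)) (at x)"
    by (rule has_derivative_compose[where g=h, OF assms(2)[unfolded frechet_derivative_works]
        d[unfolded has_field_derivative_def]])
  from dir_deriv_eq[OF this] show ?thesis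
    unfolding dir_deriv_real[OF d] by (simp add: dir_deriv_def)
qed

lemma dir_deriv_linear:
  assumes "f differentiable (at x)"
  shows "linear (\<lambda>v. dir_deriv v f x)"
  using linear_frechet_derivative[OF assms] by (simp add: dir_deriv_def)

text \<open>A version of \<open>C_k\<close> for families \<open>F i\<close> on a set \<open>S\<close> in which \<open>F\<close> and its derivatives satisfy
  a condition \<open>B\<close>, such as a bound that is uniform in \<open>i\<close>.\<close>

primrec Ckb :: "nat \<Rightarrow> 'a::real_normed_vector set \<Rightarrow> (('i \<Rightarrow> 'a \<Rightarrow> real) \<Rightarrow> bool) \<Rightarrow> ('i \<Rightarrow> 'a \<Rightarrow> real) \<Rightarrow> bool" where
  "Ckb 0 S B F \<longleftrightarrow> B F \<and> (\<forall>i. continuous_on S (F i))"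
| "Ckb (Suc k) S B F \<longleftrightarrow> B F \<and> (\<forall>i. \<forall>x\<in>S. F i differentiable (at x)) \<and> (\<forall>v. Ckb k S B (\<lambda>i. dir_deriv v (F i)))"

lemma Ckb_bound: "Ckb k S B F \<Longrightarrow> B F"
  by (cases k) auto

lemma Ckb_SucD: "Ckb (Suc k) S B F \<Longrightarrow> Ckb k S B F"
proof (induction k arbitrary: F)
  case 0
  then show ?case
    by (auto intro: differentiable_imp_continuous_on simp: differentiable_on_def differentiable_at_withinI)
next
  case (Suc k)
  have "Ckb k S B (\<lambda>i. dir_deriv v (F i))" for v
    by (rule Suc.IH) (use Suc.prems in \<open>subst (asm) Ckb.simps(2), blast\<close>)
  then show ?case using Suc.prems unfolding Ckb.simps by blast
qed

lemma Ckb_mono: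
  assumes "Ckb k S B F" "T \<subseteq> S" "\<And>F. B F \<Longrightarrow> B' F"
  shows "Ckb k T B' F"
  using assms(1)
proof (induction k arbitrary: F)
  case 0
  then have "B' F" using assms(3)[of F] by simp
  moreover have "continuous_on T (F i)" for i
    by (rule continuous_on_subset[OF _ assms(2)]) (use 0 in simp)
  ultimately show ?case by simp
next
  case (Suc k)
  then have "B' F" using assms(3)[of F] by simp
  then show ?case using Suc assms(2) by (auto simp del: split_paired_All)
qed

lemma Ckb_reindex:
  assumes "Ckb k S B F" "\<And>F. B F \<Longrightarrow> B' (\<lambda>j. F (r j))"
  shows "Ckb k S B' (\<lambda>j. F (r j))"
  using assms(1)
proof (induction k arbitrary: F)
  case 0
  then show ?case using assms(2)[of F] by simp
next
  case (Suc k)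
  have "Ckb k S B' (\<lambda>j. dir_deriv v (F (r j)))" for v
    by (rule Suc.IH) (use Suc.prems in simp)
  then show ?case using assms(2)[of F] Suc.prems by simp
qed

text \<open>Openness of \<open>S\<close> passes the agreement on to all derivatives. As
  \<open>B\<close> is arbitrary, its invariance under changes off \<open>S\<close> has to be
  assumed; the same assumption recurs in the sum and product rules, where the derivatives are
  computed on \<open>S\<close> only.\<close>

lemma Ckb_cong:
  assumes "open S" "Ckb k S B F" "\<And>i x. x \<in> S \<Longrightarrow> F i x = G i x"
    and B: "\<And>F G. B F \<Longrightarrow> (\<And>i x. x \<in> S \<Longrightarrow> F i x = G i x) \<Longrightarrow> B G"
  shows "Ckb k S B G"
  using assms(2,3)
proof (induction k arbitrary: F G)
  case 0
  have "B G" by (rule B[of F]) (use 0 in auto)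
  moreover have "continuous_on S (G i)" for i
    using 0 continuous_on_cong[OF refl, of S "F i" "G i"] by simp
  ultimately show ?case by simp
next
  case (Suc k)
  have d: "\<And>i x. x \<in> S \<Longrightarrow> F i differentiable (at x)" using Suc.prems by auto
  have "Ckb k S B (\<lambda>i. dir_deriv v (G i))" for v
  proof (rule Suc.IH)
    show "Ckb k S B (\<lambda>i. dir_deriv v (F i))" using Suc.prems by auto
    show "dir_deriv v (F i) x = dir_deriv v (G i) x" if "x \<in> S" for i x
      by (rule dir_deriv_cong_open[OF assms(1) that d[OF that] Suc.prems(2)])
  qed
  moreover have "\<And>i x. x \<in> S \<Longrightarrow> G i differentiable (at x)"
    using dir_deriv_cong_open(2)[OF assms(1) _ d Suc.prems(2)] by blast
  moreover have "B G" by (rule B[of F]) (use Suc.prems in auto)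
  ultimately show ?case by auto
qed

lemma Ckb_add:
  assumes "open S" "Ckb k S B F" "Ckb k S B G"
    and B: "\<And>F G. B F \<Longrightarrow> (\<And>i x. x \<in> S \<Longrightarrow> F i x = G i x) \<Longrightarrow> B G"
    and B2: "\<And>F G. B F \<Longrightarrow> B G \<Longrightarrow> B (\<lambda>i x. F i x + G i x)"
  shows "Ckb k S B (\<lambda>i x. F i x + G i x)"
  using assms(2,3)
proof (induction k arbitrary: F G)
  case 0
  then show ?case using B2[of F G] by (auto intro!: continuous_intros)
next
  case (Suc k)
  have "Ckb k S B (\<lambda>i. dir_deriv v (\<lambda>x. F i x + G i x))" for v
  proof (rule Ckb_cong[OF assms(1)])
    show "Ckb k S B (\<lambda>i x. dir_deriv v (F i) x + dir_deriv v (G i) x)"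
      by (rule Suc.IH) (use Suc.prems in simp_all)
    show "dir_deriv v (F i) x + dir_deriv v (G i) x = dir_deriv v (\<lambda>x. F i x + G i x) x" if "x \<in> S" for i x
      using Suc.prems that by (simp add: dir_deriv_add)
  qed (rule B)
  then show ?case using Suc.prems B2[of F G] by (auto)
qed

text \<open>By the Leibniz rule every derivative is a sum of products of a \<open>B1\<close> family
  and a \<open>B2\<close> family. Separate conditions on the factors let a growing factor be paired
  with a decaying one.\<close>

lemma Ckb_mult:
  assumes "open S" "Ckb k S B1 F" "Ckb k S B2 G"
    and B: "\<And>F G. B F \<Longrightarrow> (\<And>i x. x \<in> S \<Longrightarrow> F i x = G i x) \<Longrightarrow> B G"
    and B2: "\<And>F G. B F \<Longrightarrow> B G \<Longrightarrow> B (\<lambda>i x. F i x + G i x)"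
    and B3: "\<And>F G. B1 F \<Longrightarrow> B2 G \<Longrightarrow> B (\<lambda>i x. F i x * G i x)"
  shows "Ckb k S B (\<lambda>i x. F i x * G i x)"
  using assms(2,3)
proof (induction k arbitrary: F G)
  case 0
  then show ?case using B3[of F G] by (auto intro!: continuous_intros)
next
  case (Suc k)
  have "Ckb k S B (\<lambda>i x. dir_deriv v (F i) x * G i x + F i x * dir_deriv v (G i) x)" for v
  proof (rule Ckb_add[OF assms(1)])
    show "Ckb k S B (\<lambda>i x. dir_deriv v (F i) x * G i x)"
      by (rule Suc.IH[OF _ Ckb_SucD[OF Suc.prems(2)]]) (use Suc.prems in simp)
    show "Ckb k S B (\<lambda>i x. F i x * dir_deriv v (G i) x)"
      by (rule Suc.IH[OF Ckb_SucD[OF Suc.prems(1)]]) (use Suc.prems in simp)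
  qed (fact B, fact B2)
  then have "Ckb k S B (\<lambda>i. dir_deriv v (\<lambda>x. F i x * G i x))" for v
  proof (rule Ckb_cong[OF assms(1)])
    show "dir_deriv v (F i) x * G i x + F i x * dir_deriv v (G i) x = dir_deriv v (\<lambda>x. F i x * G i x) x"
      if "x \<in> S" for i x
      using Suc.prems that by (simp add: dir_deriv_mult)
  qed (rule B)
  then show ?case using Suc.prems B3[of F G] by simp
qed

lemma Ckb_Un:
  assumes "open S" "open T" "Ckb k S B F" "Ckb k T B' F"
    and B: "\<And>F. B F \<Longrightarrow> B' F \<Longrightarrow> B'' F"
  shows "Ckb k (S \<union> T) B'' F"
  using assms(3,4)
proof (induction k arbitrary: F)
  case 0
  then show ?case using B[of F] continuous_on_open_Un[OF assms(1,2)] by auto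
next
  case (Suc k)
  then show ?case using B[of F] by auto
qed

abbreviation "Cinf S B F \<equiv> (\<forall>k. Ckb k S B F)"

text \<open>Transfers the sum and product rules for families to real-valued \<open>C_k\<close>
  functions.\<close>

lemma C_k_eq_Ckb: "C_k k f \<longleftrightarrow> Ckb k UNIV (\<lambda>_. True) (\<lambda>_::unit. f)"
  by (induction k arbitrary: f) auto

lemma C_k_add:
  fixes f g :: "'a::real_normed_vector \<Rightarrow> real"
  assumes "C_k k f" "C_k k g" shows "C_k k (\<lambda>x. f x + g x)"
  using assms unfolding C_k_eq_Ckb by (intro Ckb_add) auto

lemma C_k_mult:
  fixes f g :: "'a::real_normed_vector \<Rightarrow> real"
  assumes "C_k k f" "C_k k g" shows "C_k k (\<lambda>x. f x * g x)"
  using assms unfolding C_k_eq_Ckb by (intro Ckb_mult) auto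

lemma C_k_SucD:
  assumes "C_k (Suc k) f" shows "C_k k f"
  using assms
proof (induction k arbitrary: f)
  case 0
  then show ?case
    by (auto intro: differentiable_imp_continuous_on simp: differentiable_on_def differentiable_at_withinI)
next
  case (Suc k)
  have "C_k k (dir_deriv v f)" for v
    by (rule Suc.IH) (use Suc.prems in \<open>subst (asm) C_k.simps(2), blast\<close>)
  then show ?case using Suc.prems unfolding C_k.simps by blast
qed

lemma C_k_const: "C_k k (\<lambda>_. c)"
  by (induction k arbitrary: c) (auto simp: dir_deriv_def[abs_def])

lemma C_k_bounded_linear:
  assumes "bounded_linear f" shows "C_k k f"
proof (cases k)
  case (Suc n)
  have "dir_deriv v f = (\<lambda>_. f v)" for v
    using dir_deriv_eq[OF bounded_linear_imp_has_derivative[OF assms]] by auto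
  then show ?thesis using Suc C_k_const bounded_linear_imp_differentiable[OF assms] by auto
qed (auto simp: assms linear_continuous_on)

lemma C_k_compose:
  fixes h :: "real \<Rightarrow> real"
  assumes "C_k k h" "C_k k f" shows "C_k k (\<lambda>x. h (f x))"
  using assms
proof (induction k arbitrary: h)
  case 0
  then show ?case by (auto intro: continuous_on_compose2)
next
  case (Suc k)
  have "C_k k (\<lambda>x. dir_deriv 1 h (f x) * dir_deriv v f x)" for v
    using Suc C_k_SucD[OF Suc.prems(2)] by (intro C_k_mult) auto
  moreover have "dir_deriv v (\<lambda>x. h (f x)) = (\<lambda>x. dir_deriv 1 h (f x) * dir_deriv v f x)" for v
    using Suc.prems by (auto simp: dir_deriv_compose)
  ultimately show ?case using Suc.prems
    by (auto intro: differentiable_compose[of h f, unfolded o_def])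
qed

lemma C_k_scaleR_const:
  fixes f :: "'a::real_normed_vector \<Rightarrow> real"
  assumes "C_k k f" shows "C_k k (\<lambda>x. f x *\<^sub>R c)"
  using assms
proof (induction k arbitrary: f)
  case 0
  then show ?case by (auto intro!: continuous_intros)
next
  case (Suc k)
  have "dir_deriv v (\<lambda>x. f x *\<^sub>R c) = (\<lambda>x. dir_deriv v f x *\<^sub>R c)" for v
    using Suc.prems by (auto simp: dir_deriv_scaleR_const)
  then show ?case using Suc
    by (auto intro!: differentiable_scaleR)
qed

lemma C_k_add':
  assumes "C_k k f" "C_k k g" shows "C_k k (\<lambda>x. f x + g x)"
  using assms
proof (induction k arbitrary: f g)
  case 0
  then show ?case by (auto intro!: continuous_intros)
next
  case (Suc k)
  have "dir_deriv v (\<lambda>x. f x + g x) = (\<lambda>x. dir_deriv v f x + dir_deriv v g x)" for v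
    using Suc.prems by (auto simp: dir_deriv_add)
  then show ?case using Suc by auto
qed

lemma smooth_const: "smooth (\<lambda>_. c)"
  by (simp add: smooth_def C_k_const)

lemma smooth_add: "smooth f \<Longrightarrow> smooth g \<Longrightarrow> smooth (\<lambda>x. f x + g x)"
  by (simp add: smooth_def C_k_add')

lemma smooth_mult:
  fixes f g :: "'a::real_normed_vector \<Rightarrow> real"
  shows "smooth f \<Longrightarrow> smooth g \<Longrightarrow> smooth (\<lambda>x. f x * g x)"
  by (simp add: smooth_def C_k_mult)

lemma smooth_compose:
  fixes h :: "real \<Rightarrow> real"
  shows "smooth h \<Longrightarrow> smooth f \<Longrightarrow> smooth (\<lambda>x. h (f x))"
  by (simp add: smooth_def C_k_compose)

lemma smooth_bounded_linear: "bounded_linear f \<Longrightarrow> smooth f"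
  by (simp add: smooth_def C_k_bounded_linear)

lemma smooth_sum: "(\<And>i. i \<in> I \<Longrightarrow> smooth (f i)) \<Longrightarrow> smooth (\<lambda>x. \<Sum>i\<in>I. f i x)"
  by (induction I rule: infinite_finite_induct) (auto simp: smooth_const smooth_add)

lemma smooth_scaleR_const:
  fixes f :: "'a::real_normed_vector \<Rightarrow> real"
  shows "smooth f \<Longrightarrow> smooth (\<lambda>x. f x *\<^sub>R c)"
  by (simp add: smooth_def C_k_scaleR_const)

lemma smooth_dir_deriv: "smooth f \<Longrightarrow> smooth (dir_deriv v f)"
  unfolding smooth_def by (metis C_k.simps(2))

lemma smooth_differentiable: "smooth f \<Longrightarrow> f differentiable (at x)"
  unfolding smooth_def using C_k.simps(2)[of 0 f] by blast

lemma smooth_continuous_on: "smooth f \<Longrightarrow> continuous_on S f"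
  unfolding smooth_def using C_k.simps(1)[of f] continuous_on_subset by blast

lemma smooth_minus:
  fixes f g :: "'a::real_normed_vector \<Rightarrow> real"
  assumes "smooth f" "smooth g" shows "smooth (\<lambda>x. f x - g x)"
  using smooth_add[OF assms(1) smooth_mult[OF smooth_const[of "-1"] assms(2)]] by simp

lemma smooth_antiderivative:
  fixes f F :: "real \<Rightarrow> real"
  assumes "smooth f" "\<And>x. (F has_real_derivative f x) (at x)"
  shows "smooth F"
  unfolding smooth_def
proof
  fix k
  have d: "dir_deriv v F = (\<lambda>x. f x * v)" for v
    using dir_deriv_real[OF assms(2)] by auto
  have "C_k (Suc k) F"
    using assms(2) smooth_mult[OF assms(1) smooth_const]
    by (auto simp: d smooth_def real_differentiable_def)
  then show "C_k k F" by (rule C_k_SucD)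
qed

subsection \<open>Symmetry of second derivatives\<close>

lemma dir_deriv_along_line:
  fixes f :: "'a::real_normed_vector \<Rightarrow> real"
  assumes "f differentiable (at (x + t *\<^sub>R v))"
  shows "((\<lambda>t. f (x + t *\<^sub>R v)) has_real_derivative dir_deriv v f (x + t *\<^sub>R v)) (at t)"
proof -
  have "((\<lambda>t. f (x + t *\<^sub>R v)) has_derivative (\<lambda>s. frechet_derivative f (at (x + t *\<^sub>R v)) (s *\<^sub>R v))) (at t)"
    by (rule has_derivative_compose[where g=f and f="\<lambda>t. x + t *\<^sub>R v", OF _ assms[unfolded frechet_derivative_works]])
       (auto intro!: derivative_eq_intros)
  then show ?thesis
    unfolding has_field_derivative_def dir_deriv_def
    using linear_scale[OF linear_frechet_derivative[OF assms]] by (simp add: mult.commute[of _ "frechet_derivative f _ v"])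
qed

text \<open>The mean value theorem twice: along \<open>v\<close> for the increment of
  \<open>f\<close> in the direction \<open>w\<close>, then along \<open>w\<close> for
  \<open>dir_deriv v f\<close>.\<close>

lemma second_difference:
  fixes f :: "'a::real_normed_vector \<Rightarrow> real"
  assumes f: "\<And>x. f differentiable (at x)" and fv: "\<And>x. dir_deriv v f differentiable (at x)" and "h > 0"
  shows "\<exists>c d. 0 < c \<and> c < h \<and> 0 < d \<and> d < h \<and>
     f (x + h *\<^sub>R v + h *\<^sub>R w) - f (x + h *\<^sub>R v) - f (x + h *\<^sub>R w) + f x
       = h * (h * dir_deriv w (dir_deriv v f) (x + c *\<^sub>R v + d *\<^sub>R w))"
proof -
  let ?g = "\<lambda>t. f ((x + h *\<^sub>R w) + t *\<^sub>R v) - f (x + t *\<^sub>R v)"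
  have "(?g has_real_derivative dir_deriv v f ((x + h *\<^sub>R w) + t *\<^sub>R v) - dir_deriv v f (x + t *\<^sub>R v)) (at t)" for t
    by (intro DERIV_diff dir_deriv_along_line f)
  from MVT2[of 0 h ?g, OF \<open>h > 0\<close> this] obtain c where c: "0 < c" "c < h"
    "?g h - ?g 0 = h * (dir_deriv v f ((x + h *\<^sub>R w) + c *\<^sub>R v) - dir_deriv v f (x + c *\<^sub>R v))" by auto
  let ?k = "\<lambda>t. dir_deriv v f ((x + c *\<^sub>R v) + t *\<^sub>R w)"
  have "(?k has_real_derivative dir_deriv w (dir_deriv v f) ((x + c *\<^sub>R v) + t *\<^sub>R w)) (at t)" for t
    by (intro dir_deriv_along_line fv)
  from MVT2[of 0 h ?k, OF \<open>h > 0\<close> this] obtain d where d: "0 < d" "d < h"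
    "?k h - ?k 0 = h * dir_deriv w (dir_deriv v f) ((x + c *\<^sub>R v) + d *\<^sub>R w)" by auto
  show ?thesis
    using c d by (intro exI[of _ c] exI[of _ d]) (auto simp: algebra_simps)
qed

text \<open>The second difference over a parallelogram is symmetric in its two sides. It therefore
  expresses both mixed derivatives, each at some point that tends to \<open>x\<close> as the
  parallelogram shrinks, and continuity concludes.\<close>

lemma dir_deriv_commute:
  fixes f :: "'a::real_normed_vector \<Rightarrow> real"
  assumes "smooth f"
  shows "dir_deriv v (dir_deriv w f) = dir_deriv w (dir_deriv v f)"
proof
  fix x
  let ?A = "dir_deriv w (dir_deriv v f)" and ?B = "dir_deriv v (dir_deriv w f)"
  have "continuous_on UNIV ?A" "continuous_on UNIV ?B"
    by (intro smooth_continuous_on smooth_dir_deriv assms)+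
  then have cont: "isCont ?A x" "isCont ?B x" by (auto simp: continuous_on_eq_continuous_at)
  define h where "h n = 1 / real (Suc n)" for n
  have h: "h n > 0" for n by (simp add: h_def)
  have h0: "h \<longlonglongrightarrow> 0" unfolding h_def by (rule LIMSEQ_Suc[OF lim_1_over_n])
  let ?D = "\<lambda>n. f (x + h n *\<^sub>R v + h n *\<^sub>R w) - f (x + h n *\<^sub>R v) - f (x + h n *\<^sub>R w) + f x"
  have "\<exists>c d. 0 < c \<and> c < h n \<and> 0 < d \<and> d < h n \<and> ?D n = h n * (h n * ?A (x + c *\<^sub>R v + d *\<^sub>R w))" for n
    by (intro second_difference smooth_differentiable smooth_dir_deriv assms h)
  then obtain c d where cd: "\<And>n. 0 < c n \<and> c n < h n \<and> 0 < d n \<and> d n < h n \<and>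
    ?D n = h n * (h n * ?A (x + c n *\<^sub>R v + d n *\<^sub>R w))" by metis
  have "\<exists>c d. 0 < c \<and> c < h n \<and> 0 < d \<and> d < h n \<and> ?D n = h n * (h n * ?B (x + c *\<^sub>R w + d *\<^sub>R v))" for n
    using second_difference[of f w "h n" x v] assms h
    by (auto simp: smooth_differentiable smooth_dir_deriv algebra_simps)
  then obtain c' d' where cd': "\<And>n. 0 < c' n \<and> c' n < h n \<and> 0 < d' n \<and> d' n < h n \<and>
    ?D n = h n * (h n * ?B (x + c' n *\<^sub>R w + d' n *\<^sub>R v))" by metis
  have eq: "?A (x + c n *\<^sub>R v + d n *\<^sub>R w) = ?B (x + c' n *\<^sub>R w + d' n *\<^sub>R v)" for n
    using cd[of n] cd'[of n] h[of n] by auto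
  have z: "z \<longlonglongrightarrow> 0" if "\<And>n. 0 < z n \<and> z n < h n" for z :: "nat \<Rightarrow> real"
    by (rule tendsto_sandwich[OF _ _ tendsto_const h0]) (use that in \<open>auto simp: eventually_sequentially intro!: less_imp_le\<close>)
  have "(\<lambda>n. x + c n *\<^sub>R v + d n *\<^sub>R w) \<longlonglongrightarrow> x + 0 *\<^sub>R v + 0 *\<^sub>R w"
    by (intro tendsto_intros z) (use cd in auto)
  then have A: "(\<lambda>n. ?A (x + c n *\<^sub>R v + d n *\<^sub>R w)) \<longlonglongrightarrow> ?A x"
    using isCont_tendsto_compose[OF cont(1)] by auto
  have "(\<lambda>n. x + c' n *\<^sub>R w + d' n *\<^sub>R v) \<longlonglongrightarrow> x + 0 *\<^sub>R w + 0 *\<^sub>R v"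
    by (intro tendsto_intros z) (use cd' in auto)
  then have "(\<lambda>n. ?B (x + c' n *\<^sub>R w + d' n *\<^sub>R v)) \<longlonglongrightarrow> ?B x"
    using isCont_tendsto_compose[OF cont(2)] by auto
  with A eq show "?B x = ?A x" using LIMSEQ_unique by auto
qed

subsection \<open>Cutoff functions\<close>

definition flatexp :: "real \<Rightarrow> real" where
  "flatexp r = (if r \<le> 0 then 0 else exp (- 1 / r))"

text \<open>The terms that occur, up to coefficients, in the derivatives of \<open>flatexp\<close>.
  The family is closed under differentiation, so smoothness becomes an induction over all
  \<open>n\<close> at once.\<close>

definition flatexp_div :: "nat \<Rightarrow> real \<Rightarrow> real" where
  "flatexp_div n r = (if r \<le> 0 then 0 else exp (- 1 / r) / r ^ n)"

lemma flatexp_div_limit: "(flatexp_div n \<longlongrightarrow> 0) (at 0)"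
proof (rule filterlim_split_at)
  show "(flatexp_div n \<longlongrightarrow> 0) (at_left 0)"
    by (rule tendsto_eventually) (auto simp: flatexp_div_def eventually_at_filter)
  have lim: "((\<lambda>r::real. exp (- 1 / r) / r ^ n) \<longlongrightarrow> 0) (at_right 0)"
  proof -
    have "((\<lambda>x::real. x ^ n / exp x) \<longlongrightarrow> 0) at_top" by (rule tendsto_power_div_exp_0)
    from filterlim_compose[OF this filterlim_inverse_at_top_right]
    show ?thesis by (simp add: exp_minus field_simps power_inverse)
  qed
  show "(flatexp_div n \<longlongrightarrow> 0) (at_right 0)"
    by (rule Lim_transform_eventually[OF lim])
       (auto simp: flatexp_div_def eventually_at_filter)
qed

lemma flatexp_div_deriv:
  "(flatexp_div n has_real_derivative flatexp_div (n + 2) r - of_nat n * flatexp_div (Suc n) r) (at r)"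
proof -
  consider "r < 0" | "r = 0" | "r > 0" by linarith
  then show ?thesis
  proof cases
    case 1
    have "(flatexp_div n has_real_derivative 0) (at r)"
      by (rule has_field_derivative_transform_within_open[of "\<lambda>_. 0" _ _ "{..<0}"])
         (use 1 in \<open>auto simp: flatexp_div_def\<close>)
    then show ?thesis using 1 by (simp add: flatexp_div_def)
  next
    case 2
    \<comment> \<open>The difference quotient at 0 is the next member of the family, so its limit is
      the one already known.\<close>
    have *: "(flatexp_div n y - flatexp_div n 0) / (y - 0) = flatexp_div (Suc n) y" for y
      by (auto simp: flatexp_div_def)
    have "(flatexp_div n has_real_derivative 0) (at 0)"
      unfolding has_field_derivative_iff * by (rule flatexp_div_limit)
    then show ?thesis using 2 by (simp add: flatexp_div_def)
  next
    case 3
    have "((\<lambda>r. exp (- 1 / r) / r ^ n) has_real_derivative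
        ((exp (-1/r) * (1 / r^2)) * r ^ n - exp (-1/r) * (of_nat n * r ^ (n - 1))) / (r ^ n * r ^ n)) (at r)"
      using 3 by (auto intro!: derivative_eq_intros simp: power2_eq_square)
    also have "((exp (-1/r) * (1 / r^2)) * r ^ n - exp (-1/r) * (of_nat n * r ^ (n - 1))) / (r ^ n * r ^ n)
        = flatexp_div (n + 2) r - of_nat n * flatexp_div (Suc n) r"
      using 3 by (cases n) (auto simp: flatexp_div_def field_simps power2_eq_square)
    finally show ?thesis
      by (rule has_field_derivative_transform_within_open[of _ _ _ "{0<..}"])
         (use 3 in \<open>auto simp: flatexp_div_def\<close>)
  qed
qed

lemma smooth_flatexp: "smooth flatexp"
proof -
  have "C_k k (flatexp_div n)" for k n
  proof (induction k arbitrary: n)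
    case 0
    have "isCont (flatexp_div n) x" for x using DERIV_isCont[OF flatexp_div_deriv] .
    then show ?case by (auto simp: continuous_on_eq_continuous_at)
  next
    case (Suc k)
    have d: "dir_deriv v (flatexp_div n) = (\<lambda>r. (flatexp_div (n + 2) r + (- of_nat n) * flatexp_div (Suc n) r) * v)" for v
      using dir_deriv_real[OF flatexp_div_deriv] by auto
    have "C_k k (\<lambda>r. (flatexp_div (n + 2) r + (- of_nat n) * flatexp_div (Suc n) r) * v)" for v
      by (intro C_k_mult C_k_add Suc C_k_const)
    then show ?case
      unfolding C_k.simps d using flatexp_div_deriv by (auto simp: real_differentiable_def)
  qed
  moreover have "flatexp = flatexp_div 0" by (auto simp: flatexp_def flatexp_div_def)
  ultimately show ?thesis unfolding smooth_def by metis
qed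

lemma flatexp_0: "r \<le> 0 \<Longrightarrow> flatexp r = 0"
  by (simp add: flatexp_def)

lemma flatexp_nonneg: "flatexp r \<ge> 0" by (auto simp: flatexp_def)

lemma flatexp_mono: "r \<le> s \<Longrightarrow> flatexp r \<le> flatexp s"
  by (auto simp: flatexp_def field_simps)

lemma flatexp_1: "flatexp 1 = exp (-1)" by (simp add: flatexp_def)

text \<open>A composition of two flat exponentials instead of the usual quotient of bump functions.
  The factor \<open>exp 1\<close> compensates \<open>flatexp 1 = exp (-1)\<close>: the inner term is
  0 for \<open>r \<le> 1\<close> and at least 1 for \<open>r \<ge> 2\<close>, so the outer one runs
  from 1 down to 0.\<close>

definition cut :: "real \<Rightarrow> real" where
  "cut r = exp 1 * flatexp (1 - exp 1 * flatexp (r - 1))"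

lemma smooth_cut: "smooth cut"
proof -
  have "smooth (\<lambda>r. exp 1 * flatexp (1 - exp 1 * flatexp (r - 1)))"
    by (intro smooth_mult smooth_const smooth_compose[OF smooth_flatexp] smooth_minus
        smooth_bounded_linear bounded_linear_ident)
  then show ?thesis by (simp add: cut_def[abs_def])
qed

lemma cut_1: "r \<le> 1 \<Longrightarrow> cut r = 1"
  by (simp add: cut_def flatexp_0 flatexp_1 mult_exp_exp)

lemma cut_0: "r \<ge> 2 \<Longrightarrow> cut r = 0"
proof -
  assume "r \<ge> 2"
  then have "flatexp 1 \<le> flatexp (r - 1)" by (intro flatexp_mono) auto
  then have "exp 1 * flatexp 1 \<le> exp 1 * flatexp (r - 1)" by simp
  then have "1 \<le> exp 1 * flatexp (r - 1)" by (simp add: flatexp_1 mult_exp_exp)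
  then show ?thesis by (simp add: cut_def flatexp_0)
qed

lemma cut_nonneg: "cut r \<ge> 0" by (simp add: cut_def flatexp_nonneg)

lemma cut_le_1: "cut r \<le> 1"
proof -
  have "flatexp (1 - exp 1 * flatexp (r - 1)) \<le> flatexp 1"
    by (rule flatexp_mono) (simp add: flatexp_nonneg)
  then have "exp 1 * flatexp (1 - exp 1 * flatexp (r - 1)) \<le> exp 1 * flatexp 1" by simp
  then show ?thesis by (simp add: cut_def flatexp_1 mult_exp_exp)
qed

text \<open>Functions that agree near \<open>x\<close> have the same derivatives there, so the
  choice made by \<open>frechet_derivative\<close> is the same for both, even where no derivative
  exists.\<close>

lemma dir_deriv_local:
  assumes "open S" "x \<in> S" "\<And>y. y \<in> S \<Longrightarrow> f y = g y"
  shows "dir_deriv v f x = dir_deriv v g x"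
proof -
  have "(f has_derivative D) (at x) \<longleftrightarrow> (g has_derivative D) (at x)" for D
    using has_derivative_transform_within_open[of f D x UNIV S g]
      has_derivative_transform_within_open[of g D x UNIV S f] assms by auto
  then show ?thesis by (simp add: dir_deriv_def frechet_derivative_def)
qed

lemma dir_deriv_eqI:
  fixes f :: "'a::real_normed_vector \<Rightarrow> real"
  assumes "f differentiable (at x)" "((\<lambda>r. f (x + r *\<^sub>R v)) has_real_derivative d) (at 0)"
  shows "dir_deriv v f x = d"
  using dir_deriv_along_line[of f x 0 v] assms DERIV_unique by fastforce

subsection \<open>Weighted bounds on all derivatives\<close>

definition wbd :: "'a set \<Rightarrow> ('a \<Rightarrow> real) \<Rightarrow> ('i \<Rightarrow> 'a \<Rightarrow> real) \<Rightarrow> bool" where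
  "wbd S w F \<longleftrightarrow> (\<exists>C\<ge>0. \<forall>i. \<forall>x\<in>S. \<bar>F i x\<bar> \<le> C * w x)"

lemma wbdI:
  assumes "\<And>i x. x \<in> S \<Longrightarrow> \<bar>F i x\<bar> \<le> C * w x" "\<And>x. x \<in> S \<Longrightarrow> 0 \<le> w x"
  shows "wbd S w F"
proof -
  have "\<bar>F i x\<bar> \<le> \<bar>C\<bar> * w x" if "x \<in> S" for i x
    using assms(1)[OF that, of i] mult_right_mono[OF abs_ge_self assms(2)[OF that], of C] by linarith
  then show ?thesis unfolding wbd_def by (intro exI[of _ "\<bar>C\<bar>"]) auto
qed

lemma wbdE:
  assumes "wbd S w F"
  obtains C where "C \<ge> 0" "\<And>i x. x \<in> S \<Longrightarrow> \<bar>F i x\<bar> \<le> C * w x"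
  using assms unfolding wbd_def by blast

lemma wbd_cong: "wbd S w F \<Longrightarrow> (\<And>i x. x \<in> S \<Longrightarrow> F i x = G i x) \<Longrightarrow> wbd S w G"
  unfolding wbd_def by auto

lemma wbd_add:
  assumes "wbd S w F" "wbd S w G" shows "wbd S w (\<lambda>i x. F i x + G i x)"
proof -
  from assms obtain C D where "C \<ge> 0" "D \<ge> 0" and C: "\<And>i x. x \<in> S \<Longrightarrow> \<bar>F i x\<bar> \<le> C * w x"
    and D: "\<And>i x. x \<in> S \<Longrightarrow> \<bar>G i x\<bar> \<le> D * w x" by (metis wbdE)
  have "\<bar>F i x + G i x\<bar> \<le> (C + D) * w x" if "x \<in> S" for i x
    using C[OF that, of i] D[OF that, of i] by (simp add: algebra_simps)
  then show ?thesis unfolding wbd_def using \<open>C \<ge> 0\<close> \<open>D \<ge> 0\<close> by (intro exI[of _ "C + D"]) auto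
qed

lemma wbd_mult:
  assumes "wbd S w F" "wbd S w' G" and w: "\<And>x. x \<in> S \<Longrightarrow> w x * w' x \<le> w'' x"
  shows "wbd S w'' (\<lambda>i x. F i x * G i x)"
proof -
  from assms obtain C D where "C \<ge> 0" "D \<ge> 0" and C: "\<And>i x. x \<in> S \<Longrightarrow> \<bar>F i x\<bar> \<le> C * w x"
    and D: "\<And>i x. x \<in> S \<Longrightarrow> \<bar>G i x\<bar> \<le> D * w' x" by (metis wbdE)
  have "\<bar>F i x * G i x\<bar> \<le> (C * D) * w'' x" if "x \<in> S" for i x
  proof -
    have "\<bar>F i x * G i x\<bar> \<le> (C * w x) * (D * w' x)"
      unfolding abs_mult using C[OF that] D[OF that] by (intro mult_mono') auto
    also have "\<dots> = (C * D) * (w x * w' x)" by simp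
    also have "\<dots> \<le> (C * D) * w'' x" using \<open>C \<ge> 0\<close> \<open>D \<ge> 0\<close> w[OF that] by (intro mult_left_mono) auto
    finally show ?thesis .
  qed
  then show ?thesis unfolding wbd_def using \<open>C \<ge> 0\<close> \<open>D \<ge> 0\<close> by (intro exI[of _ "C * D"]) auto
qed

abbreviation "Ckw k S w F \<equiv> Ckb k S (wbd S w) F"

lemma Ckw_cong:
  assumes "open S" "Ckw k S w F" "\<And>i x. x \<in> S \<Longrightarrow> F i x = G i x" shows "Ckw k S w G"
  by (rule Ckb_cong[OF assms]) (assumption, rule wbd_cong)

lemma Ckw_add:
  assumes "open S" "Ckw k S w F" "Ckw k S w G" shows "Ckw k S w (\<lambda>i x. F i x + G i x)"
  by (rule Ckb_add[OF assms]) (rule wbd_cong, assumption, blast, rule wbd_add)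

lemma Ckw_mult:
  assumes "open S" "Ckw k S w F" "Ckw k S w' G" "\<And>x. x \<in> S \<Longrightarrow> w x * w' x \<le> w'' x"
  shows "Ckw k S w'' (\<lambda>i x. F i x * G i x)"
  by (rule Ckb_mult[OF assms(1-3)])
     (rule wbd_cong, assumption, blast, rule wbd_add, assumption+, rule wbd_mult[OF _ _ assms(4)])

lemma Ckw_reindex:
  assumes "Ckw k S w F" shows "Ckw k S w (\<lambda>j. F (r j))"
proof (rule Ckb_reindex[OF assms])
  fix F :: "'b \<Rightarrow> 'a \<Rightarrow> real" assume "wbd S w F"
  then show "wbd S w (\<lambda>j. F (r j))" unfolding wbd_def by blast
qed

lemma Ckw_mono:
  assumes "Ckw k S w F" "T \<subseteq> S" "\<And>x. x \<in> T \<Longrightarrow> w x \<le> w' x" shows "Ckw k T w' F"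
proof (rule Ckb_mono[OF assms(1,2)])
  fix F :: "'b \<Rightarrow> 'a \<Rightarrow> real" assume "wbd S w F"
  then obtain C where C: "C \<ge> 0" "\<And>i x. x \<in> S \<Longrightarrow> \<bar>F i x\<bar> \<le> C * w x" by (metis wbdE)
  have "\<bar>F i x\<bar> \<le> C * w' x" if "x \<in> T" for i x
    using C(2)[of x i] assms(2) that mult_left_mono[OF assms(3)[OF that] C(1)] by fastforce
  then show "wbd T w' F" unfolding wbd_def using C(1) by blast
qed

lemma Ckw_dir_deriv:
  assumes "\<And>k. Ckw k S w F" shows "Ckw k S w (\<lambda>i. dir_deriv v (F i))"
  using assms[of "Suc k"] by simp

lemma Ckw_const:
  assumes "\<And>i::'b. \<bar>c i\<bar> \<le> C" "\<And>x::'a::real_normed_vector. x \<in> S \<Longrightarrow> 1 \<le> w x"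
  shows "Ckw k S w (\<lambda>i _. c i)"
proof -
  have b: "wbd S w (\<lambda>i _. c i)" if "\<And>i. \<bar>c i\<bar> \<le> C" for c :: "'b \<Rightarrow> real" and C
  proof (rule wbdI[of _ _ "\<bar>C\<bar>"])
    show "\<bar>c i\<bar> \<le> \<bar>C\<bar> * w x" if "x \<in> S" for i x
      using mult_left_mono[OF assms(2)[OF that], of "\<bar>C\<bar>"] \<open>\<And>i. \<bar>c i\<bar> \<le> C\<close>[of i] by linarith
    show "0 \<le> w x" if "x \<in> S" for x using assms(2)[OF that] by linarith
  qed
  show ?thesis using assms(1)
  proof (induction k arbitrary: c C)
    case 0
    then show ?case using b[of c C] by simp
  next
    case (Suc k)
    have "Ckw k S w (\<lambda>(i::'b) _. 0)" by (rule Suc.IH[of "\<lambda>_. 0" 0]) simp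
    moreover have "dir_deriv v (\<lambda>_::'a. c i) = (\<lambda>_. 0)" for v i by (auto simp: dir_deriv_def)
    ultimately show ?case using Suc b[of c C] by simp
  qed
qed

lemma Ckw_sum:
  assumes "open S" "finite I" "\<And>x. x \<in> S \<Longrightarrow> 1 \<le> w x" "\<And>j. j \<in> I \<Longrightarrow> Ckw k S w (F j)"
  shows "Ckw k S w (\<lambda>i x. \<Sum>j\<in>I. F j i x)"
  using assms(2,4)
proof (induction I rule: finite_induct)
  case empty
  then show ?case using Ckw_const[of "\<lambda>_. 0" 0 S w] assms(3) by simp
next
  case (insert j I)
  then show ?case by (auto intro!: Ckw_add assms(1))
qed

lemma Ckw_linear:
  assumes "bounded_linear l" "\<And>x. x \<in> S \<Longrightarrow> \<bar>l x + c\<bar> \<le> C * w x" "\<And>x. x \<in> S \<Longrightarrow> 1 \<le> w x"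
  shows "Ckw k S w (\<lambda>(_::'i) x. l x + c)"
proof -
  have b: "wbd S w (\<lambda>(_::'i) x. l x + c)"
  proof (rule wbdI[of _ _ C])
    show "0 \<le> w x" if "x \<in> S" for x using assms(3)[OF that] by linarith
  qed (use assms(2) in auto)
  have d: "((\<lambda>x. l x + c) has_derivative l) (at x)" for x
    using bounded_linear_imp_has_derivative[OF assms(1), of "at x"] has_derivative_add_const by blast
  show ?thesis
  proof (cases k)
    case 0
    have "continuous_on S (\<lambda>x. l x + c)"
      by (intro continuous_intros linear_continuous_on assms(1))
    then show ?thesis using b 0 by simp
  next
    case (Suc n)
    have "dir_deriv v (\<lambda>x. l x + c) = (\<lambda>_. l v)" for v using dir_deriv_eq[OF d] by auto
 then have "Ckw n S w (\<lambda>_::'i. dir_deriv v (\<lambda>x. l x + c))" for v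
      using Ckw_const[of "\<lambda>_::'i. l v" "\<bar>l v\<bar>" S w n] assms(3) by simp
    moreover have "(\<lambda>x. l x + c) differentiable (at x)" for x using d differentiable_def by blast
    ultimately show ?thesis using b Suc by simp
  qed
qed

text \<open>For products of a cutoff with a function that is smooth on \<open>S\<close> only, such
  as the heat kernel at positive diffusion parameters: on \<open>T\<close> the cutoff vanishes, and
  there the product is smooth for trivial reasons.\<close>

lemma Ckw_extend_by_zero:
  assumes "open S" "open T" "Ckw k S w F" "\<And>i x. x \<in> T \<Longrightarrow> F i x = 0" "S \<union> T = UNIV"
    and w: "\<And>x. x \<in> S \<Longrightarrow> w x \<le> w' x" "\<And>x. 0 \<le> w' x"
  shows "Ckw k UNIV w' F"
proof -
  have S: "Ckw k S w' F" by (rule Ckw_mono[OF assms(3)]) (use w in auto)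
  have T: "Ckw k T w' (\<lambda>(_::'b) _. 0)"
  proof -
    have "wbd T w' (\<lambda>(_::'b) _. 0)" by (rule wbdI[of _ _ 0]) (use w in auto)
    moreover have "dir_deriv v (\<lambda>_::'a. 0::real) = (\<lambda>_. 0)" for v by (auto simp: dir_deriv_def)
    ultimately show ?thesis by (induction k) auto
  qed
  have "Ckw k T w' F" by (rule Ckw_cong[OF assms(2) T]) (use assms(4) in auto)
  show ?thesis
    unfolding assms(5)[symmetric]
  proof (rule Ckb_Un[OF assms(1,2) S \<open>Ckw k T w' F\<close>], unfold assms(5))
    fix F :: "'b \<Rightarrow> 'a \<Rightarrow> real" assume "wbd S w' F" "wbd T w' F"
    then obtain C D where "C \<ge> 0" "D \<ge> 0" and C: "\<And>i x. x \<in> S \<Longrightarrow> \<bar>F i x\<bar> \<le> C * w' x"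
    and D: "\<And>i x. x \<in> T \<Longrightarrow> \<bar>F i x\<bar> \<le> D * w' x" by (metis wbdE)
    have "\<bar>F i x\<bar> \<le> (C + D) * w' x" for i x
    proof -
      have "x \<in> S \<or> x \<in> T" using assms(5) by auto
      then show ?thesis using C[of x i] D[of x i] mult_nonneg_nonneg[OF \<open>C \<ge> 0\<close> w(2)[of x]]
        mult_nonneg_nonneg[OF \<open>D \<ge> 0\<close> w(2)[of x]] by (auto simp: algebra_simps)
    qed
    then show "wbd UNIV w' F" unfolding wbd_def using \<open>C \<ge> 0\<close> \<open>D \<ge> 0\<close> by (intro exI[of _ "C + D"]) auto
  qed
qed

lemma C_k_if_Ckw: "Ckw k UNIV w (\<lambda>_::unit. f) \<Longrightarrow> C_k k f"
  unfolding C_k_eq_Ckb by (rule Ckb_mono) auto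

lemma C_k_if_Ckw_family: "Ckw k UNIV w F \<Longrightarrow> C_k k (F i)"
  by (rule C_k_if_Ckw[OF Ckw_reindex[where r="\<lambda>_. i"]])

lemma smooth_if_Ckw:
  assumes "\<And>k. Ckw k UNIV w F" shows "smooth (F i)"
  unfolding smooth_def using C_k_if_Ckw_family[OF assms] by simp

text \<open>Every derivative is again continuous and vanishes off the compact set \<open>?K\<close>,
  so compactness bounds each order.\<close>

lemma test_function_Ckw:
  fixes f :: "'a::euclidean_space \<Rightarrow> real"
  assumes "test_function f"
  shows "Ckw k UNIV (\<lambda>_. 1) (\<lambda>_::'i. f)"
proof -
  let ?K = "closure {x. f x \<noteq> 0}"
  have K: "compact ?K" and s: "smooth f" using assms by (auto simp: test_function_def)
 have *: "Ckw k UNIV (\<lambda>_. 1) (\<lambda>_::'i. h)" if "smooth h" "\<And>x. x \<notin> ?K \<Longrightarrow> h x = 0" for h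
    using that
  proof (induction k arbitrary: h)
 have b: "wbd UNIV (\<lambda>_. 1) (\<lambda>_::'i. h)" if "smooth h" "\<And>x. x \<notin> ?K \<Longrightarrow> h x = 0" for h
    proof -
      have "bounded (h ` ?K)"
        by (intro compact_imp_bounded compact_continuous_image K smooth_continuous_on that)
      then obtain B where "\<And>x. x \<in> ?K \<Longrightarrow> \<bar>h x\<bar> \<le> B" unfolding bounded_iff by auto
      then have "\<bar>h x\<bar> \<le> \<bar>B\<bar> * 1" for x
        using that(2)[of x] by (cases "x \<in> ?K") force+
      then show ?thesis by (intro wbdI[of _ _ "\<bar>B\<bar>"]) auto
    qed
    {
      case 0
      then show ?case using b[of h] smooth_continuous_on[of h] by simp
    next
      case (Suc k)
      have "dir_deriv v h x = 0" if "x \<notin> ?K" for v x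
      proof -
        have "dir_deriv v h x = dir_deriv v (\<lambda>_. 0) x"
          by (rule dir_deriv_local[of "- ?K"]) (use that Suc.prems in auto)
        then show ?thesis by (simp add: dir_deriv_def)
      qed
      then have "Ckw k UNIV (\<lambda>_. 1) (\<lambda>_::'i. dir_deriv v h)" for v
        by (rule Suc.IH[OF smooth_dir_deriv[OF Suc.prems(1)]])
      then show ?case using b[of h] Suc.prems smooth_differentiable by auto
    }
  qed
  show ?thesis
  proof (rule *[OF s])
    show "f x = 0" if "x \<notin> ?K" for x
      using that closure_subset[of "{x. f x \<noteq> 0}"] by auto
  qed
qed

lemma dir_deriv_compose_linear:
  assumes "bounded_linear A" "f differentiable (at (A x))"
  shows "dir_deriv v (\<lambda>x. f (A x)) x = dir_deriv (A v) f (A x)"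
    "(\<lambda>x. f (A x)) differentiable (at x)"
proof -
  have "((\<lambda>x. f (A x)) has_derivative (\<lambda>v. frechet_derivative f (at (A x)) (A v))) (at x)"
    by (rule has_derivative_compose[where g=f and f=A, OF bounded_linear_imp_has_derivative[OF assms(1)]
       assms(2)[unfolded frechet_derivative_works]])
  from dir_deriv_eq[OF this] this show "dir_deriv v (\<lambda>x. f (A x)) x = dir_deriv (A v) f (A x)"
    "(\<lambda>x. f (A x)) differentiable (at x)" unfolding dir_deriv_def differentiable_def by auto
qed

lemma dir_deriv_scaled:
  fixes f :: "'a::real_normed_vector \<Rightarrow> real"
  assumes "f differentiable (at x)"
  shows "dir_deriv (c *\<^sub>R v) f x = c * dir_deriv v f x"
  using linear_scale[OF linear_frechet_derivative[OF assms]] by (simp add: dir_deriv_def)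

lemma C_k_compose_linear:
  assumes "bounded_linear A" "C_k k f" shows "C_k k (\<lambda>x. f (A x))"
  using assms(2)
proof (induction k arbitrary: f)
  case 0
  then show ?case using linear_continuous_on[OF assms(1)] by (auto intro: continuous_on_compose2)
next
  case (Suc k)
  then have diff: "f differentiable (at x)" for x by simp
  then have "dir_deriv v (\<lambda>x. f (A x)) = (\<lambda>x. dir_deriv (A v) f (A x))" for v
    using dir_deriv_compose_linear(1)[OF assms(1)] by blast
  then show ?case using Suc dir_deriv_compose_linear(2)[OF assms(1) diff] by auto
qed

lemma smooth_compose_linear: "bounded_linear A \<Longrightarrow> smooth f \<Longrightarrow> smooth (\<lambda>x. f (A x))"
  unfolding smooth_def using C_k_compose_linear by blast

text \<open>Rescaled arguments: the chain rule only produces factors \<open>c i\<close>, which stay bounded.\<close>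

lemma Ckw_compose_scaled_linear:
  fixes f :: "'b::real_normed_vector \<Rightarrow> real"
  assumes A: "bounded_linear A" and c: "\<And>i. \<bar>c i\<bar> \<le> 1"
    and f: "Ckw k UNIV (\<lambda>_. 1) (\<lambda>_::unit. f)"
  shows "Ckw k UNIV (\<lambda>_. 1) (\<lambda>i x. f (c i *\<^sub>R A x))"
  using f
proof (induction k arbitrary: f)
  have b: "wbd UNIV (\<lambda>_. 1) (\<lambda>i x. f (c i *\<^sub>R A x))" if "wbd UNIV (\<lambda>_. 1) (\<lambda>_::unit. f)" for f :: "'b \<Rightarrow> real"
    using that unfolding wbd_def by auto
  {
    case 0
    have "continuous_on UNIV (\<lambda>x. c i *\<^sub>R A x)" for i
      by (intro continuous_on_scaleR continuous_on_const linear_continuous_on A)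
    then have "continuous_on UNIV (\<lambda>x. f (c i *\<^sub>R A x))" for i
      by (rule continuous_on_compose2[of UNIV f, rotated])
         (use 0 in auto)
    then show ?case using b[of f] 0 by simp
  next
    case (Suc k)
    have lin: "bounded_linear (\<lambda>x. c i *\<^sub>R A x)" for i
      using A bounded_linear_compose[OF bounded_linear_scaleR_right] by blast
    have diff: "f differentiable (at x)" for x using Suc.prems by auto
    have d: "dir_deriv v (\<lambda>x. f (c i *\<^sub>R A x)) = (\<lambda>x. c i * dir_deriv (A v) f (c i *\<^sub>R A x))" for v i
      using dir_deriv_compose_linear(1)[OF lin diff] dir_deriv_scaled[OF diff] by auto
    have "Ckw k UNIV (\<lambda>_. 1) (\<lambda>i x. c i * dir_deriv (A v) f (c i *\<^sub>R A x))" for v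
      by (rule Ckw_mult[OF _ Ckw_const[of c 1] Suc.IH]) (use c Suc.prems in auto)
    then show ?case using b[of f] Suc.prems d dir_deriv_compose_linear(2)[OF lin diff] by simp
  }
qed

section \<open>Spatial cutoffs with derivatives bounded uniformly in the radius\<close>

text \<open>The square of the norm keeps the cutoff smooth at the origin, and \<open>Suc n\<close>
  admits \<open>chi 0\<close> as the profile of which all others are dilations.\<close>

definition chi :: "nat \<Rightarrow> 'a::euclidean_space \<Rightarrow> real" where
  "chi n x = cut ((norm ((1 / Suc n) *\<^sub>R x))\<^sup>2)"

lemma chi_eq_1: "norm x < Suc n \<Longrightarrow> chi n x = 1"
proof -
  assume "norm x < Suc n"
  then have "norm ((1 / Suc n) *\<^sub>R x) \<le> 1" by (simp add: field_simps)
  then have "(norm ((1 / Suc n) *\<^sub>R x))\<^sup>2 \<le> 1" by (rule power_le_one[OF norm_ge_zero])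
  then show ?thesis unfolding chi_def by (rule cut_1)
qed

lemma chi_eq_0: "norm x \<ge> 2 * Suc n \<Longrightarrow> chi n x = 0"
proof -
  assume "norm x \<ge> 2 * Suc n"
  then have "norm ((1 / Suc n) *\<^sub>R x) \<ge> 2" by (simp add: field_simps)
  then have "2^2 \<le> (norm ((1 / Suc n) *\<^sub>R x))\<^sup>2" by (intro power_mono) auto
  then show ?thesis unfolding chi_def by (intro cut_0) auto
qed

lemma chi_rescale: "chi n x = chi 0 ((1 / Suc n) *\<^sub>R x)"
  by (simp add: chi_def)

lemma norm_sq_sum_Basis: "(norm (x::'a::euclidean_space))\<^sup>2 = (\<Sum>b\<in>Basis. (x \<bullet> b) * (x \<bullet> b))"
  by (subst power2_norm_eq_inner) (rule euclidean_inner)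

lemma smooth_norm_sq: "smooth (\<lambda>x::'a::euclidean_space. (norm x)\<^sup>2)"
  unfolding norm_sq_sum_Basis
  by (intro smooth_sum smooth_mult smooth_bounded_linear bounded_linear_inner_left)

lemma smooth_chi: "smooth (chi n)"
  unfolding chi_def
  by (intro smooth_compose[OF smooth_cut] smooth_compose_linear[OF _ smooth_norm_sq] bounded_linear_scaleR_right)

lemma compact_supportI:
  fixes f :: "'a::euclidean_space \<Rightarrow> 'b::zero"
  assumes "\<And>x. norm x > r \<Longrightarrow> f x = 0"
  shows "compact (closure {x. f x \<noteq> 0})"
proof -
  have "{x. f x \<noteq> 0} \<subseteq> cball 0 r" using assms by force
  then show ?thesis using bounded_subset[OF bounded_cball] compact_closure by blast
qed

lemma test_function_chi: "test_function (chi n :: 'a::euclidean_space \<Rightarrow> real)"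
proof -
  have "chi n x = 0" if "norm x > 2 * Suc n" for x :: 'a using chi_eq_0[of n x] that by simp
  then show ?thesis unfolding test_function_def using smooth_chi compact_supportI by blast
qed

lemma chi_Ckw:
  assumes "bounded_linear A"
  shows "Ckw k UNIV (\<lambda>_. 1) (\<lambda>n x. chi n (A x))"
proof -
  have "Ckw k UNIV (\<lambda>_. 1) (\<lambda>n x. chi 0 ((1 / Suc n) *\<^sub>R A x))"
    by (rule Ckw_compose_scaled_linear[OF assms _ test_function_Ckw[OF test_function_chi]]) simp
  then show ?thesis by (subst chi_rescale)
qed

text \<open>\<open>A\<close> will be the identity of space or the projection from space-time to
  space. The bounds are uniform in \<open>n\<close>, which supplies the dominating function when the
  cutoff is removed.\<close>

lemma cutoff_Ckw:
  assumes "bounded_linear A" "\<And>k. Ckw k UNIV w (\<lambda>_::unit. P)"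
  shows "Ckw k UNIV w (\<lambda>n x. chi n (A x) * P x)"
  by (rule Ckw_mult[OF open_UNIV chi_Ckw[OF assms(1)] Ckw_reindex[OF assms(2)]]) auto

text \<open>Equality on a neighbourhood, not merely at \<open>x\<close>, so that every derivative of
  the truncation is eventually equal to that of \<open>P\<close> at \<open>x\<close>.\<close>

lemma cutoff_eventually_local:
  assumes "bounded_linear A"
  obtains S N where "open S" "x \<in> S" "\<And>n y. n \<ge> N \<Longrightarrow> y \<in> S \<Longrightarrow> chi n (A y) * P y = P y"
proof -
  obtain N where N: "norm (A x) < real N" using reals_Archimedean2 by blast
  let ?S = "{y. norm (A y) < real N}"
  have "open ?S" using linear_continuous_on[OF assms, of UNIV]
    by (intro open_Collect_less continuous_intros)
  moreover have "chi n (A y) * P y = P y" if "n \<ge> N" "y \<in> ?S" for n y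
  proof -
    have "norm (A y) < Suc n" using that by simp
    from chi_eq_1[OF this] show ?thesis by simp
  qed
  ultimately show ?thesis using that N by blast
qed

section \<open>The heat kernel and its spatial derivatives\<close>

definition heat :: "real \<Rightarrow> real^3 \<Rightarrow> real" where
  "heat \<sigma> z = (4 * pi * \<sigma>) powr (-3/2) * exp (- (norm z)\<^sup>2 / (4 * \<sigma>))"

definition kron :: "3 \<Rightarrow> 3 \<Rightarrow> real" where
  "kron j k = (if j = k then 1 else 0)"

text \<open>With \<open>heat2\<close> and \<open>heat3\<close>, the partial derivatives of
  \<open>heat\<close> up to order three. Each is the product rule applied to
  \<open>- z $ j / (2 * \<sigma>)\<close> times the preceding order, a recursive form that serves
  both the derivative formulas and the size estimates.\<close>

definition heat1 :: "3 \<Rightarrow> real \<Rightarrow> real^3 \<Rightarrow> real" where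
  "heat1 j \<sigma> z = - (z $ j) / (2 * \<sigma>) * heat \<sigma> z"

definition heat2 :: "3 \<Rightarrow> 3 \<Rightarrow> real \<Rightarrow> real^3 \<Rightarrow> real" where
  "heat2 j k \<sigma> z = - kron j k / (2 * \<sigma>) * heat \<sigma> z - z $ j / (2 * \<sigma>) * heat1 k \<sigma> z"

definition heat3 :: "3 \<Rightarrow> 3 \<Rightarrow> 3 \<Rightarrow> real \<Rightarrow> real^3 \<Rightarrow> real" where
  "heat3 j k l \<sigma> z = - kron j k / (2 * \<sigma>) * heat1 l \<sigma> z - kron j l / (2 * \<sigma>) * heat1 k \<sigma> z
     - z $ j / (2 * \<sigma>) * heat2 k l \<sigma> z"

definition heat_lap :: "real \<Rightarrow> real^3 \<Rightarrow> real" where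
  "heat_lap \<sigma> z = ((norm z)\<^sup>2 / (4 * \<sigma>\<^sup>2) - 3 / (2 * \<sigma>)) * heat \<sigma> z"

lemma axis_nth_kron: "(axis k 1 :: real^3) $ j = kron j k"
  by (simp add: axis_def kron_def)

lemma norm_sq_sum: "(norm (z::real^3))\<^sup>2 = (\<Sum>j\<in>UNIV. (z $ j)\<^sup>2)"
  by (simp add: norm_vec_def L2_set_def sum_nonneg)

lemma norm_sq_line: "(norm (z + r *\<^sub>R axis j 1 :: real^3))\<^sup>2 = (norm z)\<^sup>2 + 2 * r * z $ j + r\<^sup>2"
  unfolding power2_norm_eq_inner inner_add_left inner_add_right inner_scaleR_left inner_scaleR_right
  by (simp add: inner_axis inner_axis' power2_eq_square algebra_simps)

lemma heat_line:
  "((\<lambda>r. heat \<sigma> (z + r *\<^sub>R axis j 1)) has_real_derivative heat1 j \<sigma> z) (at 0)"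
proof -
  have "((\<lambda>r. - ((norm z)\<^sup>2 + 2 * r * z $ j + r\<^sup>2) / (4 * \<sigma>)) has_real_derivative (- (2 * z $ j)) / (4 * \<sigma>)) (at 0)"
    by (rule DERIV_cdivide) (auto intro!: derivative_eq_intros)
  from DERIV_cmult[OF DERIV_fun_exp[OF this], of "(4 * pi * \<sigma>) powr (-3/2)"]
  show ?thesis unfolding heat_def heat1_def norm_sq_line
    by (simp add: mult_ac)
qed

lemma coord_line: "((\<lambda>r. (z + r *\<^sub>R axis k 1 :: real^3) $ j) has_real_derivative kron j k) (at 0)"
  by (auto simp: axis_nth_kron intro!: derivative_eq_intros)

lemma heat1_line:
  "((\<lambda>r. heat1 j \<sigma> (z + r *\<^sub>R axis k 1)) has_real_derivative heat2 j k \<sigma> z) (at 0)"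
  using DERIV_cmult[OF DERIV_mult[OF coord_line[of z k j] heat_line[of \<sigma> z k]], of "- 1 / (2 * \<sigma>)"]
  unfolding heat1_def[of j] heat2_def
  by (simp add: algebra_simps add_divide_distrib diff_divide_distrib)

lemma heat2_line:
  "((\<lambda>r. heat2 j k \<sigma> (z + r *\<^sub>R axis l 1)) has_real_derivative heat3 j k l \<sigma> z) (at 0)"
  using DERIV_diff[OF DERIV_cmult[OF heat_line[of \<sigma> z l], of "- kron j k / (2 * \<sigma>)"]
     DERIV_cmult[OF DERIV_mult[OF coord_line[of z l j] heat1_line[of k \<sigma> z l]], of "1 / (2 * \<sigma>)"]]
  unfolding heat2_def[of j] heat3_def
  by (simp add: algebra_simps add_divide_distrib diff_divide_distrib)

lemma heat2_trace: "(\<Sum>j\<in>UNIV. heat2 j j \<sigma> z) = heat_lap \<sigma> z"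
proof -
  have "heat2 j j \<sigma> z = ((z $ j)\<^sup>2 / (4 * \<sigma>\<^sup>2) - 1 / (2 * \<sigma>)) * heat \<sigma> z" for j
    by (simp add: heat2_def heat1_def kron_def power2_eq_square algebra_simps)
  then show ?thesis
    unfolding heat_lap_def norm_sq_sum sum_3 by (simp only:) (simp add: add_divide_distrib algebra_simps)
qed

text \<open>Together with \<open>heat2_trace\<close> this is the heat equation:
  \<open>heat_lap\<close> is at the same time the Laplacian and the derivative in the diffusion
  parameter.\<close>

lemma heat_time:
  assumes "\<sigma> > 0"
  shows "((\<lambda>\<sigma>. heat \<sigma> z) has_real_derivative heat_lap \<sigma> z) (at \<sigma>)"
proof -
  have 0: "((\<lambda>\<sigma>. (4 * pi * \<sigma>) powr (-3/2)) has_real_derivative (-3/2) * (4 * pi * \<sigma>) powr (-3/2 - 1) * (4 * pi)) (at \<sigma>)"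
    using assms by (auto intro!: derivative_eq_intros)
  have "(4 * pi * \<sigma>) powr (-3/2 - 1) = (4 * pi * \<sigma>) powr (-3/2) / (4 * pi * \<sigma>)"
    using assms by (subst powr_diff) auto
  then have eq: "(-3/2) * (4 * pi * \<sigma>) powr (-3/2 - 1) * (4 * pi) = - ((4 * pi * \<sigma>) powr (-3/2) * 3 / (2 * \<sigma>))"
    using assms by (simp only:) (simp add: field_simps)
  have 1: "((\<lambda>\<sigma>. (4 * pi * \<sigma>) powr (-3/2)) has_real_derivative - ((4 * pi * \<sigma>) powr (-3/2) * 3 / (2 * \<sigma>))) (at \<sigma>)"
    using 0 unfolding eq .
  have 2: "((\<lambda>\<sigma>. exp (- (norm z)\<^sup>2 / (4 * \<sigma>))) has_real_derivative exp (- (norm z)\<^sup>2 / (4 * \<sigma>)) * ((norm z)\<^sup>2 / (4 * \<sigma>\<^sup>2))) (at \<sigma>)"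
    using assms by (auto intro!: derivative_eq_intros simp: power2_eq_square)
  show ?thesis
    unfolding heat_def heat_lap_def
    using DERIV_mult[OF 1 2] by (simp add: algebra_simps)
qed

text \<open>From \<open>1 + r \<le> exp r\<close> the left-hand side is at most
  \<open>exp (m * r - c * r\<^sup>2)\<close>, and completing the square bounds the exponent.\<close>

lemma poly_exp_bound:
  fixes c :: real
  assumes "c > 0"
  obtains C where "C > 0" "\<And>r. r \<ge> 0 \<Longrightarrow> (1 + r) ^ m * exp (- c * r\<^sup>2) \<le> C"
proof
  show "exp ((real m)\<^sup>2 / (4 * c)) > 0" by simp
  show "(1 + r) ^ m * exp (- c * r\<^sup>2) \<le> exp ((real m)\<^sup>2 / (4 * c))" if "r \<ge> 0" for r
  proof -
    have "(1 + r) ^ m \<le> exp r ^ m" using that by (intro power_mono exp_ge_add_one_self) auto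
    then have "(1 + r) ^ m * exp (- c * r\<^sup>2) \<le> exp (m * r) * exp (- c * r\<^sup>2)"
      by (intro mult_right_mono) (auto simp: exp_of_nat_mult[symmetric] mult.commute)
    also have "\<dots> = exp (m * r - c * r\<^sup>2)" by (simp add: exp_add[symmetric])
    also have "m * r - c * r\<^sup>2 \<le> (real m)\<^sup>2 / (4 * c)"
    proof -
      have "(m * r - c * r\<^sup>2) * (4 * c) = (real m)\<^sup>2 - (real m - 2 * c * r)\<^sup>2"
        by (simp add: power2_eq_square algebra_simps)
      also have "\<dots> \<le> (real m)\<^sup>2" by simp
      finally show ?thesis using assms by (simp add: pos_le_divide_eq)
    qed
    finally show ?thesis by simp
  qed
qed

section \<open>The test function solving the backward heat equation\<close>

abbreviation wt :: "nat \<Rightarrow> real \<times> (real^3) \<Rightarrow> real" where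
  "wt m p \<equiv> 1 / (1 + norm (snd p)) ^ m"

text \<open>At time \<open>s\<close> the diffusion parameter is \<open>\<sigma> - \<nu> * s\<close>,
  so that the kernel solves the backward equation with viscosity \<open>\<nu>\<close>. It stays
  positive before time \<open>c\<close>, while \<open>\<theta>\<close> is already zero after
  \<open>b\<close>; the times between \<open>b\<close> and \<open>c\<close> are the room in which
  the product is glued to zero. In the past the support ends at -2 and the domain \<open>U\<close>
  at -3 for the same reason.\<close>

locale backward_heat =
  fixes \<nu> \<sigma> b c :: real and x :: "real^3" and \<theta> :: "real \<Rightarrow> real"
  assumes \<nu>: "\<nu> > 0" and bc: "b < c" and c: "\<nu> * c < \<sigma>"
    and smooth_theta: "smooth \<theta>" and theta_zero: "\<And>s. s < -2 \<or> b < s \<Longrightarrow> \<theta> s = 0"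
begin

definition U :: "(real \<times> (real^3)) set" where "U = {p. -3 < fst p \<and> fst p < c}"

definition P :: "real \<times> (real^3) \<Rightarrow> real" where
  "P p = \<theta> (fst p) * heat (\<sigma> - \<nu> * fst p) (snd p - x)"

lemma open_U: "open U"
  unfolding U_def by (intro open_Collect_conj open_Collect_less continuous_intros)

lemma tau_bounds: "p \<in> U \<Longrightarrow> \<sigma> - \<nu> * c < \<sigma> - \<nu> * fst p \<and> \<sigma> - \<nu> * fst p < \<sigma> + 3 * \<nu>"
  using \<nu> mult_strict_left_mono[OF _ \<nu>, of "fst p" c] mult_strict_left_mono[OF _ \<nu>, of "-3" "fst p"]
  by (auto simp: U_def)

lemma tau_pos: "p \<in> U \<Longrightarrow> \<sigma> - \<nu> * fst p > 0"
  using tau_bounds[of p] c by linarith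

text \<open>On \<open>U\<close> the diffusion parameter lies between two positive constants, so all
  its real powers are bounded. A derivative lowers the exponent, hence the induction runs over all
  exponents.\<close>

lemma powr_Ckw: "Ckw k U (\<lambda>_. 1) (\<lambda>_::unit. \<lambda>p. (\<sigma> - \<nu> * fst p) powr r)"
proof (induction k arbitrary: r)
  have b: "wbd U (\<lambda>_. 1) (\<lambda>_::unit. \<lambda>p. (\<sigma> - \<nu> * fst p) powr r)" for r
  proof (rule wbdI[of _ _ "(\<sigma> - \<nu> * c) powr r + (\<sigma> + 3 * \<nu>) powr r"])
    fix p :: "real \<times> (real^3)" assume p: "p \<in> U"
    have "(\<sigma> - \<nu> * fst p) powr r \<le> (\<sigma> - \<nu> * c) powr r + (\<sigma> + 3 * \<nu>) powr r"
    proof (cases "r \<ge> 0")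
      case True
      then have "(\<sigma> - \<nu> * fst p) powr r \<le> (\<sigma> + 3 * \<nu>) powr r"
        using tau_bounds[OF p] tau_pos[OF p] by (intro powr_mono2) auto
      then show ?thesis using powr_ge_zero[of "\<sigma> - \<nu> * c" r] by linarith
    next
      case False
      then have "(\<sigma> - \<nu> * fst p) powr r \<le> (\<sigma> - \<nu> * c) powr r"
        using tau_bounds[OF p] c by (intro powr_mono2') auto
      then show ?thesis using powr_ge_zero[of "\<sigma> + 3 * \<nu>" r] by linarith
    qed
    then show "\<bar>(\<sigma> - \<nu> * fst p) powr r\<bar> \<le> ((\<sigma> - \<nu> * c) powr r + (\<sigma> + 3 * \<nu>) powr r) * 1" by simp
  qed auto
  have d: "((\<lambda>p. (\<sigma> - \<nu> * fst p) powr r) has_derivative (\<lambda>v. (r * (- \<nu> * fst v)) * (\<sigma> - \<nu> * fst p) powr (r - 1))) (at p)"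
    if "p \<in> U" for p :: "real \<times> (real^3)" and r
  proof -
    have "((\<lambda>p::real \<times> (real^3). \<sigma> - \<nu> * fst p) has_derivative (\<lambda>v. - \<nu> * fst v)) (at p)"
      by (auto intro!: derivative_eq_intros)
    from has_derivative_compose[where f="\<lambda>p. \<sigma> - \<nu> * fst p" and g="\<lambda>t. t powr r", OF this
        has_real_derivative_powr[OF tau_pos[OF that], unfolded has_field_derivative_def]]
    show ?thesis by (simp add: algebra_simps)
  qed
  {
    case 0
    have "continuous_on U (\<lambda>p. (\<sigma> - \<nu> * fst p) powr r)"
      using tau_pos by (intro continuous_on_powr continuous_intros) force
    then show ?case using b by simp
  next
    case (Suc k)
    have *: "Ckw k U (\<lambda>_. 1) (\<lambda>_::unit. \<lambda>p. (r * (- \<nu> * fst v)) * (\<sigma> - \<nu> * fst p) powr (r - 1))" for v :: "real \<times> (real^3)"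
      by (rule Ckw_mult[OF open_U Ckw_const[of "\<lambda>_. r * (- \<nu> * fst v)" "\<bar>r * (- \<nu> * fst v)\<bar>"] Suc.IH]) auto
    have "Ckw k U (\<lambda>_. 1) (\<lambda>_::unit. dir_deriv v (\<lambda>p. (\<sigma> - \<nu> * fst p) powr r))" for v :: "real \<times> (real^3)"
      by (rule Ckw_cong[OF open_U *[of v]]) (use dir_deriv_eq[OF d, where v=v] in simp)
    moreover have "(\<lambda>p. (\<sigma> - \<nu> * fst p) powr r) differentiable at p" if "p \<in> U" for p :: "real \<times> (real^3)"
      using d[OF that] differentiable_def by blast
    ultimately show ?case using b by simp
  }
qed

definition q :: "real \<times> (real^3) \<Rightarrow> real" where
  "q p = - (norm (snd p - x))\<^sup>2 / (4 * (\<sigma> - \<nu> * fst p))"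

lemma q_Ckw: "Ckw k U (\<lambda>p. (1 + norm (snd p)) ^ 2) (\<lambda>_::unit. q)"
proof -
  have ge1: "1 \<le> (1 + norm (snd p)) ^ n" for p :: "real \<times> (real^3)" and n
    by (rule one_le_power) simp
  have lin: "Ckw k U (\<lambda>p. 1 + norm (snd p)) (\<lambda>_::unit. \<lambda>p. snd p \<bullet> e + (- (x \<bullet> e)))" if "e \<in> Basis" for e :: "real^3"
  proof (rule Ckw_linear)
    show "bounded_linear (\<lambda>p::real \<times> (real^3). snd p \<bullet> e)"
      by (intro bounded_linear_compose[OF bounded_linear_inner_left bounded_linear_snd])
    show "\<bar>snd p \<bullet> e + (- (x \<bullet> e))\<bar> \<le> (1 + norm x) * (1 + norm (snd p))" for p :: "real \<times> (real^3)"
    proof -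
      have "\<bar>snd p \<bullet> e + (- (x \<bullet> e))\<bar> \<le> norm (snd p) + norm x"
        using Basis_le_norm[OF that, of "snd p"] Basis_le_norm[OF that, of x] by linarith
      also have "\<dots> \<le> (1 + norm x) * (1 + norm (snd p))" by (simp add: algebra_simps)
      finally show ?thesis .
    qed
  qed auto
  have "Ckw k U (\<lambda>p. (1 + norm (snd p)) ^ 2) (\<lambda>_::unit. \<lambda>p. \<Sum>e\<in>Basis. (snd p \<bullet> e + (- (x \<bullet> e))) * (snd p \<bullet> e + (- (x \<bullet> e))))"
    by (intro Ckw_sum open_U Ckw_mult[OF open_U lin lin])
       (auto simp: ge1 power2_eq_square[symmetric])
  from Ckw_mult[OF open_U this powr_Ckw[of _ "-1"], where w''="\<lambda>p. (1 + norm (snd p)) ^ 2"]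
  have "Ckw k U (\<lambda>p. (1 + norm (snd p)) ^ 2) (\<lambda>_::unit. \<lambda>p. (\<Sum>e\<in>Basis. (snd p \<bullet> e + (- (x \<bullet> e))) * (snd p \<bullet> e + (- (x \<bullet> e)))) * (\<sigma> - \<nu> * fst p) powr - 1)"
    by simp
  from Ckw_mult[OF open_U Ckw_const[of "\<lambda>_. -1/4" "1/4" U "\<lambda>_. 1"] this, where w''="\<lambda>p. (1 + norm (snd p)) ^ 2"]
  have *: "Ckw k U (\<lambda>p. (1 + norm (snd p)) ^ 2) (\<lambda>_::unit. \<lambda>p. - 1/4 * ((\<Sum>e\<in>Basis. (snd p \<bullet> e + (- (x \<bullet> e))) * (snd p \<bullet> e + (- (x \<bullet> e)))) * (\<sigma> - \<nu> * fst p) powr - 1))"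
    by simp
  show ?thesis
  proof (rule Ckw_cong[OF open_U *])
    fix p assume "p \<in> U"
    from tau_pos[OF this] show "- 1/4 * ((\<Sum>e\<in>Basis. (snd p \<bullet> e + (- (x \<bullet> e))) * (snd p \<bullet> e + (- (x \<bullet> e)))) * (\<sigma> - \<nu> * fst p) powr - 1) = q p"
      unfolding q_def norm_sq_sum_Basis by (simp add: powr_minus_divide inner_diff_left field_simps)
  qed
qed

text \<open>The largest diffusion parameter on \<open>U\<close> gives one Gaussian that dominates
  all of them, and \<open>1 + norm (snd p) \<le> (1 + norm x) * (1 + norm (snd p - x))\<close> moves
  the weight from the centre \<open>x\<close> to the origin.\<close>

lemma exp_q_bound: "wbd U (wt m) (\<lambda>_::unit. \<lambda>p. exp (q p))"
proof -
  define a where "a = 1 / (4 * (\<sigma> + 3 * \<nu>))"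
  \<comment> \<open>\<open>c\<close> may be at most -3, in which case \<open>U\<close> is empty and
    \<open>\<sigma> + 3 * \<nu>\<close> need not be positive.\<close>
  have sp: "\<sigma> + 3 * \<nu> > 0 \<or> U = {}"
    using tau_bounds c by (metis all_not_in_conv less_trans diff_gt_0_iff_gt)
  show ?thesis
  proof (cases "U = {}")
    case True
    then show ?thesis unfolding wbd_def by auto
  next
    case False
    then have a: "a > 0" using sp by (simp add: a_def)
    obtain C where C: "C > 0" "\<And>r. r \<ge> 0 \<Longrightarrow> (1 + r) ^ m * exp (- a * r\<^sup>2) \<le> C"
      using poly_exp_bound[OF a, of m] by blast
    show ?thesis
    proof (rule wbdI[of _ _ "C * (1 + norm x) ^ m"])
      fix p assume p: "p \<in> U"
      let ?r = "norm (snd p - x)"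
      have "?r\<^sup>2 / (4 * (\<sigma> + 3 * \<nu>)) \<le> ?r\<^sup>2 / (4 * (\<sigma> - \<nu> * fst p))"
        using tau_bounds[OF p] tau_pos[OF p] by (intro divide_left_mono) auto
      then have "exp (q p) \<le> exp (- a * ?r\<^sup>2)" by (simp add: q_def a_def)
      moreover have "(1 + norm (snd p)) ^ m \<le> ((1 + norm x) * (1 + ?r)) ^ m"
      proof (rule power_mono)
        have "norm (snd p) \<le> norm x + ?r" using norm_triangle_sub[of "snd p" x] by simp
        moreover have "(1 + norm x) * (1 + ?r) = 1 + norm x + ?r + norm x * ?r" by (simp add: algebra_simps)
        ultimately show "1 + norm (snd p) \<le> (1 + norm x) * (1 + ?r)"
          using mult_nonneg_nonneg[OF norm_ge_zero[of x] norm_ge_zero[of "snd p - x"]] by linarith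
      qed simp
      ultimately have "(1 + norm (snd p)) ^ m * exp (q p) \<le> ((1 + norm x) * (1 + ?r)) ^ m * exp (- a * ?r\<^sup>2)"
        by (intro mult_mono) auto
      also have "\<dots> = (1 + norm x) ^ m * ((1 + ?r) ^ m * exp (- a * ?r\<^sup>2))" by (simp add: power_mult_distrib)
      also have "\<dots> \<le> (1 + norm x) ^ m * C" by (intro mult_left_mono C) auto
      finally show "\<bar>exp (q p)\<bar> \<le> C * (1 + norm x) ^ m * wt m p"
        by (simp add: field_simps add_pos_nonneg)
    qed auto
  qed
qed

text \<open>Each derivative brings down a factor of quadratic growth. It is paid for by taking the
  induction hypothesis at \<open>m + 2\<close>, which is possible since the Gaussian decays at every
  polynomial order.\<close>

lemma exp_q_Ckw: "Ckw k U (wt m) (\<lambda>_::unit. \<lambda>p. exp (q p))"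
proof (induction k arbitrary: m)
  have cq: "Ckw (Suc 0) U (\<lambda>p. (1 + norm (snd p)) ^ 2) (\<lambda>_::unit. q)" by (rule q_Ckw)
  {
    case 0
    have "continuous_on U q" using Ckb_SucD[OF cq] by simp
    then show ?case using exp_q_bound by (auto intro: continuous_intros)
  next
    case (Suc k)
    have dq: "q differentiable (at p)" if "p \<in> U" for p using cq that by simp
    have de: "(exp::real\<Rightarrow>real) differentiable (at r)" for r
      using DERIV_exp real_differentiable_def by blast
    have "Ckw k U (wt m) (\<lambda>_::unit. \<lambda>p. exp (q p) * dir_deriv v q p)" for v
    proof (rule Ckw_mult[OF open_U Suc.IH[of "m + 2"] Ckw_dir_deriv[OF q_Ckw]])
      show "wt (m + 2) p * (1 + norm (snd p)) ^ 2 \<le> wt m p" for p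
      proof -
        have "1 + norm (snd p) \<noteq> 0" using norm_ge_zero[of "snd p"] by linarith
        then show ?thesis by (simp add: power_add power2_eq_square)
      qed
    qed
    then have "Ckw k U (wt m) (\<lambda>_::unit. dir_deriv v (\<lambda>p. exp (q p)))" for v
    proof (rule Ckw_cong[OF open_U])
      show "exp (q p) * dir_deriv v q p = dir_deriv v (\<lambda>p. exp (q p)) p" if "p \<in> U" for p
        using dir_deriv_compose[OF de dq[OF that]] dir_deriv_real[OF DERIV_exp, of 1] by simp
    qed
    moreover have "(\<lambda>p. exp (q p)) differentiable (at p)" if "p \<in> U" for p
      using differentiable_compose[OF de dq[OF that]] by (simp add: o_def)
    ultimately show ?case using exp_q_bound[of m] by simp
  }
qed

lemma theta_Ckw: "Ckw k UNIV (\<lambda>_. 1) (\<lambda>_::unit. \<lambda>p::real \<times> (real^3). \<theta> (fst p))"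
proof -
  have "\<theta> s = 0" if "norm s > max 2 \<bar>b\<bar>" for s
    using theta_zero[of s] that by (cases "s > 0") auto
  then have "test_function \<theta>"
    unfolding test_function_def using smooth_theta compact_supportI[of "max 2 \<bar>b\<bar>" \<theta>] by blast
  from Ckw_compose_scaled_linear[OF bounded_linear_fst _ test_function_Ckw[OF this], of "\<lambda>_. 1"]
  show ?thesis by simp
qed

text \<open>The indicator of the time slab makes the weight integrable over space-time as soon as
  \<open>m > 3\<close>; \<open>m = 4\<close> is the case that is used.\<close>

definition w :: "nat \<Rightarrow> real \<times> (real^3) \<Rightarrow> real" where
  "w m p = indicator {-3<..<c} (fst p) * wt m p"

text \<open>The slab \<open>U\<close> and the open set where \<open>\<theta>\<close> vanishes
  overlap, at times between -3 and -2 and between \<open>b\<close> and \<open>c\<close>, and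
  together cover space-time, so the gluing applies.\<close>

lemma P_Ckw: "Ckw k UNIV (w m) (\<lambda>_::unit. P)"
proof (rule Ckw_extend_by_zero[OF open_U])
  show "open {p::real \<times> (real^3). fst p < -2 \<or> b < fst p}"
    by (intro open_Collect_disj open_Collect_less continuous_intros)
  show "U \<union> {p. fst p < -2 \<or> b < fst p} = UNIV" using bc by (auto simp: U_def)
  have "Ckw k U (\<lambda>_. 1) (\<lambda>_::unit. \<lambda>p::real \<times> (real^3). \<theta> (fst p))" by (rule Ckw_mono[OF theta_Ckw]) auto
  from Ckw_mult[OF open_U this powr_Ckw[of _ "-3/2"], of "\<lambda>_. 1"]
  have "Ckw k U (\<lambda>_. 1) (\<lambda>_::unit. \<lambda>p. \<theta> (fst p) * (\<sigma> - \<nu> * fst p) powr (-3/2))" by simp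
  from Ckw_mult[OF open_U Ckw_const[of "\<lambda>_. (4 * pi) powr (-3/2)" "(4 * pi) powr (-3/2)" U "\<lambda>_. 1"] this, of "\<lambda>_. 1"]
  have "Ckw k U (\<lambda>_. 1) (\<lambda>_::unit. \<lambda>p. (4 * pi) powr (-3/2) * (\<theta> (fst p) * (\<sigma> - \<nu> * fst p) powr (-3/2)))" by simp
  from Ckw_mult[OF open_U this exp_q_Ckw, of m "wt m"]
  have *: "Ckw k U (wt m) (\<lambda>_::unit. \<lambda>p. (4 * pi) powr (-3/2) * (\<theta> (fst p) * (\<sigma> - \<nu> * fst p) powr (-3/2)) * exp (q p))" by simp
  show "Ckw k U (wt m) (\<lambda>_::unit. P)"
  proof (rule Ckw_cong[OF open_U *])
    show "(4 * pi) powr (-3/2) * (\<theta> (fst p) * (\<sigma> - \<nu> * fst p) powr (-3/2)) * exp (q p) = P p" if "p \<in> U" for p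
      using tau_pos[OF that] by (simp add: P_def heat_def q_def powr_mult)
  qed
qed (auto simp: P_def theta_zero U_def w_def)

lemma smooth_P: "smooth P"
  using smooth_if_Ckw[OF P_Ckw] by blast

lemma P_spatial:
  assumes "\<And>\<tau> z. ((\<lambda>r. f \<tau> (z + r *\<^sub>R axis j 1)) has_real_derivative f' \<tau> z) (at 0)"
    and "(\<lambda>p. \<theta> (fst p) * f (\<sigma> - \<nu> * fst p) (snd p - x)) differentiable (at p)"
  shows "dir_deriv (0, axis j 1) (\<lambda>p. \<theta> (fst p) * f (\<sigma> - \<nu> * fst p) (snd p - x)) p
    = \<theta> (fst p) * f' (\<sigma> - \<nu> * fst p) (snd p - x)"
proof (rule dir_deriv_eqI[OF assms(2)])
  have "((\<lambda>r. \<theta> (fst p) * f (\<sigma> - \<nu> * fst p) ((snd p - x) + r *\<^sub>R axis j 1)) has_real_derivative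
     \<theta> (fst p) * f' (\<sigma> - \<nu> * fst p) (snd p - x)) (at 0)"
    by (intro DERIV_cmult assms(1))
  then show "((\<lambda>r. \<theta> (fst (p + r *\<^sub>R (0, axis j 1))) * f (\<sigma> - \<nu> * fst (p + r *\<^sub>R (0, axis j 1))) (snd (p + r *\<^sub>R (0, axis j 1)) - x))
      has_real_derivative \<theta> (fst p) * f' (\<sigma> - \<nu> * fst p) (snd p - x)) (at 0)"
    by (simp add: algebra_simps)
qed

lemma P_1: "dir_deriv (0, axis j 1) P = (\<lambda>p. \<theta> (fst p) * heat1 j (\<sigma> - \<nu> * fst p) (snd p - x))"
proof
  fix p
  show "dir_deriv (0, axis j 1) P p = \<theta> (fst p) * heat1 j (\<sigma> - \<nu> * fst p) (snd p - x)"
    using P_spatial[of heat j "heat1 j", OF heat_line] smooth_differentiable[OF smooth_P] unfolding P_def[abs_def] .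
qed

lemma P_2: "dir_deriv (0, axis k 1) (dir_deriv (0, axis j 1) P)
    = (\<lambda>p. \<theta> (fst p) * heat2 j k (\<sigma> - \<nu> * fst p) (snd p - x))"
  by (rule ext, use P_spatial[of "heat1 j" k "heat2 j k", OF heat1_line]
    smooth_differentiable[OF smooth_dir_deriv[OF smooth_P], of "(0, axis j 1)"] in \<open>simp add: P_1\<close>)

lemma P_3: "dir_deriv (0, axis l 1) (dir_deriv (0, axis k 1) (dir_deriv (0, axis j 1) P))
    = (\<lambda>p. \<theta> (fst p) * heat3 j k l (\<sigma> - \<nu> * fst p) (snd p - x))"
  by (rule ext, use P_spatial[of "heat2 j k" l "heat3 j k l", OF heat2_line]
    smooth_differentiable[OF smooth_dir_deriv[OF smooth_dir_deriv[OF smooth_P]], of "(0, axis k 1)" "(0, axis j 1)"] in \<open>simp add: P_2\<close>)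

text \<open>The backward heat equation for \<open>P\<close>, up to the term in which the derivative
  falls on \<open>\<theta>\<close>. From time \<open>c\<close> on the diffusion parameter may fail
  to be positive and \<open>heat_time\<close> says nothing; there both sides vanish with
  \<open>\<theta>\<close>.\<close>

lemma P_t: "dir_deriv (1, 0) P p = dir_deriv 1 \<theta> (fst p) * heat (\<sigma> - \<nu> * fst p) (snd p - x)
   - \<nu> * (\<theta> (fst p) * heat_lap (\<sigma> - \<nu> * fst p) (snd p - x))"
proof (cases "fst p < c")
  case True
  then have tau: "\<sigma> - \<nu> * fst p > 0" using c mult_strict_left_mono[OF True \<nu>] by linarith
  obtain d where d: "(\<theta> has_real_derivative d) (at (fst p))"
    using smooth_differentiable[OF smooth_theta] real_differentiable_def by blast
  have d1: "((\<lambda>r. \<theta> (fst p + r)) has_real_derivative d) (at 0)"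
    using d DERIV_shift[of \<theta> d 0 "fst p"] by (simp add: add.commute)
  have "((\<lambda>r. (\<sigma> - \<nu> * fst p) - \<nu> * r) has_real_derivative - \<nu>) (at 0)"
    by (auto intro!: derivative_eq_intros)
  from DERIV_chain2[OF _ this, of "\<lambda>\<tau>. heat \<tau> (snd p - x)"]
  have d2: "((\<lambda>r. heat ((\<sigma> - \<nu> * fst p) - \<nu> * r) (snd p - x)) has_real_derivative
    heat_lap (\<sigma> - \<nu> * fst p) (snd p - x) * - \<nu>) (at 0)"
    using heat_time[OF tau] by simp
  show ?thesis
  proof (rule dir_deriv_eqI[OF smooth_differentiable[OF smooth_P]])
    show "((\<lambda>r. P (p + r *\<^sub>R (1, 0))) has_real_derivative dir_deriv 1 \<theta> (fst p) * heat (\<sigma> - \<nu> * fst p) (snd p - x)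
        - \<nu> * (\<theta> (fst p) * heat_lap (\<sigma> - \<nu> * fst p) (snd p - x))) (at 0)"
      using DERIV_mult[OF d1 d2] by (simp add: P_def dir_deriv_real[OF d] algebra_simps)
  qed
next
  case False
  then have "fst p > b" using bc by simp
  then have "dir_deriv (1, 0) P p = dir_deriv (1, 0) (\<lambda>_. 0) p"
    by (intro dir_deriv_local[of "{p. b < fst p}"])
       (auto simp: P_def theta_zero intro!: open_Collect_less continuous_intros)
  moreover have "dir_deriv 1 \<theta> (fst p) = dir_deriv 1 (\<lambda>_. 0) (fst p)"
    using \<open>fst p > b\<close> by (intro dir_deriv_local[of "{b<..}"]) (auto simp: theta_zero)
  ultimately show ?thesis using \<open>fst p > b\<close> by (simp add: dir_deriv_def theta_zero)
qed

end

section \<open>Integrals of powers on the line and in space\<close>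

lemma nn_integral_translate:
  fixes f :: "'a::euclidean_space \<Rightarrow> ennreal"
  assumes [measurable]: "f \<in> borel_measurable borel"
  shows "(\<integral>\<^sup>+y. f (y - x) \<partial>lborel) = (\<integral>\<^sup>+y. f y \<partial>lborel)"
proof -
  have "(\<integral>\<^sup>+y. f y \<partial>lborel) = (\<integral>\<^sup>+y. f y \<partial>distr lborel borel ((+) (- x)))"
    by (simp add: lborel_distr_plus)
  also have "\<dots> = (\<integral>\<^sup>+y. f (- x + y) \<partial>lborel)" by (subst nn_integral_distr) auto
  finally show ?thesis by simp
qed

lemma nn_integral_even_le:
  fixes f :: "real \<Rightarrow> ennreal"
  assumes [measurable]: "f \<in> borel_measurable borel"
  shows "(\<integral>\<^sup>+t. f \<bar>t\<bar> \<partial>lborel) \<le> 2 * (\<integral>\<^sup>+t. f t * indicator {0..} t \<partial>lborel)"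
proof -
  have "(\<integral>\<^sup>+t. f \<bar>t\<bar> \<partial>lborel) \<le> (\<integral>\<^sup>+t. f t * indicator {0..} t + f (-t) * indicator {0..} (-t) \<partial>lborel)"
    by (intro nn_integral_mono) (auto split: split_indicator)
  also have "\<dots> = (\<integral>\<^sup>+t. f t * indicator {0..} t \<partial>lborel) + (\<integral>\<^sup>+t. f (-t) * indicator {0..} (-t) \<partial>lborel)"
    by (intro nn_integral_add) auto
  also have "(\<integral>\<^sup>+t. f (-t) * indicator {0..} (-t) \<partial>lborel) = (\<integral>\<^sup>+t. f t * indicator {0..} t \<partial>lborel)"
    using nn_integral_real_affine[of "\<lambda>t. f t * indicator {0..} t" "-1" 0] by simp
  finally show ?thesis by (simp add: mult_2)
qed

lemma nn_integral_powr_tail: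
  fixes q a :: real
  assumes "q > 1" "a > 0"
  shows "(\<integral>\<^sup>+t. ennreal (t powr - q) * indicator {a..} t \<partial>lborel) = ennreal (a powr (1 - q) / (q - 1))"
proof -
  have "(\<integral>\<^sup>+t. ennreal (t powr - q) * indicator {a..} t \<partial>lborel) = ennreal (0 - (- (a powr (1 - q) / (q - 1))))"
  proof (rule nn_integral_FTC_atLeast)
    show "((\<lambda>t. - (t powr (1 - q) / (q - 1))) has_real_derivative t powr - q) (at t)" if "a \<le> t" for t
    proof -
      have "((\<lambda>t. t powr (1 - q)) has_real_derivative (1 - q) * t powr (1 - q - 1)) (at t)"
        using assms that by (intro has_real_derivative_powr) auto
      from DERIV_minus[OF DERIV_cdivide[OF this, of "q - 1"]]
      have "((\<lambda>t. - (t powr (1 - q) / (q - 1))) has_real_derivative - ((1 - q) * t powr (1 - q - 1) / (q - 1))) (at t)" .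
      moreover have "- ((1 - q) * t powr (1 - q - 1) / (q - 1)) = t powr - q"
        using assms by (simp add: field_simps)
      ultimately show ?thesis by simp
    qed
    have "((\<lambda>t. t powr (1 - q)) \<longlongrightarrow> 0) at_top"
      using tendsto_neg_powr[of "1 - q" "\<lambda>t. t" at_top] assms filterlim_ident by auto
    from tendsto_minus[OF tendsto_divide[OF this tendsto_const[of "q - 1"]]]
    show "((\<lambda>t. - (t powr (1 - q) / (q - 1))) \<longlongrightarrow> 0) at_top" using assms by simp
  qed auto
  then show ?thesis by simp
qed

lemma nn_integral_powr_abs_finite:
  fixes q :: real
  assumes "q > 1"
  shows "(\<integral>\<^sup>+t. ennreal ((1 + \<bar>t\<bar>) powr - q) \<partial>lborel) < \<infinity>"
proof -
  have "(\<integral>\<^sup>+t. ennreal ((1 + \<bar>t\<bar>) powr - q) \<partial>lborel) \<le> 2 * (\<integral>\<^sup>+t. ennreal ((1 + t) powr - q) * indicator {0..} t \<partial>lborel)"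
    by (rule nn_integral_even_le) auto
  also have "(\<integral>\<^sup>+t. ennreal ((1 + t) powr - q) * indicator {0..} t \<partial>lborel) = (\<integral>\<^sup>+t. ennreal (t powr - q) * indicator {1..} t \<partial>lborel)"
    using nn_integral_translate[of "\<lambda>t. ennreal ((1 + t) powr - q) * indicator {0..} t" 1]
    by (simp add: indicator_def of_bool_def)
  also have "\<dots> = ennreal (1 powr (1 - q) / (q - 1))" by (rule nn_integral_powr_tail) (use assms in auto)
  finally show ?thesis by (auto simp: ennreal_mult_less_top intro: le_less_trans)
qed

lemma powr_abs_unit_finite:
  fixes q :: real
  assumes "0 \<le> q" "q < 1"
  shows "(\<integral>\<^sup>+t. ennreal (\<bar>t\<bar> powr - q) * indicator {..1} \<bar>t\<bar> \<partial>lborel) < \<infinity>"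
proof -
  have "(\<integral>\<^sup>+t. ennreal (\<bar>t\<bar> powr - q) * indicator {..1} \<bar>t\<bar> \<partial>lborel)
     \<le> 2 * (\<integral>\<^sup>+t. ennreal (t powr - q) * indicator {..1} t * indicator {0..} t \<partial>lborel)"
    by (rule nn_integral_even_le) auto
  also have "(\<integral>\<^sup>+t. ennreal (t powr - q) * indicator {..1} t * indicator {0..} t \<partial>lborel)
      = (\<integral>\<^sup>+t. ennreal (indicator {0..1} t * t powr - q) \<partial>lborel)"
    by (intro nn_integral_cong) (auto split: split_indicator)
  also have "\<dots> = ennreal (1 powr (- q + 1) / (- q + 1))"
    by (rule nn_integral_has_integral_lebesgue) (use assms has_integral_powr_from_0[of "-q" 1] in auto)
  finally show ?thesis by (auto simp: ennreal_mult_less_top intro: le_less_trans)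
qed

lemma prod_Basis_powr:
  "0 \<le> r \<Longrightarrow> (\<Prod>b\<in>(Basis::(real^3) set). r powr (p / 3)) = r powr (p::real)"
proof (cases "r = 0")
  case False
  assume "0 \<le> r"
  have "(r powr (p / 3)) ^ 3 = (r powr (p / 3)) powr real 3"
    using False by (subst powr_realpow) auto
  then show ?thesis by (simp add: powr_powr)
qed simp

text \<open>A substitute for polar coordinates: since every coordinate is at most the norm, the
  integrand is bounded by a product of three one-dimensional powers, each of exponent
  \<open>p / 3 > 1\<close>.\<close>

lemma nn_integral_radial_finite:
  fixes p :: real
  assumes "p > 3"
  shows "(\<integral>\<^sup>+y. ennreal ((1 + norm (y::real^3)) powr - p) \<partial>lborel) < \<infinity>"
proof -
  have "(\<integral>\<^sup>+y. ennreal ((1 + norm (y::real^3)) powr - p) \<partial>lborel)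
     \<le> (\<integral>\<^sup>+y. (\<Prod>b\<in>Basis. ennreal ((1 + \<bar>y \<bullet> b\<bar>) powr - (p / 3))) \<partial>(lborel :: (real^3) measure))"
  proof (intro nn_integral_mono)
    fix y :: "real^3"
    have "(1 + norm y) powr - p = (\<Prod>b\<in>(Basis::(real^3) set). (1 + norm y) powr (- p / 3))"
      by (rule prod_Basis_powr[symmetric]) (simp add: add_nonneg_nonneg)
    also have "\<dots> \<le> (\<Prod>b\<in>Basis. (1 + \<bar>y \<bullet> b\<bar>) powr - (p / 3))"
    proof (intro prod_mono conjI)
      fix b :: "real^3" assume "b \<in> Basis"
      then have "\<bar>y \<bullet> b\<bar> \<le> norm y" by (rule Basis_le_norm)
      then show "(1 + norm y) powr (- p / 3) \<le> (1 + \<bar>y \<bullet> b\<bar>) powr - (p / 3)"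
        using assms powr_mono2'[of "- p / 3" "1 + \<bar>y \<bullet> b\<bar>" "1 + norm y"] by simp
    qed auto
    finally show "ennreal ((1 + norm y) powr - p) \<le> (\<Prod>b\<in>Basis. ennreal ((1 + \<bar>y \<bullet> b\<bar>) powr - (p / 3)))"
      by (simp add: prod_ennreal ennreal_leI)
  qed
  also have "\<dots> = (\<Prod>b\<in>(Basis::(real^3) set). \<integral>\<^sup>+t. ennreal ((1 + \<bar>t\<bar>) powr - (p / 3)) \<partial>lborel)"
    by (rule nn_integral_lborel_prod) auto
  also have "\<dots> < \<infinity>"
    using nn_integral_powr_abs_finite[of "p / 3"] assms by (simp add: power_less_top_ennreal)
  finally show ?thesis .
qed

text \<open>The same splitting over the coordinates near the origin, where \<open>p / 3 < 1\<close>
  makes each factor integrable.\<close>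

lemma nn_integral_singular_unit_ball_finite:
  fixes p :: real
  assumes "0 \<le> p" "p < 3"
  shows "(\<integral>\<^sup>+y. ennreal (norm (y::real^3) powr - p) * indicator (cball 0 1) y \<partial>lborel) < \<infinity>"
proof -
  have "(\<integral>\<^sup>+y. ennreal (norm (y::real^3) powr - p) * indicator (cball 0 1) y \<partial>lborel)
     \<le> (\<integral>\<^sup>+y. (\<Prod>b\<in>Basis. ennreal (\<bar>y \<bullet> b\<bar> powr - (p / 3)) * indicator {..1} \<bar>y \<bullet> b\<bar>) \<partial>(lborel :: (real^3) measure))"
  proof (intro nn_integral_mono_AE)
    \<comment> \<open>On a coordinate plane the product on the right is 0, because
      \<open>0 powr q = 0\<close> for every \<open>q\<close>. These null sets have to be
      removed.\<close>
    have "AE y in lborel. \<forall>b\<in>(Basis::(real^3) set). y \<bullet> b \<noteq> 0"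
    proof (intro AE_finite_allI)
      fix b :: "real^3" assume b: "b \<in> Basis"
      have "negligible {y::real^3. b \<bullet> y = 0}" using b by (intro negligible_hyperplane) auto
      then have "{y::real^3. b \<bullet> y = 0} \<in> null_sets lborel"
        by (subst null_sets_completion_iff[symmetric])
           (auto simp: negligible_iff_null_sets intro!: borel_closed closed_hyperplane)
      then show "AE y in lborel. y \<bullet> b \<noteq> 0" by (auto simp: inner_commute dest: AE_not_in)
    qed simp
    then show "AE y in lborel. ennreal (norm (y::real^3) powr - p) * indicator (cball 0 1) y
        \<le> (\<Prod>b\<in>Basis. ennreal (\<bar>y \<bullet> b\<bar> powr - (p / 3)) * indicator {..1} \<bar>y \<bullet> b\<bar>)"
    proof eventually_elim
      case (elim y)
      show ?case
      proof (cases "norm y \<le> 1")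
        case True
        have ind: "\<bar>y \<bullet> b\<bar> \<le> 1" if "b \<in> Basis" for b using Basis_le_norm[OF that, of y] True by simp
        have "norm y powr - p = (\<Prod>b\<in>(Basis::(real^3) set). norm y powr (- p / 3))"
          by (rule prod_Basis_powr[symmetric]) simp
        also have "\<dots> \<le> (\<Prod>b\<in>Basis. \<bar>y \<bullet> b\<bar> powr - (p / 3))"
        proof (intro prod_mono conjI)
          fix b :: "real^3" assume b: "b \<in> Basis"
          then have "\<bar>y \<bullet> b\<bar> \<le> norm y" by (rule Basis_le_norm)
          then show "norm y powr (- p / 3) \<le> \<bar>y \<bullet> b\<bar> powr - (p / 3)"
            using assms elim b powr_mono2'[of "- p / 3" "\<bar>y \<bullet> b\<bar>" "norm y"] by simp
        qed auto
        finally have "ennreal (norm y powr - p) \<le> (\<Prod>b\<in>Basis. ennreal (\<bar>y \<bullet> b\<bar> powr - (p / 3)))"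
          by (simp add: prod_ennreal ennreal_leI)
        also have "\<dots> = (\<Prod>b\<in>Basis. ennreal (\<bar>y \<bullet> b\<bar> powr - (p / 3)) * indicator {..1} \<bar>y \<bullet> b\<bar>)"
          by (intro prod.cong) (auto simp: ind)
        finally show ?thesis using True by simp
      qed simp
    qed
  qed
  also have "\<dots> = (\<Prod>b\<in>(Basis::(real^3) set). \<integral>\<^sup>+t. ennreal (\<bar>t\<bar> powr - (p / 3)) * indicator {..1} \<bar>t\<bar> \<partial>lborel)"
    by (rule nn_integral_lborel_prod) auto
  also have "\<dots> < \<infinity>"
    using powr_abs_unit_finite[of "p / 3"] assms by (simp add: power_less_top_ennreal)
  finally show ?thesis .
qed

subsection \<open>Size of the heat kernel\<close>

lemma heat_measurable[measurable]:
  assumes [measurable]: "f \<in> borel_measurable M" "g \<in> borel_measurable M"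
  shows "(\<lambda>p. heat (f p) (g p)) \<in> borel_measurable M"
  unfolding heat_def by measurable

lemma coord_measurable[measurable]:
  assumes [measurable]: "g \<in> borel_measurable M"
  shows "(\<lambda>p. (g p :: real^3) $ j) \<in> borel_measurable M"
proof -
  have "(\<lambda>v::real^3. v $ j) \<in> borel_measurable borel"
    by (intro borel_measurable_continuous_onI continuous_intros)
  from measurable_compose[OF assms this] show ?thesis .
qed

lemma heat1_measurable[measurable]:
  assumes [measurable]: "f \<in> borel_measurable M" "g \<in> borel_measurable M"
  shows "(\<lambda>p. heat1 j (f p) (g p)) \<in> borel_measurable M"
  unfolding heat1_def by measurable

lemma heat2_measurable[measurable]:
  assumes [measurable]: "f \<in> borel_measurable M" "g \<in> borel_measurable M"
  shows "(\<lambda>p. heat2 j k (f p) (g p)) \<in> borel_measurable M"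
  unfolding heat2_def by measurable

lemma heat3_measurable[measurable]:
  assumes [measurable]: "f \<in> borel_measurable M" "g \<in> borel_measurable M"
  shows "(\<lambda>p. heat3 j k l (f p) (g p)) \<in> borel_measurable M"
  unfolding heat3_def by measurable

lemma heat_lap_measurable[measurable]:
  assumes [measurable]: "f \<in> borel_measurable M" "g \<in> borel_measurable M"
  shows "(\<lambda>p. heat_lap (f p) (g p)) \<in> borel_measurable M"
  unfolding heat_lap_def by measurable

lemma heat_nonneg: "heat \<sigma> z \<ge> 0"
  by (simp add: heat_def)

text \<open>Reduces the total mass of the kernel to that of the one-dimensional normal density of
  variance \<open>2 * \<sigma>\<close>.\<close>

lemma heat_eq_prod_normal_density:
  assumes "\<sigma> > 0"
  shows "heat \<sigma> z = (\<Prod>b\<in>Basis. normal_density 0 (sqrt (2 * \<sigma>)) (z \<bullet> b))"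
proof -
  have "normal_density 0 (sqrt (2 * \<sigma>)) t = (4 * pi * \<sigma>) powr (-1/2) * exp (- (t * t) / (4 * \<sigma>))" for t
    using assms by (simp add: normal_density_def powr_minus powr_half_sqrt divide_simps power2_eq_square mult_ac)
  then have "(\<Prod>b\<in>(Basis :: (real^3) set). normal_density 0 (sqrt (2 * \<sigma>)) (z \<bullet> b))
     = (\<Prod>b\<in>(Basis :: (real^3) set). (4 * pi * \<sigma>) powr ((-3/2) / 3)) * exp (\<Sum>b\<in>Basis. - ((z \<bullet> b) * (z \<bullet> b)) / (4 * \<sigma>))"
    by (simp add: prod.distrib exp_sum)
  also have "(\<Sum>b\<in>Basis. - ((z \<bullet> b) * (z \<bullet> b)) / (4 * \<sigma>)) = - (norm z)\<^sup>2 / (4 * \<sigma>)"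
    unfolding norm_sq_sum_Basis by (simp add: sum_negf sum_divide_distrib[symmetric])
  also have "(\<Prod>b\<in>(Basis :: (real^3) set). (4 * pi * \<sigma>) powr ((-3/2) / 3)) = (4 * pi * \<sigma>) powr (-3/2)"
    using assms by (intro prod_Basis_powr) simp
  finally show ?thesis by (simp add: heat_def)
qed

lemma nn_integral_heat:
  assumes "\<sigma> > 0"
  shows "(\<integral>\<^sup>+z. ennreal (heat \<sigma> z) \<partial>lborel) = 1"
proof -
  have 1: "(\<integral>\<^sup>+t. ennreal (normal_density 0 (sqrt (2 * \<sigma>)) t) \<partial>lborel) = 1"
    using assms by (subst nn_integral_eq_integral) auto
  have "(\<integral>\<^sup>+z. ennreal (heat \<sigma> z) \<partial>lborel) = (\<integral>\<^sup>+z. (\<Prod>b\<in>(Basis :: (real^3) set). ennreal (normal_density 0 (sqrt (2 * \<sigma>)) (z \<bullet> b))) \<partial>lborel)"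
    by (simp add: heat_eq_prod_normal_density[OF assms] prod_ennreal)
  also have "\<dots> = (\<Prod>b\<in>(Basis :: (real^3) set). \<integral>\<^sup>+t. ennreal (normal_density 0 (sqrt (2 * \<sigma>)) t) \<partial>lborel)"
    by (rule nn_integral_lborel_prod) auto
  finally show ?thesis using 1 by simp
qed

lemma nn_integral_heat_shift:
  assumes "\<sigma> > 0"
  shows "(\<integral>\<^sup>+y. ennreal (heat \<sigma> (y - x)) \<partial>lborel) = 1"
  using nn_integral_translate[of "\<lambda>z. ennreal (heat \<sigma> z)" x] nn_integral_heat[OF assms] by simp

lemma heat_le_sup: "\<sigma> > 0 \<Longrightarrow> heat \<sigma> z \<le> \<sigma> powr (-3/2)"
proof -
  assume \<sigma>: "\<sigma> > 0"
  have "heat \<sigma> z \<le> (4 * pi * \<sigma>) powr (-3/2) * 1" unfolding heat_def using \<sigma> by (intro mult_left_mono) auto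
  also have "\<dots> \<le> \<sigma> powr (-3/2)"
    using \<sigma> pi_ge_two by (simp add: powr_mono2')
  finally show ?thesis .
qed

text \<open>In terms of \<open>r = norm z / sqrt \<sigma>\<close> the Gaussian factor is
  \<open>exp (- r\<^sup>2 / 4)\<close>. Half of the exponent absorbs the polynomial and the other
  half is the Gaussian at \<open>2 * \<sigma>\<close>; the change of normalization costs
  \<open>2 powr (3/2)\<close>. The power 3 covers derivatives up to order three.\<close>

lemma heat_le_double:
  obtains C where "C > 0" "\<And>\<sigma> z. \<sigma> > 0 \<Longrightarrow> (1 + norm z / sqrt \<sigma>) ^ 3 * heat \<sigma> z \<le> C * heat (2 * \<sigma>) z"
proof -
  obtain C where C: "C > 0" "\<And>r::real. r \<ge> 0 \<Longrightarrow> (1 + r) ^ 3 * exp (- (1/8) * r\<^sup>2) \<le> C"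
    using poly_exp_bound[of "1/8" 3] by auto
  have "(1 + norm z / sqrt \<sigma>) ^ 3 * heat \<sigma> z \<le> (2 powr (3/2) * C) * heat (2 * \<sigma>) z" if \<sigma>: "\<sigma> > 0" for \<sigma> z
  proof -
    let ?r = "norm z / sqrt \<sigma>"
    have r2: "?r\<^sup>2 = (norm z)\<^sup>2 / \<sigma>" using \<sigma> by (simp add: power_divide)
    have "(4 * pi * \<sigma>) powr (-3/2) = 2 powr (3/2) * (2 powr (-3/2) * (4 * pi * \<sigma>) powr (-3/2))"
      by (simp add: powr_minus)
    also have "2 powr (-3/2) * (4 * pi * \<sigma>) powr (-3/2) = (4 * pi * (2 * \<sigma>)) powr (-3/2)"
      using \<sigma> by (simp add: powr_mult[symmetric] mult_ac)
    finally have A: "(4 * pi * \<sigma>) powr (-3/2) = 2 powr (3/2) * (4 * pi * (2 * \<sigma>)) powr (-3/2)" .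
    have B: "exp (- (norm z)\<^sup>2 / (4 * \<sigma>)) = exp (- (1/8) * ?r\<^sup>2) * exp (- (norm z)\<^sup>2 / (4 * (2 * \<sigma>)))"
      unfolding r2 using \<sigma> by (simp add: exp_add[symmetric] field_simps)
    have "(1 + ?r) ^ 3 * heat \<sigma> z = ((1 + ?r) ^ 3 * exp (- (1/8) * ?r\<^sup>2)) * (2 powr (3/2) * heat (2 * \<sigma>) z)"
      unfolding heat_def[of \<sigma>] A B by (simp add: heat_def)
    also have "\<dots> \<le> C * (2 powr (3/2) * heat (2 * \<sigma>) z)"
      using C(2)[of ?r] \<sigma> by (intro mult_right_mono) (auto simp: heat_nonneg)
    finally show ?thesis by (simp add: mult_ac)
  qed
  then show ?thesis using that[of "2 powr (3/2) * C"] C(1) by simp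
qed

lemma kron_abs: "\<bar>kron j k\<bar> \<le> 1" by (simp add: kron_def)

text \<open>In the self-similar variable \<open>r\<close> every derivative costs at most a factor
  \<open>(1 + r) / sqrt \<sigma>\<close>. The proof first derives slightly sharper polynomials in
  \<open>r\<close> from the recursive definitions and then relaxes them to powers of
  \<open>1 + r\<close>.\<close>

lemma heat_derivs_le:
  fixes z :: "real^3"
  assumes \<sigma>: "\<sigma> > 0"
  defines "r \<equiv> norm z / sqrt \<sigma>"
  shows "\<bar>heat1 j \<sigma> z\<bar> \<le> (1 + r) * \<sigma> powr (-1/2) * heat \<sigma> z"
    and "\<bar>heat2 j k \<sigma> z\<bar> \<le> (1 + r) ^ 2 * \<sigma> powr (-1) * heat \<sigma> z"
    and "\<bar>heat3 j k l \<sigma> z\<bar> \<le> (1 + r) ^ 3 * \<sigma> powr (-3/2) * heat \<sigma> z"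
    and "\<bar>heat_lap \<sigma> z\<bar> \<le> 2 * ((1 + r) ^ 2 * \<sigma> powr (-1) * heat \<sigma> z)"
proof -
  have r: "r \<ge> 0" using \<sigma> by (simp add: r_def)
  define s where "s = sqrt \<sigma>"
  have s: "s > 0" "\<sigma> = s\<^sup>2" using \<sigma> by (auto simp: s_def)
  have nz: "norm z = r * s" using s by (simp add: r_def s_def[symmetric])
  have p1: "\<sigma> powr (-1/2) = 1 / s" using \<sigma> by (simp add: powr_minus powr_half_sqrt s_def divide_simps)
  have p2: "\<sigma> powr (-1) = 1 / s\<^sup>2" using s by (simp add: powr_minus_divide)
  have "\<sigma> powr (-3/2) = \<sigma> powr (-1) * \<sigma> powr (-1/2)" by (subst powr_add[symmetric]) simp
  then have p3: "\<sigma> powr (-3/2) = 1 / s ^ 3" unfolding p1 p2 by (simp add: power2_eq_square power3_eq_cube)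
  let ?H = "heat \<sigma> z"
  have H: "?H \<ge> 0" by (rule heat_nonneg)
  have c: "\<bar>z $ j\<bar> / (2 * \<sigma>) \<le> r / 2 * (1 / s)" for j
  proof -
    have "\<bar>z $ j\<bar> / (2 * \<sigma>) \<le> (r * s) / (2 * \<sigma>)"
      using component_le_norm_cart[of z j] nz \<sigma> by (intro divide_right_mono) auto
    then show ?thesis using s by (simp add: power2_eq_square)
  qed
  have h1: "\<bar>heat1 j \<sigma> z\<bar> \<le> r / 2 * (1 / s) * ?H" for j
  proof -
    have "\<bar>heat1 j \<sigma> z\<bar> = \<bar>z $ j\<bar> / (2 * \<sigma>) * ?H" using H \<sigma> by (simp add: heat1_def abs_mult)
    then show ?thesis using mult_right_mono[OF c[of j] H] by simp
  qed
  have k: "\<bar>kron j k / (2 * \<sigma>)\<bar> \<le> 1 / 2 * (1 / s\<^sup>2)" for j k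
    using kron_abs[of j k] s by (simp add: abs_mult divide_right_mono)
  have h2: "\<bar>heat2 j k \<sigma> z\<bar> \<le> (1/2 + r\<^sup>2 / 4) * (1 / s\<^sup>2) * ?H" for j k
  proof -
    have "\<bar>heat2 j k \<sigma> z\<bar> \<le> \<bar>kron j k / (2 * \<sigma>)\<bar> * ?H + \<bar>z $ j\<bar> / (2 * \<sigma>) * \<bar>heat1 k \<sigma> z\<bar>"
      unfolding heat2_def using \<sigma> H abs_triangle_ineq4[of "- kron j k / (2 * \<sigma>) * ?H" "z $ j / (2 * \<sigma>) * heat1 k \<sigma> z"]
      by (simp add: abs_mult)
    also have "\<dots> \<le> 1 / 2 * (1 / s\<^sup>2) * ?H + (r / 2 * (1 / s)) * (r / 2 * (1 / s) * ?H)"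
      using k c h1 H r s by (intro add_mono mult_mono mult_nonneg_nonneg) auto
    also have "\<dots> = (1/2 + r\<^sup>2 / 4) * (1 / s\<^sup>2) * ?H" by (simp add: power2_eq_square algebra_simps)
    finally show ?thesis .
  qed
  have h3: "\<bar>heat3 j k l \<sigma> z\<bar> \<le> (r + r ^ 3 / 8) * (1 / s ^ 3) * ?H"
  proof -
    have "\<bar>heat3 j k l \<sigma> z\<bar> \<le> \<bar>kron j k / (2 * \<sigma>)\<bar> * \<bar>heat1 l \<sigma> z\<bar> + \<bar>kron j l / (2 * \<sigma>)\<bar> * \<bar>heat1 k \<sigma> z\<bar>
       + \<bar>z $ j\<bar> / (2 * \<sigma>) * \<bar>heat2 k l \<sigma> z\<bar>"
    proof -
      have tri: "\<bar>- a - b - c\<bar> \<le> \<bar>a\<bar> + \<bar>b\<bar> + \<bar>c\<bar>" for a b c :: real by linarith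
      show ?thesis unfolding heat3_def using \<sigma>
        tri[of "kron j k / (2 * \<sigma>) * heat1 l \<sigma> z" "kron j l / (2 * \<sigma>) * heat1 k \<sigma> z" "z $ j / (2 * \<sigma>) * heat2 k l \<sigma> z"]
        by (simp add: abs_mult)
    qed
    also have "\<dots> \<le> 1 / 2 * (1 / s\<^sup>2) * (r / 2 * (1 / s) * ?H) + 1 / 2 * (1 / s\<^sup>2) * (r / 2 * (1 / s) * ?H)
       + (r / 2 * (1 / s)) * ((1/2 + r\<^sup>2 / 4) * (1 / s\<^sup>2) * ?H)"
      using k c h1 h2 H r s by (intro add_mono mult_mono mult_nonneg_nonneg) auto
    also have "\<dots> = (r * 3 / 4 + r ^ 3 / 8) * (1 / s ^ 3) * ?H"
      by (simp add: power2_eq_square power3_eq_cube algebra_simps)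
    also have "\<dots> \<le> (r + r ^ 3 / 8) * (1 / s ^ 3) * ?H"
      using r s H by (intro mult_right_mono) auto
    finally show ?thesis .
  qed
  have hl: "\<bar>heat_lap \<sigma> z\<bar> \<le> (r\<^sup>2 / 4 + 3 / 2) * (1 / s\<^sup>2) * ?H"
  proof -
    have e1: "(norm z)\<^sup>2 / (4 * \<sigma>\<^sup>2) = r\<^sup>2 / 4 * (1 / s\<^sup>2)" unfolding nz s(2) using s(1) by (simp add: power2_eq_square)
    have e2: "3 / (2 * \<sigma>) = 3 / 2 * (1 / s\<^sup>2)" using s by simp
    have "\<bar>(norm z)\<^sup>2 / (4 * \<sigma>\<^sup>2) - 3 / (2 * \<sigma>)\<bar> \<le> (r\<^sup>2 / 4 + 3 / 2) * (1 / s\<^sup>2)"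
    proof -
      have "\<bar>a - b\<bar> \<le> a + b" if "a \<ge> 0" "b \<ge> 0" for a b :: real using that by linarith
      from this[of "r\<^sup>2 / 4 * (1 / s\<^sup>2)" "3 / 2 * (1 / s\<^sup>2)"] show ?thesis unfolding e1 e2 by (simp add: algebra_simps)
    qed
    from mult_right_mono[OF this H] show ?thesis unfolding heat_lap_def abs_mult abs_of_nonneg[OF H] .
  qed
  have q2: "1/2 + r\<^sup>2 / 4 \<le> (1 + r) ^ 2"
  proof -
    have "(1 + r) ^ 2 = 1 + 2 * r + r\<^sup>2" by (simp add: power2_eq_square algebra_simps)
    then show ?thesis using r zero_le_power2[of r] by linarith
  qed
  have q3: "r + r ^ 3 / 8 \<le> (1 + r) ^ 3"
  proof -
    have "(1 + r) ^ 3 = 1 + 3 * r + 3 * r\<^sup>2 + r ^ 3" by (simp add: power3_eq_cube power2_eq_square algebra_simps)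
    then show ?thesis using r zero_le_power2[of r] zero_le_power[OF r, of 3] by linarith
  qed
  show "\<bar>heat1 j \<sigma> z\<bar> \<le> (1 + r) * \<sigma> powr (-1/2) * ?H"
    unfolding p1 by (rule order_trans[OF h1]) (use r s H in \<open>intro mult_right_mono, auto\<close>)
  show "\<bar>heat2 j k \<sigma> z\<bar> \<le> (1 + r) ^ 2 * \<sigma> powr (-1) * ?H"
    unfolding p2 by (rule order_trans[OF h2]) (use r s H in \<open>intro mult_right_mono, auto simp: q2\<close>)
  show "\<bar>heat3 j k l \<sigma> z\<bar> \<le> (1 + r) ^ 3 * \<sigma> powr (-3/2) * ?H"
    unfolding p3 by (rule order_trans[OF h3]) (use r s H in \<open>intro mult_right_mono, auto simp: q3\<close>)
  have "(r\<^sup>2 / 4 + 3 / 2) \<le> 2 * (1 + r) ^ 2" 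
  proof -
    have "(1 + r) ^ 2 = 1 + 2 * r + r\<^sup>2" by (simp add: power2_eq_square algebra_simps)
    then show ?thesis using r zero_le_power2[of r] by linarith
  qed
  then have "(r\<^sup>2 / 4 + 3 / 2) * (1 / s\<^sup>2) * ?H \<le> 2 * (1 + r) ^ 2 * (1 / s\<^sup>2) * ?H"
    using s H by (intro mult_right_mono) auto
  then show "\<bar>heat_lap \<sigma> z\<bar> \<le> 2 * ((1 + r) ^ 2 * \<sigma> powr (-1) * ?H)"
    unfolding p2 using hl by simp
qed

lemma heat_derivs_le_double:
  obtains C where "C > 0" "\<And>\<sigma> z j k l. \<sigma> > 0 \<Longrightarrow> \<bar>heat3 j k l \<sigma> z\<bar> \<le> C * (\<sigma> powr (-3/2) * heat (2 * \<sigma>) z)"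
    "\<And>\<sigma> z. \<sigma> > 0 \<Longrightarrow> \<bar>heat_lap \<sigma> z\<bar> \<le> C * (\<sigma> powr (-1) * heat (2 * \<sigma>) z)"
proof -
  obtain C where C: "C > 0" "\<And>\<sigma> z. \<sigma> > 0 \<Longrightarrow> (1 + norm z / sqrt \<sigma>) ^ 3 * heat \<sigma> z \<le> C * heat (2 * \<sigma>) z"
    using heat_le_double by blast
  have 3: "\<bar>heat3 j k l \<sigma> z\<bar> \<le> (2 * C) * (\<sigma> powr (-3/2) * heat (2 * \<sigma>) z)" if "\<sigma> > 0" for j k l \<sigma> z
  proof -
    have "\<bar>heat3 j k l \<sigma> z\<bar> \<le> \<sigma> powr (-3/2) * ((1 + norm z / sqrt \<sigma>) ^ 3 * heat \<sigma> z)"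
      using heat_derivs_le(3)[OF that, of j k l z] by (simp add: mult_ac)
    also have "\<dots> \<le> \<sigma> powr (-3/2) * (C * heat (2 * \<sigma>) z)" by (intro mult_left_mono C that) auto
    also have "\<dots> \<le> (2 * C) * (\<sigma> powr (-3/2) * heat (2 * \<sigma>) z)" using C(1) heat_nonneg[of "2*\<sigma>" z] by simp
    finally show ?thesis .
  qed
  have l: "\<bar>heat_lap \<sigma> z\<bar> \<le> (2 * C) * (\<sigma> powr (-1) * heat (2 * \<sigma>) z)" if "\<sigma> > 0" for \<sigma> z
  proof -
    have "(1 + norm z / sqrt \<sigma>) ^ 2 * heat \<sigma> z \<le> (1 + norm z / sqrt \<sigma>) ^ 3 * heat \<sigma> z"
      using that by (intro mult_right_mono power_increasing) (auto simp: heat_nonneg)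
    also have "\<dots> \<le> C * heat (2 * \<sigma>) z" by (rule C(2)[OF that])
    finally have *: "(1 + norm z / sqrt \<sigma>) ^ 2 * heat \<sigma> z \<le> C * heat (2 * \<sigma>) z" .
    have "\<bar>heat_lap \<sigma> z\<bar> \<le> 2 * (\<sigma> powr (-1) * ((1 + norm z / sqrt \<sigma>) ^ 2 * heat \<sigma> z))"
      using heat_derivs_le(4)[OF that, of z] by (simp add: mult_ac)
    also have "\<dots> \<le> 2 * (\<sigma> powr (-1) * (C * heat (2 * \<sigma>) z))" by (intro mult_left_mono *) auto
    finally show ?thesis by (simp add: mult_ac)
  qed
  show ?thesis using that[of "2 * C"] C(1) 3 l by simp
qed

subsection \<open>Divergence-free test fields\<close>

lemma fst_borel_measurable[measurable]:
  fixes f :: "'c \<Rightarrow> 'a::second_countable_topology \<times> 'b::second_countable_topology"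
  assumes "f \<in> borel_measurable M" shows "(\<lambda>p. fst (f p)) \<in> borel_measurable M"
  by (rule measurable_compose[OF assms]) (intro borel_measurable_continuous_onI continuous_intros)

lemma snd_borel_measurable[measurable]:
  fixes f :: "'c \<Rightarrow> 'a::second_countable_topology \<times> 'b::second_countable_topology"
  assumes "f \<in> borel_measurable M" shows "(\<lambda>p. snd (f p)) \<in> borel_measurable M"
  by (rule measurable_compose[OF assms]) (intro borel_measurable_continuous_onI continuous_intros)

lemma dir_deriv_cmult:
  fixes f :: "'a::real_normed_vector \<Rightarrow> real"
  assumes "f differentiable (at x)"
  shows "dir_deriv v (\<lambda>x. c * f x) x = c * dir_deriv v f x"
  using assms[unfolded frechet_derivative_works]
  by (subst dir_deriv_eq[OF has_derivative_mult_right]) (auto simp: dir_deriv_def)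

lemma dir_deriv_diff:
  assumes "f differentiable (at x)" "g differentiable (at x)"
  shows "dir_deriv v (\<lambda>x. f x - g x) x = dir_deriv v f x - dir_deriv v g x"
  using assms[unfolded frechet_derivative_works]
  by (subst dir_deriv_eq[OF has_derivative_diff]) (auto simp: dir_deriv_def)

text \<open>The curl of the curl of the field \<open>G e_i\<close>, written out by the identity curl
  curl = grad div - \<Delta>. This form avoids cross products and shows the two parts that are
  treated separately later.\<close>

definition curlcurl :: "3 \<Rightarrow> (real \<times> (real^3) \<Rightarrow> real) \<Rightarrow> real \<times> (real^3) \<Rightarrow> real^3" where
  "curlcurl i G p = (\<Sum>j\<in>UNIV. (dx j (dx i G) p - kron i j * (\<Sum>k\<in>UNIV. dx k (dx k G) p)) *\<^sub>R axis j 1)"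

lemma sum_axis_nth: "(\<Sum>j\<in>UNIV. c j *\<^sub>R axis j 1 :: real^3) $ k = c k"
  using basis_expansion[of "\<chi> j. c j"] by (simp add: vec_eq_iff scalar_mult_eq_scaleR)

lemma curlcurl_nth: "curlcurl i G p $ j = dx j (dx i G) p - kron i j * (\<Sum>k\<in>UNIV. dx k (dx k G) p)"
  unfolding curlcurl_def by (rule sum_axis_nth)

lemma smooth_dx: "smooth G \<Longrightarrow> smooth (dx j G)"
  unfolding dx_def by (rule smooth_dir_deriv)

lemma smooth_curlcurl: "smooth G \<Longrightarrow> smooth (curlcurl i G)"
  unfolding curlcurl_def[abs_def]
  by (intro smooth_sum smooth_scaleR_const smooth_minus smooth_mult smooth_const smooth_dx)

lemma dx_commute: "smooth (G :: _ \<Rightarrow> real) \<Longrightarrow> dx j (dir_deriv v G) = dir_deriv v (dx j G)"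
  unfolding dx_def by (rule dir_deriv_commute)

lemma dir_deriv_curlcurl:
  assumes G: "smooth G"
  shows "dir_deriv v (curlcurl i G) = curlcurl i (dir_deriv v G)"
proof
  fix p
  have diff: "F differentiable (at p)" if "smooth F" for F :: "real \<times> (real^3) \<Rightarrow> real" by (rule smooth_differentiable[OF that])
  note sm = smooth_minus smooth_mult smooth_const smooth_sum smooth_dx G
  have "dir_deriv v (curlcurl i G) p = (\<Sum>j\<in>UNIV. dir_deriv v (\<lambda>p. (dx j (dx i G) p - kron i j * (\<Sum>k\<in>UNIV. dx k (dx k G) p)) *\<^sub>R axis j 1) p)"
    unfolding curlcurl_def[abs_def]
    by (rule dir_deriv_sum) (intro smooth_differentiable smooth_scaleR_const sm)
  also have "\<dots> = (\<Sum>j\<in>UNIV. (dir_deriv v (\<lambda>p. dx j (dx i G) p - kron i j * (\<Sum>k\<in>UNIV. dx k (dx k G) p)) p) *\<^sub>R axis j 1)"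
    by (intro sum.cong refl dir_deriv_scaleR_const diff sm)
  also have "\<dots> = (\<Sum>j\<in>UNIV. (dir_deriv v (dx j (dx i G)) p - dir_deriv v (\<lambda>p. kron i j * (\<Sum>k\<in>UNIV. dx k (dx k G) p)) p) *\<^sub>R axis j 1)"
    by (intro sum.cong refl arg_cong2[where f=scaleR] dir_deriv_diff diff sm)
  also have "\<dots> = (\<Sum>j\<in>UNIV. (dir_deriv v (dx j (dx i G)) p - kron i j * dir_deriv v (\<lambda>p. (\<Sum>k\<in>UNIV. dx k (dx k G) p)) p) *\<^sub>R axis j 1)"
    by (intro sum.cong refl arg_cong2[where f=scaleR] arg_cong2[where f="(-)"] dir_deriv_cmult diff sm)
  also have "dir_deriv v (\<lambda>p. (\<Sum>k\<in>UNIV. dx k (dx k G) p)) p = (\<Sum>k\<in>UNIV. dir_deriv v (dx k (dx k G)) p)"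
    by (rule dir_deriv_sum) (intro smooth_differentiable sm)
  finally show "dir_deriv v (curlcurl i G) p = curlcurl i (dir_deriv v G) p"
    unfolding curlcurl_def by (simp add: dx_commute smooth_dx G)
qed

text \<open>The combination has the shape of the backward heat operator, with \<open>G\<close> a
  time derivative, \<open>H j\<close> a second derivative in direction \<open>j\<close> and
  \<open>c\<close> the viscosity.\<close>

lemma curlcurl_linear:
  assumes G: "smooth G" and H: "\<And>j. smooth (H j)"
  shows "curlcurl i (\<lambda>p. G p + c * (\<Sum>j\<in>(UNIV::3 set). H j p)) p = curlcurl i G p + c *\<^sub>R (\<Sum>j\<in>UNIV. curlcurl i (H j) p)"
proof -
  have 1: "dx k (\<lambda>p. F p + c * (\<Sum>j\<in>(UNIV::3 set). K j p)) = (\<lambda>p. dx k F p + c * (\<Sum>j\<in>UNIV. dx k (K j) p))"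
    if F: "smooth F" and K: "\<And>j. smooth (K j)" for F K k
  proof
    fix p
    have diff: "F differentiable (at p)" if "smooth F" for F :: "real \<times> (real^3) \<Rightarrow> real" by (rule smooth_differentiable[OF that])
    have "dx k (\<lambda>p. F p + c * (\<Sum>j\<in>(UNIV::3 set). K j p)) p = dx k F p + dx k (\<lambda>p. c * (\<Sum>j\<in>(UNIV::3 set). K j p)) p"
      unfolding dx_def by (intro dir_deriv_add diff smooth_mult smooth_const smooth_sum F K)
    also have "dx k (\<lambda>p. c * (\<Sum>j\<in>(UNIV::3 set). K j p)) p = c * dx k (\<lambda>p. (\<Sum>j\<in>(UNIV::3 set). K j p)) p"
      unfolding dx_def by (intro dir_deriv_cmult diff smooth_mult smooth_const smooth_sum F K)
    also have "dx k (\<lambda>p. (\<Sum>j\<in>(UNIV::3 set). K j p)) p = (\<Sum>j\<in>UNIV. dx k (K j) p)"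
      unfolding dx_def by (intro dir_deriv_sum diff K)
    finally show "dx k (\<lambda>p. F p + c * (\<Sum>j\<in>(UNIV::3 set). K j p)) p = dx k F p + c * (\<Sum>j\<in>UNIV. dx k (K j) p)" .
  qed
  have 2: "dx l (dx k (\<lambda>p. G p + c * (\<Sum>j\<in>(UNIV::3 set). H j p))) p = dx l (dx k G) p + c * (\<Sum>j\<in>UNIV. dx l (dx k (H j)) p)" for l k
    unfolding 1[OF G H] 1[OF smooth_dx[OF G] smooth_dx[OF H]] ..
  show ?thesis
    unfolding vec_eq_iff vector_add_component vector_scaleR_component sum_component curlcurl_nth 2
    by (simp add: sum_3 algebra_simps)
qed

lemma curlcurl_local:
  assumes "open S" "p \<in> S" "\<And>q. q \<in> S \<Longrightarrow> G q = H q"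
  shows "curlcurl i G p = curlcurl i H p"
proof -
  have 1: "dx k G q = dx k H q" if "q \<in> S" for k q
    unfolding dx_def by (rule dir_deriv_local[OF assms(1) that assms(3)])
  have "dx l (dx k G) p = dx l (dx k H) p" for k l
    unfolding dx_def[of l] by (rule dir_deriv_local[OF assms(1,2) 1])
  then show ?thesis by (simp add: curlcurl_def)
qed

text \<open>By the symmetry of mixed derivatives, the gradient part and the Laplacian part both
  contribute the Laplacian of \<open>dx i G\<close>, with opposite signs.\<close>

lemma div_curlcurl:
  assumes G: "smooth G"
  shows "div_x (curlcurl i G) p = 0"
proof -
  have "div_x (curlcurl i G) p = (\<Sum>j\<in>UNIV. dx j (dx i (dx j G)) p - kron i j * (\<Sum>k\<in>UNIV. dx k (dx k (dx j G)) p))"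
    unfolding div_x_def dx_def[of _ "curlcurl i G"] dir_deriv_curlcurl[OF G] curlcurl_nth by (simp add: dx_def)
  also have "\<dots> = (\<Sum>j\<in>UNIV. dx j (dx j (dx i G)) p) - (\<Sum>k\<in>UNIV. dx k (dx k (dx i G)) p)"
  proof -
    have "dx i (dx j G) = dx j (dx i G)" for j
      using dx_commute[OF G, of i "(0, axis j 1)"] by (simp add: dx_def)
    moreover have "(\<Sum>j\<in>UNIV. kron i j * f j) = f i" for f
      by (simp add: kron_def if_distrib[of "\<lambda>c. c * _"] cong: if_cong)
    ultimately show ?thesis by (simp add: sum_subtractf)
  qed
  finally show ?thesis by simp
qed

lemma curlcurl_bound:
  assumes "\<And>k. Ckw k UNIV w G" and w: "\<And>p. w p \<ge> 0"
  obtains C where "C \<ge> 0" "\<And>n p. norm (curlcurl i (G n) p) \<le> C * w p"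
proof -
  have d: "wbd UNIV w (\<lambda>n. dx l (dx k (G n)))" for l k
  proof -
    have "Ckw 0 UNIV w (\<lambda>n. dx l (dx k (G n)))"
      unfolding dx_def by (rule Ckw_dir_deriv[OF Ckw_dir_deriv[OF assms(1)]])
    then show ?thesis by simp
  qed
  then have "\<exists>C\<ge>0. \<forall>n p. \<bar>dx l (dx k (G n)) p\<bar> \<le> C * w p" for l k unfolding wbd_def by auto
  then obtain C where C: "\<And>l k. C l k \<ge> 0" "\<And>l k n p. \<bar>dx l (dx k (G n)) p\<bar> \<le> C l k * w p" by metis
  define D where "D = (\<Sum>j\<in>UNIV. C j i + (\<Sum>k\<in>UNIV. C k k))"
  show ?thesis
  proof
    show "D \<ge> 0" unfolding D_def by (intro sum_nonneg add_nonneg_nonneg C)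
    fix n p
    have "norm (curlcurl i (G n) p) \<le> (\<Sum>j\<in>UNIV. norm ((dx j (dx i (G n)) p - kron i j * (\<Sum>k\<in>UNIV. dx k (dx k (G n)) p)) *\<^sub>R (axis j 1 :: real^3)))"
      unfolding curlcurl_def by (rule norm_sum)
    also have "\<dots> \<le> (\<Sum>j\<in>UNIV. (C j i + (\<Sum>k\<in>UNIV. C k k)) * w p)"
    proof (rule sum_mono)
      fix j :: 3
      have "\<bar>kron i j * (\<Sum>k\<in>UNIV. dx k (dx k (G n)) p)\<bar> \<le> 1 * (\<Sum>k\<in>UNIV. C k k * w p)"
        unfolding abs_mult using C(2) by (intro mult_mono kron_abs order_trans[OF sum_abs] sum_mono) auto
      then show "norm ((dx j (dx i (G n)) p - kron i j * (\<Sum>k\<in>UNIV. dx k (dx k (G n)) p)) *\<^sub>R (axis j 1 :: real^3)) \<le> (C j i + (\<Sum>k\<in>UNIV. C k k)) * w p"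
        using C(2)[of j i n p] by (simp add: sum_distrib_right distrib_right)
    qed
    finally show "norm (curlcurl i (G n) p) \<le> D * w p" by (simp add: D_def sum_distrib_right)
  qed
qed

lemma wt_integrable:
  "integrable lborel (\<lambda>y::real^3. 1 / (1 + norm y) ^ 4)"
proof (rule integrableI_bounded)
  have "1 / (1 + norm y) ^ 4 = (1 + norm y) powr - 4" for y :: "real^3"
  proof -
    have "(1 + norm y) powr real 4 = (1 + norm y) ^ 4" by (rule powr_realpow) (simp add: add_pos_nonneg)
    then show ?thesis by (simp add: powr_minus_divide)
  qed
  then have "(\<integral>\<^sup>+y. ennreal (norm (1 / (1 + norm (y::real^3)) ^ 4)) \<partial>lborel) = (\<integral>\<^sup>+y. ennreal ((1 + norm (y::real^3)) powr - 4) \<partial>lborel)"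
    by (intro nn_integral_cong) simp
  then show "(\<integral>\<^sup>+y. ennreal (norm (1 / (1 + norm (y::real^3)) ^ 4)) \<partial>lborel) < \<infinity>"
    using nn_integral_radial_finite[of 4] by simp
qed simp

lemma integrable_product_lborel:
  fixes f :: "'a::euclidean_space \<Rightarrow> real" and g :: "'b::euclidean_space \<Rightarrow> real"
  assumes f: "integrable lborel f" and g: "integrable lborel g"
  shows "integrable lborel (\<lambda>p. f (fst p) * g (snd p))"
proof (rule integrableI_bounded)
  have [measurable]: "f \<in> borel_measurable borel" "g \<in> borel_measurable borel" using f g by auto
  show "(\<lambda>p. f (fst p) * g (snd p)) \<in> borel_measurable lborel" by measurable
  have "(\<integral>\<^sup>+p. ennreal (norm (f (fst p) * g (snd p))) \<partial>lborel) = (\<integral>\<^sup>+p. ennreal (norm (f (fst p) * g (snd p))) \<partial>(lborel \<Otimes>\<^sub>M lborel))"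
    by (simp add: lborel_prod)
  also have "\<dots> = (\<integral>\<^sup>+s. \<integral>\<^sup>+y. ennreal (norm (f s * g y)) \<partial>lborel \<partial>lborel)"
    by (subst lborel.nn_integral_fst[symmetric]) auto
  also have "\<dots> = (\<integral>\<^sup>+s. ennreal (norm (f s)) * (\<integral>\<^sup>+y. ennreal (norm (g y)) \<partial>lborel) \<partial>lborel)"
    by (simp add: abs_mult ennreal_mult nn_integral_cmult)
  also have "\<dots> = (\<integral>\<^sup>+s. ennreal (norm (f s)) \<partial>lborel) * (\<integral>\<^sup>+y. ennreal (norm (g y)) \<partial>lborel)"
    by (simp add: nn_integral_multc)
  also have "\<dots> < \<infinity>"
    using f g unfolding integrable_iff_bounded by (auto simp: ennreal_mult_less_top)
  finally show "(\<integral>\<^sup>+p. ennreal (norm (f (fst p) * g (snd p))) \<partial>lborel) < \<infinity>" .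
qed

context backward_heat
begin

lemma w_integrable: "integrable lborel (w 4)"
proof -
  have "integrable lborel (indicator {-3<..<c} :: real \<Rightarrow> real)" by (cases "-3 \<le> c") auto
  from integrable_product_lborel[OF this wt_integrable] show ?thesis by (simp add: w_def[abs_def])
qed

lemma w_nonneg: "w m p \<ge> 0" by (simp add: w_def)

lemma w_le_1: "w m p \<le> 1"
proof -
  have "(1 + norm (snd p)) ^ m \<ge> 1" by (rule one_le_power) simp
  then show ?thesis by (simp add: w_def indicator_def divide_simps)
qed

lemma heat_deriv_theta: "backward_heat \<nu> \<sigma> b c (dir_deriv 1 \<theta>)"
proof
  show "dir_deriv 1 \<theta> s = 0" if "s < -2 \<or> b < s" for s
  proof -
    have "dir_deriv 1 \<theta> s = dir_deriv 1 (\<lambda>_. 0) s"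
      by (rule dir_deriv_local[of "{..<-2} \<union> {b<..}"]) (use that theta_zero in auto)
    then show ?thesis by (simp add: dir_deriv_def)
  qed
qed (use \<nu> bc c smooth_dir_deriv[OF smooth_theta] in auto)

end

text \<open>Truncated Navier--Stokes data: \<open>V\<close> is a Borel version of the velocity on \<open>[0, T]\<close>, extended
  by zero to other times.\<close>

locale ns_data =
  fixes \<nu> T M E :: real and V :: "real \<times> (real^3) \<Rightarrow> real^3" and u0 :: "real^3 \<Rightarrow> real^3"
  assumes \<nu>_pos: "\<nu> > 0" and T_pos: "T > 0"
    and V_meas[measurable]: "V \<in> borel_measurable borel"
    and V_past: "\<And>p. fst p < 0 \<Longrightarrow> V p = 0" and V_future: "\<And>p. T < fst p \<Longrightarrow> V p = 0"
    and M_nonneg: "M \<ge> 0" and V_bound: "\<And>p. norm (V p) \<le> M"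
    and E_nonneg: "E \<ge> 0" and V_energy: "\<And>s. (\<integral>\<^sup>+y. ennreal ((norm (V (s, y)))\<^sup>2) \<partial>lborel) \<le> ennreal E"
    and u0_int: "integrable lborel u0"
    and V_div: "AE s in lborel. \<forall>\<phi> :: real^3 \<Rightarrow> real. test_function \<phi> \<longrightarrow> (LINT y|lborel. dir_deriv (V (s, y)) \<phi> y) = 0"
    and u0_div: "\<And>\<phi> :: real^3 \<Rightarrow> real. test_function \<phi> \<Longrightarrow> (LINT y|lborel. dir_deriv (u0 y) \<phi> y) = 0"
    and weak_form: "\<And>\<phi>. test_function \<phi> \<Longrightarrow> (\<And>p. div_x \<phi> p = 0) \<Longrightarrow> (\<And>p. T \<le> fst p \<Longrightarrow> \<phi> p = 0) \<Longrightarrow>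
      (LINT p|lborel. V p \<bullet> dt \<phi> p + \<nu> * (V p \<bullet> laplace_x \<phi> p) + V p \<bullet> (\<Sum>j\<in>UNIV. (V p $ j) *\<^sub>R dx j \<phi> p))
        + (LINT x|lborel. u0 x \<bullet> \<phi> (0, x)) = 0"
begin

lemma u0_meas[measurable]: "u0 \<in> borel_measurable borel"
  using u0_int by auto

text \<open>The integrand of the weak formulation for the test field \<open>curlcurl i G\<close>,
  with all derivatives commuted past \<open>curlcurl\<close> onto the scalar
  \<open>G\<close>.\<close>

definition J :: "3 \<Rightarrow> (real \<times> (real^3) \<Rightarrow> real) \<Rightarrow> real \<times> (real^3) \<Rightarrow> real" where
  "J i G p = V p \<bullet> curlcurl i (dt G) p + \<nu> * (V p \<bullet> (\<Sum>j\<in>UNIV. curlcurl i (dx j (dx j G)) p))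
     + V p \<bullet> (\<Sum>j\<in>UNIV. (V p $ j) *\<^sub>R curlcurl i (dx j G) p)"

text \<open>The gap \<open>b < T\<close> makes \<open>G\<close> vanish on a neighbourhood of the
  times from \<open>T\<close> on, so its derivatives vanish at time \<open>T\<close> as
  well.\<close>

lemma weak_form_curlcurl:
  assumes G: "smooth G" and supp: "\<And>p. norm p > r \<Longrightarrow> G p = 0" "\<And>p. b < fst p \<Longrightarrow> G p = 0" and "b < T"
  shows "(LINT p|lborel. J i G p) + (LINT x|lborel. u0 x \<bullet> curlcurl i G (0, x)) = 0"
proof -
  let ?\<phi> = "curlcurl i G"
  have loc: "?\<phi> p = 0" if "open S" "p \<in> S" "\<And>q. q \<in> S \<Longrightarrow> G q = 0" for S p
  proof -
    have "?\<phi> p = curlcurl i (\<lambda>_. 0) p" by (rule curlcurl_local[OF that])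
     then show ?thesis by (simp add: curlcurl_def dx_def dir_deriv_def[abs_def])
  qed
  have "?\<phi> p = 0" if "norm p > r" for p
    by (rule loc[of "{p. r < norm p}"]) (use that supp in \<open>auto intro!: open_Collect_less continuous_intros\<close>)
  then have "test_function ?\<phi>"
    unfolding test_function_def using smooth_curlcurl[OF G] compact_supportI by blast
  moreover have "?\<phi> p = 0" if "T \<le> fst p" for p
    by (rule loc[of "{p. b < fst p}"]) (use that supp \<open>b < T\<close> in \<open>auto intro!: open_Collect_less continuous_intros\<close>)
  ultimately have "(LINT p|lborel. V p \<bullet> dt ?\<phi> p + \<nu> * (V p \<bullet> laplace_x ?\<phi> p) + V p \<bullet> (\<Sum>j\<in>UNIV. (V p $ j) *\<^sub>R dx j ?\<phi> p))
        + (LINT x|lborel. u0 x \<bullet> ?\<phi> (0, x)) = 0"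
    by (intro weak_form div_curlcurl[OF G])
  moreover have "dt ?\<phi> = curlcurl i (dt G)" "dx j ?\<phi> = curlcurl i (dx j G)" for j
    using dir_deriv_curlcurl[OF G] by (auto simp: dt_def dx_def)
  moreover have "dx j (curlcurl i (dx j G)) = curlcurl i (dx j (dx j G))" for j
    using dir_deriv_curlcurl[OF smooth_dx[OF G]] by (auto simp: dx_def)
  ultimately show ?thesis by (simp add: J_def laplace_x_def)
qed

lemma J_local:
  assumes "open S" "p \<in> S" "\<And>q. q \<in> S \<Longrightarrow> G q = H q"
  shows "J i G p = J i H p"
proof -
  have 1: "dir_deriv v G q = dir_deriv v H q" if "q \<in> S" for v q
    by (rule dir_deriv_local[OF assms(1) that assms(3)])
  have 2: "dir_deriv v (dir_deriv v' G) q = dir_deriv v (dir_deriv v' H) q" if "q \<in> S" for v v' q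
    by (rule dir_deriv_local[OF assms(1) that 1])
  have 3: "curlcurl i (dir_deriv v G) p = curlcurl i (dir_deriv v H) p" for v
    by (rule curlcurl_local[OF assms(1,2) 1])
  have 4: "curlcurl i (dir_deriv v (dir_deriv v' G)) p = curlcurl i (dir_deriv v (dir_deriv v' H)) p" for v v'
    by (rule curlcurl_local[OF assms(1,2) 2])
  show ?thesis unfolding J_def dt_def dx_def 3 4 ..
qed

lemma curlcurl_meas:
  assumes "smooth G" shows "curlcurl i G \<in> borel_measurable borel"
  by (intro borel_measurable_continuous_onI smooth_continuous_on smooth_curlcurl assms)

lemma J_meas:
  assumes G: "smooth G" shows "J i G \<in> borel_measurable borel"
proof -
  have [measurable]: "curlcurl i (dt G) \<in> borel_measurable borel" "curlcurl i (dx j G) \<in> borel_measurable borel"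
     "curlcurl i (dx j (dx j G)) \<in> borel_measurable borel" for j
    unfolding dt_def dx_def by (intro curlcurl_meas smooth_dir_deriv G)+
  show ?thesis unfolding J_def[abs_def] by measurable
qed

lemma J_bound:
  assumes "\<And>k. Ckw k UNIV w G" and w: "\<And>p. w p \<ge> 0"
  obtains C where "C \<ge> 0" "\<And>n p. \<bar>J i (G n) p\<bar> \<le> C * w p"
proof -
  note d = Ckw_dir_deriv[OF assms(1)]
  obtain A where A: "A \<ge> 0" "\<And>n p. norm (curlcurl i (dt (G n)) p) \<le> A * w p"
    using curlcurl_bound[OF d w] unfolding dt_def by metis
  have "\<exists>B\<ge>0. \<forall>n p. norm (curlcurl i (dx j (dx j (G n))) p) \<le> B * w p" for j
    using curlcurl_bound[OF Ckw_dir_deriv[OF d] w] unfolding dx_def by metis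
  then obtain B where B: "\<And>j. B j \<ge> 0" "\<And>j n p. norm (curlcurl i (dx j (dx j (G n))) p) \<le> B j * w p" by metis
  have "\<exists>B\<ge>0. \<forall>n p. norm (curlcurl i (dx j (G n)) p) \<le> B * w p" for j
    using curlcurl_bound[OF d w] unfolding dx_def by metis
  then obtain D where D: "\<And>j. D j \<ge> 0" "\<And>j n p. norm (curlcurl i (dx j (G n)) p) \<le> D j * w p" by metis
  show ?thesis
  proof
    show "0 \<le> M * A + \<nu> * (M * (\<Sum>j\<in>UNIV. B j)) + M * (\<Sum>j\<in>UNIV. M * D j)"
      using M_nonneg A B D \<nu>_pos by (intro add_nonneg_nonneg mult_nonneg_nonneg sum_nonneg) auto
    fix n p
    have CS: "\<bar>V p \<bullet> v\<bar> \<le> M * r" if "norm v \<le> r" for v r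
      using Cauchy_Schwarz_ineq2[of "V p" v] mult_mono[OF V_bound[of p] that M_nonneg norm_ge_zero] by linarith
    have 1: "\<bar>V p \<bullet> curlcurl i (dt (G n)) p\<bar> \<le> M * (A * w p)" by (rule CS[OF A(2)])
    have 2: "\<bar>V p \<bullet> (\<Sum>j\<in>UNIV. curlcurl i (dx j (dx j (G n))) p)\<bar> \<le> M * (\<Sum>j\<in>UNIV. B j * w p)"
      by (rule CS) (intro order_trans[OF norm_sum] sum_mono B)
    have 3: "\<bar>V p \<bullet> (\<Sum>j\<in>UNIV. (V p $ j) *\<^sub>R curlcurl i (dx j (G n)) p)\<bar> \<le> M * (\<Sum>j\<in>UNIV. M * (D j * w p))"
    proof (rule CS, rule order_trans[OF norm_sum], rule sum_mono)
      fix j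
      have "\<bar>V p $ j\<bar> \<le> M" using component_le_norm_cart[of "V p" j] V_bound[of p] by linarith
      then show "norm ((V p $ j) *\<^sub>R curlcurl i (dx j (G n)) p) \<le> M * (D j * w p)"
        using mult_mono[OF _ D(2)[of j n p] M_nonneg norm_ge_zero] by simp
    qed
    have "\<bar>J i (G n) p\<bar> \<le> M * (A * w p) + \<nu> * (M * (\<Sum>j\<in>UNIV. B j * w p)) + M * (\<Sum>j\<in>UNIV. M * (D j * w p))"
    proof -
      have "\<bar>\<nu> * (V p \<bullet> (\<Sum>j\<in>UNIV. curlcurl i (dx j (dx j (G n))) p))\<bar> \<le> \<nu> * (M * (\<Sum>j\<in>UNIV. B j * w p))"
        unfolding abs_mult using 2 \<nu>_pos by (intro mult_mono) auto
      with 1 3 show ?thesis unfolding J_def by linarith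
    qed
    then show "\<bar>J i (G n) p\<bar> \<le> (M * A + \<nu> * (M * (\<Sum>j\<in>UNIV. B j)) + M * (\<Sum>j\<in>UNIV. M * D j)) * w p"
      by (simp add: sum_distrib_right sum_distrib_left algebra_simps)
  qed
qed

text \<open>Heat kernels do not have compact support. The cutoff multiplies \<open>P\<close> inside
  \<open>curlcurl\<close>, so the truncated field is still exactly divergence free. When the radius
  tends to infinity, the weighted bounds dominate the space-time integral, and \<open>u0_int\<close>
  dominates the initial term.\<close>

lemma weak_form_rapid:
  fixes x :: "real^3"
  assumes "backward_heat \<nu> \<sigma> b c \<theta>" and "b < T"
  defines "P \<equiv> backward_heat.P \<nu> \<sigma> x \<theta>"
  shows "(LINT p|lborel. J i P p) + (LINT y|lborel. u0 y \<bullet> curlcurl i P (0, y)) = 0"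
    and "integrable lborel (J i P)"
proof -
  interpret B: backward_heat \<nu> \<sigma> b c x \<theta> by (rule assms(1))
  define G where "G n p = chi n (snd p) * B.P p" for n p
  have PG: "P = B.P" by (simp add: P_def)
  have G: "Ckw k UNIV (B.w 4) G" for k
    unfolding G_def[abs_def] by (rule cutoff_Ckw[OF bounded_linear_snd B.P_Ckw])
  have sG: "smooth (G n)" for n by (rule smooth_if_Ckw[OF G])
  have "(LINT p|lborel. J i (G n) p) + (LINT y|lborel. u0 y \<bullet> curlcurl i (G n) (0, y)) = 0" for n
  proof (rule weak_form_curlcurl[OF sG _ _ \<open>b < T\<close>])
    show "G n p = 0" if "b < fst p" for p
      using that B.theta_zero by (simp add: G_def B.P_def)
    show "G n p = 0" if "norm p > (2 * Suc n) + max 2 \<bar>b\<bar>" for p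
    proof -
      have "norm p \<le> norm (fst p) + norm (snd p)" by (metis norm_Pair_le prod.collapse)
      then have "norm (snd p) \<ge> 2 * Suc n \<or> \<bar>fst p\<bar> > max 2 \<bar>b\<bar>" using that by auto
      then show ?thesis
      proof
        assume "\<bar>fst p\<bar> > max 2 \<bar>b\<bar>"
        then have "fst p < -2 \<or> b < fst p" by (cases "fst p > 0") auto
        then show ?thesis using B.theta_zero by (simp add: G_def B.P_def)
      qed (simp add: G_def chi_eq_0)
    qed
  qed
  moreover have lim1: "(\<lambda>n. LINT p|lborel. J i (G n) p) \<longlonglongrightarrow> (LINT p|lborel. J i P p)" "integrable lborel (J i P)"
  proof -
    obtain C where C: "C \<ge> 0" "\<And>n p. \<bar>J i (G n) p\<bar> \<le> C * B.w 4 p"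
      using J_bound[OF G B.w_nonneg] by metis
    have a: "J i P \<in> borel_measurable lborel" using J_meas[OF B.smooth_P] by (simp add: PG)
    have b: "\<And>n. J i (G n) \<in> borel_measurable lborel" using J_meas[OF sG] by simp
    have c: "integrable lborel (\<lambda>p. C * B.w 4 p)" by (rule integrable_mult_right[OF B.w_integrable])
    have d: "AE p in lborel. (\<lambda>n. J i (G n) p) \<longlonglongrightarrow> J i P p"
    proof (intro AE_I2 tendsto_eventually)
      fix p :: "real \<times> (real^3)"
      obtain S N where S: "open S" "p \<in> S" "\<And>n y. n \<ge> N \<Longrightarrow> y \<in> S \<Longrightarrow> chi n (snd y) * B.P y = B.P y"
        using cutoff_eventually_local[OF bounded_linear_snd] by blast
      have "J i (G n) p = J i P p" if "n \<ge> N" for n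
        by (rule J_local[OF S(1,2)]) (use S(3)[OF that] in \<open>simp add: G_def PG\<close>)
      then show "\<forall>\<^sub>F n in sequentially. J i (G n) p = J i P p" unfolding eventually_sequentially by blast
    qed
    have e: "AE p in lborel. norm (J i (G n) p) \<le> C * B.w 4 p" for n using C(2) by simp
    show "(\<lambda>n. LINT p|lborel. J i (G n) p) \<longlonglongrightarrow> (LINT p|lborel. J i P p)"
      by (rule integral_dominated_convergence[OF a b c d e])
    show "integrable lborel (J i P)" by (rule integrable_dominated_convergence[OF a b c d e])
  qed
  moreover have lim2: "(\<lambda>n. LINT y|lborel. u0 y \<bullet> curlcurl i (G n) (0, y)) \<longlonglongrightarrow> (LINT y|lborel. u0 y \<bullet> curlcurl i P (0, y))"
  proof -
    obtain C where C: "C \<ge> 0" "\<And>n p. norm (curlcurl i (G n) p) \<le> C * B.w 4 p"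
      using curlcurl_bound[OF G B.w_nonneg] by metis
    have [measurable]: "curlcurl i P \<in> borel_measurable borel" "curlcurl i (G n) \<in> borel_measurable borel" for n
      using curlcurl_meas[OF B.smooth_P] curlcurl_meas[OF sG] by (simp_all add: PG)
    show ?thesis
    proof (rule integral_dominated_convergence[where w="\<lambda>y. C * norm (u0 y)"])
      show "integrable lborel (\<lambda>y. C * norm (u0 y))" using u0_int by simp
      show "AE y in lborel. (\<lambda>n. u0 y \<bullet> curlcurl i (G n) (0, y)) \<longlonglongrightarrow> u0 y \<bullet> curlcurl i P (0, y)"
      proof (intro AE_I2 tendsto_eventually)
        fix y :: "real^3"
        obtain S N where S: "open S" "(0::real, y) \<in> S" "\<And>n q. n \<ge> N \<Longrightarrow> q \<in> S \<Longrightarrow> chi n (snd q) * B.P q = B.P q"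
          using cutoff_eventually_local[OF bounded_linear_snd] by blast
        have "curlcurl i (G n) (0, y) = curlcurl i P (0, y)" if "n \<ge> N" for n
          by (rule curlcurl_local[OF S(1,2)]) (use S(3)[OF that] in \<open>simp add: G_def PG\<close>)
        then show "\<forall>\<^sub>F n in sequentially. u0 y \<bullet> curlcurl i (G n) (0, y) = u0 y \<bullet> curlcurl i P (0, y)"
          unfolding eventually_sequentially by (intro exI[of _ N]) simp
      qed
      show "AE y in lborel. norm (u0 y \<bullet> curlcurl i (G n) (0, y)) \<le> C * norm (u0 y)" for n
      proof (rule AE_I2)
        fix y
        have "norm (curlcurl i (G n) (0, y)) \<le> C"
          using C(2)[of n "(0, y)"] mult_left_mono[OF B.w_le_1 C(1), of 4 "(0, y)"] by simp
        then show "norm (u0 y \<bullet> curlcurl i (G n) (0, y)) \<le> C * norm (u0 y)"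
          using Cauchy_Schwarz_ineq2[of "u0 y" "curlcurl i (G n) (0, y)"]
            mult_left_mono[of "norm (curlcurl i (G n) (0, y))" C "norm (u0 y)"] by (simp add: mult.commute)
      qed
    qed measurable
  qed
  ultimately have "(\<lambda>n::nat. 0::real) \<longlonglongrightarrow> (LINT p|lborel. J i P p) + (LINT y|lborel. u0 y \<bullet> curlcurl i P (0, y))"
    using tendsto_add[OF lim1(1) lim2] by simp
  then show "(LINT p|lborel. J i P p) + (LINT y|lborel. u0 y \<bullet> curlcurl i P (0, y)) = 0"
    using LIMSEQ_unique tendsto_const by blast
  show "integrable lborel (J i P)" by fact
qed

end

lemma Ckw_dir_deriv_single:
  assumes "\<And>k. Ckw k S w (\<lambda>_::unit. P)" shows "Ckw k S w (\<lambda>_::unit. dir_deriv v P)"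
  using assms[of "Suc k"] by simp

lemma second_deriv_bound:
  assumes "\<And>k. Ckw k UNIV w (\<lambda>_::unit. P)"
  shows "\<exists>C\<ge>0. \<forall>p. \<bar>dx l (dx k P) p\<bar> \<le> C * w p"
proof -
  have 1: "Ckw m UNIV w (\<lambda>_::unit. dx k P)" for m
    unfolding dx_def by (rule Ckw_dir_deriv_single) (rule assms)
  have "Ckw 0 UNIV w (\<lambda>_::unit. dx l (dx k P))"
    unfolding dx_def[of l] by (rule Ckw_dir_deriv_single) (rule 1)
  then have "wbd UNIV w (\<lambda>_::unit. dx l (dx k P))" by simp
  then show ?thesis unfolding wbd_def by simp
qed

lemma dir_deriv_coords:
  fixes F :: "real^3 \<Rightarrow> 'b::real_normed_vector"
  assumes "F differentiable (at y)"
  shows "dir_deriv v F y = (\<Sum>j\<in>UNIV. (v $ j) *\<^sub>R dir_deriv (axis j 1) F y)"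
proof -
  have "v = (\<Sum>j\<in>UNIV. (v $ j) *\<^sub>R axis j 1)"
    by (rule sym) (simp only: vec_eq_iff sum_axis_nth, simp)
  then have "dir_deriv v F y = dir_deriv (\<Sum>j\<in>UNIV. (v $ j) *\<^sub>R axis j 1) F y" by simp
  also have "\<dots> = (\<Sum>j\<in>UNIV. (v $ j) *\<^sub>R dir_deriv (axis j 1) F y)"
    unfolding linear_sum[OF dir_deriv_linear[OF assms]] linear_scale[OF dir_deriv_linear[OF assms]] ..
  finally show ?thesis .
qed

lemma dir_deriv_abs_le:
  fixes F :: "real^3 \<Rightarrow> real"
  assumes "F differentiable (at y)"
  shows "\<bar>dir_deriv v F y\<bar> \<le> norm v * (\<Sum>j\<in>UNIV. \<bar>dir_deriv (axis j 1) F y\<bar>)"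
  by (subst dir_deriv_coords[OF assms], unfold sum_distrib_left, rule order_trans[OF sum_abs]) (auto simp: abs_mult intro!: sum_mono mult_right_mono component_le_norm_cart)

lemma dir_deriv_field_meas:
  assumes "smooth (F :: real^3 \<Rightarrow> real)" and [measurable]: "f \<in> borel_measurable borel"
  shows "(\<lambda>y. dir_deriv (f y) F y) \<in> borel_measurable borel"
proof -
  have [measurable]: "dir_deriv (axis j 1) F \<in> borel_measurable borel" for j
    by (intro borel_measurable_continuous_onI smooth_continuous_on smooth_dir_deriv assms)
  show ?thesis by (subst dir_deriv_coords[OF smooth_differentiable[OF assms(1)]]) measurable
qed

text \<open>Vanishing divergence is assumed against compactly supported gradients only. Truncating
  \<open>G\<close> and using bounds uniform in the radius extends it to every \<open>G\<close> whose
  weight \<open>g\<close> is integrable against \<open>norm (f y)\<close>.\<close>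

lemma divergence_free_rapid:
  fixes f :: "real^3 \<Rightarrow> real^3" and G :: "real^3 \<Rightarrow> real"
  assumes [measurable]: "f \<in> borel_measurable borel"
    and div: "\<And>\<phi> :: real^3 \<Rightarrow> real. test_function \<phi> \<Longrightarrow> (LINT y|lborel. dir_deriv (f y) \<phi> y) = 0"
    and G: "\<And>k. Ckw k UNIV g (\<lambda>_::unit. G)"
    and int: "integrable lborel (\<lambda>y. norm (f y) * g y)"
  shows "(LINT y|lborel. dir_deriv (f y) G y) = 0"
proof -
  define H where "H n y = chi n y * G y" for n y
  have H: "Ckw k UNIV g H" for k
    unfolding H_def[abs_def] by (rule cutoff_Ckw[OF bounded_linear_ident G])
  have sH: "smooth (H n)" for n by (rule smooth_if_Ckw[OF H])
  have sG: "smooth G" by (rule smooth_if_Ckw[OF G])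
  have "\<exists>C\<ge>0. \<forall>n. \<forall>y. \<bar>dir_deriv (axis j 1) (H n) y\<bar> \<le> C * g y" for j
  proof -
    have "Ckw 0 UNIV g (\<lambda>n. dir_deriv (axis j 1) (H n))" by (rule Ckw_dir_deriv[OF H])
    then show ?thesis by (simp add: wbd_def)
  qed
  then obtain C where C: "\<And>j. C j \<ge> 0" "\<And>j n y. \<bar>dir_deriv (axis j 1) (H n) y\<bar> \<le> C j * g y" by metis
  have "H n y = 0" if "norm y > 2 * Suc n" for n y
    using chi_eq_0[of n y] that by (simp add: H_def)
  then have "test_function (H n)" for n
    unfolding test_function_def using sH compact_supportI by blast
  then have 0: "(LINT y|lborel. dir_deriv (f y) (H n) y) = 0" for n by (rule div)
  have "(\<lambda>n. LINT y|lborel. dir_deriv (f y) (H n) y) \<longlonglongrightarrow> (LINT y|lborel. dir_deriv (f y) G y)"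
  proof (rule integral_dominated_convergence[where w="\<lambda>y. (\<Sum>j\<in>UNIV. C j) * (norm (f y) * g y)"])
    show "integrable lborel (\<lambda>y. (\<Sum>j\<in>UNIV. C j) * (norm (f y) * g y))" using int by simp
    show "AE y in lborel. (\<lambda>n. dir_deriv (f y) (H n) y) \<longlonglongrightarrow> dir_deriv (f y) G y"
    proof (intro AE_I2 tendsto_eventually)
      fix y :: "real^3"
      obtain S N where S: "open S" "y \<in> S" "\<And>n q. n \<ge> N \<Longrightarrow> q \<in> S \<Longrightarrow> chi n q * G q = G q"
        using cutoff_eventually_local[OF bounded_linear_ident] by blast
      have "dir_deriv (f y) (H n) y = dir_deriv (f y) G y" if "n \<ge> N" for n
        by (rule dir_deriv_local[OF S(1,2)]) (use S(3)[OF that] in \<open>simp add: H_def\<close>)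
      then show "\<forall>\<^sub>F n in sequentially. dir_deriv (f y) (H n) y = dir_deriv (f y) G y"
        unfolding eventually_sequentially by (intro exI[of _ N]) simp
    qed
    show "AE y in lborel. norm (dir_deriv (f y) (H n) y) \<le> (\<Sum>j\<in>UNIV. C j) * (norm (f y) * g y)" for n
    proof (rule AE_I2)
      fix y
      have "\<bar>dir_deriv (f y) (H n) y\<bar> \<le> norm (f y) * (\<Sum>j\<in>UNIV. C j * g y)"
        by (rule order_trans[OF dir_deriv_abs_le[OF smooth_differentiable[OF sH]]])
           (intro mult_left_mono sum_mono C norm_ge_zero)
      then show "norm (dir_deriv (f y) (H n) y) \<le> (\<Sum>j\<in>UNIV. C j) * (norm (f y) * g y)"
        by (simp add: sum_distrib_right sum_distrib_left mult_ac)
    qed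
    show "(\<lambda>y. dir_deriv (f y) G y) \<in> borel_measurable lborel" using dir_deriv_field_meas[OF sG] by simp
    show "\<And>n. (\<lambda>y. dir_deriv (f y) (H n) y) \<in> borel_measurable lborel" using dir_deriv_field_meas[OF sH] by simp
  qed
  then show ?thesis unfolding 0 using LIMSEQ_unique tendsto_const by blast
qed

lemma slice_has_derivative:
  fixes F :: "real \<times> (real^3) \<Rightarrow> real"
  assumes "F differentiable (at (s, y))"
  shows "dir_deriv v (\<lambda>y. F (s, y)) y = dir_deriv (0, v) F (s, y)" "(\<lambda>y. F (s, y)) differentiable (at y)"
proof -
  have "((\<lambda>y::real^3. (s, y)) has_derivative (\<lambda>v. (0, v))) (at y)"
    by (auto intro!: derivative_eq_intros)
  from has_derivative_compose[where g=F and f="Pair s", OF this assms[unfolded frechet_derivative_works]]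
  have D: "((\<lambda>y. F (s, y)) has_derivative (\<lambda>v. frechet_derivative F (at (s, y)) (0, v))) (at y)" .
  show "dir_deriv v (\<lambda>y. F (s, y)) y = dir_deriv (0, v) F (s, y)" using dir_deriv_eq[OF D] by (simp add: dir_deriv_def)
  show "(\<lambda>y. F (s, y)) differentiable (at y)" using D differentiable_def by blast
qed

lemma Ckw_slice:
  fixes F :: "real \<times> (real^3) \<Rightarrow> real"
  assumes "Ckw k UNIV g (\<lambda>_::unit. F)"
  shows "Ckw k UNIV (\<lambda>y. g (s, y)) (\<lambda>_::unit. \<lambda>y. F (s, y))"
  using assms
proof (induction k arbitrary: F)
  have b: "wbd UNIV (\<lambda>y. g (s, y)) (\<lambda>_::unit. \<lambda>y. F (s, y))" if "wbd UNIV g (\<lambda>_::unit. F)" for F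
    using that unfolding wbd_def by auto
  {
    case 0
    have "continuous_on UNIV (\<lambda>y. F (s, y))"
      by (rule continuous_on_compose2[of UNIV F]) (use 0 in \<open>auto intro!: continuous_intros\<close>)
    then show ?case using b 0 by simp
  next
    case (Suc k)
    have diff: "F differentiable (at p)" for p using Suc.prems by (cases p) simp
    have "Ckw k UNIV (\<lambda>y. g (s, y)) (\<lambda>_::unit. \<lambda>y. dir_deriv (0, v) F (s, y))" for v
      by (rule Suc.IH) (use Suc.prems in simp)
    then have "Ckw k UNIV (\<lambda>y. g (s, y)) (\<lambda>_::unit. dir_deriv v (\<lambda>y. F (s, y)))" for v
      by (simp add: slice_has_derivative(1)[OF diff, abs_def])
    then show ?case using b[of F] Suc.prems slice_has_derivative(2)[OF diff] by simp
  }
qed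

subsection \<open>Integrals of the heat kernel over the diffusion parameter\<close>

lemma heat_lap_bound_powr:
  obtains C where "C > 0" "\<And>\<sigma> z. \<sigma> > 0 \<Longrightarrow> \<bar>heat_lap \<sigma> z\<bar> \<le> C * \<sigma> powr (-5/2)"
proof -
  obtain C where C: "C > 0" "\<And>\<sigma> z. \<sigma> > 0 \<Longrightarrow> \<bar>heat_lap \<sigma> z\<bar> \<le> C * (\<sigma> powr (-1) * heat (2 * \<sigma>) z)"
    using heat_derivs_le_double by metis
  have "\<bar>heat_lap \<sigma> z\<bar> \<le> C * \<sigma> powr (-5/2)" if "\<sigma> > 0" for \<sigma> z
  proof -
    have "heat (2 * \<sigma>) z \<le> (2 * \<sigma>) powr (-3/2)" using that by (intro heat_le_sup) simp
    also have "\<dots> \<le> \<sigma> powr (-3/2)" using that by (intro powr_mono2') auto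
    finally have "C * (\<sigma> powr (-1) * heat (2 * \<sigma>) z) \<le> C * (\<sigma> powr (-1) * \<sigma> powr (-3/2))"
      using C(1) by (intro mult_left_mono) auto
    also have "\<sigma> powr (-1) * \<sigma> powr (-3/2) = \<sigma> powr (-5/2)" by (subst powr_add[symmetric]) simp
    finally show ?thesis using C(2)[OF that, of z] by linarith
  qed
  then show ?thesis using that C(1) by blast
qed

lemma integrable_powr_tail:
  fixes q a :: real
  assumes "q > 1" "a > 0"
  shows "integrable lborel (\<lambda>t. indicator {a..} t * t powr - q)"
proof (rule integrableI_bounded)
  have "(\<integral>\<^sup>+t. ennreal (norm (indicator {a..} t * t powr - q)) \<partial>lborel) = (\<integral>\<^sup>+t. ennreal (t powr - q) * indicator {a..} t \<partial>lborel)"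
    by (intro nn_integral_cong) (auto split: split_indicator)
  then show "(\<integral>\<^sup>+t. ennreal (norm (indicator {a..} t * t powr - q)) \<partial>lborel) < \<infinity>"
    using nn_integral_powr_tail[OF assms] by simp
qed measurable

text \<open>\<open>heat_lap\<close> is the derivative in the diffusion parameter, so the integral
  telescopes, and the kernel tends to 0 like \<open>\<sigma> powr (-3/2)\<close>. Read the other
  way, integrating over the parameter inverts the Laplacian.\<close>

lemma heat_lap_tail:
  assumes "\<tau> > 0"
  shows "integrable lborel (\<lambda>\<sigma>. indicator {\<tau>..} \<sigma> * heat_lap \<sigma> z)"
    and "(LINT \<sigma>|lborel. indicator {\<tau>..} \<sigma> * heat_lap \<sigma> z) = - heat \<tau> z"
proof -
  obtain C where C: "C > 0" "\<And>\<sigma> z. \<sigma> > 0 \<Longrightarrow> \<bar>heat_lap \<sigma> z\<bar> \<le> C * \<sigma> powr (-5/2)"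
    using heat_lap_bound_powr by blast
  have dom: "integrable lborel (\<lambda>\<sigma>. C * (indicator {\<tau>..} \<sigma> * \<sigma> powr - (5/2)))"
    using integrable_powr_tail[of "5/2" \<tau>] assms by simp
  show int: "integrable lborel (\<lambda>\<sigma>. indicator {\<tau>..} \<sigma> * heat_lap \<sigma> z)"
    by (rule Bochner_Integration.integrable_bound[OF dom])
       (use C assms in \<open>auto simp: indicator_def abs_mult intro!: AE_I2\<close>)
  have cont: "isCont (\<lambda>\<sigma>. heat_lap \<sigma> z) \<sigma>" if "\<sigma> \<ge> \<tau>" for \<sigma>
    unfolding heat_lap_def heat_def using that assms by (auto intro!: continuous_intros)
  have fin: "(LINT \<sigma>|lborel. indicator {\<tau>..\<tau> + real n} \<sigma> *\<^sub>R heat_lap \<sigma> z) = heat (\<tau> + real n) z - heat \<tau> z" for n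
  proof (rule integral_FTC_Icc)
    show "((\<lambda>\<sigma>. heat \<sigma> z) has_vector_derivative heat_lap \<sigma> z) (at \<sigma> within {\<tau>..\<tau> + real n})" if "\<tau> \<le> \<sigma>" "\<sigma> \<le> \<tau> + real n" for \<sigma>
      using heat_time[of \<sigma> z] that assms by (auto simp: has_real_derivative_iff_has_vector_derivative intro: has_vector_derivative_at_within)
    show "continuous_on {\<tau>..\<tau> + real n} (\<lambda>\<sigma>. heat_lap \<sigma> z)"
      using cont by (intro continuous_at_imp_continuous_on) auto
  qed simp
  have l1: "(\<lambda>n. LINT \<sigma>|lborel. indicator {\<tau>..\<tau> + real n} \<sigma> *\<^sub>R heat_lap \<sigma> z) \<longlonglongrightarrow> (LINT \<sigma>|lborel. indicator {\<tau>..} \<sigma> * heat_lap \<sigma> z)"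
  proof (rule integral_dominated_convergence[OF _ _ dom])
    show "AE \<sigma> in lborel. (\<lambda>n. indicator {\<tau>..\<tau> + real n} \<sigma> *\<^sub>R heat_lap \<sigma> z) \<longlonglongrightarrow> indicator {\<tau>..} \<sigma> * heat_lap \<sigma> z"
    proof (intro AE_I2 tendsto_eventually)
      fix \<sigma> :: real
      obtain N where N: "\<sigma> - \<tau> < real N" using reals_Archimedean2 by blast
      then have "indicator {\<tau>..\<tau> + real n} \<sigma> *\<^sub>R heat_lap \<sigma> z = indicator {\<tau>..} \<sigma> * heat_lap \<sigma> z" if "n \<ge> N" for n
        using that by (auto simp: indicator_def)
      then show "\<forall>\<^sub>F n in sequentially. indicator {\<tau>..\<tau> + real n} \<sigma> *\<^sub>R heat_lap \<sigma> z = indicator {\<tau>..} \<sigma> * heat_lap \<sigma> z"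
        unfolding eventually_sequentially by (intro exI[of _ N]) simp
    qed
    show "AE \<sigma> in lborel. norm (indicator {\<tau>..\<tau> + real n} \<sigma> *\<^sub>R heat_lap \<sigma> z) \<le> C * (indicator {\<tau>..} \<sigma> * \<sigma> powr - (5/2))" for n
      using C assms by (auto simp: indicator_def abs_mult intro!: AE_I2)
  qed measurable
  have "(\<lambda>n. heat (\<tau> + real n) z - heat \<tau> z) \<longlonglongrightarrow> 0 - heat \<tau> z"
  proof (intro tendsto_diff tendsto_const)
    have lim: "(\<lambda>n. (\<tau> + real n) powr (-3/2)) \<longlonglongrightarrow> 0"
      by (rule tendsto_neg_powr) (auto intro: filterlim_tendsto_add_at_top filterlim_real_sequentially)
    show "(\<lambda>n. heat (\<tau> + real n) z) \<longlonglongrightarrow> 0"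
      by (rule tendsto_sandwich[OF _ _ tendsto_const lim])
         (use assms heat_le_sup[of "\<tau> + real _" z] in \<open>auto simp: heat_nonneg add_pos_nonneg intro!: always_eventually\<close>)
  qed
  with l1 show "(LINT \<sigma>|lborel. indicator {\<tau>..} \<sigma> * heat_lap \<sigma> z) = - heat \<tau> z"
    unfolding fin using LIMSEQ_unique by fastforce
qed

lemma heat_lap_tail_shift:
  assumes "\<nu> * s < \<sigma>1"
  shows "(LINT \<sigma>|lborel. indicator {\<sigma>1..} \<sigma> * heat_lap (\<sigma> - \<nu> * s) z) = - heat (\<sigma>1 - \<nu> * s) z"
proof -
  have "(LINT \<sigma>|lborel. indicator {\<sigma>1..} \<sigma> * heat_lap (\<sigma> - \<nu> * s) z)
     = (LINT \<sigma>|lborel. indicator {\<sigma>1..} (\<nu> * s + 1 * \<sigma>) * heat_lap ((\<nu> * s + 1 * \<sigma>) - \<nu> * s) z)"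
    using lborel_integral_real_affine[of 1 "\<lambda>\<sigma>. indicator {\<sigma>1..} \<sigma> * heat_lap (\<sigma> - \<nu> * s) z" "\<nu> * s"] by simp
  also have "\<dots> = (LINT \<sigma>|lborel. indicator {\<sigma>1 - \<nu> * s..} \<sigma> * heat_lap \<sigma> z)"
    by (intro Bochner_Integration.integral_cong) (auto simp: indicator_def)
  also have "\<dots> = - heat (\<sigma>1 - \<nu> * s) z" by (rule heat_lap_tail(2)) (use assms in simp)
  finally show ?thesis .
qed

subsection \<open>The representation formula for one heat kernel\<close>

text \<open>The component \<open>j\<close> of the curl curl of \<open>e_i\<close> times the
  \<open>l\<close>-th derivative of the heat kernel. Its integral over all diffusion parameters from
  \<open>\<tau>\<close> on is the \<open>l\<close>-th derivative of the Oseen kernel, that is, of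
  the heat kernel composed with the Leray projection.\<close>

definition oseen3 :: "3 \<Rightarrow> 3 \<Rightarrow> 3 \<Rightarrow> real \<Rightarrow> real^3 \<Rightarrow> real" where
  "oseen3 i l j \<tau> z = heat3 l i j \<tau> z - kron i j * (\<Sum>k\<in>UNIV. heat3 l k k \<tau> z)"

lemma oseen3_bound:
  obtains C where "C > 0" "\<And>i l j \<tau> z. \<tau> > 0 \<Longrightarrow> \<bar>oseen3 i l j \<tau> z\<bar> \<le> C * (\<tau> powr (-3/2) * heat (2 * \<tau>) z)"
proof -
  obtain C where C: "C > 0" "\<And>\<sigma> z j k l. \<sigma> > 0 \<Longrightarrow> \<bar>heat3 j k l \<sigma> z\<bar> \<le> C * (\<sigma> powr (-3/2) * heat (2 * \<sigma>) z)"
    using heat_derivs_le_double by metis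
  have "\<bar>oseen3 i l j \<tau> z\<bar> \<le> (4 * C) * (\<tau> powr (-3/2) * heat (2 * \<tau>) z)" if "\<tau> > 0" for i l j \<tau> z
  proof -
    let ?b = "C * (\<tau> powr (-3/2) * heat (2 * \<tau>) z)"
    have "\<bar>\<Sum>k\<in>UNIV. heat3 l k k \<tau> z\<bar> \<le> 3 * ?b"
      using C(2)[OF that, of l 1 1 z] C(2)[OF that, of l 2 2 z] C(2)[OF that, of l 3 3 z] by (simp add: sum_3)
    then have "\<bar>kron i j * (\<Sum>k\<in>UNIV. heat3 l k k \<tau> z)\<bar> \<le> 1 * (3 * ?b)"
      unfolding abs_mult by (intro mult_mono kron_abs) auto
    then show ?thesis using C(2)[OF that, of l i j z] unfolding oseen3_def by linarith
  qed
  then show ?thesis using that[of "4 * C"] C(1) by simp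
qed

context ns_data
begin

definition nonlin :: "3 \<Rightarrow> real \<Rightarrow> real \<times> (real^3) \<Rightarrow> real^3 \<Rightarrow> real" where
  "nonlin i \<tau> p z = (\<Sum>l\<in>UNIV. \<Sum>j\<in>UNIV. V p $ l * V p $ j * oseen3 i l j \<tau> z)"

text \<open>The gradient part of the curl curl is orthogonal to divergence-free fields, both at time
  \<open>s\<close> and at time 0. What remains of the linear terms is the Laplacian of the kernel,
  weighted by the derivative of the time cutoff.\<close>

lemma representation_one_kernel:
  fixes x :: "real^3"
  assumes bh: "backward_heat \<nu> \<sigma> b c \<theta>" and "b < T"
  shows "integrable lborel (\<lambda>p. dir_deriv 1 \<theta> (fst p) * V p $ i * heat_lap (\<sigma> - \<nu> * fst p) (snd p - x))"
    and "(LINT p|lborel. \<theta> (fst p) * nonlin i (\<sigma> - \<nu> * fst p) p (snd p - x)) =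
      (LINT p|lborel. dir_deriv 1 \<theta> (fst p) * V p $ i * heat_lap (\<sigma> - \<nu> * fst p) (snd p - x))
      + \<theta> 0 * (LINT y|lborel. u0 y $ i * heat_lap \<sigma> (y - x))"
proof -
  interpret B: backward_heat \<nu> \<sigma> b c x \<theta> by (rule bh)
  interpret Q: backward_heat \<nu> \<sigma> b c x "dir_deriv 1 \<theta>" by (rule B.heat_deriv_theta)
  have dxP: "dx k (dx j B.P) = (\<lambda>p. \<theta> (fst p) * heat2 j k (\<sigma> - \<nu> * fst p) (snd p - x))" for j k
    unfolding dx_def by (rule B.P_2)
  have dxQ: "dx k (dx j Q.P) = (\<lambda>p. dir_deriv 1 \<theta> (fst p) * heat2 j k (\<sigma> - \<nu> * fst p) (snd p - x))" for j k
    unfolding dx_def by (rule Q.P_2)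
  have lapP: "(\<Sum>k\<in>UNIV. dx k (dx k B.P) p) = \<theta> (fst p) * heat_lap (\<sigma> - \<nu> * fst p) (snd p - x)" for p
    unfolding dxP by (simp add: sum_distrib_left[symmetric] heat2_trace)
  have lapQ: "(\<Sum>k\<in>UNIV. dx k (dx k Q.P) p) = dir_deriv 1 \<theta> (fst p) * heat_lap (\<sigma> - \<nu> * fst p) (snd p - x)" for p
    unfolding dxQ by (simp add: sum_distrib_left[symmetric] heat2_trace)
  have kron_sum: "(\<Sum>j\<in>UNIV. f j * (kron i j * a)) = f i * a" for f a
    by (simp add: kron_def if_distrib[of "\<lambda>c. c * _"] if_distrib[of "\<lambda>c. _ * c"] cong: if_cong)
  have V_ccl: "v \<bullet> curlcurl i G p = (\<Sum>j\<in>UNIV. v $ j * dx j (dx i G) p) - v $ i * (\<Sum>k\<in>UNIV. dx k (dx k G) p)" for v G p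
    by (simp add: inner_vec_def curlcurl_nth right_diff_distrib sum_subtractf kron_sum)
  \<comment> \<open>The kernel solves the backward heat equation, so only the derivative of the time
    cutoff survives. The result is the same construction with \<open>dir_deriv 1 \<theta>\<close> in
    place of \<open>\<theta>\<close>, hence the second interpretation \<open>Q\<close>.\<close>
  have heat_eq: "Q.P = (\<lambda>p. dt B.P p + \<nu> * (\<Sum>k\<in>UNIV. dx k (dx k B.P) p))"
    by (rule ext) (simp add: lapP dt_def B.P_t Q.P_def)
  define A1 where "A1 p = (\<Sum>j\<in>UNIV. V p $ j * dx j (dx i Q.P) p)" for p
  define A2 where "A2 p = dir_deriv 1 \<theta> (fst p) * V p $ i * heat_lap (\<sigma> - \<nu> * fst p) (snd p - x)" for p
  define A3 where "A3 p = \<theta> (fst p) * nonlin i (\<sigma> - \<nu> * fst p) p (snd p - x)" for p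
  have smP: "smooth (dt B.P)" "smooth (dx k (dx l B.P))" for k l
    unfolding dt_def dx_def by (intro smooth_dir_deriv B.smooth_P)+
  \<comment> \<open>\<open>A1\<close> is the gradient part, \<open>A2\<close> the Laplacian part and
    \<open>A3\<close> the convection term.\<close>
  have J: "J i B.P p = A1 p - A2 p + A3 p" for p
  proof -
    have "V p \<bullet> curlcurl i (dt B.P) p + \<nu> * (V p \<bullet> (\<Sum>j\<in>UNIV. curlcurl i (dx j (dx j B.P)) p)) = V p \<bullet> curlcurl i Q.P p"
      unfolding heat_eq curlcurl_linear[OF smP] by (simp add: inner_add_right)
    also have "\<dots> = A1 p - A2 p"
      unfolding V_ccl A1_def A2_def lapQ by (simp add: mult_ac)
    finally have 1: "V p \<bullet> curlcurl i (dt B.P) p + \<nu> * (V p \<bullet> (\<Sum>j\<in>UNIV. curlcurl i (dx j (dx j B.P)) p)) = A1 p - A2 p" .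
    have d3: "dx j (dx k (dx l B.P)) p = \<theta> (fst p) * heat3 l k j (\<sigma> - \<nu> * fst p) (snd p - x)" for j k l
      using B.P_3[of j k l] by (simp add: dx_def)
    have "V p \<bullet> (\<Sum>l\<in>UNIV. (V p $ l) *\<^sub>R curlcurl i (dx l B.P) p)
       = (\<Sum>l\<in>UNIV. V p $ l * (\<Sum>j\<in>UNIV. V p $ j * (\<theta> (fst p) * oseen3 i l j (\<sigma> - \<nu> * fst p) (snd p - x))))"
      unfolding inner_sum_right inner_scaleR_right
      by (intro sum.cong refl arg_cong2[where f="(*)"])
         (simp add: inner_vec_def curlcurl_nth d3 oseen3_def sum_distrib_left[symmetric] right_diff_distrib mult_ac)
    also have "\<dots> = A3 p" unfolding A3_def nonlin_def by (simp add: sum_distrib_left mult_ac)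
    finally show ?thesis using 1 by (simp add: J_def)
  qed
  have "\<exists>C\<ge>0. \<forall>p. \<bar>dx l (dx k Q.P) p\<bar> \<le> C * B.w 4 p" for l k
    by (rule second_deriv_bound) (rule Q.P_Ckw)
  then obtain CQ where CQ: "\<And>l k. CQ l k \<ge> 0" "\<And>l k p. \<bar>dx l (dx k Q.P) p\<bar> \<le> CQ l k * B.w 4 p" by metis
  have "\<exists>C\<ge>0. \<forall>p. \<bar>dx l (dx k B.P) p\<bar> \<le> C * B.w 4 p" for l k
    by (rule second_deriv_bound) (rule B.P_Ckw)
  then obtain CP where CP: "\<And>l k. CP l k \<ge> 0" "\<And>l k p. \<bar>dx l (dx k B.P) p\<bar> \<le> CP l k * B.w 4 p" by metis
  have Vc: "\<bar>V p $ j\<bar> \<le> M" for p j using component_le_norm_cart[of "V p" j] V_bound[of p] by linarith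
  have mQ[measurable]: "dx l (dx k Q.P) \<in> borel_measurable borel" for l k
    unfolding dx_def by (intro borel_measurable_continuous_onI smooth_continuous_on smooth_dir_deriv Q.smooth_P)
  have mB[measurable]: "dx l (dx k B.P) \<in> borel_measurable borel" for l k
    unfolding dx_def by (intro borel_measurable_continuous_onI smooth_continuous_on smooth_dir_deriv B.smooth_P)
  have intVQ: "integrable lborel (\<lambda>p. V p $ m * dx l (dx k Q.P) p)" for m l k
  proof (rule Bochner_Integration.integrable_bound)
    show "integrable lborel (\<lambda>p. (M * CQ l k) * B.w 4 p)" using B.w_integrable by simp
    have "\<bar>V p $ m * dx l (dx k Q.P) p\<bar> \<le> M * (CQ l k * B.w 4 p)" for p
      unfolding abs_mult by (intro mult_mono Vc CQ M_nonneg) auto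
    then show "AE p in lborel. norm (V p $ m * dx l (dx k Q.P) p) \<le> norm ((M * CQ l k) * B.w 4 p)"
      using M_nonneg CQ(1) B.w_nonneg by (auto simp: abs_mult mult_ac)
  qed measurable
  have A1_int: "integrable lborel A1" unfolding A1_def[abs_def] by (intro Bochner_Integration.integrable_sum intVQ)
  have A2_eq: "A2 p = (\<Sum>k\<in>UNIV. V p $ i * dx k (dx k Q.P) p)" for p
    unfolding A2_def sum_distrib_left[symmetric] lapQ by simp
  have A2_int: "integrable lborel A2" unfolding A2_eq[abs_def] by (intro Bochner_Integration.integrable_sum intVQ)
  have slice: "(\<Sum>j\<in>UNIV. v $ j * dx j (dx i P) (s, y)) = dir_deriv v (\<lambda>y. dx i P (s, y)) y"
    if "smooth P" for P :: "real \<times> (real^3) \<Rightarrow> real" and s y v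
  proof -
    have d: "dx i P differentiable (at q)" for q by (rule smooth_differentiable[OF smooth_dx[OF that]])
    show ?thesis
      by (subst dir_deriv_coords[OF slice_has_derivative(2)[OF d]])
         (simp add: slice_has_derivative(1)[OF d], simp add: dx_def)
  qed
  have g_int: "integrable lborel (\<lambda>y. norm (f y) * B.w 4 (s, y))"
    if "f \<in> borel_measurable borel" "\<And>y. norm (f y) \<le> M" for f :: "real^3 \<Rightarrow> real^3" and s
  proof (rule Bochner_Integration.integrable_bound)
    note [measurable] = that(1)
    show "integrable lborel (\<lambda>y::real^3. M * (1 / (1 + norm y) ^ 4))" by (rule integrable_mult_right[OF wt_integrable])
    show "(\<lambda>y. norm (f y) * B.w 4 (s, y)) \<in> borel_measurable lborel" unfolding B.w_def by measurable
    have "\<bar>norm (f y) * B.w 4 (s, y)\<bar> \<le> M * (1 / (1 + norm y) ^ 4)" for y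
      unfolding abs_mult using that(2)[of y] M_nonneg by (intro mult_mono) (auto simp: B.w_def indicator_def)
    then show "AE y in lborel. norm (norm (f y) * B.w 4 (s, y)) \<le> norm (M * (1 / (1 + norm y) ^ 4))"
      using M_nonneg by (auto intro!: AE_I2 order_trans[OF _ abs_ge_self])
  qed
  \<comment> \<open>At almost every time this is the pairing of the velocity with the spatial
    gradient of \<open>dx i Q.P\<close>, which vanishes since the velocity is divergence
    free.\<close>
  have "(LINT p|lborel. A1 p) = 0"
  proof -
    have i: "integrable (lborel \<Otimes>\<^sub>M lborel) A1" using A1_int by (simp add: lborel_prod)
    have "(LINT p|lborel. A1 p) = (LINT p|(lborel \<Otimes>\<^sub>M lborel). A1 p)" by (simp add: lborel_prod)
    also have "\<dots> = (LINT s|lborel. LINT y|lborel. A1 (s, y))" by (rule lborel_pair.integral_fst'[OF i, symmetric])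
    also have "\<dots> = (LINT s::real|lborel. 0)"
    proof (rule Bochner_Integration.integral_cong_AE)
      show "AE s in lborel. (LINT y|lborel. A1 (s, y)) = 0"
        using V_div
      proof eventually_elim
        case (elim s)
        have "(LINT y|lborel. dir_deriv (V (s, y)) (\<lambda>y. dx i Q.P (s, y)) y) = 0"
        proof (rule divergence_free_rapid[where f="\<lambda>y. V (s, y)" and g="\<lambda>y. B.w 4 (s, y)"])
          show "Ckw k UNIV (\<lambda>y. B.w 4 (s, y)) (\<lambda>_::unit. \<lambda>y. dx i Q.P (s, y))" for k
            by (rule Ckw_slice) (unfold dx_def, rule Ckw_dir_deriv_single, rule Q.P_Ckw)
          show "integrable lborel (\<lambda>y. norm (V (s, y)) * B.w 4 (s, y))" by (rule g_int) (use V_bound in auto)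
        qed (use elim in auto)
        then show ?case unfolding A1_def slice[OF Q.smooth_P] .
      qed
      show "(\<lambda>s. LINT y|lborel. A1 (s, y)) \<in> borel_measurable lborel"
        using lborel_pair.integrable_fst'[OF i] by auto
    qed auto
    finally show ?thesis by simp
  qed
  moreover have "(LINT y|lborel. u0 y \<bullet> curlcurl i B.P (0, y)) = - (\<theta> 0 * (LINT y|lborel. u0 y $ i * heat_lap \<sigma> (y - x)))"
  proof -
    have b0: "B.w 4 (0, y) \<le> 1" for y by (rule B.w_le_1)
    have intu: "integrable lborel (\<lambda>y. u0 y $ m * dx l (dx k B.P) (0, y))" for m l k
    proof (rule Bochner_Integration.integrable_bound)
      show "integrable lborel (\<lambda>y. CP l k * norm (u0 y))" using u0_int by simp
      have "\<bar>u0 y $ m * dx l (dx k B.P) (0, y)\<bar> \<le> norm (u0 y) * (CP l k * 1)" for y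
        unfolding abs_mult
        by (intro mult_mono component_le_norm_cart order_trans[OF CP(2)] mult_left_mono[OF b0] CP(1)) auto
      then show "AE y in lborel. norm (u0 y $ m * dx l (dx k B.P) (0, y)) \<le> norm (CP l k * norm (u0 y))"
        using CP(1) by (auto simp: abs_mult mult_ac)
    qed measurable
    have e: "u0 y \<bullet> curlcurl i B.P (0, y) = (\<Sum>j\<in>UNIV. u0 y $ j * dx j (dx i B.P) (0, y)) - (\<Sum>k\<in>UNIV. u0 y $ i * dx k (dx k B.P) (0, y))" for y
      by (simp add: V_ccl sum_distrib_left)
    have "(LINT y|lborel. u0 y \<bullet> curlcurl i B.P (0, y)) =
      (LINT y|lborel. (\<Sum>j\<in>UNIV. u0 y $ j * dx j (dx i B.P) (0, y))) - (LINT y|lborel. (\<Sum>k\<in>UNIV. u0 y $ i * dx k (dx k B.P) (0, y)))"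
      unfolding e by (intro Bochner_Integration.integral_diff Bochner_Integration.integrable_sum intu)
    also have "(LINT y|lborel. (\<Sum>j\<in>UNIV. u0 y $ j * dx j (dx i B.P) (0, y))) = 0"
      unfolding slice[OF B.smooth_P]
    proof (rule divergence_free_rapid[where g="\<lambda>y. B.w 4 (0, y)"])
      show "Ckw k UNIV (\<lambda>y. B.w 4 (0, y)) (\<lambda>_::unit. \<lambda>y. dx i B.P (0, y))" for k
        by (rule Ckw_slice) (unfold dx_def, rule Ckw_dir_deriv_single, rule B.P_Ckw)
      show "integrable lborel (\<lambda>y. norm (u0 y) * B.w 4 (0, y))"
      proof (rule Bochner_Integration.integrable_bound[OF u0_int])
        show "(\<lambda>y. norm (u0 y) * B.w 4 (0, y)) \<in> borel_measurable lborel" unfolding B.w_def by measurable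
        show "AE y in lborel. norm (norm (u0 y) * B.w 4 (0, y)) \<le> norm (u0 y)"
          using mult_left_mono[OF b0 norm_ge_zero] B.w_nonneg by (auto simp: abs_mult)
      qed
    qed (use u0_div in auto)
    also have "(LINT y|lborel. (\<Sum>k\<in>UNIV. u0 y $ i * dx k (dx k B.P) (0, y))) = (LINT y|lborel. \<theta> 0 * (u0 y $ i * heat_lap \<sigma> (y - x)))"
      unfolding sum_distrib_left[symmetric] lapP by (simp add: mult_ac)
    finally show ?thesis by simp
  qed
  moreover have J_int: "integrable lborel (J i B.P)" and J0: "(LINT p|lborel. J i B.P p) + (LINT y|lborel. u0 y \<bullet> curlcurl i B.P (0, y)) = 0"
    using weak_form_rapid[OF bh \<open>b < T\<close>] by blast+
  moreover have "A3 = (\<lambda>p. J i B.P p - A1 p + A2 p)" using J by auto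
  ultimately have "(LINT p|lborel. A3 p) = (LINT p|lborel. A2 p) + \<theta> 0 * (LINT y|lborel. u0 y $ i * heat_lap \<sigma> (y - x))"
    using A1_int A2_int by simp
  then show "(LINT p|lborel. \<theta> (fst p) * nonlin i (\<sigma> - \<nu> * fst p) p (snd p - x)) =
      (LINT p|lborel. dir_deriv 1 \<theta> (fst p) * V p $ i * heat_lap (\<sigma> - \<nu> * fst p) (snd p - x))
      + \<theta> 0 * (LINT y|lborel. u0 y $ i * heat_lap \<sigma> (y - x))"
    by (simp add: A3_def A2_def)
  show "integrable lborel (\<lambda>p. dir_deriv 1 \<theta> (fst p) * V p $ i * heat_lap (\<sigma> - \<nu> * fst p) (snd p - x))"
    using A2_int by (simp add: A2_def[abs_def])
qed

end

text \<open>If \<open>f\<close> is not integrable, its Bochner integral is 0 by convention and the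
  bound is trivial.\<close>

lemma norm_integral_le_nn_integral:
  fixes f :: "'a \<Rightarrow> 'b::{banach, second_countable_topology}"
  shows "ennreal (norm (integral\<^sup>L M f)) \<le> (\<integral>\<^sup>+x. ennreal (norm (f x)) \<partial>M)"
  by (cases "integrable M f") (auto simp: integral_norm_bound_ennreal not_integrable_integral_eq)

lemma nn_integral_lborel_pair:
  fixes f :: "'a::euclidean_space \<times> 'b::euclidean_space \<Rightarrow> ennreal"
  assumes [measurable]: "f \<in> borel_measurable borel"
  shows "(\<integral>\<^sup>+p. f p \<partial>lborel) = (\<integral>\<^sup>+s. \<integral>\<^sup>+y. f (s, y) \<partial>lborel \<partial>lborel)"
proof -
  have "f \<in> borel_measurable (lborel \<Otimes>\<^sub>M lborel)" by (simp add: lborel_prod)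
  from lborel.nn_integral_fst[OF this] show ?thesis by (simp add: lborel_prod)
qed

lemma nn_integral_lborel_swap:
  fixes f :: "'a::euclidean_space \<Rightarrow> 'b::euclidean_space \<Rightarrow> ennreal"
  assumes "(\<lambda>p. f (fst p) (snd p)) \<in> borel_measurable borel"
  shows "(\<integral>\<^sup>+s. \<integral>\<^sup>+y. f s y \<partial>lborel \<partial>lborel) = (\<integral>\<^sup>+y. \<integral>\<^sup>+s. f s y \<partial>lborel \<partial>lborel)"
proof -
  have "case_prod f \<in> borel_measurable (lborel \<Otimes>\<^sub>M lborel)" using assms by (simp add: lborel_prod case_prod_beta')
  from lborel_pair.Fubini'[OF this] show ?thesis by simp
qed

lemma slice_measurable:
  fixes f :: "'a::second_countable_topology \<times> 'b::second_countable_topology \<Rightarrow> 'c::topological_space"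
  assumes [measurable]: "f \<in> borel_measurable borel"
  shows "(\<lambda>y. f (s, y)) \<in> borel_measurable borel"
  by measurable

context backward_heat
begin

lemma theta_deriv_bound: obtains D where "D \<ge> 0" "\<And>s. \<bar>dir_deriv 1 \<theta> s\<bar> \<le> D"
proof -
  interpret Q: backward_heat \<nu> \<sigma> b c x "dir_deriv 1 \<theta>" by (rule heat_deriv_theta)
  have "wbd UNIV (\<lambda>_. 1) (\<lambda>_::unit. \<lambda>p::real \<times> (real^3). dir_deriv 1 \<theta> (fst p))"
    by (rule Ckb_bound[OF Q.theta_Ckw])
  then obtain D where "D \<ge> 0" "\<And>p::real \<times> (real^3). \<bar>dir_deriv 1 \<theta> (fst p)\<bar> \<le> D * 1"
    unfolding wbd_def by auto
  then show ?thesis using that[of D] by (metis fst_conv mult.right_neutral)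
qed

lemma theta_deriv_zero: "s < -2 \<or> b < s \<Longrightarrow> dir_deriv 1 \<theta> s = 0"
proof -
  interpret Q: backward_heat \<nu> \<sigma> b c x "dir_deriv 1 \<theta>" by (rule heat_deriv_theta)
  show "s < -2 \<or> b < s \<Longrightarrow> dir_deriv 1 \<theta> s = 0" by (rule Q.theta_zero)
qed

lemma theta_deriv_measurable: "dir_deriv 1 \<theta> \<in> borel_measurable borel"
  by (intro borel_measurable_continuous_onI smooth_continuous_on smooth_dir_deriv smooth_theta)

end

text \<open>Young's inequality with the weight \<open>\<tau> powr (3/4)\<close> makes the bound on the right integrable both in
  space, for square integrable fields, and in \<open>\<tau>\<close> at infinity.\<close>

lemma velocity_heat_lap_le:
  fixes v :: real
  assumes "\<tau> > 0" "v \<ge> 0"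
  shows "v * (\<tau> powr (-1) * heat (2 * \<tau>) z) \<le> \<tau> powr (-7/4) * (heat (2 * \<tau>) z + v\<^sup>2)"
proof -
  define k where "k = \<tau> powr (3/4) * v"
  have k: "k \<ge> 0" using assms by (simp add: k_def)
  have e: "\<tau> powr (-1) = \<tau> powr (-7/4) * \<tau> powr (3/4)" by (subst powr_add[symmetric]) simp
  have h: "heat (2 * \<tau>) z * \<tau> powr (3/2) \<le> 1"
  proof -
    have "heat (2 * \<tau>) z \<le> (2 * \<tau>) powr (-3/2)" using assms by (intro heat_le_sup) simp
    also have "\<dots> \<le> \<tau> powr (-3/2)" using assms by (intro powr_mono2') auto
    finally have "heat (2 * \<tau>) z * \<tau> powr (3/2) \<le> \<tau> powr (-3/2) * \<tau> powr (3/2)" by (intro mult_right_mono) auto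
    also have "\<dots> = 1" using assms by (subst powr_add[symmetric]) simp
    finally show ?thesis .
  qed
  have k2: "k\<^sup>2 = \<tau> powr (3/2) * v\<^sup>2"
    by (simp add: k_def power_mult_distrib power2_eq_square powr_add[symmetric])
  have "heat (2 * \<tau>) z * k \<le> heat (2 * \<tau>) z * (1 + k\<^sup>2)"
  proof (intro mult_left_mono heat_nonneg)
    have "0 \<le> (k - 1/2)\<^sup>2" by simp
    then show "k \<le> 1 + k\<^sup>2" by (simp add: power2_eq_square algebra_simps)
  qed
  also have "\<dots> = heat (2 * \<tau>) z + (heat (2 * \<tau>) z * \<tau> powr (3/2)) * v\<^sup>2" by (simp add: k2 algebra_simps)
  also have "\<dots> \<le> heat (2 * \<tau>) z + 1 * v\<^sup>2" by (intro add_left_mono mult_right_mono h) auto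
  finally have "\<tau> powr (-7/4) * (heat (2 * \<tau>) z * k) \<le> \<tau> powr (-7/4) * (heat (2 * \<tau>) z + v\<^sup>2)"
    by (intro mult_left_mono) auto
  then show ?thesis unfolding e k_def by (simp add: mult_ac)
qed

context ns_data
begin

lemma V_nth_le: "\<bar>V p $ j\<bar> \<le> norm (V p)"
  by (rule component_le_norm_cart)

text \<open>The hypothesis of Fubini for exchanging the diffusion parameter with space-time.
  Boundedness of the velocity alone would leave a power -1 of the parameter, which is not integrable
  at infinity; the energy bound improves it to -7/4.\<close>

lemma heat_lap_triple_integrable:
  fixes x :: "real^3"
  assumes bh: "backward_heat \<nu> \<sigma>1 b c \<theta>"
  shows "integrable (lborel \<Otimes>\<^sub>M lborel)
    (\<lambda>(\<sigma>, p). indicator {\<sigma>1..} \<sigma> * (dir_deriv 1 \<theta> (fst p) * V p $ i * heat_lap (\<sigma> - \<nu> * fst p) (snd p - x)))"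
    (is "integrable _ ?F")
proof (rule integrableI_bounded)
  interpret B: backward_heat \<nu> \<sigma>1 b c x \<theta> by (rule bh)
  note [measurable] = B.theta_deriv_measurable
  obtain C where C: "C > 0" "\<And>\<sigma> z. \<sigma> > 0 \<Longrightarrow> \<bar>heat_lap \<sigma> z\<bar> \<le> C * (\<sigma> powr (-1) * heat (2 * \<sigma>) z)"
    using heat_derivs_le_double by metis
  obtain D where D: "D \<ge> 0" "\<And>s. \<bar>dir_deriv 1 \<theta> s\<bar> \<le> D" using B.theta_deriv_bound by blast
  have \<sigma>1: "\<sigma>1 - \<nu> * b > 0"
    using B.c mult_strict_left_mono[OF B.bc B.\<nu>] by linarith
  have meas: "?F \<in> borel_measurable borel" unfolding case_prod_beta' by measurable
  then show "?F \<in> borel_measurable (lborel \<Otimes>\<^sub>M lborel)" by (simp add: lborel_prod)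
  \<comment> \<open>Replacing \<open>\<sigma> - \<nu> * s\<close> by the smaller
    \<open>\<sigma> - \<nu> * b\<close> in the negative power removes \<open>s\<close> from it, so
    the bound on the space integral factors into a function of \<open>\<sigma>\<close> and one of
    \<open>s\<close>.\<close>
  let ?G = "\<lambda>\<sigma> s y. ennreal (D * C * (\<sigma> - \<nu> * b) powr (-7/4)) * indicator {\<sigma>1..} \<sigma> * indicator {-2..b} s
     * (ennreal (heat (2 * (\<sigma> - \<nu> * s)) (y - x)) + ennreal ((norm (V (s, y)))\<^sup>2))"
  have pw: "ennreal (norm (?F (\<sigma>, (s, y)))) \<le> ?G \<sigma> s y" for \<sigma> s y
  proof (cases "\<sigma>1 \<le> \<sigma> \<and> -2 \<le> s \<and> s \<le> b")
    case True
    then have sb: "\<nu> * s \<le> \<nu> * b" using B.\<nu> by simp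
    have tau: "\<sigma> - \<nu> * s > 0" using True sb \<sigma>1 by linarith
    let ?t = "\<sigma> - \<nu> * s"
    have "\<bar>V (s, y) $ i\<bar> * \<bar>heat_lap ?t (y - x)\<bar> \<le> norm (V (s, y)) * (C * (?t powr (-1) * heat (2 * ?t) (y - x)))"
      by (intro mult_mono V_nth_le C(2)[OF tau]) auto
    also have "\<dots> = C * (norm (V (s, y)) * (?t powr (-1) * heat (2 * ?t) (y - x)))" by simp
    also have "\<dots> \<le> C * (?t powr (-7/4) * (heat (2 * ?t) (y - x) + (norm (V (s, y)))\<^sup>2))"
      using C(1) by (intro mult_left_mono velocity_heat_lap_le tau) auto
    also have "\<dots> \<le> C * ((\<sigma> - \<nu> * b) powr (-7/4) * (heat (2 * ?t) (y - x) + (norm (V (s, y)))\<^sup>2))"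
      using C(1) True sb \<sigma>1 by (intro mult_left_mono mult_right_mono powr_mono2') (auto simp: heat_nonneg)
    finally have le: "\<bar>V (s, y) $ i\<bar> * \<bar>heat_lap ?t (y - x)\<bar> \<le> C * ((\<sigma> - \<nu> * b) powr (-7/4) * (heat (2 * ?t) (y - x) + (norm (V (s, y)))\<^sup>2))" .
    have "norm (?F (\<sigma>, (s, y))) = \<bar>dir_deriv 1 \<theta> s\<bar> * (\<bar>V (s, y) $ i\<bar> * \<bar>heat_lap ?t (y - x)\<bar>)"
      using True by (simp add: abs_mult)
    also have "\<dots> \<le> D * (C * ((\<sigma> - \<nu> * b) powr (-7/4) * (heat (2 * ?t) (y - x) + (norm (V (s, y)))\<^sup>2)))"
      by (intro mult_mono D le) auto
    finally have "ennreal (norm (?F (\<sigma>, (s, y)))) \<le> ennreal ((D * C * (\<sigma> - \<nu> * b) powr (-7/4)) * (heat (2 * ?t) (y - x) + (norm (V (s, y)))\<^sup>2))"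
      by (intro ennreal_leI) (simp add: mult_ac)
    also have "\<dots> = ?G \<sigma> s y"
      using True C(1) D(1) by (simp add: ennreal_mult heat_nonneg ennreal_plus)
    finally show ?thesis .
  next
    case False
    then have "?F (\<sigma>, (s, y)) = 0" using B.theta_deriv_zero[of s] by (auto simp: indicator_def)
    then have "ennreal (norm (?F (\<sigma>, (s, y)))) = 0" by (simp only: norm_zero ennreal_0)
    then show ?thesis by (simp only: zero_le)
  qed
  have inner: "(\<integral>\<^sup>+y. ?G \<sigma> s y \<partial>lborel) \<le> ennreal (D * C * (\<sigma> - \<nu> * b) powr (-7/4)) * indicator {\<sigma>1..} \<sigma> * indicator {-2..b} s * (1 + ennreal E)" for \<sigma> s
  proof (cases "\<sigma>1 \<le> \<sigma> \<and> -2 \<le> s \<and> s \<le> b")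
    case True
    then have "\<nu> * s \<le> \<nu> * b" using B.\<nu> by simp
    then have "\<sigma> - \<nu> * s > 0" using True \<sigma>1 by linarith
    then have "2 * (\<sigma> - \<nu> * s) > 0" by simp
    then have "(\<integral>\<^sup>+y. (ennreal (heat (2 * (\<sigma> - \<nu> * s)) (y - x)) + ennreal ((norm (V (s, y)))\<^sup>2)) \<partial>lborel) \<le> 1 + ennreal E"
      by (subst nn_integral_add) (auto simp: nn_integral_heat_shift intro!: add_mono V_energy)
    then show ?thesis by (subst nn_integral_cmult) (auto intro!: mult_left_mono)
  qed (auto simp: indicator_def)
  have "(\<integral>\<^sup>+q. ennreal (norm (?F q)) \<partial>(lborel \<Otimes>\<^sub>M lborel)) = (\<integral>\<^sup>+\<sigma>. \<integral>\<^sup>+s. \<integral>\<^sup>+y. ennreal (norm (?F (\<sigma>, (s, y)))) \<partial>lborel \<partial>lborel \<partial>lborel)"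
  proof -
    have m: "(\<lambda>q. ennreal (norm (?F q))) \<in> borel_measurable borel" using meas by measurable
    have "(\<integral>\<^sup>+q. ennreal (norm (?F q)) \<partial>(lborel \<Otimes>\<^sub>M lborel)) = (\<integral>\<^sup>+q. ennreal (norm (?F q)) \<partial>lborel)"
      by (simp add: lborel_prod)
    also have "\<dots> = (\<integral>\<^sup>+\<sigma>. \<integral>\<^sup>+p. ennreal (norm (?F (\<sigma>, p))) \<partial>lborel \<partial>lborel)"
      by (rule nn_integral_lborel_pair[OF m])
    also have "\<dots> = (\<integral>\<^sup>+\<sigma>. \<integral>\<^sup>+s. \<integral>\<^sup>+y. ennreal (norm (?F (\<sigma>, (s, y)))) \<partial>lborel \<partial>lborel \<partial>lborel)"
      by (intro nn_integral_cong nn_integral_lborel_pair slice_measurable[OF m])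
    finally show ?thesis .
  qed
  also have "\<dots> \<le> (\<integral>\<^sup>+\<sigma>. \<integral>\<^sup>+s. \<integral>\<^sup>+y. ?G \<sigma> s y \<partial>lborel \<partial>lborel \<partial>lborel)"
    by (intro nn_integral_mono pw)
  also have "\<dots> \<le> (\<integral>\<^sup>+\<sigma>. \<integral>\<^sup>+s. ennreal (D * C * (\<sigma> - \<nu> * b) powr (-7/4)) * indicator {\<sigma>1..} \<sigma> * indicator {-2..b} s * (1 + ennreal E) \<partial>lborel \<partial>lborel)"
    by (intro nn_integral_mono inner)
  also have "\<dots> = (\<integral>\<^sup>+\<sigma>. ennreal (D * C) * (ennreal ((\<sigma> - \<nu> * b) powr (-7/4)) * indicator {\<sigma>1 - \<nu> * b..} (\<sigma> - \<nu> * b)) * (emeasure lborel {-2..b} * (1 + ennreal E)) \<partial>lborel)"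
  proof (rule nn_integral_cong)
    fix \<sigma> :: real
    show "(\<integral>\<^sup>+s. ennreal (D * C * (\<sigma> - \<nu> * b) powr (-7/4)) * indicator {\<sigma>1..} \<sigma> * indicator {-2..b} s * (1 + ennreal E) \<partial>lborel)
      = ennreal (D * C) * (ennreal ((\<sigma> - \<nu> * b) powr (-7/4)) * indicator {\<sigma>1 - \<nu> * b..} (\<sigma> - \<nu> * b)) * (emeasure lborel {-2..b} * (1 + ennreal E))"
      using C(1) D(1) by (cases "\<sigma>1 \<le> \<sigma>") (simp_all add: nn_integral_cmult nn_integral_multc mult.assoc ennreal_mult)
  qed
  also have "\<dots> = ennreal (D * C) * (\<integral>\<^sup>+\<sigma>. ennreal ((\<sigma> - \<nu> * b) powr (-7/4)) * indicator {\<sigma>1 - \<nu> * b..} (\<sigma> - \<nu> * b) \<partial>lborel) * (emeasure lborel {-2..b} * (1 + ennreal E))"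
    by (subst nn_integral_multc, measurable, subst nn_integral_cmult) auto
  also have "(\<integral>\<^sup>+\<sigma>. ennreal ((\<sigma> - \<nu> * b) powr (-7/4)) * indicator {\<sigma>1 - \<nu> * b..} (\<sigma> - \<nu> * b) \<partial>lborel)
      = (\<integral>\<^sup>+\<sigma>. ennreal (\<sigma> powr (-7/4)) * indicator {\<sigma>1 - \<nu> * b..} \<sigma> \<partial>lborel)"
    by (rule nn_integral_translate) measurable
  also have "\<dots> = ennreal ((\<sigma>1 - \<nu> * b) powr (1 - 7/4) / (7/4 - 1))"
    using nn_integral_powr_tail[of "7/4" "\<sigma>1 - \<nu> * b"] \<sigma>1 by simp
  finally have "(\<integral>\<^sup>+q. ennreal (norm (?F q)) \<partial>(lborel \<Otimes>\<^sub>M lborel)) \<le> ennreal (D * C) * ennreal ((\<sigma>1 - \<nu> * b) powr (1 - 7/4) / (7/4 - 1)) * (emeasure lborel {-2..b} * (1 + ennreal E))" .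
  also have "\<dots> < \<infinity>"
    by (cases "-2 \<le> b") (auto simp: ennreal_mult_less_top)
  finally show "(\<integral>\<^sup>+q. ennreal (norm (?F q)) \<partial>(lborel \<Otimes>\<^sub>M lborel)) < \<infinity>" .
qed

lemma heat_lap_u0_integrable:
  fixes x :: "real^3"
  assumes "\<sigma>1 > 0"
  shows "integrable (lborel \<Otimes>\<^sub>M lborel) (\<lambda>(\<sigma>, y). indicator {\<sigma>1..} \<sigma> * (u0 y $ i * heat_lap \<sigma> (y - x)))"
proof -
  obtain C where C: "C > 0" "\<And>\<sigma> z. \<sigma> > 0 \<Longrightarrow> \<bar>heat_lap \<sigma> z\<bar> \<le> C * \<sigma> powr (-5/2)"
    using heat_lap_bound_powr by blast
  have dom: "integrable lborel (\<lambda>q::real \<times> (real^3). (C * (indicator {\<sigma>1..} (fst q) * fst q powr - (5/2))) * norm (u0 (snd q)))"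
    using integrable_powr_tail[of "5/2" \<sigma>1] assms u0_int by (intro integrable_product_lborel) auto
  have "integrable lborel (\<lambda>(\<sigma>, y). indicator {\<sigma>1..} \<sigma> * (u0 y $ i * heat_lap \<sigma> (y - x)))"
  proof (rule Bochner_Integration.integrable_bound[OF dom])
    show "(\<lambda>(\<sigma>, y). indicator {\<sigma>1..} \<sigma> * (u0 y $ i * heat_lap \<sigma> (y - x))) \<in> borel_measurable lborel"
      unfolding case_prod_beta' by measurable
    have "\<bar>indicator {\<sigma>1..} \<sigma> * (u0 y $ i * heat_lap \<sigma> (y - x))\<bar> \<le> (C * (indicator {\<sigma>1..} \<sigma> * \<sigma> powr - (5/2))) * norm (u0 y)" for \<sigma> y
    proof (cases "\<sigma>1 \<le> \<sigma>")
      case True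
      have "\<bar>u0 y $ i\<bar> * \<bar>heat_lap \<sigma> (y - x)\<bar> \<le> norm (u0 y) * (C * \<sigma> powr (-5/2))"
        using C(2)[of \<sigma> "y - x"] True assms by (intro mult_mono component_le_norm_cart) auto
      then show ?thesis using True by (simp add: abs_mult mult_ac)
    qed simp
    then show "AE q in lborel. norm (case q of (\<sigma>, y) \<Rightarrow> indicator {\<sigma>1..} \<sigma> * (u0 y $ i * heat_lap \<sigma> (y - x)))
        \<le> norm ((C * (indicator {\<sigma>1..} (fst q) * fst q powr - (5/2))) * norm (u0 (snd q)))"
      by (auto intro!: AE_I2 order_trans[OF _ abs_ge_self])
  qed
  then show ?thesis by (simp add: lborel_prod)
qed

text \<open>The identity for one kernel, integrated over \<open>\<sigma> \<ge> \<sigma>1\<close>: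
  the linear terms telescope to the heat kernel at \<open>\<sigma>1\<close>. The convection term is
  needed in absolute value only, so an inequality with a nonnegative integral suffices, and its
  integrability need not be settled here.\<close>

lemma integrated_representation:
  fixes x :: "real^3"
  assumes bh: "backward_heat \<nu> \<sigma>1 b c \<theta>" and "b < T" and \<sigma>1: "\<sigma>1 > 0"
  shows "ennreal \<bar>(LINT p|lborel. dir_deriv 1 \<theta> (fst p) * V p $ i * heat (\<sigma>1 - \<nu> * fst p) (snd p - x))
      + \<theta> 0 * (LINT y|lborel. u0 y $ i * heat \<sigma>1 (y - x))\<bar>
    \<le> (\<integral>\<^sup>+\<sigma>. indicator {\<sigma>1..} \<sigma> * (\<integral>\<^sup>+p. ennreal \<bar>\<theta> (fst p) * nonlin i (\<sigma> - \<nu> * fst p) p (snd p - x)\<bar> \<partial>lborel) \<partial>lborel)"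
proof -
  interpret B: backward_heat \<nu> \<sigma>1 b c x \<theta> by (rule bh)
  let ?F = "\<lambda>(\<sigma>, p). indicator {\<sigma>1..} \<sigma> * (dir_deriv 1 \<theta> (fst p) * V p $ i * heat_lap (\<sigma> - \<nu> * fst p) (snd p - x))"
  let ?H = "\<lambda>(\<sigma>, y). indicator {\<sigma>1..} \<sigma> * (u0 y $ i * heat_lap \<sigma> (y - x))"
  note F = heat_lap_triple_integrable[OF bh, of i x] and F0 = heat_lap_u0_integrable[OF \<sigma>1, of i x]
  have 1: "(LINT \<sigma>|lborel. LINT p|lborel. ?F (\<sigma>, p)) = - (LINT p|lborel. dir_deriv 1 \<theta> (fst p) * V p $ i * heat (\<sigma>1 - \<nu> * fst p) (snd p - x))"
  proof -
    have "(LINT \<sigma>|lborel. LINT p|lborel. ?F (\<sigma>, p)) = (LINT p|lborel. LINT \<sigma>|lborel. ?F (\<sigma>, p))"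
      using lborel_pair.Fubini_integral[OF F] by simp
    also have "\<dots> = (LINT p|lborel. - (dir_deriv 1 \<theta> (fst p) * V p $ i * heat (\<sigma>1 - \<nu> * fst p) (snd p - x)))"
    proof (rule Bochner_Integration.integral_cong)
      fix p :: "real \<times> (real^3)"
      have "(LINT \<sigma>|lborel. ?F (\<sigma>, p)) = dir_deriv 1 \<theta> (fst p) * V p $ i * (LINT \<sigma>|lborel. indicator {\<sigma>1..} \<sigma> * heat_lap (\<sigma> - \<nu> * fst p) (snd p - x))"
        by (subst integral_mult_right_zero[symmetric]) (simp add: mult_ac)
      also have "\<dots> = - (dir_deriv 1 \<theta> (fst p) * V p $ i * heat (\<sigma>1 - \<nu> * fst p) (snd p - x))"
      proof (cases "fst p \<le> b")
        case True
        then have "fst p < c" using B.bc by simp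
        then have "\<nu> * fst p < \<sigma>1" using B.c mult_strict_left_mono[OF \<open>fst p < c\<close> B.\<nu>] by linarith
        then show ?thesis by (simp add: heat_lap_tail_shift)
      qed (simp add: B.theta_deriv_zero)
      finally show "(LINT \<sigma>|lborel. ?F (\<sigma>, p)) = - (dir_deriv 1 \<theta> (fst p) * V p $ i * heat (\<sigma>1 - \<nu> * fst p) (snd p - x))" .
    qed simp
    finally show ?thesis by simp
  qed
  have 2: "(LINT \<sigma>|lborel. LINT y|lborel. ?H (\<sigma>, y)) = - (LINT y|lborel. u0 y $ i * heat \<sigma>1 (y - x))"
  proof -
    have "(LINT \<sigma>|lborel. LINT y|lborel. ?H (\<sigma>, y)) = (LINT y|lborel. LINT \<sigma>|lborel. ?H (\<sigma>, y))"
      using lborel_pair.Fubini_integral[OF F0] by simp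
    also have "\<dots> = (LINT y|lborel. - (u0 y $ i * heat \<sigma>1 (y - x)))"
    proof (rule Bochner_Integration.integral_cong)
      fix y :: "real^3"
      have "(LINT \<sigma>|lborel. ?H (\<sigma>, y)) = u0 y $ i * (LINT \<sigma>|lborel. indicator {\<sigma>1..} \<sigma> * heat_lap \<sigma> (y - x))"
        by (subst integral_mult_right_zero[symmetric]) (simp add: mult_ac)
      then show "(LINT \<sigma>|lborel. ?H (\<sigma>, y)) = - (u0 y $ i * heat \<sigma>1 (y - x))" by (simp add: heat_lap_tail(2)[OF \<sigma>1])
    qed simp
    finally show ?thesis by simp
  qed
  have i1: "integrable lborel (\<lambda>\<sigma>. LINT p|lborel. ?F (\<sigma>, p))" using lborel_pair.integrable_fst'[OF F] .
  have i2: "integrable lborel (\<lambda>\<sigma>. LINT y|lborel. ?H (\<sigma>, y))" using lborel_pair.integrable_fst'[OF F0] .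
  let ?I = "\<lambda>\<sigma>. (LINT p|lborel. ?F (\<sigma>, p)) + \<theta> 0 * (LINT y|lborel. ?H (\<sigma>, y))"
  have "(LINT \<sigma>|lborel. ?I \<sigma>) = - ((LINT p|lborel. dir_deriv 1 \<theta> (fst p) * V p $ i * heat (\<sigma>1 - \<nu> * fst p) (snd p - x))
      + \<theta> 0 * (LINT y|lborel. u0 y $ i * heat \<sigma>1 (y - x)))"
    unfolding Bochner_Integration.integral_add[OF i1 integrable_mult_right[OF i2]] integral_mult_right_zero 1 2
    by simp
  then have "ennreal \<bar>(LINT p|lborel. dir_deriv 1 \<theta> (fst p) * V p $ i * heat (\<sigma>1 - \<nu> * fst p) (snd p - x))
      + \<theta> 0 * (LINT y|lborel. u0 y $ i * heat \<sigma>1 (y - x))\<bar> = ennreal (norm (LINT \<sigma>|lborel. ?I \<sigma>))" by simp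
  also have "\<dots> \<le> (\<integral>\<^sup>+\<sigma>. ennreal (norm (?I \<sigma>)) \<partial>lborel)" by (rule norm_integral_le_nn_integral)
  also have "\<dots> \<le> (\<integral>\<^sup>+\<sigma>. indicator {\<sigma>1..} \<sigma> * (\<integral>\<^sup>+p. ennreal \<bar>\<theta> (fst p) * nonlin i (\<sigma> - \<nu> * fst p) p (snd p - x)\<bar> \<partial>lborel) \<partial>lborel)"
  proof (rule nn_integral_mono)
    fix \<sigma> :: real
    show "ennreal (norm (?I \<sigma>)) \<le> indicator {\<sigma>1..} \<sigma> * (\<integral>\<^sup>+p. ennreal \<bar>\<theta> (fst p) * nonlin i (\<sigma> - \<nu> * fst p) p (snd p - x)\<bar> \<partial>lborel)"
    proof (cases "\<sigma>1 \<le> \<sigma>")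
      case True
      \<comment> \<open>One pair of times \<open>b < c\<close> serves all kernels, since the
        condition \<open>\<nu> * c < \<sigma>\<close> only improves as \<open>\<sigma>\<close>
        grows.\<close>
      have bh': "backward_heat \<nu> \<sigma> b c \<theta>" using bh True unfolding backward_heat_def by auto
      have "?I \<sigma> = (LINT p|lborel. \<theta> (fst p) * nonlin i (\<sigma> - \<nu> * fst p) p (snd p - x))"
        using True representation_one_kernel(2)[OF bh' \<open>b < T\<close>, of i x] by simp
      then show ?thesis using True norm_integral_le_nn_integral[of lborel "\<lambda>p. \<theta> (fst p) * nonlin i (\<sigma> - \<nu> * fst p) p (snd p - x)"]
        by simp
    qed simp
  qed
  finally show ?thesis .
qed

end

subsection \<open>The Duhamel inequality\<close>

text \<open>A majorant, up to a constant, of the differentiated Oseen kernel: the bound for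
  \<open>oseen3\<close>, integrated over the diffusion parameters from \<open>\<tau>\<close>
  on.\<close>

definition kern :: "real \<Rightarrow> real^3 \<Rightarrow> ennreal" where
  "kern \<tau> z = (\<integral>\<^sup>+\<sigma>. indicator {\<tau>..} \<sigma> * ennreal (\<sigma> powr (-3/2) * heat (2 * \<sigma>) z) \<partial>lborel)"

lemma kern_measurable[measurable]:
  assumes [measurable]: "f \<in> borel_measurable M" "g \<in> borel_measurable M"
  shows "(\<lambda>p. kern (f p) (g p)) \<in> borel_measurable M"
proof -
  have i: "indicator {f p..} \<sigma> = (if f p \<le> \<sigma> then 1 else (0::ennreal))" for p \<sigma> by (simp add: indicator_def)
  have "(\<lambda>(p, \<sigma>). indicator {f p..} \<sigma> * ennreal (\<sigma> powr (-3/2) * heat (2 * \<sigma>) (g p))) \<in> borel_measurable (M \<Otimes>\<^sub>M borel)"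
    unfolding case_prod_beta' i by measurable
  also have "borel_measurable (M \<Otimes>\<^sub>M borel) = borel_measurable (M \<Otimes>\<^sub>M lborel)"
    by (intro measurable_cong_sets sets_pair_measure_cong) simp_all
  finally show ?thesis unfolding kern_def
    by (rule lborel.borel_measurable_nn_integral)
qed

text \<open>With \<open>q = (norm z)\<^sup>2 / 8\<close> the integrand is at most
  \<open>exp (- q / \<sigma>) / \<sigma> ^ 3\<close>, which has the elementary antiderivative
  \<open>?F\<close>. Its limit \<open>1 / q\<^sup>2\<close> at infinity is the stated bound,
  uniformly in \<open>\<tau>\<close>.\<close>

lemma kern_decay:
  assumes "\<tau> > 0" "z \<noteq> 0"
  shows "kern \<tau> z \<le> ennreal (64 / norm z ^ 4)"
proof -
  define q where "q = (norm z)\<^sup>2 / 8"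
  have q: "q > 0" using assms by (simp add: q_def)
  let ?f = "\<lambda>\<sigma>. exp (- q / \<sigma>) / \<sigma> ^ 3"
  let ?F = "\<lambda>\<sigma>. (1 + q / \<sigma>) * exp (- q / \<sigma>) / q\<^sup>2"
  have le: "\<sigma> powr (-3/2) * heat (2 * \<sigma>) z \<le> ?f \<sigma>" if "\<tau> \<le> \<sigma>" for \<sigma>
  proof -
    have \<sigma>: "\<sigma> > 0" using that assms by simp
    have pi: "4 * pi * (2 * \<sigma>) \<ge> \<sigma>" using \<sigma> mult_right_mono[of 1 "8 * pi" \<sigma>] pi_ge_two by (simp add: mult_ac)
    have e: "exp (- (norm z)\<^sup>2 / (4 * (2 * \<sigma>))) = exp (- q / \<sigma>)" by (simp add: q_def)
    have "(4 * pi * (2 * \<sigma>)) powr (-3/2) \<le> \<sigma> powr (-3/2)"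
      using \<sigma> pi by (intro powr_mono2') auto
    then have "heat (2 * \<sigma>) z \<le> \<sigma> powr (-3/2) * exp (- q / \<sigma>)"
      unfolding heat_def e by (intro mult_right_mono) simp_all
    then have "\<sigma> powr (-3/2) * heat (2 * \<sigma>) z \<le> \<sigma> powr (-3/2) * (\<sigma> powr (-3/2) * exp (- q / \<sigma>))"
      by (rule mult_left_mono) simp
    also have "\<dots> = (\<sigma> powr (-3/2) * \<sigma> powr (-3/2)) * exp (- q / \<sigma>)" by (rule mult.assoc[symmetric])
    also have "\<sigma> powr (-3/2) * \<sigma> powr (-3/2) = 1 / \<sigma> ^ 3"
    proof -
      have "\<sigma> powr (-3/2) * \<sigma> powr (-3/2) = \<sigma> powr (- real 3)" by (subst powr_add[symmetric]) simp
      also have "\<dots> = 1 / \<sigma> ^ 3" unfolding powr_minus powr_realpow[OF \<sigma>] by (rule inverse_eq_divide)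
      finally show ?thesis .
    qed
    finally show ?thesis by simp
  qed
  have "kern \<tau> z \<le> (\<integral>\<^sup>+\<sigma>. ennreal (?f \<sigma>) * indicator {\<tau>..} \<sigma> \<partial>lborel)"
    unfolding kern_def
  proof (rule nn_integral_mono)
    fix \<sigma> :: real
    show "indicator {\<tau>..} \<sigma> * ennreal (\<sigma> powr (-3/2) * heat (2 * \<sigma>) z) \<le> ennreal (?f \<sigma>) * indicator {\<tau>..} \<sigma>"
      using ennreal_leI[OF le[of \<sigma>]] by (cases "\<tau> \<le> \<sigma>") simp_all
  qed
  also have "\<dots> = ennreal (1 / q\<^sup>2 - ?F \<tau>)"
  proof (rule nn_integral_FTC_atLeast)
    show "(?F has_real_derivative ?f \<sigma>) (at \<sigma>)" if "\<tau> \<le> \<sigma>" for \<sigma>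
    proof -
      have \<sigma>: "\<sigma> > 0" using that assms by simp
      have 1: "((\<lambda>\<sigma>. 1 + q / \<sigma>) has_real_derivative (- q / \<sigma>\<^sup>2)) (at \<sigma>)"
        using \<sigma> by (auto intro!: derivative_eq_intros simp: power2_eq_square)
      have 2: "((\<lambda>\<sigma>. exp (- q / \<sigma>)) has_real_derivative (exp (- q / \<sigma>) * (q / \<sigma>\<^sup>2))) (at \<sigma>)"
        using \<sigma> by (auto intro!: derivative_eq_intros simp: power2_eq_square)
      have "((- q / \<sigma>\<^sup>2) * exp (- q / \<sigma>) + (exp (- q / \<sigma>) * (q / \<sigma>\<^sup>2)) * (1 + q / \<sigma>)) / q\<^sup>2 = ?f \<sigma>"
        using \<sigma> q by (simp add: field_simps power2_eq_square power3_eq_cube)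
      then show ?thesis using DERIV_cdivide[OF DERIV_mult[OF 1 2], of "q\<^sup>2"] by simp
    qed
    have lim: "((\<lambda>\<sigma>::real. q / \<sigma>) \<longlongrightarrow> 0) at_top"
      by (intro tendsto_divide_0[OF tendsto_const] filterlim_at_top_imp_at_infinity filterlim_ident)
    have "((\<lambda>\<sigma>. (1 + q / \<sigma>) * exp (- (q / \<sigma>)) / q\<^sup>2) \<longlongrightarrow> (1 + 0) * exp (- 0) / q\<^sup>2) at_top"
      using q by (intro tendsto_intros lim) auto
    then show "(?F \<longlongrightarrow> 1 / q\<^sup>2) at_top" by simp
    show "0 \<le> ?f \<sigma>" if "\<tau> \<le> \<sigma>" for \<sigma> using that assms by simp
  qed measurable
  also have "\<dots> \<le> ennreal (1 / q\<^sup>2)" using assms q by (intro ennreal_leI) auto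
  also have "1 / q\<^sup>2 = 64 / norm z ^ 4" by (simp add: q_def power2_eq_square field_simps power4_eq_xxxx)
  finally show ?thesis .
qed

lemma nn_integral_kern:
  assumes "\<tau> > 0"
  shows "(\<integral>\<^sup>+y. kern \<tau> (y - x) \<partial>lborel) = ennreal (2 * \<tau> powr (-1/2))"
proof -
  have "(\<integral>\<^sup>+y. kern \<tau> (y - x) \<partial>lborel) = (\<integral>\<^sup>+\<sigma>. \<integral>\<^sup>+y. indicator {\<tau>..} \<sigma> * ennreal (\<sigma> powr (-3/2) * heat (2 * \<sigma>) (y - x)) \<partial>lborel \<partial>lborel)"
    unfolding kern_def by (rule nn_integral_lborel_swap) measurable
  also have "\<dots> = (\<integral>\<^sup>+\<sigma>. ennreal (\<sigma> powr - (3/2)) * indicator {\<tau>..} \<sigma> \<partial>lborel)"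
  proof (rule nn_integral_cong)
    fix \<sigma> :: real
    show "(\<integral>\<^sup>+y. indicator {\<tau>..} \<sigma> * ennreal (\<sigma> powr (-3/2) * heat (2 * \<sigma>) (y - x)) \<partial>lborel) = ennreal (\<sigma> powr - (3/2)) * indicator {\<tau>..} \<sigma>"
    proof (cases "\<tau> \<le> \<sigma>")
      case True
      then have "2 * \<sigma> > 0" using assms by simp
      then show ?thesis using True
        by (simp add: ennreal_mult heat_nonneg nn_integral_cmult nn_integral_heat_shift)
    qed simp
  qed
  also have "\<dots> = ennreal (\<tau> powr (1 - 3/2) / (3/2 - 1))" by (rule nn_integral_powr_tail) (use assms in auto)
  finally show ?thesis by simp
qed

text \<open>With \<open>r = b - s\<close>, split at \<open>r = 1 / l\<close>. Below, dropping the
  decaying exponential leaves \<open>2 / sqrt l\<close>; above, \<open>r powr (-1/2)\<close> is at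
  most \<open>sqrt l\<close>, which leaves \<open>1 / sqrt l\<close>. The gain for large
  \<open>l\<close> is what makes the Duhamel inequality contractive.\<close>

lemma nn_integral_exp_sqrt:
  fixes l b :: real
  assumes l: "l > 0"
  shows "(\<integral>\<^sup>+s. ennreal (exp (l * s) * (b - s) powr (-1/2)) * indicator {..b} s \<partial>lborel) \<le> ennreal (exp (l * b) * (3 / sqrt l))"
proof -
  have "(\<integral>\<^sup>+s. ennreal (exp (l * s) * (b - s) powr (-1/2)) * indicator {..b} s \<partial>lborel)
     = (\<integral>\<^sup>+r. ennreal (exp (l * (b - r)) * r powr (-1/2)) * indicator {0..} r \<partial>lborel)"
    using nn_integral_real_affine[of "\<lambda>s. ennreal (exp (l * s) * (b - s) powr (-1/2)) * indicator {..b} s" "-1" b]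
    by (simp add: indicator_def)
  also have "\<dots> \<le> (\<integral>\<^sup>+r. ennreal (exp (l * b)) * (ennreal (r powr (-1/2)) * indicator {0..1/l} r + ennreal (sqrt l * exp (- l * r)) * indicator {0..} r) \<partial>lborel)"
  proof (rule nn_integral_mono)
    fix r :: real
    show "ennreal (exp (l * (b - r)) * r powr (-1/2)) * indicator {0..} r
       \<le> ennreal (exp (l * b)) * (ennreal (r powr (-1/2)) * indicator {0..1/l} r + ennreal (sqrt l * exp (- l * r)) * indicator {0..} r)"
    proof (cases "0 \<le> r")
      case True
      have e: "exp (l * (b - r)) = exp (l * b) * exp (- l * r)" by (simp add: exp_add[symmetric] algebra_simps)
      have le1: "exp (- l * r) \<le> 1" using True l by simp
      show ?thesis
      proof (cases "r \<le> 1 / l")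
        case r: True
        have "exp (l * (b - r)) * r powr (-1/2) \<le> exp (l * b) * (r powr (-1/2) + sqrt l * exp (- l * r))"
        proof -
          have "exp (- l * r) * r powr (-1/2) \<le> 1 * r powr (-1/2)" by (rule mult_right_mono[OF le1]) simp
          then have "exp (- l * r) * r powr (-1/2) \<le> r powr (-1/2) + sqrt l * exp (- l * r)" using l by (simp add: add_increasing2)
          then show ?thesis unfolding e by (simp add: mult.assoc)
        qed
        then show ?thesis using True r l by (simp add: ennreal_mult[symmetric] ennreal_plus[symmetric] del: ennreal_plus)
      next
        case r: False
        have "r powr (-1/2) \<le> (1 / l) powr (-1/2)" using r l True by (intro powr_mono2') auto
        also have "\<dots> = sqrt l" using l by (simp add: powr_divide powr_minus powr_half_sqrt)
        finally have "exp (- l * r) * r powr (-1/2) \<le> exp (- l * r) * sqrt l" by (intro mult_left_mono) auto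
        then have "exp (l * (b - r)) * r powr (-1/2) \<le> exp (l * b) * (sqrt l * exp (- l * r))"
          unfolding e by (simp add: mult_ac)
        then show ?thesis using True r l by (simp add: ennreal_mult[symmetric])
      qed
    qed simp
  qed
  also have "\<dots> = ennreal (exp (l * b)) * ((\<integral>\<^sup>+r. ennreal (r powr (-1/2)) * indicator {0..1/l} r \<partial>lborel) + (\<integral>\<^sup>+r. ennreal (sqrt l * exp (- l * r)) * indicator {0..} r \<partial>lborel))"
    by (subst nn_integral_cmult, measurable, subst nn_integral_add) auto
  also have "(\<integral>\<^sup>+r. ennreal (r powr (-1/2)) * indicator {0..1/l} r \<partial>lborel) = ennreal ((1/l) powr (-1/2 + 1) / (-1/2 + 1))"
    by (rule nn_integral_has_integral_lebesgue') (use l has_integral_powr_from_0[of "-1/2" "1/l"] in auto)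
  also have "(1/l) powr (-1/2 + 1) / (-1/2 + 1) = 2 / sqrt l" using l by (simp add: powr_half_sqrt real_sqrt_divide)
  also have "(\<integral>\<^sup>+r. ennreal (sqrt l * exp (- l * r)) * indicator {0..} r \<partial>lborel) = ennreal (0 - (- (1 / sqrt l) * exp (- l * 0)))"
  proof (rule nn_integral_FTC_atLeast)
    have sl: "sqrt l * sqrt l = l" using l by simp
    show "((\<lambda>r. - (1 / sqrt l) * exp (- l * r)) has_real_derivative sqrt l * exp (- l * r)) (at r)" for r
    proof -
      have "((\<lambda>r. - (1 / sqrt l) * exp (- l * r)) has_real_derivative - (1 / sqrt l) * (exp (- l * r) * (- l))) (at r)"
        by (rule DERIV_cmult) (auto intro!: derivative_eq_intros)
      moreover have "- (1 / sqrt l) * (exp (- l * r) * (- l)) = sqrt l * exp (- l * r)"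
      proof -
        have "l / sqrt l = sqrt l" using l by (simp add: real_div_sqrt)
        moreover have "- (1 / sqrt l) * (exp (- l * r) * (- l)) = (l / sqrt l) * exp (- l * r)" by simp
        ultimately show ?thesis by simp
      qed
      ultimately show ?thesis by simp
    qed
    have "filterlim (\<lambda>r. - l * r) at_bot at_top"
      using l by (simp add: filterlim_uminus_at_bot filterlim_tendsto_pos_mult_at_top[OF tendsto_const _ filterlim_ident])
    from tendsto_mult[OF tendsto_const filterlim_compose[OF exp_at_bot this], of "- (1 / sqrt l)"]
    show "((\<lambda>r. - (1 / sqrt l) * exp (- l * r)) \<longlongrightarrow> 0) at_top" by simp
  qed (use l in auto)
  also have "ennreal (exp (l * b)) * (ennreal (2 / sqrt l) + ennreal (0 - (- (1 / sqrt l) * exp (- l * 0)))) = ennreal (exp (l * b) * (3 / sqrt l))"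
    using l by (simp add: ennreal_mult[symmetric] ennreal_plus[symmetric] add_divide_distrib[symmetric] del: ennreal_plus)
  finally show ?thesis .
qed

text \<open>The derivative is prescribed first: \<open>\<eta> n\<close> increases in effect to the
  indicator of the window, and \<open>\<theta> n\<close> is its integral over later times, hence at
  most \<open>b - a\<close>. The derivative is controlled for \<open>0 \<le> s\<close> only, which
  is enough because the velocity is zero at negative times.\<close>

lemma time_cutoff:
  fixes a b :: real
  assumes ab: "0 \<le> a" "a < b"
  obtains \<eta> \<theta> :: "nat \<Rightarrow> real \<Rightarrow> real" where
    "\<And>n. smooth (\<theta> n)" "\<And>n s. s < -2 \<or> b < s \<Longrightarrow> \<theta> n s = 0" "\<And>n s. 0 \<le> \<theta> n s" "\<And>n s. \<theta> n s \<le> b - a"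
    "\<And>n s. 0 \<le> s \<Longrightarrow> dir_deriv 1 (\<theta> n) s = - \<eta> n s" "\<And>n s. 0 \<le> \<eta> n s" "\<And>n s. \<eta> n s \<le> indicator {a<..<b} s"
    "\<And>s. (\<lambda>n. \<eta> n s) \<longlonglongrightarrow> indicator {a<..<b} s" "\<And>n. \<eta> n \<in> borel_measurable borel"
proof -
  \<comment> \<open>A smooth step from 0 at \<open>r \<le> 0\<close> to 1 at
    \<open>r \<ge> 1\<close>. Two steeper and steeper copies of it form the window.\<close>
  define z where "z r = 1 - cut (r + 1)" for r
  have z: "z r \<ge> 0" "z r \<le> 1" for r using cut_nonneg cut_le_1 by (auto simp: z_def)
  have z0: "z r = 0" if "r \<le> 0" for r using that by (simp add: z_def cut_1)
  have z1: "z r = 1" if "r \<ge> 1" for r using that by (simp add: z_def cut_0)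
  have sz: "smooth z" unfolding z_def
    by (intro smooth_minus smooth_const smooth_compose[OF smooth_cut] smooth_add smooth_bounded_linear bounded_linear_ident)
  define \<eta> where "\<eta> n s = z (Suc n * (s - a)) * z (Suc n * (b - s))" for n s
  have s\<eta>: "smooth (\<eta> n)" for n unfolding \<eta>_def
    by (intro smooth_mult smooth_compose[OF sz] smooth_minus smooth_const smooth_bounded_linear bounded_linear_ident)
  have \<eta>0: "\<eta> n s = 0" if "s \<le> a \<or> b \<le> s" for n s
    using that z0 by (auto simp: \<eta>_def mult_le_0_iff)
  have \<eta>nn: "\<eta> n s \<ge> 0" "\<eta> n s \<le> 1" for n s using z by (auto simp: \<eta>_def intro: mult_le_one)
  have cont: "continuous_on S (\<eta> n)" for S n by (rule smooth_continuous_on[OF s\<eta>])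
  define F where "F n s = integral {-3..s} (\<eta> n)" for n s
  have F0: "F n s = 0" if "s \<le> a" for n s
  proof -
    have "F n s = integral {-3..s} (\<lambda>_. 0)" unfolding F_def by (rule integral_cong) (use \<eta>0 that in auto)
    then show ?thesis by simp
  qed
  have Fd: "(F n has_real_derivative \<eta> n s) (at s)" for n s
  proof (cases "s < 0")
    case True
    have "(F n has_real_derivative 0) (at s)"
      by (rule has_field_derivative_transform_within_open[of "\<lambda>_. 0" _ _ "{..<0}"])
         (use True F0 ab in auto)
    then show ?thesis using \<eta>0 True ab by simp
  next
    case False
    have "((\<lambda>u. integral {-3..u} (\<eta> n)) has_real_derivative \<eta> n s) (at s within {-3..s+1})"
      by (rule integral_has_real_derivative[OF cont]) (use False in auto)
    then have "((\<lambda>u. integral {-3..u} (\<eta> n)) has_real_derivative \<eta> n s) (at s within {-3<..<s+1})"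
      by (rule has_field_derivative_subset) auto
    then show ?thesis unfolding F_def[abs_def] using False by (subst (asm) at_within_open) auto
  qed
  have Fmono: "F n s \<le> F n t" if "s \<le> t" for n s t
    by (rule DERIV_nonneg_imp_nondecreasing[OF that]) (use Fd \<eta>nn in blast)
  have Fb: "F n s = F n b" if "b \<le> s" for n s
  proof -
    have "F n s \<le> F n b"
    proof (rule DERIV_nonpos_imp_nonincreasing[OF that])
      fix x assume "b \<le> x"
      then show "\<exists>y. (F n has_real_derivative y) (at x) \<and> y \<le> 0" using Fd \<eta>0 by (metis order_refl)
    qed
    then show ?thesis using Fmono[OF that, of n] by simp
  qed
  have Fle: "F n b - F n s \<le> b - a" for n s
  proof -
    have "F n b - F n a \<le> b - a"
    proof -
      have "a - F n a \<le> b - F n b"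
      proof (rule DERIV_nonneg_imp_nondecreasing[where f="\<lambda>s. s - F n s"])
        fix x show "\<exists>y. ((\<lambda>s. s - F n s) has_real_derivative y) (at x) \<and> 0 \<le> y"
          using DERIV_diff[OF DERIV_ident Fd[of n x]] \<eta>nn(2)[of n x] by (intro exI[of _ "1 - \<eta> n x"]) auto
      qed (use ab in auto)
      then show ?thesis by simp
    qed
    moreover have "F n a \<le> F n s" using F0[of a n] F0[of s n] Fmono[of a s n] by (cases "s \<le> a") auto
    ultimately show ?thesis by simp
  qed
  have Fge: "0 \<le> F n b - F n s" for n s
    using Fmono[of s b n] Fb[of s n] by (cases "s \<le> b") auto
  have sF: "smooth (F n)" for n by (rule smooth_antiderivative[OF s\<eta> Fd])
  \<comment> \<open>The integral over later times stays constant towards the past; the factor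
    \<open>cut (- s)\<close> is 1 from time -1 on and ends the support at -2, as
    \<open>backward_heat\<close> demands.\<close>
  define \<theta> where "\<theta> n s = cut (- s) * (F n b - F n s)" for n s
  show ?thesis
  proof (rule that[of \<theta> \<eta>])
    show "smooth (\<theta> n)" for n unfolding \<theta>_def
      using smooth_minus[OF smooth_const[of 0] smooth_bounded_linear[OF bounded_linear_ident]]
      by (intro smooth_mult smooth_compose[OF smooth_cut] smooth_minus smooth_const sF) simp
    show "\<theta> n s = 0" if "s < -2 \<or> b < s" for n s
      using that Fb[of s n] cut_0[of "-s"] by (auto simp: \<theta>_def)
    show "0 \<le> \<theta> n s" for n s unfolding \<theta>_def by (intro mult_nonneg_nonneg cut_nonneg Fge)
    show "\<theta> n s \<le> b - a" for n s
      unfolding \<theta>_def using mult_mono[OF cut_le_1 Fle _ Fge, of "-s" n s] by simp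
    show "dir_deriv 1 (\<theta> n) s = - \<eta> n s" if "0 \<le> s" for n s
    proof -
      have "((\<lambda>s. F n b - F n s) has_real_derivative - \<eta> n s) (at s)"
        using DERIV_diff[OF DERIV_const Fd] by simp
      then have "(\<theta> n has_real_derivative - \<eta> n s) (at s)"
        by (rule has_field_derivative_transform_within_open[of _ _ _ "{-1<..}"])
           (use that in \<open>auto simp: \<theta>_def cut_1\<close>)
      then show ?thesis by (simp add: dir_deriv_real)
    qed
    show "0 \<le> \<eta> n s" for n s by (rule \<eta>nn)
    show "\<eta> n s \<le> indicator {a<..<b} s" for n s using \<eta>nn(2) \<eta>0[of s n] by (auto simp: indicator_def)
    show "(\<lambda>n. \<eta> n s) \<longlonglongrightarrow> indicator {a<..<b} s" for s
    proof (cases "a < s \<and> s < b")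
      case True
      obtain N where N: "1 / (s - a) < real N" "1 / (b - s) < real N"
        using reals_Archimedean2[of "max (1 / (s - a)) (1 / (b - s))"] by auto
      have "\<eta> n s = 1" if "n \<ge> N" for n
      proof -
        have "1 / (s - a) \<le> Suc n" "1 / (b - s) \<le> Suc n" using N that by auto
        then have "Suc n * (s - a) \<ge> 1" "Suc n * (b - s) \<ge> 1" using True by (auto simp: field_simps)
        then show ?thesis unfolding \<eta>_def using z1 by simp
      qed
      then have "\<forall>\<^sub>F n in sequentially. \<eta> n s = indicator {a<..<b} s"
        using True unfolding eventually_sequentially by (intro exI[of _ N]) simp
      then show ?thesis by (rule tendsto_eventually)
    next
      case False
      then show ?thesis using \<eta>0[of s] by (auto simp: not_less)
    qed
    show "\<eta> n \<in> borel_measurable borel" for n by (intro borel_measurable_continuous_onI cont)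
  qed
qed

text \<open>Fixing the constant once allows \<open>duhamel\<close> to be an explicit
  function.\<close>

definition oseen_const :: real where
  "oseen_const = (SOME C. C > 0 \<and> (\<forall>i l j \<tau> z. \<tau> > 0 \<longrightarrow> \<bar>oseen3 i l j \<tau> z\<bar> \<le> C * (\<tau> powr (-3/2) * heat (2 * \<tau>) z)))"

lemma oseen_const: "oseen_const > 0"
  "\<tau> > 0 \<Longrightarrow> \<bar>oseen3 i l j \<tau> z\<bar> \<le> oseen_const * (\<tau> powr (-3/2) * heat (2 * \<tau>) z)"
proof -
  have "\<exists>C. C > 0 \<and> (\<forall>i l j \<tau> z. \<tau> > 0 \<longrightarrow> \<bar>oseen3 i l j \<tau> z\<bar> \<le> C * (\<tau> powr (-3/2) * heat (2 * \<tau>) z))"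
    using oseen3_bound by metis
  from someI_ex[OF this, folded oseen_const_def]
  show "oseen_const > 0" "\<tau> > 0 \<Longrightarrow> \<bar>oseen3 i l j \<tau> z\<bar> \<le> oseen_const * (\<tau> powr (-3/2) * heat (2 * \<tau>) z)"
    by blast+
qed

lemma oseen3_measurable[measurable]:
  assumes [measurable]: "f \<in> borel_measurable M" "g \<in> borel_measurable M"
  shows "(\<lambda>p. oseen3 i l j (f p) (g p)) \<in> borel_measurable M"
  unfolding oseen3_def by measurable

text \<open>The floor \<open>\<delta>\<close> lets a merely bounded field satisfy a bound by a
  multiple of \<open>decay\<close>, namely with the factor \<open>M / \<delta>\<close>. The final
  constants do not depend on \<open>\<delta>\<close>, which then tends to 0.\<close>

definition decay :: "real \<Rightarrow> real \<Rightarrow> real^3 \<Rightarrow> real" where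
  "decay a \<delta> y = (1 + norm y) powr - a + \<delta>"

lemma decay_measurable[measurable]: "decay a \<delta> \<in> borel_measurable borel"
  unfolding decay_def[abs_def] by measurable

text \<open>Halving the argument costs \<open>2 powr a\<close>, and 16 is its value at the largest
  exponent 4.\<close>

lemma half_powr_le:
  fixes r R a :: real
  assumes "R \<ge> 1" "r \<ge> R / 2" "0 \<le> a" "a \<le> 4"
  shows "r powr - a \<le> 16 * R powr - a"
proof -
  have "r powr - a \<le> (R / 2) powr - a" using assms by (intro powr_mono2') auto
  also have "\<dots> = 2 powr a * R powr - a" using assms by (simp add: powr_divide powr_minus field_simps)
  also have "\<dots> \<le> 2 powr 4 * R powr - a" using assms by (intro mult_right_mono powr_mono) auto
  finally show ?thesis by simp
qed

lemma decay_far: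
  assumes "(1 + norm x) / 2 \<le> 1 + norm y" "0 \<le> a" "a \<le> 4" "0 \<le> \<delta>"
  shows "decay a \<delta> y \<le> 16 * decay a \<delta> x"
proof -
  have "(1 + norm y) powr - a \<le> 16 * (1 + norm x) powr - a" using assms by (intro half_powr_le) auto
  then show ?thesis using assms by (simp add: decay_def)
qed

lemma near_norm:
  fixes x y :: "real^3"
  assumes "1 + norm y < (1 + norm x) / 2"
  shows "(1 + norm x) / 2 \<le> norm (y - x)"
proof -
  have "norm x \<le> norm y + norm (y - x)" using norm_triangle_ineq4[of y "y - x"] by simp
  moreover have "norm y < (norm x - 1) / 2" using assms by (simp add: field_simps)
  ultimately show ?thesis by (simp add: field_simps)
qed

lemma near_inverse_power:
  fixes x y :: "real^3"
  assumes "1 + norm y < (1 + norm x) / 2"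
  shows "y - x \<noteq> 0" "1 / norm (y - x) ^ 4 \<le> 16 * (1 + norm x) powr -4"
proof -
  note z = near_norm[OF assms]
  have p: "0 < (1 + norm x) / 2" "0 < 1 + norm x" by (simp_all add: add_pos_nonneg)
  show z0: "y - x \<noteq> 0"
  proof
    assume "y - x = 0"
    then have "(1 + norm x) / 2 \<le> 0" using z by (simp only: norm_zero)
    then show False using p(1) by (meson not_le)
  qed
  have le: "((1 + norm x) / 2) ^ 4 \<le> norm (y - x) ^ 4" using z p by (intro power_mono) auto
  have "0 < ((1 + norm x) / 2) ^ 4" using p(1) by (rule zero_less_power)
  then have "1 / norm (y - x) ^ 4 \<le> 1 / ((1 + norm x) / 2) ^ 4"
    by (intro divide_left_mono[OF le zero_le_one] mult_pos_pos) (use le in \<open>meson less_le_trans\<close>)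
  also have "\<dots> = 16 * inverse ((1 + norm x) ^ 4)"
    unfolding power_divide inverse_eq_divide by simp
  also have "inverse ((1 + norm x) ^ 4) = (1 + norm x) powr - real 4"
    unfolding powr_minus powr_realpow[OF p(2)] ..
  finally show "1 / norm (y - x) ^ 4 \<le> 16 * (1 + norm x) powr -4" by (simp only: of_nat_numeral)
qed

text \<open>Two regions. If \<open>y\<close> is much closer to the origin than \<open>x\<close>,
  then \<open>norm (y - x)\<close> is at least half of \<open>1 + norm x\<close> and the kernel
  itself decays, with \<open>1024 = 64 * 16\<close>; \<open>v\<^sup>2\<close> is left to the energy.
  Otherwise the weights at \<open>y\<close> and \<open>x\<close> are comparable: one factor
  \<open>v\<close> is bounded by \<open>M\<close>, the other by the weighted hypothesis, so the
  bound is linear in \<open>L\<close>.\<close>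

lemma kern_split:
  fixes x y :: "real^3" and v L M \<delta> :: real
  assumes v: "0 \<le> v" "v \<le> M" "v \<le> L * decay a \<delta> y" and \<tau>: "\<tau> > 0"
    and a: "0 \<le> a" "a \<le> 4" and \<delta>: "0 \<le> \<delta>" and L: "0 \<le> L"
  shows "ennreal (v\<^sup>2) * kern \<tau> (y - x) \<le> ennreal (1024 * (1 + norm x) powr -4) * ennreal (v\<^sup>2)
     + ennreal (16 * M * L * decay a \<delta> x) * kern \<tau> (y - x)"
proof (cases "1 + norm y < (1 + norm x) / 2")
  case True
  have z0: "y - x \<noteq> 0" and "64 / norm (y - x) ^ 4 \<le> 1024 * (1 + norm x) powr -4"
    using near_inverse_power[OF True] by simp_all
  then have "kern \<tau> (y - x) \<le> ennreal (1024 * (1 + norm x) powr -4)"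
    using kern_decay[OF \<tau> z0] by (meson ennreal_leI order_trans)
  then have "ennreal (v\<^sup>2) * kern \<tau> (y - x) \<le> ennreal (v\<^sup>2) * ennreal (1024 * (1 + norm x) powr -4)"
    by (rule mult_left_mono) simp
  then show ?thesis by (simp add: mult.commute add_increasing2)
next
  case False
  have "v\<^sup>2 \<le> M * (L * decay a \<delta> y)" unfolding power2_eq_square using v by (intro mult_mono) auto
  also have "\<dots> \<le> M * (L * (16 * decay a \<delta> x))"
    using False a \<delta> L v by (intro mult_left_mono decay_far) auto
  finally have "ennreal (v\<^sup>2) \<le> ennreal (16 * M * L * decay a \<delta> x)" by (intro ennreal_leI) (simp add: mult_ac)
  then have "ennreal (v\<^sup>2) * kern \<tau> (y - x) \<le> ennreal (16 * M * L * decay a \<delta> x) * kern \<tau> (y - x)"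
    by (rule mult_right_mono) simp
  then show ?thesis by (simp add: add_increasing)
qed

context ns_data
begin

lemma nonlin_le:
  assumes "\<tau> > 0"
  shows "\<bar>nonlin i \<tau> p z\<bar> \<le> 9 * oseen_const * (norm (V p))\<^sup>2 * (\<tau> powr (-3/2) * heat (2 * \<tau>) z)"
proof -
  let ?b = "oseen_const * (\<tau> powr (-3/2) * heat (2 * \<tau>) z)"
  have b: "?b \<ge> 0" using oseen_const(1) by (simp add: heat_nonneg)
  have "\<bar>nonlin i \<tau> p z\<bar> \<le> (\<Sum>l\<in>(UNIV::3 set). \<Sum>j\<in>(UNIV::3 set). (norm (V p))\<^sup>2 * ?b)"
    unfolding nonlin_def
  proof (intro order_trans[OF sum_abs] sum_mono)
    fix l j :: 3
    show "\<bar>V p $ l * V p $ j * oseen3 i l j \<tau> z\<bar> \<le> (norm (V p))\<^sup>2 * ?b"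
      unfolding abs_mult power2_eq_square
      by (intro mult_mono V_nth_le oseen_const(2)[OF assms]) auto
  qed
  then show ?thesis by (simp add: mult_ac)
qed

text \<open>The bound for the convection term up to time \<open>b\<close>. The 9 counts the index
  pairs in \<open>nonlin\<close>. The first summand comes from the energy near the origin and does
  not involve \<open>L\<close>. In the second, \<open>96 = 16 * 2 * 3\<close> collects the constants
  of \<open>decay_far\<close>, \<open>nn_integral_kern\<close> and
  \<open>nn_integral_exp_sqrt\<close>.\<close>

definition duhamel :: "real \<Rightarrow> real \<Rightarrow> real \<Rightarrow> real \<Rightarrow> real \<Rightarrow> real^3 \<Rightarrow> real" where
  "duhamel a \<delta> L l b x = 9 * oseen_const * (1024 * E * b * (1 + norm x) powr -4
     + 96 * M * L * decay a \<delta> x * \<nu> powr (-1/2) * exp (l * b) / sqrt l)"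

lemma nonlin_measurable[measurable]:
  assumes [measurable]: "f \<in> borel_measurable N" "h \<in> borel_measurable N" "g \<in> borel_measurable N"
  shows "(\<lambda>p. nonlin i (f p) (h p) (g p)) \<in> borel_measurable N"
  unfolding nonlin_def by measurable

text \<open>Integrating first over the diffusion parameter turns the bound for \<open>nonlin\<close>
  into \<open>kern\<close>. The space integral is then split by \<open>kern_split\<close>, the
  energy controls the first part and the mass of \<open>kern\<close> the second, and the remaining
  time integral has an integrable singularity at \<open>b\<close>.\<close>

lemma duhamel_bound:
  fixes x :: "real^3"
  assumes hyp: "AE p in lborel. norm (V p) \<le> L * exp (l * fst p) * decay a \<delta> (snd p)"
    and l: "l > 0" and L: "L \<ge> 0" and a: "0 \<le> a" "a \<le> 4" and \<delta>: "0 \<le> \<delta>"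
    and b: "0 \<le> b" "\<nu> * b < \<sigma>1"
    and \<theta>[measurable]: "\<theta> \<in> borel_measurable borel" and \<theta>b: "\<And>s. 0 \<le> \<theta> s" "\<And>s. \<theta> s \<le> \<Theta>" "\<And>s. b < s \<Longrightarrow> \<theta> s = 0"
  shows "(\<integral>\<^sup>+\<sigma>. indicator {\<sigma>1..} \<sigma> * (\<integral>\<^sup>+p. ennreal \<bar>\<theta> (fst p) * nonlin i (\<sigma> - \<nu> * fst p) p (snd p - x)\<bar> \<partial>lborel) \<partial>lborel)
    \<le> ennreal (\<Theta> * duhamel a \<delta> L l b x)"
proof -
  have \<Theta>: "\<Theta> \<ge> 0" using \<theta>b(1,2)[of 0] by linarith
  let ?c = "\<Theta> * (9 * oseen_const)"
  have c: "?c \<ge> 0" using \<Theta> oseen_const(1) by simp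
  have ind: "indicator {\<sigma>1..} \<sigma> = (if \<sigma>1 \<le> \<sigma> then 1 else (0::ennreal))" for \<sigma> by (simp add: indicator_def)
  have "(\<integral>\<^sup>+\<sigma>. indicator {\<sigma>1..} \<sigma> * (\<integral>\<^sup>+p. ennreal \<bar>\<theta> (fst p) * nonlin i (\<sigma> - \<nu> * fst p) p (snd p - x)\<bar> \<partial>lborel) \<partial>lborel)
     = (\<integral>\<^sup>+\<sigma>. \<integral>\<^sup>+p. indicator {\<sigma>1..} \<sigma> * ennreal \<bar>\<theta> (fst p) * nonlin i (\<sigma> - \<nu> * fst p) p (snd p - x)\<bar> \<partial>lborel \<partial>lborel)"
    by (intro nn_integral_cong, subst nn_integral_cmult) auto
  also have "\<dots> = (\<integral>\<^sup>+p. \<integral>\<^sup>+\<sigma>. indicator {\<sigma>1..} \<sigma> * ennreal \<bar>\<theta> (fst p) * nonlin i (\<sigma> - \<nu> * fst p) p (snd p - x)\<bar> \<partial>lborel \<partial>lborel)"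
    by (rule nn_integral_lborel_swap) (unfold ind, measurable)
  also have "\<dots> \<le> (\<integral>\<^sup>+p. ennreal ?c * (indicator {0..b} (fst p) * (ennreal ((norm (V p))\<^sup>2) * kern (\<sigma>1 - \<nu> * fst p) (snd p - x))) \<partial>lborel)"
  proof (rule nn_integral_mono)
    fix p :: "real \<times> (real^3)"
    let ?s = "fst p" and ?z = "snd p - x"
    show "(\<integral>\<^sup>+\<sigma>. indicator {\<sigma>1..} \<sigma> * ennreal \<bar>\<theta> ?s * nonlin i (\<sigma> - \<nu> * ?s) p ?z\<bar> \<partial>lborel)
       \<le> ennreal ?c * (indicator {0..b} ?s * (ennreal ((norm (V p))\<^sup>2) * kern (\<sigma>1 - \<nu> * ?s) ?z))"
    proof (cases "0 \<le> ?s \<and> ?s \<le> b")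
      case True
      then have "\<nu> * ?s \<le> \<nu> * b" using \<nu>_pos by simp
      then have tau: "\<sigma> - \<nu> * ?s > 0" if "\<sigma>1 \<le> \<sigma>" for \<sigma> using b that by linarith
      have "(\<integral>\<^sup>+\<sigma>. indicator {\<sigma>1..} \<sigma> * ennreal \<bar>\<theta> ?s * nonlin i (\<sigma> - \<nu> * ?s) p ?z\<bar> \<partial>lborel)
        \<le> (\<integral>\<^sup>+\<sigma>. ennreal (?c * (norm (V p))\<^sup>2) * (indicator {\<sigma>1 - \<nu> * ?s..} (\<sigma> - \<nu> * ?s) * ennreal ((\<sigma> - \<nu> * ?s) powr (-3/2) * heat (2 * (\<sigma> - \<nu> * ?s)) ?z)) \<partial>lborel)"
      proof (rule nn_integral_mono)
        fix \<sigma> :: real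
        show "indicator {\<sigma>1..} \<sigma> * ennreal \<bar>\<theta> ?s * nonlin i (\<sigma> - \<nu> * ?s) p ?z\<bar>
          \<le> ennreal (?c * (norm (V p))\<^sup>2) * (indicator {\<sigma>1 - \<nu> * ?s..} (\<sigma> - \<nu> * ?s) * ennreal ((\<sigma> - \<nu> * ?s) powr (-3/2) * heat (2 * (\<sigma> - \<nu> * ?s)) ?z))"
        proof (cases "\<sigma>1 \<le> \<sigma>")
          case True
          have "\<bar>\<theta> ?s * nonlin i (\<sigma> - \<nu> * ?s) p ?z\<bar> \<le> \<Theta> * (9 * oseen_const * (norm (V p))\<^sup>2 * ((\<sigma> - \<nu> * ?s) powr (-3/2) * heat (2 * (\<sigma> - \<nu> * ?s)) ?z))"
            unfolding abs_mult using \<theta>b(1,2)[of ?s] by (intro mult_mono nonlin_le[OF tau[OF True]]) auto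
          also have "\<dots> = (?c * (norm (V p))\<^sup>2) * ((\<sigma> - \<nu> * ?s) powr (-3/2) * heat (2 * (\<sigma> - \<nu> * ?s)) ?z)" by (simp only: mult_ac)
          finally have "ennreal \<bar>\<theta> ?s * nonlin i (\<sigma> - \<nu> * ?s) p ?z\<bar> \<le> ennreal (?c * (norm (V p))\<^sup>2) * ennreal ((\<sigma> - \<nu> * ?s) powr (-3/2) * heat (2 * (\<sigma> - \<nu> * ?s)) ?z)"
            using c by (subst ennreal_mult[symmetric]) (auto simp: heat_nonneg intro!: ennreal_leI)
          then show ?thesis using True by simp
        qed simp
      qed
      also have "\<dots> = (\<integral>\<^sup>+\<sigma>. ennreal (?c * (norm (V p))\<^sup>2) * (indicator {\<sigma>1 - \<nu> * ?s..} \<sigma> * ennreal (\<sigma> powr (-3/2) * heat (2 * \<sigma>) ?z)) \<partial>lborel)"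
        by (rule nn_integral_translate) measurable
      also have "\<dots> = ennreal (?c * (norm (V p))\<^sup>2) * kern (\<sigma>1 - \<nu> * ?s) ?z"
        unfolding kern_def by (rule nn_integral_cmult) measurable
      also have "\<dots> = ennreal ?c * (indicator {0..b} ?s * (ennreal ((norm (V p))\<^sup>2) * kern (\<sigma>1 - \<nu> * ?s) ?z))"
        using True ennreal_mult[OF c, of "(norm (V p))\<^sup>2"] by (simp add: mult.assoc)
      finally show ?thesis .
    next
      case False
      then have "\<theta> ?s * nonlin i \<tau> p ?z = 0" for \<tau>
        using \<theta>b(3)[of ?s] V_past[of p] by (auto simp: nonlin_def not_le)
      then show ?thesis by (simp only: abs_zero ennreal_0 mult_zero_right nn_integral_const) simp
    qed
  qed
  also have "\<dots> = ennreal ?c * (\<integral>\<^sup>+s. \<integral>\<^sup>+y. indicator {0..b} s * (ennreal ((norm (V (s, y)))\<^sup>2) * kern (\<sigma>1 - \<nu> * s) (y - x)) \<partial>lborel \<partial>lborel)"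
    by (subst nn_integral_cmult, measurable, subst nn_integral_lborel_pair) auto
  also have "(\<integral>\<^sup>+s. \<integral>\<^sup>+y. indicator {0..b} s * (ennreal ((norm (V (s, y)))\<^sup>2) * kern (\<sigma>1 - \<nu> * s) (y - x)) \<partial>lborel \<partial>lborel)
     \<le> (\<integral>\<^sup>+s. ennreal (1024 * (1 + norm x) powr -4 * E) * indicator {0..b} s
          + ennreal (32 * M * L * decay a \<delta> x * \<nu> powr (-1/2)) * (ennreal (exp (l * s) * (b - s) powr (-1/2)) * indicator {..b} s) \<partial>lborel)"
  proof (rule nn_integral_mono_AE)
    have "AE p in lborel \<Otimes>\<^sub>M lborel. norm (V p) \<le> L * exp (l * fst p) * decay a \<delta> (snd p)"
      unfolding lborel_prod by (rule hyp)
    \<comment> \<open>The single time \<open>s = b\<close> is discarded: there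
      \<open>(b - s) powr (-1/2)\<close> is 0 by convention and would not bound the kernel.\<close>
    from lborel_pair.AE_pair[OF this] AE_lborel_singleton[of b]
    show "AE s in lborel. (\<integral>\<^sup>+y. indicator {0..b} s * (ennreal ((norm (V (s, y)))\<^sup>2) * kern (\<sigma>1 - \<nu> * s) (y - x)) \<partial>lborel)
      \<le> ennreal (1024 * (1 + norm x) powr -4 * E) * indicator {0..b} s
          + ennreal (32 * M * L * decay a \<delta> x * \<nu> powr (-1/2)) * (ennreal (exp (l * s) * (b - s) powr (-1/2)) * indicator {..b} s)"
    proof eventually_elim
      case (elim s)
      show ?case
      proof (cases "0 \<le> s \<and> s \<le> b")
        case True
        then have sb: "s < b" using elim by simp
        have "\<nu> * (b - s) > 0" using sb \<nu>_pos by simp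
        \<comment> \<open>Since \<open>\<sigma>1\<close> exceeds \<open>\<nu> * b\<close>, the mass
          of the kernel is controlled by the distance of \<open>s\<close> from \<open>b\<close>,
          however close \<open>\<sigma>1\<close> comes to \<open>\<nu> * b\<close>.\<close>
        then have tau: "\<sigma>1 - \<nu> * s > 0" "\<nu> * (b - s) \<le> \<sigma>1 - \<nu> * s" using b by (simp_all add: algebra_simps)
        let ?D = "16 * M * (L * exp (l * s)) * decay a \<delta> x"
        have dx: "decay a \<delta> x \<ge> 0" using \<delta> by (simp add: decay_def)
        have "(\<integral>\<^sup>+y. indicator {0..b} s * (ennreal ((norm (V (s, y)))\<^sup>2) * kern (\<sigma>1 - \<nu> * s) (y - x)) \<partial>lborel)
           \<le> (\<integral>\<^sup>+y. ennreal (1024 * (1 + norm x) powr -4) * ennreal ((norm (V (s, y)))\<^sup>2) + ennreal ?D * kern (\<sigma>1 - \<nu> * s) (y - x) \<partial>lborel)"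
        proof (rule nn_integral_mono_AE)
          show "AE y in lborel. indicator {0..b} s * (ennreal ((norm (V (s, y)))\<^sup>2) * kern (\<sigma>1 - \<nu> * s) (y - x))
            \<le> ennreal (1024 * (1 + norm x) powr -4) * ennreal ((norm (V (s, y)))\<^sup>2) + ennreal ?D * kern (\<sigma>1 - \<nu> * s) (y - x)"
            using elim(1)
          proof eventually_elim
            case (elim y)
            have "ennreal ((norm (V (s, y)))\<^sup>2) * kern (\<sigma>1 - \<nu> * s) (y - x)
              \<le> ennreal (1024 * (1 + norm x) powr -4) * ennreal ((norm (V (s, y)))\<^sup>2) + ennreal ?D * kern (\<sigma>1 - \<nu> * s) (y - x)"
              using elim V_bound[of "(s, y)"] tau(1) a \<delta> L by (intro kern_split) auto
            then show ?case using True by simp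
          qed
        qed
        also have "\<dots> = ennreal (1024 * (1 + norm x) powr -4) * (\<integral>\<^sup>+y. ennreal ((norm (V (s, y)))\<^sup>2) \<partial>lborel) + ennreal ?D * (\<integral>\<^sup>+y. kern (\<sigma>1 - \<nu> * s) (y - x) \<partial>lborel)"
          by (subst nn_integral_add, measurable, subst nn_integral_cmult, measurable, subst nn_integral_cmult) auto
        also have "\<dots> \<le> ennreal (1024 * (1 + norm x) powr -4) * ennreal E + ennreal ?D * ennreal (2 * (\<nu> powr (-1/2) * (b - s) powr (-1/2)))"
        proof (intro add_mono mult_left_mono V_energy)
          have "(\<sigma>1 - \<nu> * s) powr (-1/2) \<le> (\<nu> * (b - s)) powr (-1/2)" using tau \<open>\<nu> * (b - s) > 0\<close> by (intro powr_mono2') auto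
          also have "\<dots> = \<nu> powr (-1/2) * (b - s) powr (-1/2)" using \<nu>_pos sb by (simp add: powr_mult)
          finally show "(\<integral>\<^sup>+y. kern (\<sigma>1 - \<nu> * s) (y - x) \<partial>lborel) \<le> ennreal (2 * (\<nu> powr (-1/2) * (b - s) powr (-1/2)))"
            unfolding nn_integral_kern[OF tau(1)] by (intro ennreal_leI) simp
        qed auto
        also have "\<dots> = ennreal (1024 * (1 + norm x) powr -4 * E) * indicator {0..b} s
          + ennreal (32 * M * L * decay a \<delta> x * \<nu> powr (-1/2)) * (ennreal (exp (l * s) * (b - s) powr (-1/2)) * indicator {..b} s)"
        proof -
          have 1: "ennreal (1024 * (1 + norm x) powr -4) * ennreal E = ennreal (1024 * (1 + norm x) powr -4 * E)"
            using E_nonneg by (simp add: ennreal_mult)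
          have 2: "ennreal ?D * ennreal (2 * (\<nu> powr (-1/2) * (b - s) powr (-1/2)))
            = ennreal (32 * M * L * decay a \<delta> x * \<nu> powr (-1/2)) * ennreal (exp (l * s) * (b - s) powr (-1/2))"
            using M_nonneg L dx by (subst (1 2) ennreal_mult[symmetric]) (auto simp: mult_ac)
          show ?thesis unfolding 1 2 using True by simp
        qed
        finally show ?thesis .
      qed simp
    qed
  qed
  also have "\<dots> = ennreal (1024 * (1 + norm x) powr -4 * E) * emeasure lborel {0..b}
      + ennreal (32 * M * L * decay a \<delta> x * \<nu> powr (-1/2)) * (\<integral>\<^sup>+s. ennreal (exp (l * s) * (b - s) powr (-1/2)) * indicator {..b} s \<partial>lborel)"
    by (subst nn_integral_add, measurable, subst nn_integral_cmult, measurable, subst nn_integral_cmult) auto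
  also have "\<dots> \<le> ennreal (1024 * (1 + norm x) powr -4 * E) * ennreal b
      + ennreal (32 * M * L * decay a \<delta> x * \<nu> powr (-1/2)) * ennreal (exp (l * b) * (3 / sqrt l))"
    using nn_integral_exp_sqrt[OF l] b by (intro add_mono mult_left_mono) auto
  also have "\<dots> = ennreal (1024 * (1 + norm x) powr -4 * E * b + 32 * M * L * decay a \<delta> x * \<nu> powr (-1/2) * (exp (l * b) * (3 / sqrt l)))"
  proof -
    have "decay a \<delta> x \<ge> 0" using \<delta> by (simp add: decay_def)
    then show ?thesis using M_nonneg L E_nonneg b l
      by (simp add: ennreal_mult[symmetric] ennreal_plus[symmetric] del: ennreal_plus)
  qed
  finally have "(\<integral>\<^sup>+\<sigma>. indicator {\<sigma>1..} \<sigma> * (\<integral>\<^sup>+p. ennreal \<bar>\<theta> (fst p) * nonlin i (\<sigma> - \<nu> * fst p) p (snd p - x)\<bar> \<partial>lborel) \<partial>lborel)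
    \<le> ennreal ?c * ennreal (1024 * (1 + norm x) powr -4 * E * b + 32 * M * L * decay a \<delta> x * \<nu> powr (-1/2) * (exp (l * b) * (3 / sqrt l)))"
    by (simp add: mult_left_mono)
  also have "\<dots> = ennreal (?c * (1024 * (1 + norm x) powr -4 * E * b + 32 * M * L * decay a \<delta> x * \<nu> powr (-1/2) * (exp (l * b) * (3 / sqrt l))))"
    using c by (rule ennreal_mult'[symmetric])
  also have "?c * (1024 * (1 + norm x) powr -4 * E * b + 32 * M * L * decay a \<delta> x * \<nu> powr (-1/2) * (exp (l * b) * (3 / sqrt l))) = \<Theta> * duhamel a \<delta> L l b x"
    by (simp add: duhamel_def algebra_simps)
  finally show ?thesis .
qed

end

section \<open>From time windows to almost every time\<close>

lemma integrable_indicator_heat: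
  fixes x :: "real^3"
  assumes "\<nu> > 0" "\<nu> * b \<le> \<sigma>1"
  shows "integrable lborel (\<lambda>p. indicator {a<..<b} (fst p) * heat (\<sigma>1 - \<nu> * fst p) (snd p - x))"
proof (rule integrableI_bounded)
  show "(\<lambda>p. indicator {a<..<b} (fst p) * heat (\<sigma>1 - \<nu> * fst p) (snd p - x)) \<in> borel_measurable lborel" by measurable
  have "(\<integral>\<^sup>+p. ennreal (norm (indicator {a<..<b} (fst p) * heat (\<sigma>1 - \<nu> * fst p) (snd p - x))) \<partial>lborel)
    = (\<integral>\<^sup>+s. \<integral>\<^sup>+y. ennreal (norm (indicator {a<..<b} s * heat (\<sigma>1 - \<nu> * s) (y - x))) \<partial>lborel \<partial>lborel)"
    by (subst nn_integral_lborel_pair) auto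
  also have "\<dots> \<le> (\<integral>\<^sup>+s. indicator {a<..<b} s \<partial>lborel)"
  proof (rule nn_integral_mono)
    fix s :: real
    show "(\<integral>\<^sup>+y. ennreal (norm (indicator {a<..<b} s * heat (\<sigma>1 - \<nu> * s) (y - x))) \<partial>lborel) \<le> indicator {a<..<b} s"
    proof (cases "a < s \<and> s < b")
      case True
      then have "\<nu> * s < \<nu> * b" using assms by simp
      then have "\<sigma>1 - \<nu> * s > 0" using assms by linarith
      then show ?thesis using True by (simp add: heat_nonneg nn_integral_heat_shift)
    qed simp
  qed
  also have "\<dots> < \<infinity>" by (cases "a \<le> b") auto
  finally show "(\<integral>\<^sup>+p. ennreal (norm (indicator {a<..<b} (fst p) * heat (\<sigma>1 - \<nu> * fst p) (snd p - x))) \<partial>lborel) < \<infinity>" .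
qed

context ns_data
begin

text \<open>The velocity at time \<open>s\<close>, averaged with a heat kernel. Below,
  \<open>\<tau>\<close> is \<open>\<sigma>1 - \<nu> * s\<close>: the averaging shrinks as time
  advances, as the backward equation dictates.\<close>

definition moll :: "3 \<Rightarrow> real \<Rightarrow> real^3 \<Rightarrow> real \<Rightarrow> real" where
  "moll i \<tau> x s = (LINT y|lborel. V (s, y) $ i * heat \<tau> (y - x))"

definition moll0 :: "3 \<Rightarrow> real \<Rightarrow> real^3 \<Rightarrow> real" where
  "moll0 i \<tau> x = (LINT y|lborel. u0 y $ i * heat \<tau> (y - x))"

lemma moll_measurable[measurable]:
  assumes [measurable]: "f \<in> borel_measurable N" "g \<in> borel_measurable N" "h \<in> borel_measurable N"
  shows "(\<lambda>p. moll i (f p) (g p) (h p)) \<in> borel_measurable N"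
proof -
  have "(\<lambda>(p, y). V (h p, y) $ i * heat (f p) (y - g p)) \<in> borel_measurable (N \<Otimes>\<^sub>M borel)"
    unfolding case_prod_beta' by measurable
  also have "borel_measurable (N \<Otimes>\<^sub>M borel) = borel_measurable (N \<Otimes>\<^sub>M lborel)"
    by (intro measurable_cong_sets sets_pair_measure_cong) simp_all
  finally show ?thesis unfolding moll_def by (rule lborel.borel_measurable_lebesgue_integral)
qed

lemma moll_bounded: "\<bar>moll i \<tau> x s\<bar> \<le> M"  if "\<tau> > 0"
proof -
  have "ennreal (norm (moll i \<tau> x s)) \<le> (\<integral>\<^sup>+y. ennreal (norm (V (s, y) $ i * heat \<tau> (y - x))) \<partial>lborel)"
    unfolding moll_def by (rule norm_integral_le_nn_integral)
  also have "\<dots> \<le> (\<integral>\<^sup>+y. ennreal M * ennreal (heat \<tau> (y - x)) \<partial>lborel)"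
  proof (rule nn_integral_mono)
    fix y
    have "\<bar>V (s, y) $ i\<bar> * heat \<tau> (y - x) \<le> M * heat \<tau> (y - x)"
      using V_nth_le[of "(s, y)" i] V_bound[of "(s, y)"] by (intro mult_right_mono heat_nonneg) simp
    then show "ennreal (norm (V (s, y) $ i * heat \<tau> (y - x))) \<le> ennreal M * ennreal (heat \<tau> (y - x))"
      using M_nonneg by (simp add: abs_mult heat_nonneg ennreal_mult[symmetric] ennreal_leI)
  qed
  also have "\<dots> = ennreal M" using that by (simp add: nn_integral_cmult nn_integral_heat_shift)
  finally show ?thesis using M_nonneg by simp
qed

lemma duhamel_nonneg:
  assumes "l > 0" "L \<ge> 0" "0 \<le> \<delta>" "0 \<le> b"
  shows "duhamel a \<delta> L l b x \<ge> 0"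
  unfolding duhamel_def decay_def using assms oseen_const(1) E_nonneg M_nonneg
  by (intro mult_nonneg_nonneg add_nonneg_nonneg divide_nonneg_nonneg) auto

text \<open>The time cutoffs converge to the indicator of the window. As \<open>\<theta> n\<close>
  is at most \<open>b1 - a1\<close>, both the initial datum and the convection term carry the length
  of the window as a factor, so that division by it gives a time average.\<close>

lemma window_bound:
  fixes x :: "real^3"
  assumes hyp: "AE p in lborel. norm (V p) \<le> L * exp (l * fst p) * decay a \<delta> (snd p)"
    and l: "l > 0" and L: "L \<ge> 0" and a: "0 \<le> a" "a \<le> 4" and \<delta>: "0 \<le> \<delta>"
    and ab: "0 \<le> a1" "a1 < b1" "b1 < T" "\<nu> * b1 < \<sigma>1"
  shows "\<bar>LINT s|lborel. indicator {a1<..<b1} s * moll i (\<sigma>1 - \<nu> * s) x s\<bar>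
    \<le> (b1 - a1) * (\<bar>moll0 i \<sigma>1 x\<bar> + duhamel a \<delta> L l b1 x)"
proof -
  obtain \<eta> \<theta> where \<theta>: "\<And>n. smooth (\<theta> n)" "\<And>n s. s < -2 \<or> b1 < s \<Longrightarrow> \<theta> n s = 0" "\<And>n s. 0 \<le> \<theta> n s" "\<And>n s. \<theta> n s \<le> b1 - a1"
    "\<And>n s. 0 \<le> s \<Longrightarrow> dir_deriv 1 (\<theta> n) s = - \<eta> n s"
    and \<eta>: "\<And>n s. 0 \<le> \<eta> n s" "\<And>n s. \<eta> n s \<le> indicator {a1<..<b1} s"
    "\<And>s. (\<lambda>n. \<eta> n s) \<longlonglongrightarrow> indicator {a1<..<b1} s" "\<And>n. \<eta> n \<in> borel_measurable borel"
    using time_cutoff[OF ab(1,2)] by metis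
  note [measurable] = \<eta>(4)
  have b1: "0 \<le> b1" using ab by simp
  have "0 \<le> \<nu> * b1" using b1 \<nu>_pos by simp
  then have \<sigma>1: "\<sigma>1 > 0" using ab by simp
  \<comment> \<open>Any time strictly between \<open>b1\<close> and
    \<open>\<sigma>1 / \<nu>\<close>, where the diffusion parameter reaches 0, would do.\<close>
  define c where "c = (b1 + \<sigma>1 / \<nu>) / 2"
  have "b1 < \<sigma>1 / \<nu>" using ab \<nu>_pos by (simp add: pos_less_divide_eq mult.commute)
  then have c: "b1 < c" "\<nu> * c < \<sigma>1" using \<nu>_pos by (simp_all add: c_def field_simps)
  have bh: "backward_heat \<nu> \<sigma>1 b1 c (\<theta> n)" for n
    unfolding backward_heat_def using c \<theta>(1,2) \<nu>_pos by blast
  have \<theta>m: "\<theta> n \<in> borel_measurable borel" for n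
    by (intro borel_measurable_continuous_onI smooth_continuous_on \<theta>(1))
  define X where "X n = (LINT p|lborel. - (\<eta> n (fst p) * (V p $ i * heat (\<sigma>1 - \<nu> * fst p) (snd p - x))))" for n
  let ?D = "duhamel a \<delta> L l b1 x" and ?U = "moll0 i \<sigma>1 x"
  have D: "?D \<ge> 0" by (rule duhamel_nonneg[OF l L \<delta> b1])
  have Xb: "\<bar>X n\<bar> \<le> (b1 - a1) * (\<bar>?U\<bar> + ?D)" for n
  proof -
    have "dir_deriv 1 (\<theta> n) (fst p) * V p $ i * heat (\<sigma>1 - \<nu> * fst p) (snd p - x) = - (\<eta> n (fst p) * (V p $ i * heat (\<sigma>1 - \<nu> * fst p) (snd p - x)))" for p
      using \<theta>(5)[of "fst p" n] V_past[of p] by (cases "0 \<le> fst p") auto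
    then have "X n = (LINT p|lborel. dir_deriv 1 (\<theta> n) (fst p) * V p $ i * heat (\<sigma>1 - \<nu> * fst p) (snd p - x))"
      by (simp add: X_def)
    then have "ennreal \<bar>X n + \<theta> n 0 * ?U\<bar> \<le> (\<integral>\<^sup>+\<sigma>. indicator {\<sigma>1..} \<sigma> * (\<integral>\<^sup>+p. ennreal \<bar>\<theta> n (fst p) * nonlin i (\<sigma> - \<nu> * fst p) p (snd p - x)\<bar> \<partial>lborel) \<partial>lborel)"
      using integrated_representation[OF bh \<open>b1 < T\<close> \<sigma>1, of n i x] by (simp add: moll0_def)
    also have "\<dots> \<le> ennreal ((b1 - a1) * ?D)"
      by (rule duhamel_bound[OF hyp l L a \<delta> b1 ab(4) \<theta>m \<theta>(3) \<theta>(4)]) (use \<theta>(2) in blast)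
    finally have "\<bar>X n + \<theta> n 0 * ?U\<bar> \<le> (b1 - a1) * ?D" using ab D by (simp add: ennreal_le_iff)
    moreover have "\<bar>\<theta> n 0 * ?U\<bar> \<le> (b1 - a1) * \<bar>?U\<bar>"
      unfolding abs_mult using \<theta>(3,4)[of n 0] by (intro mult_right_mono) auto
    ultimately show ?thesis unfolding distrib_left by linarith
  qed
  let ?f = "\<lambda>p. indicator {a1<..<b1} (fst p) * (V p $ i * heat (\<sigma>1 - \<nu> * fst p) (snd p - x))"
  have dom: "integrable lborel (\<lambda>p. M * (indicator {a1<..<b1} (fst p) * heat (\<sigma>1 - \<nu> * fst p) (snd p - x)))"
    using integrable_indicator_heat[OF \<nu>_pos, of b1 \<sigma>1 a1 x] ab by simp
  have le: "\<bar>r * (V p $ i * heat \<tau> z)\<bar> \<le> M * (indicator {a1<..<b1} (fst p) * heat \<tau> z)" if "0 \<le> r" "r \<le> indicator {a1<..<b1} (fst p)" for r p \<tau> z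
  proof -
    have "\<bar>r * (V p $ i * heat \<tau> z)\<bar> = \<bar>V p $ i\<bar> * (r * heat \<tau> z)" using that by (simp add: abs_mult heat_nonneg)
    also have "\<dots> \<le> M * (indicator {a1<..<b1} (fst p) * heat \<tau> z)"
      using that V_nth_le[of p i] V_bound[of p] M_nonneg by (intro mult_mono mult_right_mono heat_nonneg) (auto simp: heat_nonneg)
    finally show ?thesis .
  qed
  have f_int: "integrable lborel ?f"
    by (rule Bochner_Integration.integrable_bound[OF dom]) (auto intro!: AE_I2 order_trans[OF le abs_ge_self])
  have "X \<longlonglongrightarrow> (LINT p|lborel. - ?f p)"
    unfolding X_def
  proof (rule integral_dominated_convergence[OF _ _ dom])
    show "AE p in lborel. (\<lambda>n. - (\<eta> n (fst p) * (V p $ i * heat (\<sigma>1 - \<nu> * fst p) (snd p - x)))) \<longlonglongrightarrow> - ?f p"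
      by (intro AE_I2 tendsto_intros \<eta>)
    show "AE p in lborel. norm (- (\<eta> n (fst p) * (V p $ i * heat (\<sigma>1 - \<nu> * fst p) (snd p - x)))) \<le> M * (indicator {a1<..<b1} (fst p) * heat (\<sigma>1 - \<nu> * fst p) (snd p - x))" for n
      using le[OF \<eta>(1,2)] by simp
  qed measurable
  then have "(\<lambda>n. \<bar>X n\<bar>) \<longlonglongrightarrow> \<bar>LINT p|lborel. - ?f p\<bar>" by (rule tendsto_rabs)
  then have "\<bar>LINT p|lborel. - ?f p\<bar> \<le> (b1 - a1) * (\<bar>?U\<bar> + ?D)"
    by (rule tendsto_upperbound) (use Xb in auto)
  moreover have "(LINT p|lborel. ?f p) = (LINT s|lborel. indicator {a1<..<b1} s * moll i (\<sigma>1 - \<nu> * s) x s)"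
  proof -
    have "integrable (lborel \<Otimes>\<^sub>M lborel) ?f" unfolding lborel_prod by (rule f_int)
    from lborel_pair.integral_fst'[OF this]
    have "(LINT p|lborel. ?f p) = (LINT s|lborel. LINT y|lborel. ?f (s, y))" by (simp add: lborel_prod)
    then show ?thesis by (simp add: moll_def)
  qed
  ultimately show ?thesis by simp
qed

text \<open>The window estimate divided by the length of the window, which then shrinks to
  \<open>s\<close>: Lebesgue differentiation on the left and continuity of \<open>duhamel\<close> in
  time on the right. The exceptional set of times depends on \<open>x\<close> and
  \<open>\<sigma>1\<close>.\<close>

lemma mollified_bound:
  fixes x :: "real^3"
  assumes hyp: "AE p in lborel. norm (V p) \<le> L * exp (l * fst p) * decay a \<delta> (snd p)"
    and l: "l > 0" and L: "L \<ge> 0" and a: "0 \<le> a" "a \<le> 4" and \<delta>: "0 \<le> \<delta>"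
  shows "AE s in lborel. 0 \<le> s \<and> s < T \<and> \<nu> * s < \<sigma>1 \<longrightarrow>
    \<bar>moll i (\<sigma>1 - \<nu> * s) x s\<bar> \<le> \<bar>moll0 i \<sigma>1 x\<bar> + duhamel a \<delta> L l s x"
proof -
  \<comment> \<open>Only positive diffusion parameters give a bounded mollification, and boundedness
    makes \<open>f\<close> locally integrable.\<close>
  define f where "f s = (if \<nu> * s < \<sigma>1 then moll i (\<sigma>1 - \<nu> * s) x s else 0)" for s
  have fm[measurable]: "f \<in> borel_measurable borel" unfolding f_def[abs_def] by measurable
  have fb: "\<bar>f s\<bar> \<le> M" for s using moll_bounded[of "\<sigma>1 - \<nu> * s" i x s] M_nonneg by (auto simp: f_def)
  have fint: "f integrable_on cbox u v" for u v
  proof -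
    have "set_integrable lborel {u..v} f"
      unfolding set_integrable_def
      by (rule integrableI_bounded_set_indicator[where B=M]) (use fb in \<open>auto simp: emeasure_lborel_Icc_eq\<close>)
    then show ?thesis using set_borel_integral_eq_integral(1) by simp
  qed
  obtain N where N: "negligible N"
    "\<And>s e. \<lbrakk>s \<notin> N; 0 < e\<rbrakk> \<Longrightarrow> \<exists>d>0. \<forall>h. 0 < h \<and> h < d \<longrightarrow> norm (integral (cbox s (s + h *\<^sub>R One)) f /\<^sub>R h ^ DIM(real) - f s) < e"
    using integrable_ccontinuous_explicit[OF fint] by blast
  have main: "\<bar>f s\<bar> \<le> \<bar>moll0 i \<sigma>1 x\<bar> + duhamel a \<delta> L l s x" if s: "s \<notin> N" "0 \<le> s" "s < T" "\<nu> * s < \<sigma>1" for s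
  proof (rule field_le_epsilon)
    fix e :: real assume e: "e > 0"
    obtain d where d: "d > 0" "\<And>h. 0 < h \<and> h < d \<Longrightarrow> norm (integral (cbox s (s + h *\<^sub>R One)) f /\<^sub>R h ^ DIM(real) - f s) < e / 2"
      using N(2)[OF s(1), of "e / 2"] e by auto
    have "((\<lambda>h. duhamel a \<delta> L l (s + h) x) \<longlongrightarrow> duhamel a \<delta> L l (s + 0) x) (at_right 0)"
      unfolding duhamel_def using l by (intro tendsto_intros) auto
    then have "\<forall>\<^sub>F h in at_right 0. duhamel a \<delta> L l (s + h) x < duhamel a \<delta> L l s x + e / 2"
      using e by (intro order_tendstoD(2)) auto
    moreover have "\<forall>\<^sub>F h in at_right 0. h < d" using eventually_at_right_real[of 0 d] d by (auto elim!: eventually_mono)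
    moreover have "\<forall>\<^sub>F h in at_right 0. s + h < T" using eventually_at_right_real[of 0 "T - s"] s by (auto elim!: eventually_mono)
    moreover have "\<forall>\<^sub>F h in at_right 0. \<nu> * (s + h) < \<sigma>1"
      using eventually_at_right_real[of 0 "(\<sigma>1 - \<nu> * s) / \<nu>"] s \<nu>_pos
      by (auto elim!: eventually_mono simp: field_simps)
    moreover have "\<forall>\<^sub>F h::real in at_right 0. 0 < h" by (rule eventually_at_right_less)
    ultimately have "\<forall>\<^sub>F h in at_right 0. duhamel a \<delta> L l (s + h) x < duhamel a \<delta> L l s x + e / 2 \<and> h < d \<and> s + h < T \<and> \<nu> * (s + h) < \<sigma>1 \<and> 0 < h"
      by eventually_elim auto
    then obtain h where h: "duhamel a \<delta> L l (s + h) x < duhamel a \<delta> L l s x + e / 2" "h < d" "s + h < T" "\<nu> * (s + h) < \<sigma>1" "0 < h"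
      by (metis (mono_tags, lifting) eventually_happens' trivial_limit_at_right_real)
    have "integral (cbox s (s + h *\<^sub>R One)) f = integral {s<..<s + h} f"
      using integral_open_interval_real[of s "s + h" f] h by simp
    also have "\<dots> = (LINT r|lborel. indicator {s<..<s + h} r * f r)"
    proof -
      have "set_integrable lborel {s<..<s + h} f"
        unfolding set_integrable_def
        by (rule integrableI_bounded_set_indicator[where B=M]) (use fb h in auto)
      from set_borel_integral_eq_integral(2)[OF this] show ?thesis by (simp add: set_lebesgue_integral_def)
    qed
    also have "\<dots> = (LINT r|lborel. indicator {s<..<s + h} r * moll i (\<sigma>1 - \<nu> * r) x r)"
    proof (rule Bochner_Integration.integral_cong)
      fix r
      show "indicator {s<..<s + h} r * f r = indicator {s<..<s + h} r * moll i (\<sigma>1 - \<nu> * r) x r"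
      proof (cases "r < s + h")
        case True
        then have "\<nu> * r < \<nu> * (s + h)" using \<nu>_pos by simp
        then have "\<nu> * r < \<sigma>1" using h by linarith
        then show ?thesis by (simp add: f_def)
      qed simp
    qed simp
    finally have "\<bar>integral (cbox s (s + h *\<^sub>R One)) f\<bar> \<le> h * (\<bar>moll0 i \<sigma>1 x\<bar> + duhamel a \<delta> L l (s + h) x)"
      using window_bound[OF hyp l L a \<delta> s(2), of "s + h" \<sigma>1 i x] h by simp
    then have "\<bar>integral (cbox s (s + h *\<^sub>R One)) f /\<^sub>R h ^ DIM(real)\<bar> \<le> \<bar>moll0 i \<sigma>1 x\<bar> + duhamel a \<delta> L l (s + h) x"
      using h by (simp add: abs_mult divide_simps mult.commute)
    moreover have "\<bar>integral (cbox s (s + h *\<^sub>R One)) f /\<^sub>R h ^ DIM(real) - f s\<bar> < e / 2"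
      using d(2)[of h] h by (simp only: real_norm_def)
    ultimately show "\<bar>f s\<bar> \<le> \<bar>moll0 i \<sigma>1 x\<bar> + duhamel a \<delta> L l s x + e"
      using h(1) by linarith
  qed
  have "AE s in lebesgue. s \<notin> N" using N(1) by (intro AE_not_in) (simp add: negligible_iff_null_sets)
  then have "AE s in lborel. s \<notin> N" by (simp add: AE_completion_iff)
  then show ?thesis
  proof eventually_elim
    case (elim s)
    then show ?case using main[OF elim] by (auto simp: f_def)
  qed
qed

end

section \<open>Removal of the spatial mollifier\<close>

lemma lborel_integral_translate:
  fixes f :: "'a::euclidean_space \<Rightarrow> real"
  assumes [measurable]: "f \<in> borel_measurable borel"
  shows "(LINT y|lborel. f (y - x)) = (LINT y|lborel. f y)"
proof -
  have "(LINT y|lborel. f y) = (LINT y|distr lborel borel ((+) (- x)). f y)"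
    by (simp add: lborel_distr_plus)
  also have "\<dots> = (LINT y|lborel. f (- x + y))" by (subst integral_distr) auto
  finally show ?thesis by simp
qed

lemma heat_rescale_integral:
  fixes f :: "real^3 \<Rightarrow> real"
  assumes [measurable]: "f \<in> borel_measurable borel" and \<tau>: "\<tau> > 0"
  shows "(LINT z|lborel. f z * heat \<tau> z) = (LINT w|lborel. f (sqrt \<tau> *\<^sub>R w) * heat 1 w)"
proof -
  let ?c = "sqrt \<tau>"
  have c: "?c > 0" using \<tau> by simp
  have h: "?c ^ 3 * heat \<tau> (?c *\<^sub>R w) = heat 1 w" for w
  proof -
    have "?c ^ 3 = \<tau> powr (3/2)"
    proof -
      have "\<tau> powr (3/2) = (\<tau> powr (1/2)) powr real 3" by (simp add: powr_powr)
      also have "\<dots> = ?c ^ 3" unfolding powr_half_sqrt[OF less_imp_le[OF \<tau>]] by (rule powr_realpow[OF c])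
      finally show ?thesis by simp
    qed
    moreover have "(4 * pi * \<tau>) powr (-3/2) = \<tau> powr (-3/2) * (4 * pi * 1) powr (-3/2)"
      using \<tau> by (subst powr_mult[symmetric]) (auto simp: mult_ac)
    moreover have "\<tau> powr (3/2) * \<tau> powr (-3/2) = 1" using \<tau> by (subst powr_add[symmetric]) simp
    moreover have "(norm (?c *\<^sub>R w))\<^sup>2 / (4 * \<tau>) = (norm w)\<^sup>2 / (4 * 1)"
      using \<tau> by (simp add: power_mult_distrib)
    ultimately show ?thesis unfolding heat_def minus_divide_left[symmetric]
      by (simp only: mult.assoc[symmetric])
  qed
  have "(LINT z|lborel. f z * heat \<tau> z)
      = (LINT z|density (distr lborel borel (\<lambda>x. 0 + ?c *\<^sub>R x)) (\<lambda>_. ennreal (\<bar>?c\<bar> ^ DIM(real^3))). f z * heat \<tau> z)"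
    using lborel_affine[of ?c "0 :: real^3"] c by simp
  also have "\<dots> = (LINT z|distr lborel borel (\<lambda>x. 0 + ?c *\<^sub>R x). ?c ^ 3 *\<^sub>R (f z * heat \<tau> z))"
    using c by (subst integral_density) auto
  also have "\<dots> = (LINT w|lborel. ?c ^ 3 *\<^sub>R (f (?c *\<^sub>R w) * heat \<tau> (?c *\<^sub>R w)))"
    by (subst integral_distr) auto
  also have "\<dots> = (LINT w|lborel. f (?c *\<^sub>R w) * heat 1 w)"
    by (simp add: h[symmetric] mult_ac)
  finally show ?thesis .
qed

lemma integrable_heat: "\<tau> > 0 \<Longrightarrow> integrable lborel (heat \<tau>)"
proof (rule integrableI_bounded)
  assume "\<tau> > 0"
  then show "(\<integral>\<^sup>+z. ennreal (norm (heat \<tau> z)) \<partial>lborel) < \<infinity>" by (simp add: heat_nonneg nn_integral_heat)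
qed (use heat_measurable[of "\<lambda>_. \<tau>" borel "\<lambda>z. z"] in simp)

lemma integral_heat: "\<tau> > 0 \<Longrightarrow> (LINT z|lborel. heat \<tau> z) = 1"
  using nn_integral_heat[of \<tau>] by (subst integral_eq_nn_integral) (auto simp: heat_nonneg)

lemma AE_not_frontier_cbox: "AE y in lborel. y \<notin> frontier (cbox a (b::'a::euclidean_space))"
proof -
  have "negligible (frontier (cbox a b))" by (rule negligible_convex_frontier[OF convex_box(1)])
  then have "AE y in lebesgue. y \<notin> frontier (cbox a b)"
    by (intro AE_not_in) (simp add: negligible_iff_null_sets)
  then show ?thesis by (simp add: AE_completion_iff)
qed

lemma indicator_shift_tendsto:
  fixes Q :: "'a::real_normed_vector set"
  assumes "y \<notin> frontier Q" "z \<longlonglongrightarrow> 0"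
  shows "(\<lambda>n. indicator Q (y - z n) :: real) \<longlonglongrightarrow> indicator Q y"
proof -
  have lim: "(\<lambda>n. y - z n) \<longlonglongrightarrow> y" using tendsto_diff[OF tendsto_const assms(2), of y] by simp
  have "\<forall>\<^sub>F n in sequentially. indicator Q (y - z n) = (indicator Q y :: real)"
  proof (cases "y \<in> Q")
    case True
    then have "y \<in> interior Q" using assms(1) closure_subset by (auto simp: frontier_def)
    then have "\<forall>\<^sub>F n in sequentially. y - z n \<in> interior Q" using lim by (auto simp: tendsto_def)
    then show ?thesis by eventually_elim (use True interior_subset in \<open>auto simp: indicator_def\<close>)
  next
    case False
    then have "y \<in> - closure Q" using assms(1) interior_subset by (auto simp: frontier_def)
    then have "\<forall>\<^sub>F n in sequentially. y - z n \<in> - closure Q"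
      using topological_tendstoD[OF lim, of "- closure Q"] by auto
    then show ?thesis by eventually_elim (use False closure_subset in \<open>auto simp: indicator_def\<close>)
  qed
  then show ?thesis by (rule tendsto_eventually)
qed

lemma integrable_indicator_cbox: "integrable lborel (indicator (cbox a (b::'a::euclidean_space)) :: 'a \<Rightarrow> real)"
  by (rule integrable_real_indicator) (use emeasure_bounded_finite[OF bounded_cbox, of a b] in auto)

text \<open>After rescaling, the mollification is an average of translates of \<open>g\<close> by
  \<open>sqrt (\<tau> n)\<close> times a standard Gaussian variable. By Fubini its integral over the
  cube averages the integrals \<open>?in\<close> of translated \<open>g\<close>, and these are
  continuous in the translation because the boundary of a cube is a null set.\<close>

lemma mollified_cube_integral:
  fixes g :: "real^3 \<Rightarrow> real"
  assumes [measurable]: "g \<in> borel_measurable borel" and gM: "\<And>y. \<bar>g y\<bar> \<le> M"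
    and \<tau>: "\<And>n. \<tau> n > 0" "\<tau> \<longlonglongrightarrow> 0"
  shows "(\<lambda>n. LINT x|lborel. indicator (cbox a b) x * (LINT y|lborel. g y * heat (\<tau> n) (y - x)))
    \<longlonglongrightarrow> (LINT y|lborel. indicator (cbox a b) y * g y)"
proof -
  let ?Q = "cbox a b"
  have M: "M \<ge> 0" using gM[of 0] by linarith
  have Qint: "integrable lborel (indicator ?Q :: real^3 \<Rightarrow> real)"
    by (rule integrable_indicator_cbox)
  let ?in = "\<lambda>z. LINT x|lborel. indicator ?Q x * g (x + z)"
  have in_eq: "?in z = (LINT y|lborel. indicator ?Q (y - z) * g y)" for z
    using lborel_integral_translate[of "\<lambda>x. indicator ?Q x * g (x + z)" z] by simp
  have in_bound: "\<bar>?in z\<bar> \<le> M * measure lborel ?Q" for z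
  proof -
    have "norm (?in z) \<le> (LINT x|lborel. M * indicator ?Q x)"
    proof (rule order_trans[OF integral_norm_bound integral_mono])
      show "integrable lborel (\<lambda>x. M * indicator ?Q x :: real)" using Qint by simp
      show "norm (indicator ?Q x * g (x + z)) \<le> M * indicator ?Q x" for x using gM by (auto simp: indicator_def)
      show "integrable lborel (\<lambda>x. norm (indicator ?Q x * g (x + z)))"
        by (rule integrable_norm, rule Bochner_Integration.integrable_bound[OF integrable_mult_right[OF Qint, of M]])
           (use gM M in \<open>auto simp: indicator_def intro!: AE_I2\<close>)
    qed
    then show ?thesis by simp
  qed
  have in_lim: "(\<lambda>n. ?in (z n)) \<longlonglongrightarrow> ?in 0" if z: "z \<longlonglongrightarrow> 0" for z
  proof -
    obtain K where K: "\<And>n. norm (z n) \<le> K"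
      using convergent_imp_Bseq[OF convergentI[OF z]] by (auto simp: Bseq_def)
    have "bounded ?Q" by simp
    then obtain R where R: "\<And>q. q \<in> ?Q \<Longrightarrow> norm q \<le> R" by (auto simp: bounded_iff)
    have K0: "K \<ge> 0" using K[of 0] norm_ge_zero order_trans by blast
    have "(\<lambda>n. LINT y|lborel. indicator ?Q (y - z n) * g y) \<longlonglongrightarrow> (LINT y|lborel. indicator ?Q y * g y)"
    proof (rule integral_dominated_convergence[where w="\<lambda>y. M * indicator (cball 0 (R + K)) y"])
      show "integrable lborel (\<lambda>y. M * indicator (cball 0 (R + K)) y :: real)"
        by (rule integrable_mult_right[OF integrable_real_indicator[OF _ emeasure_bounded_finite[OF bounded_cball]]]) simp
      show "AE y in lborel. (\<lambda>n. indicator ?Q (y - z n) * g y) \<longlonglongrightarrow> indicator ?Q y * g y"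
        using AE_not_frontier_cbox by eventually_elim (intro tendsto_intros indicator_shift_tendsto z)
      show "AE y in lborel. norm (indicator ?Q (y - z n) * g y) \<le> M * indicator (cball 0 (R + K)) y" for n
      proof (rule AE_I2)
        fix y
        show "norm (indicator ?Q (y - z n) * g y) \<le> M * indicator (cball 0 (R + K)) y"
        proof (cases "y - z n \<in> ?Q")
          case True
          have "norm y \<le> norm (y - z n) + norm (z n)" using norm_triangle_ineq[of "y - z n" "z n"] by simp
          then have "norm y \<le> R + K" using R[OF True] K[of n] by linarith
          then show ?thesis using True gM[of y] by simp
        qed (use M in simp)
      qed
    qed measurable
    then show ?thesis unfolding in_eq by simp
  qed
  have eq: "(LINT x|lborel. indicator ?Q x * (LINT y|lborel. g y * heat (\<tau> n) (y - x))) = (LINT w|lborel. ?in (sqrt (\<tau> n) *\<^sub>R w) * heat 1 w)" for n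
  proof -
    let ?t = "sqrt (\<tau> n)"
    have 1: "(LINT y|lborel. g y * heat (\<tau> n) (y - x)) = (LINT w|lborel. g (x + ?t *\<^sub>R w) * heat 1 w)" for x
    proof -
      have "(LINT y|lborel. g y * heat (\<tau> n) (y - x)) = (LINT z|lborel. g (x + z) * heat (\<tau> n) z)"
        using lborel_integral_translate[of "\<lambda>z. g (x + z) * heat (\<tau> n) z" x] by simp
      also have "\<dots> = (LINT w|lborel. g (x + ?t *\<^sub>R w) * heat 1 w)" by (rule heat_rescale_integral[OF _ \<tau>(1)]) measurable
      finally show ?thesis .
    qed
    let ?F = "\<lambda>x w. indicator ?Q x * g (x + ?t *\<^sub>R w) * heat 1 w"
    have int: "integrable (lborel \<Otimes>\<^sub>M lborel) (\<lambda>(x, w). ?F x w)"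
      unfolding lborel_prod
    proof (rule Bochner_Integration.integrable_bound)
      show "integrable lborel (\<lambda>p::(real^3) \<times> (real^3). (M * indicator ?Q (fst p)) * heat 1 (snd p))"
        using Qint integrable_heat[of 1] by (intro integrable_product_lborel) auto
      show "(\<lambda>(x, w). ?F x w) \<in> borel_measurable lborel" unfolding case_prod_beta' by measurable
      have "\<bar>?F x w\<bar> \<le> (M * indicator ?Q x) * heat 1 w" for x w
        using gM by (auto simp: abs_mult heat_nonneg indicator_def intro!: mult_right_mono)
      then show "AE p in lborel. norm (case p of (x, w) \<Rightarrow> ?F x w) \<le> norm ((M * indicator ?Q (fst p)) * heat 1 (snd p))"
        by (auto intro!: AE_I2 order_trans[OF _ abs_ge_self])
    qed
    have "(LINT x|lborel. indicator ?Q x * (LINT y|lborel. g y * heat (\<tau> n) (y - x))) = (LINT x|lborel. LINT w|lborel. ?F x w)"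
      unfolding 1 by (simp add: mult.assoc)
    also have "\<dots> = (LINT w|lborel. LINT x|lborel. ?F x w)"
      by (rule lborel_pair.Fubini_integral[OF int, symmetric])
    finally show ?thesis by simp
  qed
  have "(\<lambda>n. LINT w|lborel. ?in (sqrt (\<tau> n) *\<^sub>R w) * heat 1 w) \<longlonglongrightarrow> (LINT w|lborel. ?in 0 * heat 1 w)"
  proof (rule integral_dominated_convergence[where w="\<lambda>w. (M * measure lborel ?Q) * heat 1 w"])
    show "integrable lborel (\<lambda>w. (M * measure lborel ?Q) * heat 1 w)"
      by (intro integrable_mult_right integrable_heat) simp
    show "AE w in lborel. (\<lambda>n. ?in (sqrt (\<tau> n) *\<^sub>R w) * heat 1 w) \<longlonglongrightarrow> ?in 0 * heat 1 w"
    proof (intro AE_I2 tendsto_mult tendsto_const in_lim)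
      fix w :: "real^3"
      have "(\<lambda>n. sqrt (\<tau> n) *\<^sub>R w) \<longlonglongrightarrow> sqrt 0 *\<^sub>R w" by (intro tendsto_intros \<tau>(2))
      then show "(\<lambda>n. sqrt (\<tau> n) *\<^sub>R w) \<longlonglongrightarrow> 0" by simp
    qed
    show "AE w in lborel. norm (?in (sqrt (\<tau> n) *\<^sub>R w) * heat 1 w) \<le> (M * measure lborel ?Q) * heat 1 w" for n
      using in_bound by (auto simp: abs_mult heat_nonneg intro!: AE_I2 mult_right_mono)
    have [measurable]: "(\<lambda>w. ?in (f w)) \<in> borel_measurable lborel" if [measurable]: "f \<in> borel_measurable borel" for f :: "real^3 \<Rightarrow> real^3"
    proof -
      have "(\<lambda>(w, x). indicator ?Q x * g (x + f w)) \<in> borel_measurable (lborel \<Otimes>\<^sub>M lborel)"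
        unfolding lborel_prod case_prod_beta' by measurable
      from lborel.borel_measurable_lebesgue_integral[OF this] show ?thesis by simp
    qed
    show "(\<lambda>w. ?in 0 * heat 1 w) \<in> borel_measurable lborel" by measurable
    show "(\<lambda>w. ?in (sqrt (\<tau> n) *\<^sub>R w) * heat 1 w) \<in> borel_measurable lborel" for n by measurable
  qed
  then show ?thesis unfolding eq by (simp add: integral_heat)
qed

text \<open>The bound is integrated over a cube, where the mollifier disappears in the limit, and
  the cube then shrinks to a point by Lebesgue differentiation; \<open>b\<close> is continuous, so
  its averages converge. In this way no pointwise convergence of mollifications is required.\<close>

lemma mollifier_removal:
  fixes g b :: "real^3 \<Rightarrow> real"
  assumes g[measurable]: "g \<in> borel_measurable borel" and gM: "\<And>y. \<bar>g y\<bar> \<le> M"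
    and \<tau>: "\<And>n. \<tau> n > 0" "\<tau> \<longlonglongrightarrow> 0" and b: "continuous_on UNIV b"
    and moll: "\<And>n. AE x in lborel. \<bar>LINT y|lborel. g y * heat (\<tau> n) (y - x)\<bar> \<le> b x"
  shows "AE x in lborel. \<bar>g x\<bar> \<le> b x"
proof -
  have M: "M \<ge> 0" using gM[of 0] by linarith
  have b_meas[measurable]: "b \<in> borel_measurable borel" by (rule borel_measurable_continuous_onI[OF b])
  have Qb: "integrable lborel (\<lambda>x. indicator (cbox u v) x * b x)" for u v
    using borel_integrable_compact[OF compact_cbox continuous_on_subset[OF b subset_UNIV], of u v]
    by (auto simp: indicator_def if_distrib[of "\<lambda>c. c * _"] cong: if_cong)
  have cube: "\<bar>LINT y|lborel. indicator (cbox u v) y * g y\<bar> \<le> (LINT x|lborel. indicator (cbox u v) x * b x)" for u v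
  proof -
    have "\<bar>LINT x|lborel. indicator (cbox u v) x * (LINT y|lborel. g y * heat (\<tau> n) (y - x))\<bar>
        \<le> (LINT x|lborel. indicator (cbox u v) x * b x)" for n
    proof -
      let ?f = "\<lambda>x. indicator (cbox u v) x * (LINT y|lborel. g y * heat (\<tau> n) (y - x))"
      have ae: "AE x in lborel. norm (?f x) \<le> indicator (cbox u v) x * b x"
        using moll[of n] by eventually_elim (auto simp: indicator_def)
      have "(\<lambda>(x, y). g y * heat (\<tau> n) (y - x)) \<in> borel_measurable (lborel \<Otimes>\<^sub>M lborel)"
        unfolding lborel_prod case_prod_beta' by measurable
      from lborel.borel_measurable_lebesgue_integral[OF this]
      have m: "?f \<in> borel_measurable lborel" by measurable
      have "integrable lborel ?f"
        by (rule Bochner_Integration.integrable_bound[OF Qb[of u v] m]) (use ae in \<open>eventually_elim, auto\<close>)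
      then have "(LINT x|lborel. \<bar>?f x\<bar>) \<le> (LINT x|lborel. indicator (cbox u v) x * b x)"
        using ae by (intro integral_mono_AE Qb) auto
      then show ?thesis using integral_abs_bound[of lborel ?f] by linarith
    qed
    moreover have "(\<lambda>n. \<bar>LINT x|lborel. indicator (cbox u v) x * (LINT y|lborel. g y * heat (\<tau> n) (y - x))\<bar>) \<longlonglongrightarrow> \<bar>LINT y|lborel. indicator (cbox u v) y * g y\<bar>"
      by (intro tendsto_rabs mollified_cube_integral[OF g gM \<tau>])
    ultimately show ?thesis by (intro tendsto_upperbound) auto
  qed
  have Hk: "f integrable_on cbox u v" "integral (cbox u v) f = (LINT y|lborel. indicator (cbox u v) y * f y)"
    if "integrable lborel (\<lambda>x. indicator (cbox u v) x * f x)" for f :: "real^3 \<Rightarrow> real" and u v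
    using set_borel_integral_eq_integral[of "cbox u v" f] that by (auto simp: set_integrable_def set_lebesgue_integral_def)
  have Qg: "integrable lborel (\<lambda>x. indicator (cbox u v) x * g x)" for u v
    by (rule Bochner_Integration.integrable_bound[OF integrable_mult_right[OF integrable_indicator_cbox, of M u v]])
       (use gM M in \<open>auto simp: indicator_def intro!: AE_I2\<close>)
  obtain N where N: "negligible N"
    "\<And>x e. \<lbrakk>x \<notin> N; 0 < e\<rbrakk> \<Longrightarrow> \<exists>d>0. \<forall>h. 0 < h \<and> h < d \<longrightarrow> norm (integral (cbox x (x + h *\<^sub>R One)) g /\<^sub>R h ^ DIM(real^3) - g x) < e"
    using integrable_ccontinuous_explicit[OF Hk(1)[OF Qg]] by blast
  have main: "\<bar>g x\<bar> \<le> b x" if x: "x \<notin> N" for x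
  proof (rule field_le_epsilon)
    fix e :: real assume e: "e > 0"
    obtain d where d: "d > 0" "\<And>h. 0 < h \<and> h < d \<Longrightarrow> norm (integral (cbox x (x + h *\<^sub>R One)) g /\<^sub>R h ^ DIM(real^3) - g x) < e / 2"
      using N(2)[OF x, of "e / 2"] e by auto
    have "isCont b x" using b by (simp add: continuous_on_eq_continuous_at)
    then obtain r where r: "r > 0" "\<And>y. dist y x < r \<Longrightarrow> dist (b y) (b x) < e / 2"
      using e unfolding continuous_at_eps_delta by (meson half_gt_zero)
    \<comment> \<open>Points of the cube differ from \<open>x\<close> by at most
      \<open>3 * h\<close> in the sum norm, which this choice keeps below \<open>r\<close>.\<close>
    define h where "h = min d (r / 4) / 2"
    have h: "0 < h" "h < d" "h * 3 < r" using d(1) r(1) by (auto simp: h_def min_def)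
    let ?Q = "cbox x (x + h *\<^sub>R One)"
    have mQ: "measure lborel ?Q = h ^ 3"
      using h(1) by (subst measure_lborel_cbox) (auto simp: inner_add_left inner_sum_left inner_Basis if_distrib cong: if_cong)
    have bQ: "b y \<le> b x + e / 2" if "y \<in> ?Q" for y
    proof -
      have "dist y x \<le> (\<Sum>e\<in>Basis. \<bar>(y - x) \<bullet> e\<bar>)" unfolding dist_norm by (rule norm_le_l1)
      also have "\<dots> \<le> (\<Sum>e\<in>(Basis :: (real^3) set). h)"
        using that by (intro sum_mono) (auto simp: mem_box inner_diff_left inner_add_left algebra_simps)
      finally have "dist y x < r" using h(3) by simp
      from r(2)[OF this] show ?thesis unfolding dist_real_def by linarith
    qed
    have "(LINT y|lborel. indicator ?Q y * b y) \<le> (LINT y|lborel. (b x + e / 2) * indicator ?Q y)"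
      by (rule integral_mono[OF Qb integrable_mult_right[OF integrable_indicator_cbox]])
         (use bQ in \<open>auto simp: indicator_def\<close>)
    also have "\<dots> = (b x + e / 2) * h ^ 3" by (simp add: mQ)
    finally have "\<bar>integral ?Q g\<bar> \<le> (b x + e / 2) * h ^ 3"
      using cube[of x "x + h *\<^sub>R One"] unfolding Hk(2)[OF Qg] by linarith
    then have "\<bar>integral ?Q g /\<^sub>R h ^ DIM(real^3)\<bar> \<le> b x + e / 2"
      using h(1) by (simp add: abs_mult divide_simps mult.commute)
    moreover have "\<bar>integral ?Q g /\<^sub>R h ^ DIM(real^3) - g x\<bar> < e / 2" using d(2)[of h] h by (simp only: real_norm_def)
    ultimately show "\<bar>g x\<bar> \<le> b x + e" by linarith
  qed
  have "AE x in lebesgue. x \<notin> N" using N(1) by (intro AE_not_in) (simp add: negligible_iff_null_sets)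
  then have "AE x in lborel. x \<notin> N" by (simp add: AE_completion_iff)
  then show ?thesis by eventually_elim (rule main)
qed

subsection \<open>Spatial decay\<close>

text \<open>With \<open>t = (norm z)\<^sup>2 / (4 * \<sigma>)\<close>, the inequality
  \<open>t\<^sup>2 / 2 \<le> exp t\<close> trades the Gaussian for \<open>2 / t\<^sup>2\<close>,
  which is where \<open>32 * \<sigma>\<^sup>2\<close> and the fourth power come from.\<close>

lemma heat_le_inverse_power:
  assumes "\<sigma> > 0" "z \<noteq> 0"
  shows "heat \<sigma> z \<le> 32 * sqrt \<sigma> * (1 / norm z ^ 4)"
proof -
  define t where "t = (norm z)\<^sup>2 / (4 * \<sigma>)"
  have t: "t > 0" using assms by (simp add: t_def)
  have "t\<^sup>2 / 2 \<le> exp t"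
    using exp_lower_Taylor_quadratic[of t] t by linarith
  then have "exp (- t) * t\<^sup>2 \<le> 2" using t by (simp add: exp_minus field_simps)
  then have e: "exp (- t) \<le> 2 / t\<^sup>2" using t by (simp add: pos_le_divide_eq)
  have "heat \<sigma> z = (4 * pi * \<sigma>) powr (-3/2) * exp (- t)" by (simp add: heat_def t_def)
  also have "\<dots> \<le> \<sigma> powr (-3/2) * (2 / t\<^sup>2)"
  proof (rule mult_mono[OF _ e])
    have "\<sigma> \<le> 4 * pi * \<sigma>" using assms pi_ge_two mult_right_mono[of 1 "4 * pi" \<sigma>] by simp
    then show "(4 * pi * \<sigma>) powr (-3/2) \<le> \<sigma> powr (-3/2)" using assms by (intro powr_mono2') auto
  qed auto
  also have "2 / t\<^sup>2 = \<sigma>\<^sup>2 * (32 * (1 / norm z ^ 4))" using assms by (simp add: t_def power2_eq_square power4_eq_xxxx field_simps)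
  also have "\<sigma> powr (-3/2) * (\<sigma>\<^sup>2 * (32 * (1 / norm z ^ 4))) = (\<sigma> powr (-3/2) * \<sigma>\<^sup>2) * (32 * (1 / norm z ^ 4))"
    by (rule mult.assoc[symmetric])
  also have "\<sigma> powr (-3/2) * \<sigma>\<^sup>2 = sqrt \<sigma>"
  proof -
    have "\<sigma>\<^sup>2 = \<sigma> powr 2" using assms by simp
    then have "\<sigma> powr (-3/2) * \<sigma>\<^sup>2 = \<sigma> powr (-3/2) * \<sigma> powr 2" by (simp only:)
    also have "\<dots> = \<sigma> powr (1/2)" by (subst powr_add[symmetric]) simp
    finally show ?thesis using assms by (simp add: powr_half_sqrt)
  qed
  finally show ?thesis by (simp only: mult_ac)
qed

lemma decay_nonneg: "0 \<le> \<delta> \<Longrightarrow> 0 \<le> decay a \<delta> x"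
  by (simp add: decay_def)

lemma decay_continuous: "continuous_on UNIV (decay a \<delta>)"
proof -
  have "1 + norm x \<noteq> 0" for x :: "real^3" using norm_ge_zero[of x] by linarith
  then show ?thesis unfolding decay_def[abs_def] by (intro continuous_intros) auto
qed

lemma powr_4_le_decay: "a \<le> 4 \<Longrightarrow> 0 \<le> \<delta> \<Longrightarrow> (1 + norm x) powr -4 \<le> decay a \<delta> x"
proof -
  assume "a \<le> 4" "0 \<le> \<delta>"
  then have "(1 + norm x) powr -4 \<le> (1 + norm x) powr - a" by (intro powr_mono) auto
  then show ?thesis using \<open>0 \<le> \<delta>\<close> by (simp add: decay_def)
qed

context ns_data
begin

text \<open>The same two regions as in \<open>kern_split\<close>: where \<open>y\<close> is near the
  origin the heat kernel decays and the total integral of \<open>u0\<close> is used, with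
  \<open>512 = 32 * 16\<close>; elsewhere the decay of \<open>u0\<close> is used and the kernel has
  mass one.\<close>

lemma moll0_bound:
  assumes u0: "AE y in lborel. norm (u0 y) \<le> A0 * (1 + norm y) powr - a" and A0: "A0 \<ge> 0"
    and a: "0 \<le> a" "a \<le> 4" and \<sigma>: "0 < \<sigma>" "\<sigma> \<le> \<sigma>m"
  shows "\<bar>moll0 i \<sigma> x\<bar> \<le> (512 * sqrt \<sigma>m * (LINT y|lborel. norm (u0 y)) + 16 * A0) * (1 + norm x) powr - a"
proof -
  let ?n = "LINT y|lborel. norm (u0 y)"
  have n: "?n \<ge> 0" by simp
  have nn: "(\<integral>\<^sup>+y. ennreal (norm (u0 y)) \<partial>lborel) = ennreal ?n"
    using u0_int by (intro nn_integral_eq_integral) auto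
  let ?c1 = "512 * sqrt \<sigma> * (1 + norm x) powr -4" and ?c2 = "16 * A0 * (1 + norm x) powr - a"
  have c: "?c1 \<ge> 0" "?c2 \<ge> 0" using A0 \<sigma> by auto
  have "ennreal (norm (moll0 i \<sigma> x)) \<le> (\<integral>\<^sup>+y. ennreal (norm (u0 y $ i * heat \<sigma> (y - x))) \<partial>lborel)"
    unfolding moll0_def by (rule norm_integral_le_nn_integral)
  also have "\<dots> \<le> (\<integral>\<^sup>+y. ennreal ?c1 * ennreal (norm (u0 y)) + ennreal ?c2 * ennreal (heat \<sigma> (y - x)) \<partial>lborel)"
  proof (rule nn_integral_mono_AE)
    show "AE y in lborel. ennreal (norm (u0 y $ i * heat \<sigma> (y - x))) \<le> ennreal ?c1 * ennreal (norm (u0 y)) + ennreal ?c2 * ennreal (heat \<sigma> (y - x))"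
      using u0
    proof eventually_elim
      case (elim y)
      have h: "heat \<sigma> (y - x) \<ge> 0" by (rule heat_nonneg)
      have "norm (u0 y $ i * heat \<sigma> (y - x)) \<le> norm (u0 y) * heat \<sigma> (y - x)"
        using h component_le_norm_cart[of "u0 y" i] by (simp add: abs_mult mult_right_mono)
      also have "\<dots> \<le> ?c1 * norm (u0 y) + ?c2 * heat \<sigma> (y - x)"
      proof (cases "1 + norm y < (1 + norm x) / 2")
        case True
        have "heat \<sigma> (y - x) \<le> 32 * sqrt \<sigma> * (1 / norm (y - x) ^ 4)"
          by (rule heat_le_inverse_power[OF \<sigma>(1) near_inverse_power(1)[OF True]])
        also have "\<dots> \<le> 32 * sqrt \<sigma> * (16 * (1 + norm x) powr -4)"
          using \<sigma> by (intro mult_left_mono near_inverse_power(2)[OF True]) auto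
        finally have "norm (u0 y) * heat \<sigma> (y - x) \<le> norm (u0 y) * ?c1" by (intro mult_left_mono) auto
        moreover have "0 \<le> ?c2 * heat \<sigma> (y - x)" using c(2) h by (rule mult_nonneg_nonneg)
        moreover have "norm (u0 y) * ?c1 = ?c1 * norm (u0 y)" by (rule mult.commute)
        ultimately show ?thesis by linarith
      next
        case False
        have "(1 + norm y) powr - a \<le> 16 * (1 + norm x) powr - a"
          using False a by (intro half_powr_le) auto
        then have "norm (u0 y) \<le> ?c2" using elim A0 mult_left_mono[of "(1 + norm y) powr - a" "16 * (1 + norm x) powr - a" A0] by simp
        then have "norm (u0 y) * heat \<sigma> (y - x) \<le> ?c2 * heat \<sigma> (y - x)" by (rule mult_right_mono[OF _ h])
        moreover have "0 \<le> ?c1 * norm (u0 y)" using c(1) by simp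
        ultimately show ?thesis by linarith
      qed
      finally show ?case using c h
        by (simp add: ennreal_mult[symmetric] ennreal_plus[symmetric] ennreal_leI del: ennreal_plus)
    qed
  qed
  also have "\<dots> = ennreal ?c1 * ennreal ?n + ennreal ?c2 * 1"
    using \<sigma>(1) by (subst nn_integral_add, measurable, subst nn_integral_cmult, measurable, subst nn_integral_cmult)
      (auto simp: nn nn_integral_heat_shift)
  also have "\<dots> = ennreal (?c1 * ?n + ?c2)"
    using c n by (simp add: ennreal_mult[symmetric] ennreal_plus[symmetric] del: ennreal_plus)
  finally have le: "ennreal (norm (moll0 i \<sigma> x)) \<le> ennreal (?c1 * ?n + ?c2)" .
  have "0 \<le> ?c1 * ?n + ?c2" by (intro add_nonneg_nonneg mult_nonneg_nonneg c n)
  from le[unfolded ennreal_le_iff[OF this]] have "\<bar>moll0 i \<sigma> x\<bar> \<le> ?c1 * ?n + ?c2" by (simp only: real_norm_def)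
  also have "?c1 * ?n \<le> (512 * sqrt \<sigma>m * (1 + norm x) powr - a) * ?n"
    using \<sigma> a by (intro mult_right_mono mult_mono mult_left_mono powr_mono) auto
  finally show ?thesis by (simp add: algebra_simps)
qed

lemma moll0_measurable[measurable]:
  assumes [measurable]: "g \<in> borel_measurable N"
  shows "(\<lambda>p. moll0 i \<tau> (g p)) \<in> borel_measurable N"
proof -
  have "(\<lambda>(p, y). u0 y $ i * heat \<tau> (y - g p)) \<in> borel_measurable (N \<Otimes>\<^sub>M borel)"
    unfolding case_prod_beta' by measurable
  also have "borel_measurable (N \<Otimes>\<^sub>M borel) = borel_measurable (N \<Otimes>\<^sub>M lborel)"
    by (intro measurable_cong_sets sets_pair_measure_cong) simp_all
  finally show ?thesis unfolding moll0_def by (rule lborel.borel_measurable_lebesgue_integral)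
qed

lemma duhamel_measurable[measurable]:
  assumes [measurable]: "f \<in> borel_measurable N" "g \<in> borel_measurable N"
  shows "(\<lambda>p. duhamel a \<delta> L l (f p) (g p)) \<in> borel_measurable N"
  unfolding duhamel_def by measurable

text \<open>So far the exceptional times depend on \<open>x\<close> and on \<open>\<sigma>1\<close>.
  Fubini exchanges \<open>x\<close> with the time, and rational \<open>\<sigma>1\<close> form a
  countable family, so almost every time admits all of them. For such a time let rational
  \<open>\<sigma>1\<close> decrease to \<open>\<nu> * s\<close>, which removes the
  mollifier.\<close>

lemma pointwise_component_bound:
  assumes hyp: "AE p in lborel. norm (V p) \<le> L * exp (l * fst p) * decay a \<delta> (snd p)"
    and l: "l > 0" and L: "L \<ge> 0" and a: "0 \<le> a" "a \<le> 4" and \<delta>: "0 \<le> \<delta>"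
    and A1: "\<And>\<sigma> x. 0 < \<sigma> \<Longrightarrow> \<sigma> \<le> \<nu> * T \<Longrightarrow> \<bar>moll0 i \<sigma> x\<bar> \<le> A1 * (1 + norm x) powr - a"
  shows "AE s in lborel. 0 \<le> s \<and> s < T \<longrightarrow>
    (AE x in lborel. \<bar>V (s, x) $ i\<bar> \<le> A1 * (1 + norm x) powr - a + duhamel a \<delta> L l s x)"
proof -
  let ?P = "\<lambda>\<sigma>1 s x. 0 \<le> s \<and> s < T \<and> \<nu> * s < \<sigma>1 \<longrightarrow>
    \<bar>moll i (\<sigma>1 - \<nu> * s) x s\<bar> \<le> \<bar>moll0 i \<sigma>1 x\<bar> + duhamel a \<delta> L l s x"
  have "AE s in lborel. AE x in lborel. ?P (of_rat q) s x" for q :: rat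
  proof -
    have "{p \<in> space (lborel \<Otimes>\<^sub>M lborel). ?P (of_rat q) (snd p) (fst p)} \<in> sets (lborel \<Otimes>\<^sub>M lborel)"
    proof -
      let ?h = "\<lambda>p::(real^3) \<times> real. if 0 \<le> snd p \<and> snd p < T \<and> \<nu> * snd p < of_rat q then
        \<bar>moll i (of_rat q - \<nu> * snd p) (fst p) (snd p)\<bar> - (\<bar>moll0 i (of_rat q) (fst p)\<bar> + duhamel a \<delta> L l (snd p) (fst p)) else 0"
      have "?h \<in> borel_measurable borel" by measurable
      from borel_measurable_le[OF this borel_measurable_const[of 0]]
      have "{p \<in> space borel. ?h p \<le> 0} \<in> sets borel" .
      moreover have "?h p \<le> 0 \<longleftrightarrow> ?P (of_rat q) (snd p) (fst p)" for p by (auto simp del: abs_le_iff)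
      ultimately show ?thesis unfolding lborel_prod space_lborel sets_lborel by (simp only:)
    qed
    from lborel_pair.AE_commute[OF this]
    have "(AE x in lborel. AE s in lborel. ?P (of_rat q) s x) \<longleftrightarrow> (AE s in lborel. AE x in lborel. ?P (of_rat q) s x)" .
    moreover have "AE x in lborel. AE s in lborel. ?P (of_rat q) s x"
      by (rule AE_I2) (rule mollified_bound[OF hyp l L a \<delta>])
    ultimately show ?thesis by (rule iffD1)
  qed
  then have "AE s in lborel. \<forall>q::rat. AE x in lborel. ?P (of_rat q) s x" by (simp add: AE_all_countable)
  then show ?thesis
  proof eventually_elim
    case (elim s)
    show ?case
    proof
      assume s: "0 \<le> s \<and> s < T"
      \<comment> \<open>Staying below \<open>\<nu> * T\<close> keeps the parameter in the range
        where \<open>A1\<close> bounds the initial term.\<close>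
      have "\<exists>q::rat. \<nu> * s < of_rat q \<and> of_rat q < min (\<nu> * s + 1 / Suc n) (\<nu> * T)" for n
      proof (rule of_rat_dense)
        have "\<nu> * s < \<nu> * T" using s \<nu>_pos by simp
        then show "\<nu> * s < min (\<nu> * s + 1 / Suc n) (\<nu> * T)" by simp
      qed
      then obtain q :: "nat \<Rightarrow> rat" where q: "\<And>n. \<nu> * s < of_rat (q n)" "\<And>n. of_rat (q n) < min (\<nu> * s + 1 / Suc n) (\<nu> * T)" by metis
      define \<tau> where "\<tau> n = of_rat (q n) - \<nu> * s" for n
      have \<tau>: "\<tau> n > 0" "\<tau> n \<le> 1 / Suc n" for n using q(1)[of n] q(2)[of n] by (auto simp: \<tau>_def)
      have \<tau>0: "\<tau> \<longlonglongrightarrow> 0"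
        by (rule tendsto_sandwich[OF _ _ tendsto_const LIMSEQ_Suc[OF lim_1_over_n]])
           (use \<tau> in \<open>auto intro!: always_eventually less_imp_le\<close>)
      show "AE x in lborel. \<bar>V (s, x) $ i\<bar> \<le> A1 * (1 + norm x) powr - a + duhamel a \<delta> L l s x"
      proof (rule mollifier_removal[OF _ _ \<tau>(1) \<tau>0])
        show "(\<lambda>y. V (s, y) $ i) \<in> borel_measurable borel" by measurable
        show "\<bar>V (s, y) $ i\<bar> \<le> M" for y using V_nth_le[of "(s, y)" i] V_bound[of "(s, y)"] by linarith
        have "continuous_on UNIV (\<lambda>x::real^3. A1 * decay a 0 x + 9 * oseen_const * (1024 * E * s * decay 4 0 x
           + 96 * M * L * decay a \<delta> x * \<nu> powr (-1/2) * exp (l * s) / sqrt l))"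
          using l by (intro continuous_intros decay_continuous) auto
        then show "continuous_on UNIV (\<lambda>x. A1 * (1 + norm x) powr - a + duhamel a \<delta> L l s x)"
          by (simp add: duhamel_def decay_def)
        fix n
        have s0: "0 < real_of_rat (q n)" using q(1)[of n] mult_nonneg_nonneg[of \<nu> s] s \<nu>_pos by linarith
        have "AE x in lborel. ?P (of_rat (q n)) s x" using elim by blast
        then show "AE x in lborel. \<bar>LINT y|lborel. V (s, y) $ i * heat (\<tau> n) (y - x)\<bar> \<le> A1 * (1 + norm x) powr - a + duhamel a \<delta> L l s x"
        proof eventually_elim
          case (elim x)
          have "\<bar>moll i (\<tau> n) x s\<bar> \<le> \<bar>moll0 i (of_rat (q n)) x\<bar> + duhamel a \<delta> L l s x"
            using elim s q(1)[of n] by (simp add: \<tau>_def)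
          moreover have "\<bar>moll0 i (of_rat (q n)) x\<bar> \<le> A1 * (1 + norm x) powr - a"
            using q(2)[of n] s0 by (intro A1) auto
          ultimately show ?case unfolding moll_def by linarith
        qed
      qed
    qed
  qed
qed

text \<open>A large growth rate \<open>l\<close> halves the old constant \<open>L\<close>. The
  constants are \<open>9216 = 9 * 1024\<close> and \<open>5184 = 6 * 864\<close>, where
  \<open>864 = 9 * 96\<close> stems from \<open>duhamel\<close> and the 6 from three components
  times the wanted factor 2.\<close>

lemma gronwall_step:
  assumes hyp: "AE p in lborel. norm (V p) \<le> L * exp (l * fst p) * decay a \<delta> (snd p)"
    and l: "l > 0" and L: "L \<ge> 0" and a: "0 \<le> a" "a \<le> 4" and \<delta>: "0 \<le> \<delta>"
    and A1: "A1 \<ge> 0" "\<And>i \<sigma> x. 0 < \<sigma> \<Longrightarrow> \<sigma> \<le> \<nu> * T \<Longrightarrow> \<bar>moll0 i \<sigma> x\<bar> \<le> A1 * (1 + norm x) powr - a"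
    and lM: "5184 * oseen_const * M * \<nu> powr (-1/2) \<le> sqrt l"
  shows "AE p in lborel. norm (V p) \<le> (3 * (A1 + 9216 * oseen_const * E * T) + L / 2) * exp (l * fst p) * decay a \<delta> (snd p)"
proof -
  let ?A = "3 * (A1 + 9216 * oseen_const * E * T) + L / 2"
  have A: "?A \<ge> 0" using A1(1) oseen_const(1) E_nonneg T_pos L by (intro add_nonneg_nonneg mult_nonneg_nonneg) auto
  have R: "3 * (A1 * (1 + norm x) powr - a + duhamel a \<delta> L l s x) \<le> ?A * exp (l * s) * decay a \<delta> x"
    if s: "0 \<le> s" "s < T" for s x
  proof -
    let ?d = "decay a \<delta> x" and ?e = "exp (l * s)"
    have d: "?d \<ge> 0" by (rule decay_nonneg[OF \<delta>])
    have e: "?e \<ge> 1" using s l by simp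
    have ed: "?d \<le> ?e * ?d" using mult_right_mono[OF e d] by simp
    have 1: "A1 * (1 + norm x) powr - a \<le> A1 * (?e * ?d)"
      using \<delta> ed by (intro mult_left_mono A1(1)) (simp add: decay_def)
    have "1024 * E * s * (1 + norm x) powr -4 \<le> 1024 * E * T * (?e * ?d)"
      using s E_nonneg T_pos powr_4_le_decay[OF a(2) \<delta>, of x] ed by (intro mult_mono) auto
    then have 2: "9 * oseen_const * (1024 * E * s * (1 + norm x) powr -4) \<le> 9 * oseen_const * (1024 * E * T * (?e * ?d))"
      using oseen_const(1) by (intro mult_left_mono) auto
    have sl: "sqrt l > 0" using l by simp
    have "6 * (864 * oseen_const * M * \<nu> powr (-1/2)) / sqrt l \<le> 1"
      using lM sl by (simp add: pos_divide_le_eq)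
    then have "864 * oseen_const * M * \<nu> powr (-1/2) / sqrt l \<le> 1 / 6" by simp
    then have "(864 * oseen_const * M * \<nu> powr (-1/2) / sqrt l) * (L * (?e * ?d)) \<le> 1 / 6 * (L * (?e * ?d))"
      using L d by (intro mult_right_mono) auto
    then have 3: "9 * oseen_const * (96 * M * L * ?d * \<nu> powr (-1/2) * ?e / sqrt l) \<le> 1 / 6 * (L * (?e * ?d))"
      by (simp add: mult_ac)
    have "A1 * (1 + norm x) powr - a + duhamel a \<delta> L l s x \<le> A1 * (?e * ?d) + 9 * oseen_const * (1024 * E * T * (?e * ?d)) + 1 / 6 * (L * (?e * ?d))"
      unfolding duhamel_def distrib_left[of "9 * oseen_const"] using 1 2 3 by linarith
    then show ?thesis by (simp add: algebra_simps)
  qed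
  have comp: "AE s in lborel. \<forall>i\<in>UNIV. 0 \<le> s \<and> s < T \<longrightarrow>
    (AE x in lborel. \<bar>V (s, x) $ i\<bar> \<le> A1 * (1 + norm x) powr - a + duhamel a \<delta> L l s x)"
    using pointwise_component_bound[OF hyp l L a \<delta> A1(2)] by (intro AE_finite_allI) auto
  have ae: "AE s in lborel. AE x in lborel. norm (V (s, x)) \<le> ?A * exp (l * s) * decay a \<delta> x"
    using comp AE_lborel_singleton[of T]
  proof eventually_elim
    case (elim s)
    show ?case
    proof (cases "0 \<le> s \<and> s < T")
      case True
      then have "AE x in lborel. \<forall>i\<in>UNIV. \<bar>V (s, x) $ i\<bar> \<le> A1 * (1 + norm x) powr - a + duhamel a \<delta> L l s x"
        using elim(1) by (intro AE_finite_allI) auto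
      then show ?thesis
      proof eventually_elim
        case (elim x)
        have "norm (V (s, x)) \<le> (\<Sum>i\<in>UNIV. \<bar>V (s, x) $ i\<bar>)" by (rule norm_le_l1_cart)
        also have "\<dots> \<le> (\<Sum>i\<in>(UNIV::3 set). A1 * (1 + norm x) powr - a + duhamel a \<delta> L l s x)"
          by (rule sum_mono) (use elim in blast)
        also have "\<dots> = 3 * (A1 * (1 + norm x) powr - a + duhamel a \<delta> L l s x)" by simp
        also have "\<dots> \<le> ?A * exp (l * s) * decay a \<delta> x" using True by (intro R) auto
        finally show ?case .
      qed
    next
      case False
      then have "V (s, x) = 0" for x using V_past[of "(s, x)"] V_future[of "(s, x)"] elim(2) by auto
      then show ?thesis using A decay_nonneg[OF \<delta>] by simp
    qed
  qed
  have m: "{p \<in> space (lborel \<Otimes>\<^sub>M lborel). norm (V p) \<le> ?A * exp (l * fst p) * decay a \<delta> (snd p)} \<in> sets (lborel \<Otimes>\<^sub>M lborel)"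
  proof -
    have "(\<lambda>p. norm (V p)) \<in> borel_measurable borel" "(\<lambda>p. ?A * exp (l * fst p) * decay a \<delta> (snd p)) \<in> borel_measurable borel"
      by measurable
    from borel_measurable_le[OF this] show ?thesis unfolding lborel_prod space_lborel sets_lborel .
  qed
  have "AE p in lborel \<Otimes>\<^sub>M lborel. norm (V p) \<le> ?A * exp (l * fst p) * decay a \<delta> (snd p)"
    by (rule lborel_pair.AE_pair_measure[OF m]) (simp only: fst_conv snd_conv ae)
  then show ?thesis unfolding lborel_prod .
qed

theorem spatial_decay:
  assumes u0: "AE y in lborel. norm (u0 y) \<le> A0 * (1 + norm y) powr - a" and A0: "A0 \<ge> 0"
    and a: "0 \<le> a" "a \<le> 4"
  obtains B where "B \<ge> 0" "AE p in lborel. norm (V p) \<le> B * (1 + norm (snd p)) powr - a"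
proof -
  define A1 where "A1 = 512 * sqrt (\<nu> * T) * (LINT y|lborel. norm (u0 y)) + 16 * A0"
  have A1: "A1 \<ge> 0" unfolding A1_def using A0 \<nu>_pos T_pos by (intro add_nonneg_nonneg mult_nonneg_nonneg) auto
  note A1b = moll0_bound[OF u0 A0 a, where \<sigma>m="\<nu> * T", folded A1_def]
  \<comment> \<open>The square meets the requirement of \<open>gronwall_step\<close>; adding 1 keeps
    \<open>l\<close> positive also when \<open>M = 0\<close>.\<close>
  define l where "l = (5184 * oseen_const * M * \<nu> powr (-1/2))\<^sup>2 + 1"
  have l: "l > 0" by (simp add: l_def add_nonneg_pos)
  have lM: "5184 * oseen_const * M * \<nu> powr (-1/2) \<le> sqrt l" by (rule real_le_rsqrt) (simp add: l_def)
  define A2 where "A2 = 3 * (A1 + 9216 * oseen_const * E * T)"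
  have A2: "A2 \<ge> 0" unfolding A2_def using A1 oseen_const(1) E_nonneg T_pos by (intro add_nonneg_nonneg mult_nonneg_nonneg) auto
  have bound: "AE p in lborel. norm (V p) \<le> 2 * A2 * exp (l * fst p) * decay a \<delta> (snd p)" if \<delta>: "\<delta> > 0" for \<delta>
  proof -
    \<comment> \<open>\<open>2 * A2\<close> is the fixed point of the map from \<open>L\<close> to
      \<open>A2 + L / 2\<close>, and each step halves the distance to it. Only this distance,
      initially \<open>M / \<delta>\<close>, depends on \<open>\<delta>\<close>.\<close>
    have "AE p in lborel. norm (V p) \<le> (2 * A2 + (M / \<delta>) * (1/2) ^ n) * exp (l * fst p) * decay a \<delta> (snd p)" for n
    proof (induction n)
      case 0
      have "norm (V p) \<le> (2 * A2 + (M / \<delta>) * (1/2) ^ 0) * exp (l * fst p) * decay a \<delta> (snd p)" for p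
      proof (cases "fst p < 0")
        case True
        then show ?thesis using V_past[of p] A2 M_nonneg \<delta> decay_nonneg[of \<delta> a "snd p"] by simp
      next
        case False
        have "M = (M / \<delta>) * 1 * \<delta>" using \<delta> by simp
        also have "\<dots> \<le> (2 * A2 + M / \<delta>) * exp (l * fst p) * decay a \<delta> (snd p)"
          using False \<delta> M_nonneg A2 l by (intro mult_mono) (auto simp: decay_def)
        finally show ?thesis using V_bound[of p] by simp
      qed
      then show ?case by simp
    next
      case (Suc n)
      have "0 \<le> 2 * A2 + (M / \<delta>) * (1/2) ^ n" using A2 M_nonneg \<delta> by simp
      from gronwall_step[OF Suc l this a less_imp_le[OF \<delta>] A1 A1b lM]
      moreover have "3 * (A1 + 9216 * oseen_const * E * T) + (2 * A2 + (M / \<delta>) * (1/2) ^ n) / 2 = 2 * A2 + (M / \<delta>) * (1/2) ^ Suc n"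
        unfolding A2_def[symmetric] by (simp add: field_simps)
      ultimately show ?case by (simp only:)
    qed
    then have "AE p in lborel. \<forall>n. norm (V p) \<le> (2 * A2 + (M / \<delta>) * (1/2) ^ n) * exp (l * fst p) * decay a \<delta> (snd p)"
      by (simp add: AE_all_countable)
    then show ?thesis
    proof eventually_elim
      case (elim p)
      have "(\<lambda>n. (2 * A2 + (M / \<delta>) * (1/2) ^ n) * exp (l * fst p) * decay a \<delta> (snd p)) \<longlonglongrightarrow> (2 * A2 + (M / \<delta>) * 0) * exp (l * fst p) * decay a \<delta> (snd p)"
        by (intro tendsto_intros LIMSEQ_power_zero) simp
      then have "norm (V p) \<le> (2 * A2 + (M / \<delta>) * 0) * exp (l * fst p) * decay a \<delta> (snd p)"
        by (rule tendsto_lowerbound) (use elim in auto)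
      then show ?case by simp
    qed
  qed
  have "AE p in lborel. \<forall>n. norm (V p) \<le> 2 * A2 * exp (l * fst p) * decay a (1 / Suc n) (snd p)"
    unfolding AE_all_countable by (intro allI bound) simp
  then have "AE p in lborel. norm (V p) \<le> (2 * A2 * exp (l * T)) * (1 + norm (snd p)) powr - a"
  proof eventually_elim
    case (elim p)
    show ?case
    proof (cases "fst p \<le> T")
      case True
      have "(\<lambda>n. 2 * A2 * exp (l * fst p) * decay a (1 / Suc n) (snd p)) \<longlonglongrightarrow> 2 * A2 * exp (l * fst p) * ((1 + norm (snd p)) powr - a + 0)"
        unfolding decay_def by (intro tendsto_intros LIMSEQ_Suc[OF lim_1_over_n])
      then have "norm (V p) \<le> 2 * A2 * exp (l * fst p) * ((1 + norm (snd p)) powr - a + 0)"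
        by (rule tendsto_lowerbound) (use elim in auto)
      also have "\<dots> \<le> (2 * A2 * exp (l * T)) * (1 + norm (snd p)) powr - a"
        using True A2 l by (simp add: mult_right_mono mult_left_mono)
      finally show ?thesis .
    qed (use V_future[of p] A2 in auto)
  qed
  then show ?thesis using that[of "2 * A2 * exp (l * T)"] A2 by simp
qed

end

subsection \<open>Leray solutions as Borel data\<close>

lemma AE_lebesgue_on_iff:
  assumes "S \<in> sets lebesgue"
  shows "(AE x in lebesgue_on S. P x) \<longleftrightarrow> (AE x in lborel. x \<in> S \<longrightarrow> P x)"
  using assms by (subst AE_restrict_space_iff) (auto simp: AE_completion_iff)

lemma time_strip_lebesgue: "({a..} \<times> UNIV :: (real \<times> 'a::euclidean_space) set) \<in> sets lebesgue"
  "({a..b} \<times> UNIV :: (real \<times> 'a::euclidean_space) set) \<in> sets lebesgue"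
proof -
  have "closed ({a..} \<times> UNIV :: (real \<times> 'a) set)" by (intro closed_Times closed_UNIV closed_atLeast)
  moreover have "closed ({a..b} \<times> UNIV :: (real \<times> 'a) set)" by (intro closed_Times closed_UNIV closed_atLeastAtMost)
  ultimately show "({a..} \<times> UNIV :: (real \<times> 'a) set) \<in> sets lebesgue" "({a..b} \<times> UNIV :: (real \<times> 'a) set) \<in> sets lebesgue"
    by auto
qed

text \<open>Completeness of Lebesgue measure; it permits comparing integrals of functions whose
  measurability is known for one of them only.\<close>

lemma lebesgue_measurable_cong_AE:
  assumes f: "f \<in> borel_measurable lebesgue" and ae: "AE x in lebesgue. f x = g x"
  shows "g \<in> borel_measurable lebesgue"
proof (rule measurableI)
  fix S :: "'b set" assume "S \<in> sets borel"
  then have 1: "f -` S \<inter> space lebesgue \<in> sets lebesgue" by (rule measurable_sets[OF f])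
  have 2: "AE x in lebesgue. x \<in> f -` S \<inter> space lebesgue \<longleftrightarrow> x \<in> g -` S \<inter> space lebesgue"
    using ae by eventually_elim auto
  show "g -` S \<inter> space lebesgue \<in> sets lebesgue"
    by (rule completion.in_sets_AE[OF 2 1]) auto
qed auto

lemma vector_borel_version:
  fixes f :: "'a::euclidean_space \<Rightarrow> real^3"
  assumes f: "f \<in> borel_measurable lebesgue"
  obtains g where "g \<in> borel_measurable borel" "AE x in lborel. f x = g x"
proof -
  have "\<exists>h\<in>borel_measurable lborel. AE x in lborel. f x $ i = h x" for i
    by (rule completion_ex_borel_measurable_real) (rule coord_measurable[OF f])
  then obtain h where h: "\<And>i. h i \<in> borel_measurable borel" "\<And>i. AE x in lborel. f x $ i = h i x"
    by (metis measurable_lborel2)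
  note [measurable] = h(1)
  define g where "g x = (\<Sum>i\<in>UNIV. h i x *\<^sub>R (axis i 1 :: real^3))" for x
  have "AE x in lborel. \<forall>i\<in>UNIV. f x $ i = h i x" using h(2) by (intro AE_finite_allI) auto
  then have "AE x in lborel. f x = g x"
    by eventually_elim (simp only: vec_eq_iff g_def sum_axis_nth, simp)
  moreover have "g \<in> borel_measurable borel" unfolding g_def[abs_def] by measurable
  ultimately show ?thesis using that by blast
qed

lemma dir_deriv_zero_direction:
  assumes "f differentiable (at x)" shows "dir_deriv 0 f x = 0"
  using linear_0[OF dir_deriv_linear[OF assms]] .

lemma divergence_free_borel_version:
  fixes f g :: "real^3 \<Rightarrow> real^3"
  assumes "weakly_divergence_free f" "AE x in lborel. f x = g x" "g \<in> borel_measurable borel"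
    and \<phi>: "test_function (\<phi> :: real^3 \<Rightarrow> real)"
  shows "(LINT x|lborel. dir_deriv (g x) \<phi> x) = 0"
proof -
  have s: "smooth \<phi>" using \<phi> by (simp add: test_function_def)
  have m: "(\<lambda>x. dir_deriv (g x) \<phi> x) \<in> borel_measurable lborel"
    using dir_deriv_field_meas[OF s assms(3)] by simp
  have m': "(\<lambda>x. dir_deriv (g x) \<phi> x) \<in> borel_measurable lebesgue"
    using measurable_completion[OF m] .
  have ae: "AE x in lebesgue. dir_deriv (g x) \<phi> x = dir_deriv (f x) \<phi> x"
    using assms(2) unfolding AE_completion_iff by eventually_elim simp
  have m'': "(\<lambda>x. dir_deriv (f x) \<phi> x) \<in> borel_measurable lebesgue"
    by (rule lebesgue_measurable_cong_AE[OF m' ae])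
  have "(LINT x|lborel. dir_deriv (g x) \<phi> x) = (LINT x|lebesgue. dir_deriv (g x) \<phi> x)"
    by (rule integral_completion[OF m, symmetric])
  also have "\<dots> = (LINT x|lebesgue. dir_deriv (f x) \<phi> x)"
    by (rule Bochner_Integration.integral_cong_AE[OF m' m'' ae])
  also have "\<dots> = 0" using assms(1) \<phi> by (simp add: weakly_divergence_free_def)
  finally show ?thesis .
qed

text \<open>Any vector field that satisfies the weak momentum equation agrees on \<open>[0, T]\<close> with a Borel field
  to which \<open>ns_data\<close> applies.\<close>

lemma borel_truncation:
  fixes u :: "real \<Rightarrow> real^3 \<Rightarrow> real^3" and T E M :: real
  assumes meas: "(\<lambda>(t, x). u t x) \<in> borel_measurable (lebesgue_on ({0..} \<times> UNIV))"
    and energy: "AE t in lebesgue_on {0..}. L2_norm_sq lebesgue (u t) \<le> ennreal E"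
    and bound: "AE p in lebesgue_on ({0..T} \<times> UNIV). norm (u (fst p) (snd p)) \<le> M" and M: "M \<ge> 0"
  obtains V where "V \<in> borel_measurable borel" "\<And>p. fst p < 0 \<Longrightarrow> V p = 0" "\<And>p. T < fst p \<Longrightarrow> V p = 0"
    "\<And>p. norm (V p) \<le> M" "\<And>s. (\<integral>\<^sup>+y. ennreal ((norm (V (s, y)))\<^sup>2) \<partial>lborel) \<le> ennreal E"
    "AE p in lborel. 0 \<le> fst p \<and> fst p \<le> T \<longrightarrow> V p = u (fst p) (snd p)"
proof -
  let ?S = "{0..} \<times> (UNIV :: (real^3) set)"
  have "(\<lambda>p. indicator ?S p *\<^sub>R (case p of (t, x) \<Rightarrow> u t x)) \<in> borel_measurable lebesgue"
    using meas by (subst borel_measurable_restrict_space_iff[symmetric]) (auto simp: time_strip_lebesgue)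
  then obtain W where W[measurable]: "W \<in> borel_measurable borel"
    and W_eq: "AE p in lborel. indicator ?S p *\<^sub>R (case p of (t, x) \<Rightarrow> u t x) = W p"
    by (rule vector_borel_version)
  have Wu: "AE p in lborel. 0 \<le> fst p \<longrightarrow> W p = u (fst p) (snd p)"
    using W_eq by eventually_elim (auto simp: indicator_def split: prod.splits)
  define e where "e s = (\<integral>\<^sup>+y. ennreal ((norm (W (s, y)))\<^sup>2) \<partial>lborel)" for s
  have e_meas[measurable]: "e \<in> borel_measurable borel"
  proof -
    have "(\<lambda>(s, y). ennreal ((norm (W (s, y)))\<^sup>2)) \<in> borel_measurable (lborel \<Otimes>\<^sub>M lborel)"
      unfolding lborel_prod case_prod_beta' by measurable
    from lborel.borel_measurable_nn_integral[OF this] show ?thesis by (simp add: e_def[abs_def])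
  qed
  \<comment> \<open>Cutting off also where the two bounds fail makes them hold everywhere, as
    \<open>ns_data\<close> demands, and changes the field on a null set only.\<close>
  define V where "V p = (if 0 \<le> fst p \<and> fst p \<le> T \<and> norm (W p) \<le> M \<and> e (fst p) \<le> ennreal E then W p else 0)" for p
  have Vm: "V \<in> borel_measurable borel" unfolding V_def[abs_def] by measurable
  have Ve: "(\<integral>\<^sup>+y. ennreal ((norm (V (s, y)))\<^sup>2) \<partial>lborel) \<le> ennreal E" for s
  proof (cases "e s \<le> ennreal E")
    case True
    have "(\<integral>\<^sup>+y. ennreal ((norm (V (s, y)))\<^sup>2) \<partial>lborel) \<le> e s"
      unfolding e_def by (intro nn_integral_mono) (simp add: V_def)
    then show ?thesis using True by (rule order_trans)
  next
    case False
    then have "V (s, y) = 0" for y by (simp add: V_def)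
    then show ?thesis by simp
  qed
  have "AE s in lborel. 0 \<le> s \<longrightarrow> e s \<le> ennreal E"
  proof -
    have "AE p in lborel \<Otimes>\<^sub>M lborel. 0 \<le> fst p \<longrightarrow> W p = u (fst p) (snd p)" unfolding lborel_prod by (rule Wu)
    from lborel_pair.AE_pair[OF this]
    have "AE s in lborel. AE y in lborel. 0 \<le> s \<longrightarrow> W (s, y) = u s y" by simp
    moreover have "AE s in lborel. 0 \<le> s \<longrightarrow> L2_norm_sq lebesgue (u s) \<le> ennreal E"
      using energy by (subst (asm) AE_lebesgue_on_iff) auto
    ultimately show ?thesis
    proof eventually_elim
      case (elim s)
      show ?case
      proof
        assume s: "0 \<le> s"
        have "e s = (\<integral>\<^sup>+y. ennreal ((norm (u s y))\<^sup>2) \<partial>lborel)"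
        proof -
          have "AE y in lborel. ennreal ((norm (W (s, y)))\<^sup>2) = ennreal ((norm (u s y))\<^sup>2)"
            using elim(1) by eventually_elim (simp add: s)
          then show ?thesis unfolding e_def by (rule nn_integral_cong_AE)
        qed
        then show "e s \<le> ennreal E" using elim(2) s by (simp add: L2_norm_sq_def nn_integral_completion)
      qed
    qed
  qed
  then have e1: "AE p in (lborel :: (real \<times> (real^3)) measure). 0 \<le> fst p \<longrightarrow> e (fst p) \<le> ennreal E"
  proof -
    assume ae: "AE s in lborel. 0 \<le> s \<longrightarrow> e s \<le> ennreal E"
    have "{p \<in> space (lborel \<Otimes>\<^sub>M lborel). 0 \<le> fst p \<longrightarrow> e (fst p) \<le> ennreal E} \<in> sets (lborel \<Otimes>\<^sub>M (lborel :: (real^3) measure))"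
    proof -
      let ?h = "\<lambda>p::real \<times> (real^3). if 0 \<le> fst p then e (fst p) else 0"
      have "?h \<in> borel_measurable borel" by measurable
      from borel_measurable_le[OF this borel_measurable_const[of "ennreal E"]]
      have "{p \<in> space borel. ?h p \<le> ennreal E} \<in> sets borel" .
      moreover have "?h p \<le> ennreal E \<longleftrightarrow> (0 \<le> fst p \<longrightarrow> e (fst p) \<le> ennreal E)" for p by simp
      ultimately show ?thesis unfolding lborel_prod space_lborel sets_lborel by (simp only:)
    qed
    moreover have "AE s in lborel. AE y in (lborel :: (real^3) measure). 0 \<le> fst (s, y) \<longrightarrow> e (fst (s, y)) \<le> ennreal E"
      using ae by eventually_elim simp
    ultimately have "AE p in lborel \<Otimes>\<^sub>M (lborel :: (real^3) measure). 0 \<le> fst p \<longrightarrow> e (fst p) \<le> ennreal E"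
      by (rule lborel_pair.AE_pair_measure)
    then show ?thesis unfolding lborel_prod .
  qed
  have "AE p in lborel. 0 \<le> fst p \<and> fst p \<le> T \<longrightarrow> norm (u (fst p) (snd p)) \<le> M"
    using bound by (subst (asm) AE_lebesgue_on_iff[OF time_strip_lebesgue(2)]) (auto simp: mem_Times_iff)
  with Wu e1 have "AE p in lborel. 0 \<le> fst p \<and> fst p \<le> T \<longrightarrow> V p = u (fst p) (snd p)"
    by eventually_elim (auto simp: V_def)
  then show ?thesis using that[OF Vm] Ve M by (simp add: V_def)
qed

lemma test_function_derivs_zero:
  fixes \<phi> :: "real \<times> (real^3) \<Rightarrow> real^3"
  assumes "\<And>p. T \<le> fst p \<Longrightarrow> \<phi> p = 0" and "T < fst p"
  shows "dir_deriv v \<phi> p = 0" "dir_deriv v (dir_deriv w \<phi>) p = 0"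
proof -
  have o: "open {p::real \<times> (real^3). T < fst p}" by (intro open_Collect_less continuous_intros)
  have 1: "dir_deriv v \<phi> q = 0" if "T < fst q" for v q
  proof -
    have "dir_deriv v \<phi> q = dir_deriv v (\<lambda>_. 0) q" by (rule dir_deriv_local[OF o]) (use that assms(1) in auto)
    then show ?thesis by (simp add: dir_deriv_def)
  qed
  show "dir_deriv v \<phi> p = 0" by (rule 1[OF assms(2)])
  have "dir_deriv v (dir_deriv w \<phi>) p = dir_deriv v (\<lambda>_. 0) p" by (rule dir_deriv_local[OF o]) (use 1 assms(2) in auto)
  then show "dir_deriv v (dir_deriv w \<phi>) p = 0" by (simp add: dir_deriv_def)
qed

text \<open>Truncation at time \<open>T\<close> is invisible to test fields that vanish from
  \<open>T\<close> on: beyond \<open>T\<close> their derivatives vanish, before time 0 both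
  integrands are zero, and in between \<open>V\<close> is the velocity. Hence the equation for
  \<open>u\<close> on all positive times passes to \<open>V\<close>.\<close>

lemma leray_ns_data:
  fixes u :: "real \<Rightarrow> real^3 \<Rightarrow> real^3" and u\<^sub>0 g :: "real^3 \<Rightarrow> real^3"
  assumes leray: "leray_solution \<nu> u\<^sub>0 u" and \<nu>: "\<nu> > 0" and T: "T > 0" and sm: "smooth_solution_upto T u"
    and g: "g \<in> borel_measurable borel" "AE x in lborel. u\<^sub>0 x = g x" "integrable lborel g"
  obtains M E V where "ns_data \<nu> T M E V g" "AE p in lborel. 0 \<le> fst p \<and> fst p \<le> T \<longrightarrow> V p = u (fst p) (snd p)"
proof -
  note [measurable] = g(1)
  obtain B where B: "AE t in lebesgue_on {0..}. L2_norm_sq lebesgue (u t) \<le> ennreal B"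
    using leray unfolding leray_solution_def by blast
  define E where "E = max B 0"
  have E: "AE t in lebesgue_on {0..}. L2_norm_sq lebesgue (u t) \<le> ennreal E"
    using B by eventually_elim (auto simp: E_def intro: order_trans ennreal_leI)
  obtain B' where B': "AE p in lebesgue_on ({0..T} \<times> UNIV). norm (case p of (s, x) \<Rightarrow> u s x) \<le> B'"
    using sm unfolding smooth_solution_upto_def in_Linf_def by blast
  define M where "M = max B' 0"
  have M: "M \<ge> 0" by (simp add: M_def)
  have M': "AE p in lebesgue_on ({0..T} \<times> UNIV). norm (u (fst p) (snd p)) \<le> M"
    using B' by eventually_elim (auto simp: M_def split: prod.splits)
  have um: "(\<lambda>(t, x). u t x) \<in> borel_measurable (lebesgue_on ({0..} \<times> UNIV))"
    using leray unfolding leray_solution_def by blast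
  obtain V where V[measurable]: "V \<in> borel_measurable borel"
    and V0: "\<And>p. fst p < 0 \<Longrightarrow> V p = 0" "\<And>p. T < fst p \<Longrightarrow> V p = 0"
    and Vb: "\<And>p. norm (V p) \<le> M" "\<And>s. (\<integral>\<^sup>+y. ennreal ((norm (V (s, y)))\<^sup>2) \<partial>lborel) \<le> ennreal E"
    and Vu: "AE p in lborel. 0 \<le> fst p \<and> fst p \<le> T \<longrightarrow> V p = u (fst p) (snd p)"
    by (rule borel_truncation[OF um E M' M]) (rule that, assumption+)
  have Vu': "AE s in lborel. AE y in lborel. 0 \<le> s \<and> s \<le> T \<longrightarrow> V (s, y) = u s y"
  proof -
    have "AE p in lborel \<Otimes>\<^sub>M lborel. 0 \<le> fst p \<and> fst p \<le> T \<longrightarrow> V p = u (fst p) (snd p)" unfolding lborel_prod by (rule Vu)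
    from lborel_pair.AE_pair[OF this] show ?thesis by simp
  qed
  have "ns_data \<nu> T M E V g"
  proof
    show "AE s in lborel. \<forall>\<phi> :: real^3 \<Rightarrow> real. test_function \<phi> \<longrightarrow> (LINT y|lborel. dir_deriv (V (s, y)) \<phi> y) = 0"
    proof -
      have "AE s in lebesgue_on {0..}. weakly_divergence_free (u s)" using leray unfolding leray_solution_def by blast
      then have "AE s in lborel. s \<in> {0..} \<longrightarrow> weakly_divergence_free (u s)" by (subst (asm) AE_lebesgue_on_iff) auto
      with Vu' show ?thesis
      proof eventually_elim
        case (elim s)
        show ?case
        proof (intro allI impI)
          fix \<phi> :: "real^3 \<Rightarrow> real" assume \<phi>: "test_function \<phi>"
          show "(LINT y|lborel. dir_deriv (V (s, y)) \<phi> y) = 0"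
          proof (cases "0 \<le> s \<and> s \<le> T")
            case True
            show ?thesis
            proof (rule divergence_free_borel_version[OF _ _ _ \<phi>])
              show "weakly_divergence_free (u s)" using elim True by simp
              show "AE y in lborel. u s y = V (s, y)" using elim(1) by eventually_elim (simp add: True)
              show "(\<lambda>y. V (s, y)) \<in> borel_measurable borel" by measurable
            qed
          next
            case False
            then have "V (s, y) = 0" for y using V0[of "(s, y)"] by auto
            moreover have "dir_deriv 0 \<phi> y = 0" for y
              using \<phi> by (intro dir_deriv_zero_direction smooth_differentiable) (simp add: test_function_def)
            ultimately show ?thesis by simp
          qed
        qed
      qed
    qed
    show "(LINT y|lborel. dir_deriv (g y) \<phi> y) = 0" if "test_function \<phi>" for \<phi> :: "real^3 \<Rightarrow> real"
    proof -
      have "weakly_divergence_free u\<^sub>0" using leray unfolding leray_solution_def by blast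
      from divergence_free_borel_version[OF this g(2,1) that] show ?thesis .
    qed
    fix \<phi> :: "real \<times> (real^3) \<Rightarrow> real^3"
    assume \<phi>: "test_function \<phi>" and div: "\<And>p. div_x \<phi> p = 0" and zero: "\<And>p. T \<le> fst p \<Longrightarrow> \<phi> p = 0"
    have s: "smooth \<phi>" using \<phi> by (simp add: test_function_def)
    have [measurable]: "dt \<phi> \<in> borel_measurable borel" "dx j \<phi> \<in> borel_measurable borel" "dx j (dx j \<phi>) \<in> borel_measurable borel" "\<phi> \<in> borel_measurable borel" for j
      unfolding dt_def dx_def by (intro borel_measurable_continuous_onI smooth_continuous_on smooth_dir_deriv s)+
    let ?I = "\<lambda>v p. v \<bullet> dt \<phi> p + \<nu> * (v \<bullet> laplace_x \<phi> p) + v \<bullet> (\<Sum>j\<in>UNIV. (v $ j) *\<^sub>R dx j \<phi> p)"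
    have Im: "(\<lambda>p. ?I (V p) p) \<in> borel_measurable lborel" unfolding laplace_x_def by measurable
    have I0: "?I v p = 0" if "T < fst p" for v p
      using test_function_derivs_zero[OF zero that] by (simp add: dt_def dx_def laplace_x_def)
    let ?S = "{0..} \<times> (UNIV :: (real^3) set)"
    let ?U = "\<lambda>p. case p of (t, x) \<Rightarrow> u t x \<bullet> dt \<phi> (t, x) + \<nu> * (u t x \<bullet> laplace_x \<phi> (t, x)) + u t x \<bullet> (\<Sum>j\<in>UNIV. (u t x $ j) *\<^sub>R dx j \<phi> (t, x))"
    have ae: "AE p in lebesgue. ?I (V p) p = indicator ?S p *\<^sub>R ?U p"
      using Vu unfolding AE_completion_iff
    proof eventually_elim
      case (elim p)
      obtain t x where p: "p = (t, x)" by (cases p)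
      consider "t < 0" | "0 \<le> t" "t \<le> T" | "T < t" by linarith
      then show ?case
      proof cases
        case 1 then show ?thesis using V0(1)[of p] p by simp
      next
        case 2 then show ?thesis using elim p by simp
      next
        case 3 then show ?thesis using I0[of p "V p"] I0[of p "u t x"] p T by simp
      qed
    qed
    have "(LINT p|lborel. ?I (V p) p) = (LINT p|lebesgue. ?I (V p) p)"
      by (rule integral_completion[OF Im, symmetric])
    also have "\<dots> = (LINT p|lebesgue. indicator ?S p *\<^sub>R ?U p)"
      by (rule Bochner_Integration.integral_cong_AE[OF measurable_completion[OF Im] lebesgue_measurable_cong_AE[OF measurable_completion[OF Im] ae] ae])
    also have "\<dots> = (LINT p|lebesgue_on ?S. ?U p)"
      by (rule integral_restrict_space[symmetric]) (simp add: time_strip_lebesgue)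
    finally have 1: "(LINT p|lborel. ?I (V p) p) = (LINT p|lebesgue_on ?S. ?U p)" .
    have m0: "(\<lambda>x. g x \<bullet> \<phi> (0, x)) \<in> borel_measurable lborel" by measurable
    have ae0: "AE x in lebesgue. g x \<bullet> \<phi> (0, x) = u\<^sub>0 x \<bullet> \<phi> (0, x)"
      using g(2) unfolding AE_completion_iff by eventually_elim simp
    have "(LINT x|lborel. g x \<bullet> \<phi> (0, x)) = (LINT x|lebesgue. g x \<bullet> \<phi> (0, x))"
      by (rule integral_completion[OF m0, symmetric])
    also have "\<dots> = (LINT x|lebesgue. u\<^sub>0 x \<bullet> \<phi> (0, x))"
      by (rule Bochner_Integration.integral_cong_AE[OF measurable_completion[OF m0] lebesgue_measurable_cong_AE[OF measurable_completion[OF m0] ae0] ae0])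
    finally have 2: "(LINT x|lborel. g x \<bullet> \<phi> (0, x)) = (LINT x|lebesgue. u\<^sub>0 x \<bullet> \<phi> (0, x))" .
    have "weak_NS \<nu> u\<^sub>0 u" using leray unfolding leray_solution_def by blast
    then show "(LINT p|lborel. ?I (V p) p) + (LINT x|lborel. g x \<bullet> \<phi> (0, x)) = 0"
      unfolding 1 2 weak_NS_def using \<phi> div by blast
  qed (use V V0 Vb \<nu> T M g in \<open>auto simp: E_def\<close>)
  then show ?thesis using that Vu by blast
qed

lemma smooth_solution_upto_mono:
  assumes "smooth_solution_upto t u" "s \<le> t" shows "smooth_solution_upto s u"
proof -
  have sub: "{0..s} \<times> (UNIV :: (real^3) set) \<subseteq> {0..t} \<times> UNIV" using assms(2) by auto
  obtain B where m: "(\<lambda>(s, x). u s x) \<in> borel_measurable (lebesgue_on ({0..t} \<times> UNIV))"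
    and B: "AE p in lebesgue_on ({0..t} \<times> UNIV). norm (case p of (s, x) \<Rightarrow> u s x) \<le> B"
    using assms(1) unfolding smooth_solution_upto_def in_Linf_def by blast
  have "AE p in lebesgue_on ({0..s} \<times> UNIV). norm (case p of (s, x) \<Rightarrow> u s x) \<le> B"
    using B unfolding AE_lebesgue_on_iff[OF time_strip_lebesgue(2)] by eventually_elim (use sub in auto)
  then show ?thesis
    using measurable_restrict_mono[OF m sub] unfolding smooth_solution_upto_def in_Linf_def by blast
qed

lemma weighted_norm_finite:
  fixes u :: "real \<Rightarrow> real^3 \<Rightarrow> real^3" and u\<^sub>0 :: "real^3 \<Rightarrow> real^3"
  assumes leray: "leray_solution \<nu> u\<^sub>0 u" and \<nu>: "\<nu> > 0" and \<beta>: "0 < \<beta>" "\<beta> < 1" "\<beta> < \<beta>'"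
    and L1: "in_L1 lebesgue u\<^sub>0" and Linf: "in_Linf lebesgue (\<lambda>x. ((1 + norm x) powr (3 + \<beta>')) *\<^sub>R u\<^sub>0 x)"
  shows "AE t in lebesgue_on {0..}. smooth_solution_upto t u \<longrightarrow>
    L2_norm_sq lebesgue (\<lambda>x. ((1 + norm x) powr (3/2 + \<beta>)) *\<^sub>R u t x) < \<infinity>"
proof -
  define fin where "fin t \<longleftrightarrow> L2_norm_sq lebesgue (\<lambda>x. ((1 + norm x) powr (3/2 + \<beta>)) *\<^sub>R u t x) < \<infinity>" for t
  \<comment> \<open>The decay of the kernel caps the exponent at 4. Both entries of the minimum
    exceed \<open>3 + \<beta>\<close>, the second because \<open>\<beta> < 1\<close>.\<close>
  define a where "a = min (3 + \<beta>') 4"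
  have a: "0 \<le> a" "a \<le> 4" "3 + \<beta> < a" "a \<le> 3 + \<beta>'" using \<beta> by (auto simp: a_def)
  have u0: "integrable lebesgue u\<^sub>0" using L1 by (simp add: in_L1_def)
  obtain g where g[measurable]: "g \<in> borel_measurable borel" and gu: "AE x in lborel. u\<^sub>0 x = g x"
    using vector_borel_version[OF borel_measurable_integrable[OF u0]] by blast
  have gi: "integrable lborel g"
  proof -
    have ae: "AE x in lebesgue. u\<^sub>0 x = g x" unfolding AE_completion_iff by (rule gu)
    have g': "g \<in> borel_measurable lborel" using g by simp
    from integrable_cong_AE[OF borel_measurable_integrable[OF u0] measurable_completion[OF g'] ae] u0
    have "integrable lebesgue g" by blast
    then show ?thesis using integrable_completion[OF g'] by blast
  qed
  obtain B0 where B0: "AE x in lebesgue. norm (((1 + norm x) powr (3 + \<beta>')) *\<^sub>R u\<^sub>0 x) \<le> B0"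
    using Linf unfolding in_Linf_def by blast
  have g_decay: "AE y in lborel. norm (g y) \<le> \<bar>B0\<bar> * (1 + norm y) powr - a"
    using gu B0[unfolded AE_completion_iff]
  proof eventually_elim
    case (elim y)
    have "1 + norm y > 0" by (simp add: add_pos_nonneg)
    then have p: "(1 + norm y) powr (3 + \<beta>') > 0" by simp
    have "norm (g y) * (1 + norm y) powr (3 + \<beta>') \<le> \<bar>B0\<bar>" using elim by (simp add: mult.commute)
    then have "norm (g y) \<le> \<bar>B0\<bar> / (1 + norm y) powr (3 + \<beta>')" using p by (simp add: pos_le_divide_eq)
    also have "\<dots> = \<bar>B0\<bar> * (1 + norm y) powr - (3 + \<beta>')" unfolding powr_minus by (simp add: divide_inverse)
    also have "\<dots> \<le> \<bar>B0\<bar> * (1 + norm y) powr - a" using a by (intro mult_left_mono powr_mono) auto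
    finally show ?case .
  qed
  have upto: "AE t in lborel. 0 \<le> t \<and> t \<le> T \<longrightarrow> fin t" if T: "T > 0" and sm: "smooth_solution_upto T u" for T
  proof -
    obtain M E V where ns: "ns_data \<nu> T M E V g" and Vu: "AE p in lborel. 0 \<le> fst p \<and> fst p \<le> T \<longrightarrow> V p = u (fst p) (snd p)"
      using leray_ns_data[OF leray \<nu> T sm g gu gi] by blast
    obtain B where B: "B \<ge> 0" "AE p in lborel. norm (V p) \<le> B * (1 + norm (snd p)) powr - a"
      using ns_data.spatial_decay[OF ns g_decay abs_ge_zero a(1,2)] by blast
    have "AE p in lborel. 0 \<le> fst p \<and> fst p \<le> T \<longrightarrow> norm (u (fst p) (snd p)) \<le> B * (1 + norm (snd p)) powr - a"
      using Vu B(2) by eventually_elim auto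
    then have "AE p in lborel \<Otimes>\<^sub>M lborel. 0 \<le> fst p \<and> fst p \<le> T \<longrightarrow> norm (u (fst p) (snd p)) \<le> B * (1 + norm (snd p)) powr - a"
      unfolding lborel_prod .
    from lborel_pair.AE_pair[OF this]
    have "AE t in lborel. AE x in lborel. 0 \<le> t \<and> t \<le> T \<longrightarrow> norm (u t x) \<le> B * (1 + norm x) powr - a" by simp
    then show ?thesis
    proof eventually_elim
      case (elim t)
      show ?case
      proof
        assume t: "0 \<le> t \<and> t \<le> T"
        have "L2_norm_sq lebesgue (\<lambda>x. ((1 + norm x) powr (3/2 + \<beta>)) *\<^sub>R u t x)
           = (\<integral>\<^sup>+x. ennreal ((norm (((1 + norm x) powr (3/2 + \<beta>)) *\<^sub>R u t x))\<^sup>2) \<partial>lborel)"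
          by (simp only: L2_norm_sq_def nn_integral_completion)
        also have "\<dots> \<le> (\<integral>\<^sup>+x. ennreal (B\<^sup>2) * ennreal ((1 + norm (x::real^3)) powr - (2 * a - 3 - 2 * \<beta>)) \<partial>lborel)"
        proof (rule nn_integral_mono_AE)
          show "AE x in lborel. ennreal ((norm (((1 + norm x) powr (3/2 + \<beta>)) *\<^sub>R u t x))\<^sup>2) \<le> ennreal (B\<^sup>2) * ennreal ((1 + norm x) powr - (2 * a - 3 - 2 * \<beta>))"
            using elim
          proof eventually_elim
            case (elim x)
            let ?r = "1 + norm x"
            have "norm ((?r powr (3/2 + \<beta>)) *\<^sub>R u t x) \<le> ?r powr (3/2 + \<beta>) * (B * ?r powr - a)"
              using elim t by (simp add: mult_left_mono)
            also have "\<dots> = B * (?r powr (3/2 + \<beta>) * ?r powr - a)" by (rule mult.left_commute)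
            also have "?r powr (3/2 + \<beta>) * ?r powr - a = ?r powr (3/2 + \<beta> + - a)" by (rule powr_add[symmetric])
            finally have "(norm ((?r powr (3/2 + \<beta>)) *\<^sub>R u t x))\<^sup>2 \<le> (B * ?r powr (3/2 + \<beta> + - a))\<^sup>2"
              by (rule power_mono) simp
            also have "\<dots> = B\<^sup>2 * (?r powr (3/2 + \<beta> + - a) * ?r powr (3/2 + \<beta> + - a))"
              unfolding power_mult_distrib power2_eq_square[of "?r powr _"] ..
            also have "?r powr (3/2 + \<beta> + - a) * ?r powr (3/2 + \<beta> + - a) = ?r powr - (2 * a - 3 - 2 * \<beta>)"
              unfolding powr_add[symmetric] by (rule arg_cong[where f="\<lambda>e. ?r powr e"]) simp
            finally have "ennreal ((norm ((?r powr (3/2 + \<beta>)) *\<^sub>R u t x))\<^sup>2) \<le> ennreal (B\<^sup>2 * ?r powr - (2 * a - 3 - 2 * \<beta>))"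
              by (rule ennreal_leI)
            also have "\<dots> = ennreal (B\<^sup>2) * ennreal (?r powr - (2 * a - 3 - 2 * \<beta>))" by (rule ennreal_mult) auto
            finally show ?case .
          qed
        qed
        also have "\<dots> = ennreal (B\<^sup>2) * (\<integral>\<^sup>+x. ennreal ((1 + norm (x::real^3)) powr - (2 * a - 3 - 2 * \<beta>)) \<partial>lborel)"
          by (rule nn_integral_cmult) measurable
        \<comment> \<open>\<open>a > 3 + \<beta>\<close> makes the exponent
          \<open>2 * a - 3 - 2 * \<beta>\<close> exceed 3.\<close>
        also have "\<dots> < \<infinity>"
          using nn_integral_radial_finite[of "2 * a - 3 - 2 * \<beta>"] a(3) by (simp add: ennreal_mult_less_top)
        finally show "fin t" by (simp add: fin_def)
      qed
    qed
  qed
  \<comment> \<open>Each final time brings its own null set, so only countably many of them may be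
    used.\<close>
  have "AE t in lborel. 0 \<le> t \<and> t \<le> of_rat q \<longrightarrow> 0 < q \<and> smooth_solution_upto (of_rat q) u \<longrightarrow> fin t" for q :: rat
  proof (cases "0 < q \<and> smooth_solution_upto (of_rat q) u")
    case True
    then show ?thesis using upto[of "of_rat q"] by simp
  next
    case False
    then show ?thesis by (intro AE_I2) blast
  qed
  then have rat: "AE t in lborel. \<forall>q::rat. 0 \<le> t \<and> t \<le> of_rat q \<longrightarrow> 0 < q \<and> smooth_solution_upto (of_rat q) u \<longrightarrow> fin t"
    by (simp add: AE_all_countable)
  \<comment> \<open>If the solution is bounded slightly beyond \<open>t\<close>, a rational final
    time fits in between. The one time that escapes is the last time of boundedness; there is at
    most one, hence a null set.\<close>
  define last where "last t \<longleftrightarrow> smooth_solution_upto t u \<and> (\<forall>s>t. \<not> smooth_solution_upto s u)" for t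
  have uniq: "t = t'" if "last t" "last t'" for t t'
    using that unfolding last_def by (meson linorder_neqE)
  have "AE t in lborel. \<not> last t"
  proof (cases "\<exists>t. last t")
    case True
    then obtain t0 where "last t0" by blast
    then show ?thesis using AE_lborel_singleton[of t0] uniq by (auto elim!: eventually_mono)
  qed simp
  with rat have "AE t in lborel. t \<in> {0..} \<longrightarrow> smooth_solution_upto t u \<longrightarrow> fin t"
  proof eventually_elim
    case (elim t)
    show ?case
    proof (intro impI)
      assume t: "t \<in> {0..}" and sm: "smooth_solution_upto t u"
      then obtain s where s: "s > t" "smooth_solution_upto s u" using elim(2) by (auto simp: last_def)
      obtain q :: rat where q: "t < of_rat q" "of_rat q < s" using of_rat_dense[OF s(1)] by blast
      have "0 < real_of_rat q" by (rule order.strict_trans1[OF _ q(1)]) (use t in simp)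
      then have "0 < q" by simp
      moreover have "smooth_solution_upto (of_rat q) u" by (rule smooth_solution_upto_mono[OF s(2)]) (use q in simp)
      ultimately show "fin t" using elim(1) t q(1) by (meson atLeast_iff less_imp_le)
    qed
  qed
  then show ?thesis unfolding fin_def by (subst AE_lebesgue_on_iff) auto
qed

subsection \<open>Fourier transform and energy spectrum\<close>

text \<open>One truncated coordinate \<open>F\<close> is dilated: the gradient of
  \<open>F (c *\<^sub>R y)\<close>, divided by \<open>c\<close>, is the gradient of \<open>F\<close>
  at \<open>c *\<^sub>R y\<close>. It is bounded uniformly in \<open>c\<close> and tends to the unit
  vector \<open>e_i\<close> as \<open>c\<close> tends to 0.\<close>

lemma divergence_free_mean_zero:
  fixes f :: "real^3 \<Rightarrow> real^3"
  assumes f: "integrable lborel f"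
    and div: "\<And>\<phi> :: real^3 \<Rightarrow> real. test_function \<phi> \<Longrightarrow> (LINT y|lborel. dir_deriv (f y) \<phi> y) = 0"
  shows "(LINT y|lborel. f y $ i) = 0"
proof -
  have [measurable]: "f \<in> borel_measurable borel" using f by auto
  define F where "F z = z $ i * chi 0 z" for z :: "real^3"
  have sF: "smooth F" unfolding F_def
    by (intro smooth_mult smooth_chi smooth_bounded_linear bounded_linear_vec_nth)
  have F_0: "F z = 0" if "norm z > 2" for z using chi_eq_0[of 0 z] that by (simp add: F_def)
  have tF: "test_function F" unfolding test_function_def by (rule conjI[OF sF compact_supportI[of 2]]) (rule F_0)
  have dF: "F differentiable (at z)" for z by (rule smooth_differentiable[OF sF])
  have "\<exists>C\<ge>0. \<forall>z. \<bar>dir_deriv (axis j 1) F z\<bar> \<le> C" for j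
  proof -
    have "Ckw 0 UNIV (\<lambda>_. 1) (\<lambda>_::unit. dir_deriv (axis j 1) F)"
      by (rule Ckw_dir_deriv_single[OF test_function_Ckw[OF tF]])
    then have "wbd UNIV (\<lambda>_. 1) (\<lambda>_::unit. dir_deriv (axis j 1) F)" by simp
    then show ?thesis unfolding wbd_def by simp
  qed
  then obtain C where C: "\<And>j. C j \<ge> 0" "\<And>j z. \<bar>dir_deriv (axis j 1) F z\<bar> \<le> C j" by metis
  define c where "c n = 1 / real (Suc n)" for n
  have c: "c n > 0" for n by (simp add: c_def)
  have c0: "c \<longlonglongrightarrow> 0" unfolding c_def by (rule LIMSEQ_Suc[OF lim_1_over_n])
  have zero: "(LINT y|lborel. dir_deriv (f y) F (c n *\<^sub>R y)) = 0" for n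
  proof -
    have sG: "smooth (\<lambda>y. F (c n *\<^sub>R y))" by (rule smooth_compose_linear[OF bounded_linear_scaleR_right sF])
    have G_0: "F (c n *\<^sub>R y) = 0" if "norm y > 2 / c n" for y
    proof -
      have "norm (c n *\<^sub>R y) > 2" using that c[of n] by (simp add: pos_divide_less_eq mult.commute)
      then show ?thesis by (rule F_0)
    qed
    have "test_function (\<lambda>y. F (c n *\<^sub>R y))" unfolding test_function_def by (rule conjI[OF sG compact_supportI[of "2 / c n"]]) (rule G_0)
    note div' = div[OF this]
    have e: "dir_deriv (f y) (\<lambda>y. F (c n *\<^sub>R y)) y = c n * dir_deriv (f y) F (c n *\<^sub>R y)" for y
      by (rule trans[OF dir_deriv_compose_linear(1)[OF bounded_linear_scaleR_right dF] dir_deriv_scaled[OF dF]])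
    have "c n * (LINT y|lborel. dir_deriv (f y) F (c n *\<^sub>R y)) = (LINT y|lborel. c n * dir_deriv (f y) F (c n *\<^sub>R y))"
      by (rule integral_mult_right_zero[symmetric])
    also have "\<dots> = 0" using div' unfolding e .
    finally show ?thesis using c[of n] by simp
  qed
  define D where "D j = dir_deriv (axis j 1) F" for j
  have coords: "dir_deriv v F z = (\<Sum>j\<in>UNIV. v $ j * D j z)" for v z
    using dir_deriv_coords[OF dF, of v z] by (simp add: D_def)
  have cont: "continuous_on UNIV (D j)" for j
    unfolding D_def by (intro smooth_continuous_on smooth_dir_deriv sF)
  have [measurable]: "D j \<in> borel_measurable borel" for j
    by (rule borel_measurable_continuous_onI[OF cont])
  have F0: "dir_deriv v F 0 = v $ i" for v
  proof -
    have "dir_deriv v F 0 = dir_deriv v (\<lambda>z. z $ i) 0"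
    proof (rule dir_deriv_local[of "ball 0 1"])
      show "F z = z $ i" if "z \<in> ball 0 1" for z using chi_eq_1[of z 0] that by (simp add: F_def)
    qed auto
    also have "\<dots> = v $ i"
      by (rule dir_deriv_eq[OF bounded_linear_imp_has_derivative[OF bounded_linear_vec_nth]])
    finally show ?thesis .
  qed
  have "(\<lambda>n. LINT y|lborel. dir_deriv (f y) F (c n *\<^sub>R y)) \<longlonglongrightarrow> (LINT y|lborel. dir_deriv (f y) F 0)"
  proof (rule integral_dominated_convergence[where w="\<lambda>y. (\<Sum>j\<in>UNIV. C j) * norm (f y)"])
    show "integrable lborel (\<lambda>y. (\<Sum>j\<in>UNIV. C j) * norm (f y))" using f by simp
    show "AE y in lborel. (\<lambda>n. dir_deriv (f y) F (c n *\<^sub>R y)) \<longlonglongrightarrow> dir_deriv (f y) F 0"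
    proof (rule AE_I2)
      fix y :: "real^3"
      have l: "(\<lambda>n. c n *\<^sub>R y) \<longlonglongrightarrow> 0" using tendsto_scaleR[OF c0 tendsto_const, of y] by simp
      have "(\<lambda>n. D j (c n *\<^sub>R y)) \<longlonglongrightarrow> D j 0" for j
        using cont[of j] by (intro isCont_tendsto_compose[OF _ l]) (simp add: continuous_on_eq_continuous_at)
      then show "(\<lambda>n. dir_deriv (f y) F (c n *\<^sub>R y)) \<longlonglongrightarrow> dir_deriv (f y) F 0"
        unfolding coords by (intro tendsto_intros)
    qed
    show "AE y in lborel. norm (dir_deriv (f y) F (c n *\<^sub>R y)) \<le> (\<Sum>j\<in>UNIV. C j) * norm (f y)" for n
    proof (rule AE_I2)
      fix y
      have "\<bar>dir_deriv (f y) F (c n *\<^sub>R y)\<bar> \<le> norm (f y) * (\<Sum>j\<in>UNIV. C j)"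
        by (rule order_trans[OF dir_deriv_abs_le[OF dF]]) (intro mult_left_mono sum_mono C norm_ge_zero)
      then show "norm (dir_deriv (f y) F (c n *\<^sub>R y)) \<le> (\<Sum>j\<in>UNIV. C j) * norm (f y)" by (simp add: mult.commute)
    qed
    show "(\<lambda>y. dir_deriv (f y) F 0) \<in> borel_measurable lborel" unfolding coords by measurable
    show "(\<lambda>y. dir_deriv (f y) F (c n *\<^sub>R y)) \<in> borel_measurable lborel" for n unfolding coords by measurable
  qed
  then have "(\<lambda>n::nat. 0::real) \<longlonglongrightarrow> (LINT y|lborel. f y $ i)" unfolding zero F0 .
  then show ?thesis using LIMSEQ_unique tendsto_const by blast
qed

lemma norm_exp_minus_one_le: "norm (exp (- \<i> * complex_of_real a) - 1) \<le> min 2 \<bar>a\<bar>"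
proof -
  have "norm (exp (\<i> * complex_of_real (- a)) - 1) \<le> \<bar>- a\<bar>"
    using iexp_approx1[of "- a" 0] by simp
  moreover have "norm (exp (- \<i> * complex_of_real a) - 1) \<le> norm (exp (- \<i> * complex_of_real a)) + norm (1::complex)"
    by (rule norm_triangle_ineq4)
  moreover have "norm (exp (- \<i> * complex_of_real a)) = 1"
    using norm_exp_i_times[of "- a"] by simp
  ultimately show ?thesis by simp
qed

text \<open>The first Cauchy--Schwarz factor at unit frequency, with the weight
  \<open>1 + norm x\<close> lowered to \<open>norm x\<close> to make it homogeneous. It converges at
  the origin because \<open>\<beta> < 1\<close> and at infinity because
  \<open>\<beta> > 0\<close>.\<close>

definition fourier_const :: "real \<Rightarrow> ennreal" where
  "fourier_const \<beta> = (\<integral>\<^sup>+y. ennreal ((min 2 (norm (y::real^3)))\<^sup>2 * norm y powr - (3 + 2 * \<beta>)) \<partial>lborel)"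

lemma fourier_const_finite:
  assumes "0 < \<beta>" "\<beta> < 1"
  shows "fourier_const \<beta> < \<infinity>"
proof -
  let ?p = "3 + 2 * \<beta>"
  have "fourier_const \<beta> \<le> (\<integral>\<^sup>+y. ennreal (norm (y::real^3) powr - (1 + 2 * \<beta>)) * indicator (cball 0 1) y
      + ennreal (4 * 2 powr ?p) * ennreal ((1 + norm y) powr - ?p) \<partial>lborel)"
    unfolding fourier_const_def
  proof (rule nn_integral_mono)
    fix y :: "real^3"
    show "ennreal ((min 2 (norm y))\<^sup>2 * norm y powr - ?p) \<le> ennreal (norm y powr - (1 + 2 * \<beta>)) * indicator (cball 0 1) y
      + ennreal (4 * 2 powr ?p) * ennreal ((1 + norm y) powr - ?p)"
    proof (cases "norm y \<le> 1")
      case True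
      have "(min 2 (norm y))\<^sup>2 * norm y powr - ?p \<le> norm y powr - (1 + 2 * \<beta>)"
      proof (cases "y = 0")
        case False
        then have n: "norm y > 0" by simp
        have "(min 2 (norm y))\<^sup>2 = norm y powr 2" using True n by simp
        then have "(min 2 (norm y))\<^sup>2 * norm y powr - ?p = norm y powr 2 * norm y powr - ?p" by (simp only:)
        also have "\<dots> = norm y powr (2 + - ?p)" by (rule powr_add[symmetric])
        also have "2 + - ?p = - (1 + 2 * \<beta>)" by simp
        finally show ?thesis by simp
      qed simp
      then show ?thesis using True by (simp add: ennreal_leI add_increasing2)
    next
      case False
      have "norm y powr - ?p \<le> ((1 + norm y) / 2) powr - ?p" using False assms by (intro powr_mono2') auto
      also have "\<dots> = 2 powr ?p * (1 + norm y) powr - ?p"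
        using False by (simp only: powr_divide powr_minus) (simp add: field_simps)
      finally have "(min 2 (norm y))\<^sup>2 * norm y powr - ?p \<le> 2\<^sup>2 * (2 powr ?p * (1 + norm y) powr - ?p)"
        by (intro mult_mono power_mono) auto
      also have "\<dots> = (4 * 2 powr ?p) * (1 + norm y) powr - ?p" by simp
      finally have "ennreal ((min 2 (norm y))\<^sup>2 * norm y powr - ?p) \<le> ennreal ((4 * 2 powr ?p) * (1 + norm y) powr - ?p)"
        by (rule ennreal_leI)
      also have "\<dots> = ennreal (4 * 2 powr ?p) * ennreal ((1 + norm y) powr - ?p)" by (rule ennreal_mult) auto
      finally show ?thesis by (simp add: add_increasing)
    qed
  qed
  also have "\<dots> = (\<integral>\<^sup>+y. ennreal (norm (y::real^3) powr - (1 + 2 * \<beta>)) * indicator (cball 0 1) y \<partial>lborel)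
      + ennreal (4 * 2 powr ?p) * (\<integral>\<^sup>+y. ennreal ((1 + norm (y::real^3)) powr - ?p) \<partial>lborel)"
  proof (subst nn_integral_add)
    show "(\<lambda>y::real^3. ennreal (norm y powr - (1 + 2 * \<beta>)) * indicator (cball 0 1) y) \<in> borel_measurable lborel"
      by (intro borel_measurable_times_ennreal borel_measurable_indicator) auto
  qed (auto simp: nn_integral_cmult)
  also have "\<dots> < \<infinity>"
    using nn_integral_singular_unit_ball_finite[of "1 + 2 * \<beta>"] nn_integral_radial_finite[of ?p] assms
    by (simp add: ennreal_mult_less_top)
  finally show ?thesis .
qed

text \<open>Substituting \<open>x = y / r\<close> yields \<open>r powr -3\<close> from the volume
  and \<open>r powr (3 + 2 * \<beta>)\<close> from the weight.\<close>

lemma fourier_const_scale: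
  assumes r: "r > 0"
  shows "(\<integral>\<^sup>+x. ennreal ((min 2 (norm (x::real^3) * r))\<^sup>2 * norm x powr - (3 + 2 * \<beta>)) \<partial>lborel) = ennreal (r powr (2 * \<beta>)) * fourier_const \<beta>"
proof -
  let ?p = "3 + 2 * \<beta>" and ?c = "1 / r"
  let ?f = "\<lambda>x::real^3. ennreal ((min 2 (norm x * r))\<^sup>2 * norm x powr - ?p)"
  have c: "?c > 0" using r by simp
  have "(\<integral>\<^sup>+x. ?f x \<partial>lborel) = (\<integral>\<^sup>+x. ?f x \<partial>density (distr lborel borel (\<lambda>x. 0 + ?c *\<^sub>R x)) (\<lambda>_. ennreal (\<bar>?c\<bar> ^ DIM(real^3))))"
    using lborel_affine[of ?c "0 :: real^3"] c by simp
  also have "\<dots> = (\<integral>\<^sup>+x. ennreal (\<bar>?c\<bar> ^ DIM(real^3)) * ?f x \<partial>distr lborel borel (\<lambda>x. 0 + ?c *\<^sub>R x))"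
    by (subst nn_integral_density) auto
  also have "\<dots> = (\<integral>\<^sup>+x. ennreal (\<bar>?c\<bar> ^ DIM(real^3)) * ?f (0 + ?c *\<^sub>R x) \<partial>lborel)"
    by (subst nn_integral_distr) auto
  also have "\<dots> = (\<integral>\<^sup>+y. ennreal (r powr (2 * \<beta>)) * ennreal ((min 2 (norm (y::real^3)))\<^sup>2 * norm y powr - ?p) \<partial>lborel)"
  proof (rule nn_integral_cong)
    fix y :: "real^3"
    have n: "norm (0 + ?c *\<^sub>R y) = norm y / r" using r by simp
    have "\<bar>?c\<bar> ^ 3 = r powr - 3"
    proof -
      have "r powr - real 3 = inverse (r ^ 3)" unfolding powr_minus powr_realpow[OF r] ..
      then have e: "r powr - 3 = inverse (r ^ 3)" by (simp only: of_nat_numeral)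
      show ?thesis unfolding e using r by (simp add: power_one_over inverse_eq_divide)
    qed
    moreover have "(norm y / r) powr - ?p = norm y powr - ?p * r powr ?p"
      using r by (simp only: powr_divide powr_minus norm_ge_zero less_imp_le) (simp add: field_simps)
    moreover have "r powr - 3 * r powr ?p = r powr (2 * \<beta>)" by (subst powr_add[symmetric]) simp
    ultimately have "\<bar>?c\<bar> ^ 3 * ((min 2 (norm y / r * r))\<^sup>2 * (norm y / r) powr - ?p) = r powr (2 * \<beta>) * ((min 2 (norm y))\<^sup>2 * norm y powr - ?p)"
      using r by (simp add: mult_ac)
    then have "\<bar>?c\<bar> ^ DIM(real^3) * ((min 2 (norm (0 + ?c *\<^sub>R y) * r))\<^sup>2 * norm (0 + ?c *\<^sub>R y) powr - ?p) = r powr (2 * \<beta>) * ((min 2 (norm y))\<^sup>2 * norm y powr - ?p)"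
      unfolding n by simp
    then show "ennreal (\<bar>?c\<bar> ^ DIM(real^3)) * ?f (0 + ?c *\<^sub>R y) = ennreal (r powr (2 * \<beta>)) * ennreal ((min 2 (norm y))\<^sup>2 * norm y powr - ?p)"
      by (subst (1 2) ennreal_mult[symmetric]) (simp_all del: min_less_iff_conj)
  qed
  also have "\<dots> = ennreal (r powr (2 * \<beta>)) * fourier_const \<beta>"
    unfolding fourier_const_def by (rule nn_integral_cmult) measurable
  finally show ?thesis .
qed

lemma fourier_bound:
  fixes g :: "real^3 \<Rightarrow> real^3"
  assumes [measurable]: "g \<in> borel_measurable borel" and int: "integrable lborel g"
    and zero: "\<And>i. (LINT y|lborel. g y $ i) = 0" and \<xi>: "\<xi> \<noteq> 0" and \<beta>: "0 < \<beta>"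
  shows "ennreal ((norm (fourier g \<xi>))\<^sup>2) \<le> ennreal 9 * (ennreal (norm \<xi> powr (2 * \<beta>)) * fourier_const \<beta>
     * (\<integral>\<^sup>+x. ennreal ((norm ((1 + norm x) powr (3/2 + \<beta>) *\<^sub>R g x))\<^sup>2) \<partial>lborel))"
proof -
  let ?m = "\<lambda>x::real^3. min 2 (norm x * norm \<xi>)" and ?w = "\<lambda>x::real^3. (1 + norm x) powr (3/2 + \<beta>)"
  let ?I = "\<integral>\<^sup>+x. ennreal (?m x * norm (g x)) \<partial>lborel"
  have gi: "integrable lborel (\<lambda>x. g x $ i)" for i
    by (rule Bochner_Integration.integrable_bound[OF integrable_norm[OF int]]) (auto simp: component_le_norm_cart)
  have comp: "ennreal (norm (fourier g \<xi> $ i)) \<le> ?I" for i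
  proof -
    let ?e = "\<lambda>x. exp (- \<i> * complex_of_real (x \<bullet> \<xi>))"
    have ne: "norm (?e x) = 1" for x using norm_exp_i_times[of "- (x \<bullet> \<xi>)"] by simp
    have cm: "(\<lambda>x. ?e x * complex_of_real (g x $ i)) \<in> borel_measurable lborel"
      by (intro borel_measurable_times borel_measurable_of_real) (auto intro!: borel_measurable_continuous_onI continuous_intros)
    have i1: "integrable lborel (\<lambda>x. ?e x * complex_of_real (g x $ i))"
      by (rule Bochner_Integration.integrable_bound[OF gi[of i] cm]) (simp add: norm_mult ne)
    have i2: "integrable lborel (\<lambda>x. complex_of_real (g x $ i))" using gi by (rule integrable_of_real)
    have "fourier g \<xi> $ i = (LINT x|lborel. ?e x * complex_of_real (g x $ i))"
      unfolding fourier_def using integral_completion[OF cm] by simp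
    \<comment> \<open>Subtracting the vanishing mean turns the exponential into its difference from
      1, which is small near the origin.\<close>
    also have "\<dots> = (LINT x|lborel. ?e x * complex_of_real (g x $ i)) - (LINT x|lborel. complex_of_real (g x $ i))"
      by (simp add: zero)
    also have "\<dots> = (LINT x|lborel. ?e x * complex_of_real (g x $ i) - complex_of_real (g x $ i))"
      using i1 i2 by simp
    also have "\<dots> = (LINT x|lborel. (?e x - 1) * complex_of_real (g x $ i))" by (simp add: algebra_simps)
    finally have eq: "fourier g \<xi> $ i = (LINT x|lborel. (?e x - 1) * complex_of_real (g x $ i))" .
    have "ennreal (norm (fourier g \<xi> $ i)) \<le> (\<integral>\<^sup>+x. ennreal (norm ((?e x - 1) * complex_of_real (g x $ i))) \<partial>lborel)"
      unfolding eq by (rule norm_integral_le_nn_integral)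
    also have "\<dots> \<le> ?I"
    proof (intro nn_integral_mono ennreal_leI)
      fix x
      have "norm (?e x - 1) \<le> ?m x"
        using norm_exp_minus_one_le[of "x \<bullet> \<xi>"] Cauchy_Schwarz_ineq2[of x \<xi>] by simp
      then show "norm ((?e x - 1) * complex_of_real (g x $ i)) \<le> ?m x * norm (g x)"
        unfolding norm_mult by (intro mult_mono) (auto simp: component_le_norm_cart)
    qed
    finally show ?thesis .
  qed
  \<comment> \<open>Summing three components costs a factor 3, which is squared to the 9 of the
    statement.\<close>
  have "ennreal (norm (fourier g \<xi>)) \<le> ennreal (\<Sum>i\<in>UNIV. norm (fourier g \<xi> $ i))"
    by (intro ennreal_leI) (simp add: norm_vec_def L2_set_le_sum)
  also have "\<dots> = (\<Sum>i\<in>UNIV. ennreal (norm (fourier g \<xi> $ i)))" by (simp add: sum_ennreal)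
  also have "\<dots> \<le> (\<Sum>i\<in>(UNIV::3 set). ?I)" by (intro sum_mono comp)
  also have "\<dots> = ennreal 3 * ?I" by simp
  finally have "(ennreal (norm (fourier g \<xi>)))\<^sup>2 \<le> (ennreal 3 * ?I)\<^sup>2" by (rule power_mono) simp
  then have 1: "ennreal ((norm (fourier g \<xi>))\<^sup>2) \<le> ennreal 9 * ?I\<^sup>2"
    by (simp add: power_mult_distrib ennreal_power)
  have "?I = (\<integral>\<^sup>+x. ennreal (?m x * inverse (?w x)) * ennreal (norm (?w x *\<^sub>R g x)) \<partial>lborel)"
  proof (rule nn_integral_cong)
    fix x :: "real^3"
    have "1 + norm x > 0" by (simp add: add_pos_nonneg)
    then have w: "?w x > 0" by simp
    have "?m x * norm (g x) = (?m x * inverse (?w x)) * norm (?w x *\<^sub>R g x)" using w by simp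
    then show "ennreal (?m x * norm (g x)) = ennreal (?m x * inverse (?w x)) * ennreal (norm (?w x *\<^sub>R g x))"
      by (simp only:) (rule ennreal_mult, auto)
  qed
  then have "?I\<^sup>2 \<le> (\<integral>\<^sup>+x. (ennreal (?m x * inverse (?w x)))\<^sup>2 \<partial>lborel) * (\<integral>\<^sup>+x. (ennreal (norm (?w x *\<^sub>R g x)))\<^sup>2 \<partial>lborel)"
    by (simp only:) (rule Cauchy_Schwarz_nn_integral, measurable)
  also have "(\<integral>\<^sup>+x. (ennreal (norm (?w x *\<^sub>R g x)))\<^sup>2 \<partial>lborel) = (\<integral>\<^sup>+x. ennreal ((norm (?w x *\<^sub>R g x))\<^sup>2) \<partial>lborel)"
    by (simp add: ennreal_power)
  \<comment> \<open>Passing to the larger homogeneous weight enables the scaling argument. At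
    \<open>x = 0\<close> the factor \<open>?m\<close> vanishes.\<close>
  also have "(\<integral>\<^sup>+x. (ennreal (?m x * inverse (?w x)))\<^sup>2 \<partial>lborel) \<le> (\<integral>\<^sup>+x. ennreal ((?m x)\<^sup>2 * norm x powr - (3 + 2 * \<beta>)) \<partial>lborel)"
  proof (rule nn_integral_mono)
    fix x :: "real^3"
    have m0: "?m x \<ge> 0" by simp
    show "(ennreal (?m x * inverse (?w x)))\<^sup>2 \<le> ennreal ((?m x)\<^sup>2 * norm x powr - (3 + 2 * \<beta>))"
    proof (cases "x = 0")
      case False
      have e: "(inverse (?w x))\<^sup>2 = (1 + norm x) powr - (3 + 2 * \<beta>)"
        unfolding power2_eq_square powr_minus[symmetric] powr_add[symmetric] by (rule arg_cong[where f="\<lambda>e. (1 + norm x) powr e"]) simp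
      have "(1 + norm x) powr - (3 + 2 * \<beta>) \<le> norm x powr - (3 + 2 * \<beta>)"
        using False \<beta> by (intro powr_mono2') auto
      then have "(?m x * inverse (?w x))\<^sup>2 \<le> (?m x)\<^sup>2 * norm x powr - (3 + 2 * \<beta>)"
        unfolding power_mult_distrib e by (intro mult_left_mono) auto
      moreover have "(ennreal (?m x * inverse (?w x)))\<^sup>2 = ennreal ((?m x * inverse (?w x))\<^sup>2)"
        by (rule ennreal_power) (intro mult_nonneg_nonneg m0, simp)
      ultimately show ?thesis by (simp only: ennreal_leI)
    qed simp
  qed
  also have "\<dots> = ennreal (norm \<xi> powr (2 * \<beta>)) * fourier_const \<beta>" by (rule fourier_const_scale) (use \<xi> in simp)
  finally have 2: "?I\<^sup>2 \<le> ennreal (norm \<xi> powr (2 * \<beta>)) * fourier_const \<beta> * (\<integral>\<^sup>+x. ennreal ((norm (?w x *\<^sub>R g x))\<^sup>2) \<partial>lborel)"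
    by (simp add: mult_right_mono)
  show ?thesis by (rule order_trans[OF 1 mult_left_mono[OF 2]]) simp
qed

text \<open>Write \<open>norm (g x)\<close> as the inverse weight times the weighted norm and use
  \<open>p * q \<le> p\<^sup>2 + q\<^sup>2\<close>; the squared inverse weight has exponent
  \<open>3 + 2 * \<beta> > 3\<close>.\<close>

lemma integrable_if_weighted_L2:
  fixes g :: "real^3 \<Rightarrow> real^3"
  assumes [measurable]: "g \<in> borel_measurable borel" and \<beta>: "0 < \<beta>"
    and fin: "(\<integral>\<^sup>+x. ennreal ((norm ((1 + norm x) powr (3/2 + \<beta>) *\<^sub>R g x))\<^sup>2) \<partial>lborel) < \<infinity>"
  shows "integrable lborel g"
proof (rule integrableI_bounded)
  let ?w = "\<lambda>x::real^3. (1 + norm x) powr (3/2 + \<beta>)"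
  have "(\<integral>\<^sup>+x. ennreal (norm (g x)) \<partial>lborel) \<le> (\<integral>\<^sup>+x. ennreal ((1 + norm x) powr - (3 + 2 * \<beta>)) + ennreal ((norm (?w x *\<^sub>R g x))\<^sup>2) \<partial>lborel)"
  proof (rule nn_integral_mono)
    fix x :: "real^3"
    have "1 + norm x > 0" by (simp add: add_pos_nonneg)
    then have w: "?w x > 0" by simp
    have e: "(inverse (?w x))\<^sup>2 = (1 + norm x) powr - (3 + 2 * \<beta>)"
      unfolding power2_eq_square powr_minus[symmetric] powr_add[symmetric] by (rule arg_cong[where f="\<lambda>e. (1 + norm x) powr e"]) simp
    have ge: "norm (g x) = inverse (?w x) * norm (?w x *\<^sub>R g x)" using w by simp
    have "p * q \<le> p\<^sup>2 + q\<^sup>2" for p q :: real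
      using zero_le_power2[of "p + q"] zero_le_power2[of "p - q"] unfolding power2_sum power2_diff by linarith
    from this[of "inverse (?w x)" "norm (?w x *\<^sub>R g x)"]
    have "norm (g x) \<le> (1 + norm x) powr - (3 + 2 * \<beta>) + (norm (?w x *\<^sub>R g x))\<^sup>2" unfolding e ge[symmetric] .
    then show "ennreal (norm (g x)) \<le> ennreal ((1 + norm x) powr - (3 + 2 * \<beta>)) + ennreal ((norm (?w x *\<^sub>R g x))\<^sup>2)"
      by (subst ennreal_plus[symmetric]) (simp_all only: powr_ge_zero zero_le_power2 ennreal_leI)
  qed
  also have "\<dots> = (\<integral>\<^sup>+x. ennreal ((1 + norm (x::real^3)) powr - (3 + 2 * \<beta>)) \<partial>lborel) + (\<integral>\<^sup>+x. ennreal ((norm (?w x *\<^sub>R g x))\<^sup>2) \<partial>lborel)"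
    by (rule nn_integral_add) measurable
  also have "\<dots> < \<infinity>" using nn_integral_radial_finite[of "3 + 2 * \<beta>"] \<beta> fin by simp
  finally show "(\<integral>\<^sup>+x. ennreal (norm (g x)) \<partial>lborel) < \<infinity>" .
qed measurable

lemma spectral_bump_bounded:
  assumes "spectral_bump \<psi>"
  obtains B where "B \<ge> 0" "\<And>r. \<psi> r \<le> B" "\<And>r. r \<notin> {1/2..2} \<Longrightarrow> \<psi> r = 0"
proof -
  have sm: "smooth \<psi>" and sub: "closure {r. \<psi> r \<noteq> 0} \<subseteq> {1/2..2}"
    using assms by (simp_all add: spectral_bump_def)
  have zero: "\<psi> r = 0" if "r \<notin> {1/2..2}" for r
    using sub closure_subset[of "{r. \<psi> r \<noteq> 0}"] that by blast
  have "bounded (\<psi> ` {1/2..2})"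
    by (intro compact_imp_bounded compact_continuous_image smooth_continuous_on[OF sm] compact_Icc)
  then obtain B where B: "B > 0" "\<And>r. r \<in> {1/2..2} \<Longrightarrow> norm (\<psi> r) \<le> B"
    unfolding bounded_pos by blast
  have "\<psi> r \<le> B" for r
  proof (cases "r \<in> {1/2..2}")
    case True
    then show ?thesis using B(2)[of r] by simp
  next
    case False
    then show ?thesis using zero[of r] B(1) by simp
  qed
  then show ?thesis using that[of B] B(1) zero by simp
qed

lemma fourier_cong_AE:
  fixes f g :: "real^3 \<Rightarrow> real^3"
  assumes [measurable]: "g \<in> borel_measurable borel" and fg: "AE x in lborel. f x = g x"
  shows "fourier f \<xi> = fourier g \<xi>"
proof -
  have "(LINT x|lebesgue. exp (- \<i> * complex_of_real (x \<bullet> \<xi>)) * complex_of_real (f x $ i))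
      = (LINT x|lebesgue. exp (- \<i> * complex_of_real (x \<bullet> \<xi>)) * complex_of_real (g x $ i))" for i
  proof -
    have cm: "(\<lambda>x. exp (- \<i> * complex_of_real (x \<bullet> \<xi>)) * complex_of_real (g x $ i)) \<in> borel_measurable lborel"
      by (intro borel_measurable_times borel_measurable_of_real) (auto intro!: borel_measurable_continuous_onI continuous_intros)
    have ae: "AE x in lebesgue. exp (- \<i> * complex_of_real (x \<bullet> \<xi>)) * complex_of_real (g x $ i)
        = exp (- \<i> * complex_of_real (x \<bullet> \<xi>)) * complex_of_real (f x $ i)"
      unfolding AE_completion_iff using fg by eventually_elim simp
    show ?thesis
      by (rule Bochner_Integration.integral_cong_AE[OF measurable_completion[OF cm] lebesgue_measurable_cong_AE[OF measurable_completion[OF cm] ae] ae, symmetric])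
  qed
  then show ?thesis by (simp add: fourier_def)
qed

lemma fourier_bound_divergence_free:
  fixes f :: "real^3 \<Rightarrow> real^3"
  assumes f: "f \<in> borel_measurable lebesgue" and div: "weakly_divergence_free f" and \<xi>: "\<xi> \<noteq> 0" and \<beta>: "0 < \<beta>"
    and fin: "L2_norm_sq lebesgue (\<lambda>x. ((1 + norm x) powr (3/2 + \<beta>)) *\<^sub>R f x) < \<infinity>"
  shows "ennreal ((norm (fourier f \<xi>))\<^sup>2) \<le> ennreal 9 * (ennreal (norm \<xi> powr (2 * \<beta>)) * fourier_const \<beta>
     * L2_norm_sq lebesgue (\<lambda>x. ((1 + norm x) powr (3/2 + \<beta>)) *\<^sub>R f x))"
proof -
  obtain g where g: "g \<in> borel_measurable borel" and fg: "AE x in lborel. f x = g x"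
    by (rule vector_borel_version[OF f])
  have N: "L2_norm_sq lebesgue (\<lambda>x. ((1 + norm x) powr (3/2 + \<beta>)) *\<^sub>R f x)
      = (\<integral>\<^sup>+x. ennreal ((norm ((1 + norm x) powr (3/2 + \<beta>) *\<^sub>R g x))\<^sup>2) \<partial>lborel)"
    unfolding L2_norm_sq_def nn_integral_completion
    by (rule nn_integral_cong_AE) (use fg in eventually_elim, simp)
  have int: "integrable lborel g"
    by (rule integrable_if_weighted_L2[OF g \<beta>]) (use fin N in simp)
  have "(LINT y|lborel. g y $ i) = 0" for i
    by (rule divergence_free_mean_zero[OF int divergence_free_borel_version[OF div fg g]])
  from fourier_bound[OF g int this \<xi> \<beta>] show ?thesis unfolding N fourier_cong_AE[OF g fg] .
qed

text \<open>Counting powers of \<open>K\<close>: the ball of radius \<open>2 * K\<close> supplies 3,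
  the bound for the Fourier transform \<open>2 * \<beta>\<close>, and the prefactor of the spectrum
  -1.\<close>

lemma energy_spectrum_bound:
  fixes u :: "real \<Rightarrow> real^3 \<Rightarrow> real^3"
  defines "V \<equiv> unit_ball_vol (real DIM(real^3))"
  assumes u: "u t \<in> borel_measurable lebesgue" and div: "weakly_divergence_free (u t)" and \<beta>: "0 < \<beta>"
    and \<psi>: "B \<ge> 0" "\<And>r. \<psi> r \<le> B" "\<And>r. r \<notin> {1/2..2} \<Longrightarrow> \<psi> r = 0" and K: "K > 0"
    and J: "fourier_const \<beta> = ennreal J" "J \<ge> 0"
    and C: "72 * B * J * V * 2 powr (2 * \<beta>) \<le> C" "C > 0"
  shows "energy_spectrum \<psi> u K t \<le> ennreal (\<rho> * C * K powr (2 * (1 + \<beta>)))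
      * L2_norm_sq lebesgue (\<lambda>x. ((1 + norm x) powr (3/2 + \<beta>)) *\<^sub>R u t x)"
\<comment> \<open>In \<open>ennreal\<close> zero times infinity is 0, so for an infinite norm the
  claim relies on the coefficient being positive, hence on \<open>C > 0\<close>.\<close>
proof (cases "L2_norm_sq lebesgue (\<lambda>x. ((1 + norm x) powr (3/2 + \<beta>)) *\<^sub>R u t x) < \<infinity>")
  case False
  have "\<rho> * C * K powr (2 * (1 + \<beta>)) > 0" using C(2) K by (simp add: \<rho>_def)
  then have "ennreal (\<rho> * C * K powr (2 * (1 + \<beta>))) \<noteq> 0" by (simp only: ennreal_eq_0_iff not_le)
  then have "ennreal (\<rho> * C * K powr (2 * (1 + \<beta>))) * L2_norm_sq lebesgue (\<lambda>x. ((1 + norm x) powr (3/2 + \<beta>)) *\<^sub>R u t x) = \<top>"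
    using False by (simp only: ennreal_mult_eq_top_iff infinity_ennreal_def less_top[symmetric]) simp
  then show ?thesis by simp
next
  case True
  define N where "N = L2_norm_sq lebesgue (\<lambda>x. ((1 + norm x) powr (3/2 + \<beta>)) *\<^sub>R u t x)"
  have V: "V \<ge> 0" unfolding V_def by (intro less_imp_le unit_ball_vol_pos) simp
  let ?a = "B * (9 * ((2 * K) powr (2 * \<beta>) * J))"
  have "(\<integral>\<^sup>+\<xi>. ennreal (\<psi> (norm \<xi> / K) * (norm (fourier (u t) \<xi>))\<^sup>2 / (2 * pi) ^ 3) \<partial>lebesgue)
      \<le> (\<integral>\<^sup>+\<xi>. (ennreal ?a * N) * indicator (cball (0::real^3) (2 * K)) \<xi> \<partial>lebesgue)"
  proof (rule nn_integral_mono)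
    fix \<xi> :: "real^3"
    let ?q = "(norm (fourier (u t) \<xi>))\<^sup>2"
    show "ennreal (\<psi> (norm \<xi> / K) * ?q / (2 * pi) ^ 3) \<le> (ennreal ?a * N) * indicator (cball 0 (2 * K)) \<xi>"
    proof (cases "norm \<xi> / K \<in> {1/2..2}")
      case True
      then have n: "0 < norm \<xi>" "norm \<xi> \<le> 2 * K" using K by (auto simp: field_simps)
      have "(1::real) \<le> 2 * pi" using pi_ge_two by simp
      then have p: "(1::real) \<le> (2 * pi) ^ 3" by (rule one_le_power)
      have "\<psi> (norm \<xi> / K) * ?q \<le> B * ?q" by (intro mult_right_mono \<psi>) simp
      also have "\<dots> \<le> B * ?q * (2 * pi) ^ 3" using mult_left_mono[OF p, of "B * ?q"] \<psi>(1) by simp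
      finally have "\<psi> (norm \<xi> / K) * ?q / (2 * pi) ^ 3 \<le> B * ?q"
        using p by (subst pos_divide_le_eq) auto
      then have "ennreal (\<psi> (norm \<xi> / K) * ?q / (2 * pi) ^ 3) \<le> ennreal (B * ?q)" by (rule ennreal_leI)
      also have "\<dots> = ennreal B * ennreal ?q" by (rule ennreal_mult) (use \<psi>(1) in auto)
      also have "\<dots> \<le> ennreal B * (ennreal 9 * (ennreal (norm \<xi> powr (2 * \<beta>)) * fourier_const \<beta> * N))"
        unfolding N_def
        by (intro mult_left_mono fourier_bound_divergence_free[OF u div _ \<beta> \<open>_ < \<infinity>\<close>]) (use n in auto)
      also have "\<dots> \<le> ennreal B * (ennreal 9 * (ennreal ((2 * K) powr (2 * \<beta>)) * ennreal J * N))"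
        unfolding J(1) using n \<beta> by (intro mult_left_mono mult_right_mono ennreal_leI powr_mono2) auto
      also have "\<dots> = ennreal ?a * N"
        using \<psi>(1) J(2) by (simp add: ennreal_mult mult.assoc)
      finally show ?thesis using n by simp
    next
      case False
      then show ?thesis using \<psi>(3) by simp
    qed
  qed
  also have "\<dots> = (ennreal ?a * N) * emeasure lebesgue (cball (0::real^3) (2 * K))"
    by (rule nn_integral_cmult_indicator) simp
  also have "emeasure lebesgue (cball (0::real^3) (2 * K)) = ennreal (V * (2 * K) ^ 3)"
    using emeasure_cball[of "2 * K" "0::real^3"] K by (simp add: V_def)
  finally have "energy_spectrum \<psi> u K t \<le> ennreal (\<rho> / K) * ((ennreal ?a * N) * ennreal (V * (2 * K) ^ 3))"
    unfolding energy_spectrum_def by (rule mult_left_mono) simp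
  also have "\<dots> = (ennreal (\<rho> / K) * ennreal ?a * ennreal (V * (2 * K) ^ 3)) * N" by (simp only: mult_ac)
  also have "ennreal (\<rho> / K) * ennreal ?a * ennreal (V * (2 * K) ^ 3) = ennreal (\<rho> / K * ?a * (V * (2 * K) ^ 3))"
  proof -
    have 1: "0 \<le> \<rho> / K" using K by (simp add: \<rho>_def)
    have 2: "0 \<le> ?a" using \<psi>(1) J(2) by simp
    have 3: "0 \<le> V * (2 * K) ^ 3" using V K by simp
    show ?thesis unfolding ennreal_mult[OF 1 2, symmetric] by (rule ennreal_mult[OF mult_nonneg_nonneg[OF 1 2] 3, symmetric])
  qed
  \<comment> \<open>\<open>72 = 9 * 8\<close>, with 9 from the bound for the Fourier transform and 8
    from the cube of \<open>2 * K\<close>; the divisor \<open>(2 * pi) ^ 3\<close> was bounded below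
    by 1.\<close>
  also have "\<rho> / K * ?a * (V * (2 * K) ^ 3) = 72 * B * J * V * 2 powr (2 * \<beta>) * K powr (2 * (1 + \<beta>))"
  proof -
    have "K powr (2 * (1 + \<beta>)) = K powr (2 + 2 * \<beta>)" by (rule arg_cong[where f="\<lambda>e. K powr e"]) simp
    also have "\<dots> = K\<^sup>2 * K powr (2 * \<beta>)" using K by (simp add: powr_add)
    finally have e: "K powr (2 * (1 + \<beta>)) = K\<^sup>2 * K powr (2 * \<beta>)" .
    have e2: "(2 * K) powr (2 * \<beta>) = 2 powr (2 * \<beta>) * K powr (2 * \<beta>)" using K by (simp add: powr_mult)
    show ?thesis unfolding e e2 using K by (simp add: \<rho>_def power2_eq_square power3_eq_cube field_simps)
  qed
  also have "ennreal (72 * B * J * V * 2 powr (2 * \<beta>) * K powr (2 * (1 + \<beta>))) * N \<le> ennreal (\<rho> * C * K powr (2 * (1 + \<beta>))) * N"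
    unfolding \<rho>_def mult_1 by (intro mult_right_mono ennreal_leI C(1)) auto
  finally show ?thesis unfolding N_def .
qed

theorem theorem10:
  fixes \<psi> :: "real \<Rightarrow> real" and \<beta> :: real
  assumes "spectral_bump \<psi>" and "0 < \<beta>" and "\<beta> < 1"
  shows "\<exists>C>0. \<forall>\<nu>>0. \<forall>(u\<^sub>0 :: real^3 \<Rightarrow> real^3) (u :: real \<Rightarrow> real^3 \<Rightarrow> real^3).
    in_L2 lebesgue u\<^sub>0 \<and> in_L1 lebesgue u\<^sub>0 \<and> leray_solution \<nu> u\<^sub>0 u \<longrightarrow>
      (AE t in lebesgue_on {0..}. \<forall>K>0.
         energy_spectrum \<psi> u K t
           \<le> ennreal (\<rho> * C * K powr (2 * (1 + \<beta>)))
             * L2_norm_sq lebesgue (\<lambda>x. ((1 + norm x) powr (3/2 + \<beta>)) *\<^sub>R u t x)) \<and>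
      (\<forall>\<beta>'>\<beta>. in_Linf lebesgue (\<lambda>x. ((1 + norm x) powr (3 + \<beta>')) *\<^sub>R u\<^sub>0 x) \<longrightarrow>
         (AE t in lebesgue_on {0..}. smooth_solution_upto t u \<longrightarrow> (\<forall>K>0.
            ennreal (\<rho> * C * K powr (2 * (1 + \<beta>)))
             * L2_norm_sq lebesgue (\<lambda>x. ((1 + norm x) powr (3/2 + \<beta>)) *\<^sub>R u t x) < \<infinity>)))"
proof -
  obtain B where B: "B \<ge> 0" "\<And>r. \<psi> r \<le> B" "\<And>r. r \<notin> {1/2..2} \<Longrightarrow> \<psi> r = 0"
    by (rule spectral_bump_bounded[OF assms(1)]) (rule that, assumption+)
  define V where "V = unit_ball_vol (real DIM(real^3))"
  have V: "V \<ge> 0" unfolding V_def by (intro less_imp_le unit_ball_vol_pos) simp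
  obtain J where J: "J \<ge> 0" "fourier_const \<beta> = ennreal J"
    using fourier_const_finite[OF assms(2,3)] by (cases "fourier_const \<beta>") auto
  \<comment> \<open>Adding 1 makes the constant positive without lower bounds on \<open>B\<close>
    and \<open>J\<close>.\<close>
  define C where "C = 72 * B * J * V * 2 powr (2 * \<beta>) + 1"
  have C0: "C > 0" unfolding C_def using B(1) J(1) V by (intro add_nonneg_pos mult_nonneg_nonneg) auto
  have C1: "72 * B * J * unit_ball_vol (real DIM(real^3)) * 2 powr (2 * \<beta>) \<le> C" by (simp add: C_def V_def)
  show ?thesis
  proof (intro exI[of _ C] conjI C0 allI impI)
    fix \<nu> :: real and u\<^sub>0 :: "real^3 \<Rightarrow> real^3" and u :: "real \<Rightarrow> real^3 \<Rightarrow> real^3"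
    assume \<nu>: "\<nu> > 0" and u: "in_L2 lebesgue u\<^sub>0 \<and> in_L1 lebesgue u\<^sub>0 \<and> leray_solution \<nu> u\<^sub>0 u"
    then have leray: "leray_solution \<nu> u\<^sub>0 u" by blast
    \<comment> \<open>Measurability of almost every slice \<open>u t\<close> is contained in the
      weak gradient condition.\<close>
    obtain G where "AE t in lebesgue_on {0..}. has_weak_gradient (u t) (G t)"
      using leray unfolding leray_solution_def by blast
    moreover have "AE t in lebesgue_on {0..}. weakly_divergence_free (u t)"
      using leray unfolding leray_solution_def by blast
    ultimately show "AE t in lebesgue_on {0..}. \<forall>K>0. energy_spectrum \<psi> u K t
        \<le> ennreal (\<rho> * C * K powr (2 * (1 + \<beta>))) * L2_norm_sq lebesgue (\<lambda>x. ((1 + norm x) powr (3/2 + \<beta>)) *\<^sub>R u t x)"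
    proof eventually_elim
      case (elim t)
      then have "u t \<in> borel_measurable lebesgue" by (simp add: has_weak_gradient_def in_L2_def)
      note bound = energy_spectrum_bound[where u=u and t=t, OF this elim(2) assms(2) B(1) _ _ _ J(2,1) C1 C0]
      show ?case by (intro allI impI bound B(2,3))
    qed
    fix \<beta>' assume "\<beta> < \<beta>'" "in_Linf lebesgue (\<lambda>x. ((1 + norm x) powr (3 + \<beta>')) *\<^sub>R u\<^sub>0 x)"
    from weighted_norm_finite[OF leray \<nu> assms(2,3) this(1) _ this(2)] u
    have "AE t in lebesgue_on {0..}. smooth_solution_upto t u \<longrightarrow> L2_norm_sq lebesgue (\<lambda>x. ((1 + norm x) powr (3/2 + \<beta>)) *\<^sub>R u t x) < \<infinity>"
      by blast
    then show "AE t in lebesgue_on {0..}. smooth_solution_upto t u \<longrightarrow> (\<forall>K>0. ennreal (\<rho> * C * K powr (2 * (1 + \<beta>)))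
        * L2_norm_sq lebesgue (\<lambda>x. ((1 + norm x) powr (3/2 + \<beta>)) *\<^sub>R u t x) < \<infinity>)"
      by eventually_elim (simp add: ennreal_mult_less_top)
  qed
qed

end
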